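(* Let $s,m\in\mathbb R$ and $a\in S^m_{1,0,\triangle}(\mathbb T^d\times\mathbb Z^d)$. Then: (i) for $0<p,q\le\infty$, $A_a:B^{s+m}_{p,q,+}(\mathbb T^d)\to B^s_{p,q,+}(\mathbb T^d)$ is bounded; (ii) for $0<p<\infty$ and $0<q\le\infty$, $A_a:F^{s+m}_{p,q,+}(\mathbb T^d)\to F^s_{p,q,+}(\mathbb T^d)$ is bounded. Consequently, via the boundary-value identification, $A_a$ defines bounded maps $$A_a:\mathcal B^{s+m}_{p,q}(\mathbb D^d)\to\mathcal B^s_{p,q}(\mathbb D^d),\qquad A_a:\mathcal F^{s+m}_{p,q}(\mathbb D^d)\to\mathcal F^s_{p,q}(\mathbb D^d)$$ in the same respective parameter ranges.
   Context: Fix $d\in\mathbb N$; $\mathbb T^d=\mathbb R^d/(2\pi\mathbb Z)^d$, $\mathbb D^d=\{z\in\mathbb C^d:|z_j|<1\text{ for all }j\}$. $\widehat f(n)=(2\pi)^{-d}\int_{[0,2\pi]^d}f(x)e^{-in\cdot x}\,dx$, extended by duality to periodic distributions $\mathcal D'(\mathbb T^d)$. $\mathcal D'_+(\mathbb T^d)=\{f\in\mathcal D'(\mathbb T^d):\widehat f(n)=0\text{ for }n\notin\mathbb N_0^d\}$. Symbols: $\Delta_{n_j}g(n)=g(n+e_j)-g(n)$, $\Delta_n^\alpha=\Delta_{n_1}^{\alpha_1}\cdots\Delta_{n_d}^{\alpha_d}$, $\langle n\rangle=(1+|n|^2)^{1/2}$. $S^m_{1,0}(\mathbb T^d\times\mathbb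 Z^d)$: functions $a:\mathbb T^d\times\mathbb Z^d\to\mathbb C$, smooth in $x$, with $\sup_{x,n}\langle n\rangle^{-m+|\alpha|}|\Delta_n^\alpha\partial_x^\beta a(x,n)|<\infty$ for all $\alpha,\beta\in\mathbb N_0^d$. Put $a_\nu(n)=(2\pi)^{-d}\int_{[0,2\pi]^d}a(x,n)e^{-i\nu\cdot x}dx$, $\nu\in\mathbb Z^d$. $S^m_{1,0,\triangle}(\mathbb T^d\times\mathbb Z^d)$ is the set of $a\in S^m_{1,0}$ with $a_\nu(n)=0$ whenever $n\in\mathbb N_0^d$ and $n+\nu\notin\mathbb N_0^d$. Quantization: $A_af(x)=\sum_{n\in\mathbb Z^d}a(x,n)\widehat f(n)e^{in\cdot x}$ (in the sense of distributions). Spaces: choose $\varphi_0,\varphi\in C_c^\infty(\mathbb R^d)$ with $\operatorname{supp}\varphi_0\subset\{|\xi|\le2\}$, $\operatorname{supp}\varphi\subset\{1/2\le|\xi|\le2\}$, $\varphi_0(\xi)+\sum_{j\ge1}\varphi(2^{-j}\xi)=1$; $\varphi_j=\varphi(2^{-j}\cdot)$ for $j\ge1$; $\Delta_jf=\sum_n\varphi_j(n)\widehat f(n)e^{in\cdot x}$. Then $\|f\|_{B^s_{p,q}(\mathbb T^d)}=\|\{2^{js}\|\Delta_jf\|_{L^p(\mathbb T^d)}\}_{j\ge0}\|_{\ell^q}$ ($0<p,q\le\infty$), and $\|f\|_{F^s_{p,q}(\mathbb T^d)}=\big\|\,\|\{2^{js}\Delta_jf(x)\}_{j\ge0}\|_{\ell^q}\big\|_{L^p_x(\mathbb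 T^d)}$ ($0<p<\infty$, $0<q\le\infty$). The spaces consist of the $f\in\mathcal D'(\mathbb T^d)$ with finite quasi-norm. $B^s_{p,q,+}=B^s_{p,q}\cap\mathcal D'_+$, $F^s_{p,q,+}=F^s_{p,q}\cap\mathcal D'_+$, with the restricted quasi-norms. Holomorphic spaces: $\mathcal B^s_{p,q}(\mathbb D^d)$ (resp. $\mathcal F^s_{p,q}(\mathbb D^d)$) is the set of holomorphic functions $f(z)=\sum_{n\in\mathbb N_0^d}c_nz^n$ on $\mathbb D^d$ whose distributional boundary value $\sum_{n\in\mathbb N_0^d}c_ne^{in\cdot x}$ belongs to $B^s_{p,q,+}(\mathbb T^d)$ (resp. $F^s_{p,q,+}(\mathbb T^d)$), with the quasi-norm of the boundary value. Every element of $\mathcal D'_+(\mathbb T^d)$ is the boundary value of a unique holomorphic function on $\mathbb D^d$; $A_a$ acts on holomorphic functions through this identification. *)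

theory Defs
  imports "HOL-Probability.Essential_Supremum"
begin

text \<open>
  The dimension \<open>d\<close> is the cardinality of the finite index type \<open>'d\<close>. Functions on the torus are
  \<open>2\<pi>\<close>-periodic functions on \<open>real ^ 'd\<close>, frequencies are elements of \<open>int ^ 'd\<close>, and
  multi-indices are elements of \<open>nat ^ 'd\<close>.
\<close>

definition real_vec :: "int ^ 'd \<Rightarrow> real ^ 'd" where
  "real_vec n = (\<chi> j. real_of_int (n $ j))"

definition nonneg_freqs :: "(int ^ 'd) set" where
  "nonneg_freqs = {n. \<forall>j. 0 \<le> n $ j}"

definition jbracket :: "int ^ 'd::finite \<Rightarrow> real" where
  "jbracket n = sqrt (1 + (norm (real_vec n))\<^sup>2)"

definition abs_mi :: "nat ^ 'd::finite \<Rightarrow> nat" where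
  "abs_mi \<alpha> = (\<Sum>j\<in>UNIV. \<alpha> $ j)"

text \<open>
  The product of the operators \<open>T j\<close> to the powers \<open>\<alpha> $ j\<close> is taken in some fixed order of the
  coordinates. The order is irrelevant, because the operators below commute (the partial
  derivatives are only applied to smooth functions).
\<close>

definition coord_list :: "'d::finite list" where
  "coord_list = (SOME js. set js = UNIV \<and> distinct js)"

definition mi_list :: "nat ^ 'd::finite \<Rightarrow> 'd list" where
  "mi_list \<alpha> = concat (map (\<lambda>j. replicate (\<alpha> $ j) j) coord_list)"

definition partial_deriv :: "'d::finite \<Rightarrow> (real ^ 'd \<Rightarrow> complex) \<Rightarrow> real ^ 'd \<Rightarrow> complex" where
  "partial_deriv j f x = frechet_derivative f (at x) (axis j 1)"

definition smooth :: "(real ^ 'd::finite \<Rightarrow> complex) \<Rightarrow> bool" where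
  "smooth f \<longleftrightarrow> (\<forall>js. foldr partial_deriv js f differentiable_on UNIV)"

definition mi_deriv :: "nat ^ 'd::finite \<Rightarrow> (real ^ 'd \<Rightarrow> complex) \<Rightarrow> real ^ 'd \<Rightarrow> complex" where
  "mi_deriv \<alpha> f = foldr partial_deriv (mi_list \<alpha>) f"

definition forward_diff :: "'d::finite \<Rightarrow> (int ^ 'd \<Rightarrow> complex) \<Rightarrow> int ^ 'd \<Rightarrow> complex" where
  "forward_diff j g n = g (n + axis j 1) - g n"

definition mi_diff :: "nat ^ 'd::finite \<Rightarrow> (int ^ 'd \<Rightarrow> complex) \<Rightarrow> int ^ 'd \<Rightarrow> complex" where
  "mi_diff \<alpha> g = foldr forward_diff (mi_list \<alpha>) g"

definition test_functions :: "(real ^ 'd::finite \<Rightarrow> complex) set" where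
  "test_functions = {\<psi>. smooth \<psi> \<and> (\<forall>x j. \<psi> (x + axis j (2 * pi)) = \<psi> x)}"

definition torus_box :: "(real ^ 'd::finite) set" where
  "torus_box = cbox 0 (\<chi> j. 2 * pi)"

definition torus_integral :: "(real ^ 'd::finite \<Rightarrow> complex) \<Rightarrow> complex" where
  "torus_integral f = (LINT x:torus_box|lborel. f x)"

definition exp_fun :: "int ^ 'd::finite \<Rightarrow> real ^ 'd \<Rightarrow> complex" where
  "exp_fun n x = cis (real_vec n \<bullet> x)"

definition fun_coeff :: "(real ^ 'd::finite \<Rightarrow> complex) \<Rightarrow> int ^ 'd \<Rightarrow> complex" where
  "fun_coeff f n = torus_integral (\<lambda>x. f x * exp_fun (- n) x) / (2 * pi) ^ CARD('d)"

text \<open>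
  A periodic distribution is a linear functional on the smooth periodic functions that is continuous
  for the Frechet topology given by the seminorms \<open>sup |\<partial>\<^sup>\<alpha> \<psi>|\<close>. The value \<open>0\<close> outside of the
  test functions makes two distributions equal as HOL functions iff they agree on test functions.
  A periodic function \<open>f\<close> corresponds to \<open>\<lambda>\<psi>. torus_integral (\<lambda>x. f x * \<psi> x)\<close>.
\<close>

type_synonym 'd dist = "(real ^ 'd \<Rightarrow> complex) \<Rightarrow> complex"

definition distributions :: "'d::finite dist set" where
  "distributions = {u.
     (\<forall>\<psi>. \<psi> \<notin> test_functions \<longrightarrow> u \<psi> = 0) \<and>
     (\<forall>\<psi>\<in>test_functions. \<forall>\<eta>\<in>test_functions. u (\<lambda>x. \<psi> x + \<eta> x) = u \<psi> + u \<eta>) \<and>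
     (\<forall>c. \<forall>\<psi>\<in>test_functions. u (\<lambda>x. c * \<psi> x) = c * u \<psi>) \<and>
     (\<exists>C N. \<forall>\<psi>\<in>test_functions.
        norm (u \<psi>) \<le> C * (\<Sum>\<alpha>\<in>{\<alpha>. abs_mi \<alpha> \<le> N}. SUP x. norm (mi_deriv \<alpha> \<psi> x)))}"

definition dist_coeff :: "'d::finite dist \<Rightarrow> int ^ 'd \<Rightarrow> complex" where
  "dist_coeff u n = u (exp_fun (- n)) / (2 * pi) ^ CARD('d)"

definition plus_distributions :: "'d::finite dist set" where
  "plus_distributions = {u \<in> distributions. \<forall>n. n \<notin> nonneg_freqs \<longrightarrow> dist_coeff u n = 0}"

definition symbols :: "real \<Rightarrow> (real ^ 'd::finite \<Rightarrow> int ^ 'd \<Rightarrow> complex) set" where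
  "symbols m = {a. (\<forall>n. (\<lambda>x. a x n) \<in> test_functions) \<and>
     (\<forall>\<alpha> \<beta>. \<exists>C. \<forall>x n. jbracket n powr (- m + real (abs_mi \<alpha>)) *
        norm (mi_diff \<alpha> (\<lambda>k. mi_deriv \<beta> (\<lambda>y. a y k) x) n) \<le> C)}"

definition triangular_symbols :: "real \<Rightarrow> (real ^ 'd::finite \<Rightarrow> int ^ 'd \<Rightarrow> complex) set" where
  "triangular_symbols m = {a \<in> symbols m. \<forall>n \<nu>.
     n \<in> nonneg_freqs \<and> n + \<nu> \<notin> nonneg_freqs \<longrightarrow> fun_coeff (\<lambda>x. a x n) \<nu> = 0}"

text \<open>The \<open>n\<close>-th term of the series for \<open>A\<^sub>a f\<close>, tested against \<open>\<psi>\<close>.\<close>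

definition quant_term ::
    "(real ^ 'd::finite \<Rightarrow> int ^ 'd \<Rightarrow> complex) \<Rightarrow> 'd dist \<Rightarrow> (real ^ 'd \<Rightarrow> complex) \<Rightarrow> int ^ 'd \<Rightarrow> complex"
  where
  "quant_term a f \<psi> n = torus_integral (\<lambda>x. a x n * dist_coeff f n * exp_fun n x * \<psi> x)"

definition quantization ::
    "(real ^ 'd::finite \<Rightarrow> int ^ 'd \<Rightarrow> complex) \<Rightarrow> 'd dist \<Rightarrow> 'd dist" where
  "quantization a f \<psi> = (if \<psi> \<in> test_functions then \<Sum>\<^sub>\<infinity>n. quant_term a f \<psi> n else 0)"

definition lp_partition :: "(real ^ 'd::finite \<Rightarrow> complex) \<Rightarrow> (real ^ 'd \<Rightarrow> complex) \<Rightarrow> bool" where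
  "lp_partition \<phi>0 \<phi> \<longleftrightarrow> smooth \<phi>0 \<and> smooth \<phi> \<and>
     closure {\<xi>. \<phi>0 \<xi> \<noteq> 0} \<subseteq> {\<xi>. norm \<xi> \<le> 2} \<and>
     closure {\<xi>. \<phi> \<xi> \<noteq> 0} \<subseteq> {\<xi>. 1 / 2 \<le> norm \<xi> \<and> norm \<xi> \<le> 2} \<and>
     (\<forall>\<xi>. (\<lambda>j. \<phi> (\<xi> /\<^sub>R 2 ^ Suc j)) sums (1 - \<phi>0 \<xi>))"

definition lp_cutoff ::
    "(real ^ 'd::finite \<Rightarrow> complex) \<Rightarrow> (real ^ 'd \<Rightarrow> complex) \<Rightarrow> nat \<Rightarrow> real ^ 'd \<Rightarrow> complex" where
  "lp_cutoff \<phi>0 \<phi> j \<xi> = (if j = 0 then \<phi>0 \<xi> else \<phi> (\<xi> /\<^sub>R 2 ^ j))"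

text \<open>Only finitely many terms of this sum are nonzero, as the cutoffs have compact support.\<close>

definition lp_block ::
    "(real ^ 'd::finite \<Rightarrow> complex) \<Rightarrow> (real ^ 'd \<Rightarrow> complex) \<Rightarrow> nat \<Rightarrow> 'd dist \<Rightarrow> real ^ 'd \<Rightarrow> complex" where
  "lp_block \<phi>0 \<phi> j f x =
     (\<Sum>\<^sub>\<infinity>n. lp_cutoff \<phi>0 \<phi> j (real_vec n) * dist_coeff f n * exp_fun n x)"

text \<open>Only used for positive exponents \<open>r\<close>.\<close>

definition epow :: "ennreal \<Rightarrow> real \<Rightarrow> ennreal" where
  "epow t r = (if t = \<infinity> then \<infinity> else ennreal (enn2real t powr r))"

definition ell_norm :: "ennreal \<Rightarrow> (nat \<Rightarrow> ennreal) \<Rightarrow> ennreal" where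
  "ell_norm q b = (if q = \<infinity> then SUP j. b j
     else epow (\<Sum>j. epow (b j) (enn2real q)) (1 / enn2real q))"

definition Lp_norm :: "ennreal \<Rightarrow> (real ^ 'd::finite \<Rightarrow> ennreal) \<Rightarrow> ennreal" where
  "Lp_norm p g = (if p = \<infinity> then esssup (restrict_space lborel torus_box) g
     else epow (\<integral>\<^sup>+x\<in>torus_box. epow (g x) (enn2real p) \<partial>lborel) (1 / enn2real p))"

definition Besov_norm ::
    "(real ^ 'd::finite \<Rightarrow> complex) \<Rightarrow> (real ^ 'd \<Rightarrow> complex) \<Rightarrow> real \<Rightarrow> ennreal \<Rightarrow> ennreal \<Rightarrow> 'd dist \<Rightarrow> ennreal" where
  "Besov_norm \<phi>0 \<phi> s p q f =
     ell_norm q (\<lambda>j. ennreal (2 powr (real j * s)) *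
       Lp_norm p (\<lambda>x. ennreal (norm (lp_block \<phi>0 \<phi> j f x))))"

definition Triebel_norm ::
    "(real ^ 'd::finite \<Rightarrow> complex) \<Rightarrow> (real ^ 'd \<Rightarrow> complex) \<Rightarrow> real \<Rightarrow> ennreal \<Rightarrow> ennreal \<Rightarrow> 'd dist \<Rightarrow> ennreal" where
  "Triebel_norm \<phi>0 \<phi> s p q f =
     Lp_norm p (\<lambda>x. ell_norm q (\<lambda>j. ennreal (2 powr (real j * s) * norm (lp_block \<phi>0 \<phi> j f x))))"

definition Besov_plus ::
    "(real ^ 'd::finite \<Rightarrow> complex) \<Rightarrow> (real ^ 'd \<Rightarrow> complex) \<Rightarrow> real \<Rightarrow> ennreal \<Rightarrow> ennreal \<Rightarrow> 'd dist set" where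
  "Besov_plus \<phi>0 \<phi> s p q = {f \<in> distributions. Besov_norm \<phi>0 \<phi> s p q f < \<infinity>} \<inter> plus_distributions"

definition Triebel_plus ::
    "(real ^ 'd::finite \<Rightarrow> complex) \<Rightarrow> (real ^ 'd \<Rightarrow> complex) \<Rightarrow> real \<Rightarrow> ennreal \<Rightarrow> ennreal \<Rightarrow> 'd dist set" where
  "Triebel_plus \<phi>0 \<phi> s p q = {f \<in> distributions. Triebel_norm \<phi>0 \<phi> s p q f < \<infinity>} \<inter> plus_distributions"

definition polydisc :: "(complex ^ 'd) set" where
  "polydisc = {z. \<forall>j. norm (z $ j) < 1}"

text \<open>Functions on the polydisc are represented by functions vanishing outside of it.\<close>

definition polydisc_holomorphic :: "(complex ^ 'd::finite \<Rightarrow> complex) set" where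
  "polydisc_holomorphic = {F. (\<forall>z. z \<notin> polydisc \<longrightarrow> F z = 0) \<and>
     (\<forall>z\<in>polydisc. \<exists>L. (F has_derivative L) (at z) \<and> (\<forall>c v. L (c *s v) = c * L v))}"

definition power_series_of :: "(complex ^ 'd::finite \<Rightarrow> complex) \<Rightarrow> (int ^ 'd \<Rightarrow> complex) \<Rightarrow> bool" where
  "power_series_of F c \<longleftrightarrow>
     (\<forall>z\<in>polydisc. ((\<lambda>n. c n * (\<Prod>j\<in>UNIV. (z $ j) ^ nat (n $ j))) has_sum F z) nonneg_freqs)"

text \<open>\<open>u\<close> is the sum, in the sense of distributions, of the series \<open>\<Sum> c\<^sub>n e\<^sup>i\<^sup>n\<^sup>x\<close>, where \<open>c\<close> are
  the Taylor coefficients of the holomorphic function \<open>F\<close>.\<close>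

definition has_boundary_value :: "(complex ^ 'd::finite \<Rightarrow> complex) \<Rightarrow> 'd dist \<Rightarrow> bool" where
  "has_boundary_value F u \<longleftrightarrow> F \<in> polydisc_holomorphic \<and> u \<in> distributions \<and>
     (\<exists>c. power_series_of F c \<and>
        (\<forall>\<psi>\<in>test_functions.
           ((\<lambda>n. torus_integral (\<lambda>x. c n * exp_fun n x * \<psi> x)) has_sum u \<psi>) nonneg_freqs))"

definition boundary_value :: "(complex ^ 'd::finite \<Rightarrow> complex) \<Rightarrow> 'd dist" where
  "boundary_value F = (THE u. has_boundary_value F u)"

definition holo_extension :: "'d::finite dist \<Rightarrow> complex ^ 'd \<Rightarrow> complex" where
  "holo_extension u = (THE F. has_boundary_value F u)"

definition Besov_holo ::
    "(real ^ 'd::finite \<Rightarrow> complex) \<Rightarrow> (real ^ 'd \<Rightarrow> complex) \<Rightarrow> real \<Rightarrow> ennreal \<Rightarrow> ennreal \<Rightarrow>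
     (complex ^ 'd \<Rightarrow> complex) set" where
  "Besov_holo \<phi>0 \<phi> s p q = {F. \<exists>u \<in> Besov_plus \<phi>0 \<phi> s p q. has_boundary_value F u}"

definition Triebel_holo ::
    "(real ^ 'd::finite \<Rightarrow> complex) \<Rightarrow> (real ^ 'd \<Rightarrow> complex) \<Rightarrow> real \<Rightarrow> ennreal \<Rightarrow> ennreal \<Rightarrow>
     (complex ^ 'd \<Rightarrow> complex) set" where
  "Triebel_holo \<phi>0 \<phi> s p q = {F. \<exists>u \<in> Triebel_plus \<phi>0 \<phi> s p q. has_boundary_value F u}"

definition Besov_holo_norm ::
    "(real ^ 'd::finite \<Rightarrow> complex) \<Rightarrow> (real ^ 'd \<Rightarrow> complex) \<Rightarrow> real \<Rightarrow> ennreal \<Rightarrow> ennreal \<Rightarrow>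
     (complex ^ 'd \<Rightarrow> complex) \<Rightarrow> ennreal" where
  "Besov_holo_norm \<phi>0 \<phi> s p q F = Besov_norm \<phi>0 \<phi> s p q (boundary_value F)"

definition Triebel_holo_norm ::
    "(real ^ 'd::finite \<Rightarrow> complex) \<Rightarrow> (real ^ 'd \<Rightarrow> complex) \<Rightarrow> real \<Rightarrow> ennreal \<Rightarrow> ennreal \<Rightarrow>
     (complex ^ 'd \<Rightarrow> complex) \<Rightarrow> ennreal" where
  "Triebel_holo_norm \<phi>0 \<phi> s p q F = Triebel_norm \<phi>0 \<phi> s p q (boundary_value F)"

definition holo_quantization ::
    "(real ^ 'd::finite \<Rightarrow> int ^ 'd \<Rightarrow> complex) \<Rightarrow> (complex ^ 'd \<Rightarrow> complex) \<Rightarrow> complex ^ 'd \<Rightarrow> complex" where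
  "holo_quantization a F = holo_extension (quantization a (boundary_value F))"

definition bounded_operator ::
    "('u \<Rightarrow> complex) set \<Rightarrow> (('u \<Rightarrow> complex) \<Rightarrow> ennreal) \<Rightarrow>
     ('v \<Rightarrow> complex) set \<Rightarrow> (('v \<Rightarrow> complex) \<Rightarrow> ennreal) \<Rightarrow>
     (('u \<Rightarrow> complex) \<Rightarrow> 'v \<Rightarrow> complex) \<Rightarrow> bool" where
  "bounded_operator X NX Y NY T \<longleftrightarrow>
     (\<forall>f\<in>X. T f \<in> Y) \<and>
     (\<forall>f\<in>X. \<forall>g\<in>X. T (\<lambda>t. f t + g t) = (\<lambda>t. T f t + T g t)) \<and>
     (\<forall>c. \<forall>f\<in>X. T (\<lambda>t. c * f t) = (\<lambda>t. c * T f t)) \<and>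
     (\<exists>C::real. \<forall>f\<in>X. NY (T f) \<le> ennreal C * NX f)"

end

theory Submission
 imports Defs
begin

text \<open>
 In terms of Fourier coefficients the operator is the infinite matrix with the entry
 \<open>symb_coeff a (k - n) n\<close>, the Fourier coefficient of \<open>a x n\<close> at the frequency \<open>k - n\<close>, in row \<open>k\<close>
 and column \<open>n\<close>. Smoothness in \<open>x\<close> makes it decay rapidly off the diagonal, so it acts on
 sequences of polynomial growth, that is, on distributions. Triangularity says that this matrix maps
 sequences supported in the positive orthant to such sequences. Hence the substance of the theorem
 is the boundedness of the operator on the spaces over the full torus.

 The operator is split according to the dyadic scale \<open>l\<close> of the input and \<open>j\<close> of the output. For a
 fixed shift \<open>\<nu>\<close> of the frequency, the product of the two cutoffs with \<open>symb_coeff a \<nu>\<close> is a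
 Fourier multiplier at scale \<open>2\<^sup>l\<close>. It can only be nonzero if \<open>\<nu>\<close> is at least as large as
 \<open>2\<^bsup>|j - l|\<^esup>\<close>, up to a constant, so the decay in \<open>\<nu>\<close> produces arbitrarily many powers of
 \<open>2\<^bsup>-|j - l|\<^esup>\<close>; this is \<open>piece_diff_bound\<close>. Summation by parts bounds the kernel of the multiplier
 (\<open>trig_sum_decay\<close>), and summing over \<open>\<nu>\<close> and \<open>l\<close> bounds each block of the image by an almost
 diagonal combination of weighted averages of the blocks of the given distribution
 (\<open>block_quant_pointwise\<close>).

 A block of scale \<open>l\<close> reproduces itself under convolution with a kernel of this scale. Therefore its
 average is bounded by the average of its \<open>r\<close>-th power, raised to the power \<open>1 / r\<close>, for every
 \<open>r\<close> in \<open>(0, 1]\<close> (\<open>wavg_power_le\<close>), and the exponents \<open>p\<close> and \<open>q\<close> may be replaced by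
 \<open>p / r\<close> and \<open>q / r\<close>, which are at least one. What remains is a vector-valued inequality for averages
 in \<open>L\<^sup>p(l\<^sup>q)\<close>. In place of a maximal function, the averages are dominated by convex combinations
 of averages over the cells of finitely many shifted dyadic grids (\<open>avg_kernel_dominated\<close>). These
 are nested like conditional expectations, so the dual form of Doob's inequality holds for them
 (\<open>dual_doob_nested\<close>). It gives the case \<open>q \<le> p\<close> directly and the case \<open>p < q\<close> by duality
 (\<open>vector_inequality_ge\<close>, \<open>vector_inequality_less\<close>). In the latter case the constants are uniform in
 \<open>q\<close>, so that \<open>q = \<infinity>\<close> is reached as a limit. An elementary lemma on almost diagonal matrices
 of scales concludes (\<open>besov_bound\<close>, \<open>triebel_bound\<close>).

 On the polydisc, a sequence of polynomial growth on the positive orthant is the sequence of Taylor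
 coefficients of exactly one holomorphic function and the sequence of Fourier coefficients of its
 boundary value. The identification is linear, and the statements for the holomorphic spaces are
 transported along it (\<open>bounded_operator_holo\<close>).
\<close>

section \<open>Sums over the lattice\<close>

lemma real_vec_nth [simp]: "real_vec n $ j = real_of_int (n $ j)"
 by (simp add: real_vec_def)

lemma real_vec_add [simp]: "real_vec (n + k) = real_vec n + real_vec k"
 by (simp add: vec_eq_iff)

lemma real_vec_diff [simp]: "real_vec (n - k) = real_vec n - real_vec k"
 by (simp add: vec_eq_iff)

lemma real_vec_uminus [simp]: "real_vec (- n) = - real_vec n"
 by (simp add: vec_eq_iff)

lemma real_vec_zero [simp]: "real_vec 0 = 0"
 by (simp add: vec_eq_iff)

lemma real_vec_axis [simp]: "real_vec (axis i 1) = axis i 1"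
 by (simp add: vec_eq_iff axis_def)

lemma jbracket_sq: "(jbracket n)\<^sup>2 = 1 + (norm (real_vec n))\<^sup>2"
 by (simp add: jbracket_def)

lemma jbracket_ge_1: "1 \<le> jbracket n"
 by (simp add: jbracket_def)

lemma jbracket_pos [simp]: "0 < jbracket n"
 using jbracket_ge_1[of n] by linarith

lemma jbracket_uminus [simp]: "jbracket (- n) = jbracket n"
 by (simp add: jbracket_def)

lemma norm_le_jbracket: "norm (real_vec n) \<le> jbracket n"
 unfolding jbracket_def by (rule real_le_rsqrt) auto

lemma jbracket_le: "jbracket n \<le> 1 + norm (real_vec n)"
 unfolding jbracket_def by (rule real_le_lsqrt) (auto simp: power2_eq_square algebra_simps)

lemma component_le_jbracket: "\<bar>real_of_int (n $ j)\<bar> \<le> jbracket n"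
 using component_le_norm_cart[of "real_vec n" j] norm_le_jbracket[of n] by simp

text \<open>Peetre's inequality, which trades a shift of the argument for a factor in the shift.\<close>

lemma jbracket_add_le: "jbracket (n + k) \<le> 2 * jbracket n * jbracket k"
proof -
 have "jbracket (n + k) \<le> 1 + norm (real_vec n + real_vec k)"
  using jbracket_le[of "n + k"] by simp
 also have "\<dots> \<le> 1 + norm (real_vec n) + norm (real_vec k)"
  using norm_triangle_ineq[of "real_vec n" "real_vec k"] by linarith
 also have "\<dots> \<le> jbracket n + jbracket k * jbracket n"
 proof -
  define t u where "t = norm (real_vec n)" and "u = norm (real_vec k)"
  have "t + u \<le> sqrt (1 + u\<^sup>2) * sqrt (1 + t\<^sup>2)"
   unfolding real_sqrt_mult[symmetric]
  proof (rule real_le_rsqrt)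
   have "0 \<le> (1 - t * u)\<^sup>2" by simp
   then show "(t + u)\<^sup>2 \<le> (1 + u\<^sup>2) * (1 + t\<^sup>2)"
    by (simp add: power2_eq_square algebra_simps)
  qed
  moreover have "1 \<le> sqrt (1 + t\<^sup>2)" by simp
  ultimately have "1 + t + u \<le> sqrt (1 + t\<^sup>2) + sqrt (1 + u\<^sup>2) * sqrt (1 + t\<^sup>2)" by linarith
  then show ?thesis by (simp add: t_def u_def jbracket_def)
 qed
 also have "\<dots> \<le> 2 * jbracket n * jbracket k"
  using jbracket_ge_1[of k] jbracket_ge_1[of n] mult_left_mono[of 1 "jbracket k" "jbracket n"] by (simp add: algebra_simps)
 finally show ?thesis .
qed

text \<open>The vectors are the functions on the finite index type, so the sum is a product of
 one-dimensional sums.\<close>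

lemma summable_on_prod_vec:
 fixes g :: "int \<Rightarrow> real"
 assumes "g summable_on A" "\<And>k. k \<in> A \<Longrightarrow> g k \<ge> 0"
 shows "(\<lambda>n :: int ^ 'd. \<Prod>j\<in>UNIV. g (n $ j)) summable_on {n. \<forall>j. n $ j \<in> A}"
proof -
 have 1: "Infinite_Set_Sum.abs_summable_on g A"
  by (rule abs_summable_equivalent[THEN iffD1], rule summable_on_iff_abs_summable_on_real[THEN iffD1], rule assms(1))
 have "Infinite_Set_Sum.abs_summable_on (\<lambda>h. \<Prod>x\<in>(UNIV::'d set). g (h x)) (PiE UNIV (\<lambda>_. A))"
  by (rule abs_summable_on_prod_PiE) (use 1 in auto)
 then have "(\<lambda>h. \<Prod>x\<in>(UNIV::'d set). g (h x)) summable_on (PiE UNIV (\<lambda>_. A))"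
  by (rule summable_on_iff_abs_summable_on_real[THEN iffD2, OF abs_summable_equivalent[THEN iffD2]])
 moreover have "bij_betw vec_nth {n :: int ^ 'd. \<forall>j. n $ j \<in> A} (PiE UNIV (\<lambda>_. A))"
  unfolding PiE_UNIV_domain
  by (rule bij_betwI[where g = vec_lambda]) (auto simp: vec_lambda_inverse)
 ultimately show ?thesis
  by (subst (asm) summable_on_reindex_bij_betw[symmetric]) auto
qed

lemma summable_on_int_inverse_square: "(\<lambda>k::int. 1 / (1 + (real_of_int k)\<^sup>2)) summable_on UNIV"
proof -
 have s: "summable (\<lambda>n. 1 / (1 + (real n)\<^sup>2))"
 proof (rule summable_comparison_test')
  show "summable (\<lambda>n. 1 / (real n)\<^sup>2)" using inverse_power_summable[of 2, where 'a = real] by (simp add: inverse_eq_divide)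
  show "norm (1 / (1 + (real n)\<^sup>2)) \<le> 1 / (real n)\<^sup>2" if "n \<ge> 1" for n
   using that by (auto simp: field_simps add_pos_nonneg)
 qed
 have s': "(\<lambda>n. 1 / (1 + (real n)\<^sup>2)) summable_on UNIV"
  by (rule norm_summable_imp_summable_on) (use s in simp)
 have a: "(\<lambda>k::int. 1 / (1 + (real_of_int k)\<^sup>2)) summable_on (int ` UNIV)"
  by (subst summable_on_reindex) (use s' in \<open>auto simp: o_def\<close>)
 have b: "(\<lambda>k::int. 1 / (1 + (real_of_int k)\<^sup>2)) summable_on ((\<lambda>n. - int n) ` UNIV)"
  by (subst summable_on_reindex) (use s' in \<open>auto simp: o_def inj_on_def\<close>)
 have "(int ` UNIV) \<union> ((\<lambda>n. - int n) ` UNIV) = UNIV"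
 proof -
  have "k \<in> (int ` UNIV) \<union> ((\<lambda>n. - int n) ` UNIV)" for k
   by (cases k rule: int_cases2) auto
  then show ?thesis by blast
 qed
 then show ?thesis using summable_on_union[OF a b] by simp
qed

definition lattice_sum :: "(int ^ 'd::finite) itself \<Rightarrow> real" where
 "lattice_sum _ = (\<Sum>\<^sub>\<infinity>n :: int ^ 'd. 1 / jbracket n ^ (2 * CARD('d)))"

text \<open>Each factor \<open>(jbracket n)\<^sup>2\<close> dominates \<open>1 + (n $ j)\<^sup>2\<close> for one of the coordinates.\<close>

lemma summable_on_jbracket: "(\<lambda>n :: int ^ 'd::finite. 1 / jbracket n ^ (2 * CARD('d))) summable_on UNIV"
proof (rule summable_on_comparison_test)
 show "(\<lambda>n :: int ^ 'd. \<Prod>j\<in>UNIV. 1 / (1 + (real_of_int (n $ j))\<^sup>2)) summable_on UNIV"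
  using summable_on_prod_vec[OF summable_on_int_inverse_square, where 'd = 'd] by simp
 fix n :: "int ^ 'd"
 have "(\<Prod>j\<in>(UNIV::'d set). (1 + (real_of_int (n $ j))\<^sup>2)) \<le> (\<Prod>j\<in>(UNIV::'d set). (jbracket n)\<^sup>2)"
 proof (rule prod_mono)
  fix j
  show "0 \<le> 1 + (real_of_int (n $ j))\<^sup>2 \<and> 1 + (real_of_int (n $ j))\<^sup>2 \<le> (jbracket n)\<^sup>2"
   unfolding jbracket_sq using component_le_norm_cart[of "real_vec n" j]
   by (auto simp: abs_le_square_iff[symmetric])
 qed
 also have "\<dots> = jbracket n ^ (2 * CARD('d))" by (simp add: power_mult)
 finally have "(\<Prod>j\<in>(UNIV::'d set). (1 + (real_of_int (n $ j))\<^sup>2)) \<le> jbracket n ^ (2 * CARD('d))" .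
 moreover have "(\<Prod>j\<in>(UNIV::'d set). (1 + (real_of_int (n $ j))\<^sup>2)) > 0"
  by (intro prod_pos) (auto intro: add_pos_nonneg)
 ultimately show "1 / jbracket n ^ (2 * CARD('d)) \<le> (\<Prod>j\<in>UNIV. 1 / (1 + (real_of_int (n $ j))\<^sup>2))"
  by (simp add: prod_dividef frac_le)
qed auto

lemma finite_lattice_box: "finite {n :: int ^ 'd::finite. \<forall>j. n $ j \<in> {- b..b}}"
 and card_lattice_box: "card {n :: int ^ 'd::finite. \<forall>j. n $ j \<in> {- b..b}} = nat (2 * b + 1) ^ CARD('d)"
proof -
 have bij: "bij_betw vec_nth {n :: int ^ 'd. \<forall>j. n $ j \<in> {- b..b}} (PiE UNIV (\<lambda>_. {- b..b}))"
  unfolding PiE_UNIV_domain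
  by (rule bij_betwI[where g = vec_lambda]) (auto simp: vec_lambda_inverse)
 have f: "finite (PiE (UNIV::'d set) (\<lambda>_. {- b..b}))" by (intro finite_PiE) auto
 show "finite {n :: int ^ 'd. \<forall>j. n $ j \<in> {- b..b}}" using bij_betw_finite[OF bij] f by simp
 show "card {n :: int ^ 'd. \<forall>j. n $ j \<in> {- b..b}} = nat (2 * b + 1) ^ CARD('d)"
  using bij_betw_same_card[OF bij] by (simp add: card_PiE algebra_simps)
qed

lemma lattice_ball_subset:
 "{n :: int ^ 'd::finite. norm (real_vec n) \<le> R} \<subseteq> {n. \<forall>j. n $ j \<in> {- \<lfloor>R\<rfloor>..\<lfloor>R\<rfloor>}}"
proof (clarify)
 fix n :: "int ^ 'd" and j
 assume "norm (real_vec n) \<le> R"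
 then have "\<bar>real_of_int (n $ j)\<bar> \<le> R" using component_le_norm_cart[of "real_vec n" j] by simp
 then have "n $ j \<le> \<lfloor>R\<rfloor>" "- (n $ j) \<le> \<lfloor>R\<rfloor>" by (auto simp: le_floor_iff)
 then show "n $ j \<in> {- \<lfloor>R\<rfloor>..\<lfloor>R\<rfloor>}" by auto
qed

lemma finite_lattice_ball: "finite {n :: int ^ 'd::finite. norm (real_vec n) \<le> R}"
 by (rule finite_subset[OF lattice_ball_subset finite_lattice_box])

lemma card_lattice_ball:
 assumes "R \<ge> 0"
 shows "real (card {n :: int ^ 'd::finite. norm (real_vec n) \<le> R}) \<le> (2 * R + 1) ^ CARD('d)"
proof -
 have "card {n :: int ^ 'd. norm (real_vec n) \<le> R} \<le> nat (2 * \<lfloor>R\<rfloor> + 1) ^ CARD('d)"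
  unfolding card_lattice_box[symmetric] by (rule card_mono[OF finite_lattice_box lattice_ball_subset])
 then have "real (card {n :: int ^ 'd. norm (real_vec n) \<le> R}) \<le> real (nat (2 * \<lfloor>R\<rfloor> + 1)) ^ CARD('d)"
  by (metis of_nat_le_iff of_nat_power)
 also have "\<dots> \<le> (2 * R + 1) ^ CARD('d)"
  by (rule power_mono) (use assms in auto)
 finally show ?thesis .
qed

section \<open>Calculus of smooth periodic functions\<close>

definition periodic :: "(real ^ 'd::finite \<Rightarrow> 'a) \<Rightarrow> bool" where
 "periodic f \<longleftrightarrow> (\<forall>x j. f (x + axis j (2 * pi)) = f x)"

lemma axis_zero [simp]: "axis j 0 = 0"
 by (simp add: axis_eq_0_iff)

lemma test_functions_iff: "\<psi> \<in> test_functions \<longleftrightarrow> smooth \<psi> \<and> periodic \<psi>"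
 by (simp add: test_functions_def periodic_def)

lemma periodic_shift_int:
 assumes "periodic f"
 shows "f (x + axis j (2 * pi * real_of_int k)) = f x"
proof (induction k rule: int_induct[where k = 0])
 case base
 then show ?case by simp
next
 case (step1 i)
 have "x + axis j (2 * pi * real_of_int (i + 1)) = (x + axis j (2 * pi * real_of_int i)) + axis j (2 * pi)"
  by (simp add: vec_eq_iff axis_def algebra_simps)
 then show ?case using step1 assms by (metis periodic_def)
next
 case (step2 i)
 have "x + axis j (2 * pi * real_of_int i) = (x + axis j (2 * pi * real_of_int (i - 1))) + axis j (2 * pi)"
  by (simp add: vec_eq_iff axis_def algebra_simps)
 then show ?case using step2 assms by (metis periodic_def)
qed

lemma periodic_shift_lattice:
 assumes "periodic f"
 shows "f (x + (2 * pi) *\<^sub>R real_vec k) = f x"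
proof -
 have "f (x + (\<Sum>j\<in>J. axis j (2 * pi * real_of_int (k $ j)))) = f x" if "finite J" for J
  using that
 proof (induction J)
  case (insert j J)
  have "f (x + (\<Sum>j\<in>insert j J. axis j (2 * pi * real_of_int (k $ j)))) =
   f ((x + (\<Sum>j\<in>J. axis j (2 * pi * real_of_int (k $ j)))) + axis j (2 * pi * real_of_int (k $ j)))"
   using insert by (simp add: algebra_simps)
  then show ?case using insert periodic_shift_int[OF assms] by simp
 qed simp
 moreover have "(\<Sum>j\<in>UNIV. axis j (2 * pi * real_of_int (k $ j))) = (2 * pi) *\<^sub>R real_vec k"
  by (simp add: vec_eq_iff axis_def if_distrib[of "\<lambda>f. f _"] sum.delta)
 ultimately show ?thesis by (metis finite)
qed

lemma mem_torus_box: "x \<in> torus_box \<longleftrightarrow> (\<forall>j. 0 \<le> x $ j \<and> x $ j \<le> 2 * pi)"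
 by (simp add: torus_box_def mem_box_cart)

lemma torus_box_representative:
 obtains y :: "real ^ 'd::finite" where "y \<in> torus_box" "\<And>f :: real ^ 'd \<Rightarrow> 'a. periodic f \<Longrightarrow> f x = f y"
proof
 define k :: "int ^ 'd" where "k = (\<chi> j. - \<lfloor>x $ j / (2 * pi)\<rfloor>)"
 show "x + (2 * pi) *\<^sub>R real_vec k \<in> torus_box"
  unfolding mem_torus_box
 proof
  fix j
  define t where "t = x $ j / (2 * pi)"
  have "0 \<le> frac t" "frac t \<le> 1" by (auto simp: frac_lt_1 less_imp_le)
  then have "0 * (2 * pi) \<le> frac t * (2 * pi)" "frac t * (2 * pi) \<le> 1 * (2 * pi)"
   by (intro mult_right_mono; simp)+
  moreover have "frac t * (2 * pi) = (x + (2 * pi) *\<^sub>R real_vec k) $ j"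
   by (simp add: k_def t_def frac_def algebra_simps)
  ultimately show "0 \<le> (x + (2 * pi) *\<^sub>R real_vec k) $ j \<and> (x + (2 * pi) *\<^sub>R real_vec k) $ j \<le> 2 * pi"
   by simp
 qed
 show "f x = f (x + (2 * pi) *\<^sub>R real_vec k)" if "periodic f" for f :: "real ^ 'd \<Rightarrow> 'a"
  using periodic_shift_lattice[OF that] by simp
qed

lemma compact_torus_box [simp]: "compact torus_box"
 by (simp add: torus_box_def compact_cbox)

lemma periodic_bounded:
 fixes f :: "real ^ 'd::finite \<Rightarrow> complex"
 assumes "periodic f" "continuous_on UNIV f"
 shows "\<exists>B\<ge>0. \<forall>x. norm (f x) \<le> B"
proof -
 have "bounded (f ` torus_box)"
  by (rule compact_imp_bounded[OF compact_continuous_image])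
    (use assms continuous_on_subset in \<open>auto\<close>)
 then obtain B where B: "B > 0" "\<And>x. x \<in> torus_box \<Longrightarrow> norm (f x) \<le> B"
  by (auto simp: bounded_pos)
 have "norm (f x) \<le> B" for x
 proof -
  obtain y where "y \<in> torus_box" "f x = f y" using torus_box_representative[of x] assms(1) by metis
  then show ?thesis using B by simp
 qed
 then show ?thesis using B(1) less_imp_le by blast
qed

subsection \<open>Partial derivatives\<close>

lemma partial_deriv_eq: "(f has_derivative D) (at x) \<Longrightarrow> partial_deriv j f x = D (axis j 1)"
 unfolding partial_deriv_def using frechet_derivative_at[of f D x] by simp

lemma smooth_differentiable: "smooth f \<Longrightarrow> f differentiable (at x)"
 unfolding smooth_def differentiable_on_def by (auto dest: spec[of _ "[]"])

lemma smooth_continuous: "smooth f \<Longrightarrow> continuous_on A f"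
 by (intro continuous_at_imp_continuous_on ballI differentiable_imp_continuous_within smooth_differentiable)

lemma smooth_partial: "smooth f \<Longrightarrow> smooth (partial_deriv j f)"
proof -
 have "foldr partial_deriv js (partial_deriv j f) = foldr partial_deriv (js @ [j]) f" for js by simp
 then show "smooth f \<Longrightarrow> smooth (partial_deriv j f)" unfolding smooth_def by metis
qed

lemma smooth_funpow_partial: "smooth f \<Longrightarrow> smooth ((partial_deriv j ^^ M) f)"
 by (induction M) (auto intro: smooth_partial)

lemma partial_deriv_mult:
 assumes "f differentiable (at x)" "g differentiable (at x)"
 shows "partial_deriv j (\<lambda>x. f x * g x) x = f x * partial_deriv j g x + partial_deriv j f x * g x"
proof -
 have "((\<lambda>x. f x * g x) has_derivative
  (\<lambda>h. f x * frechet_derivative g (at x) h + frechet_derivative f (at x) h * g x)) (at x)"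
  using assms by (intro has_derivative_mult) (auto simp: frechet_derivative_works[symmetric])
 from partial_deriv_eq[OF this] show ?thesis by (simp add: partial_deriv_def)
qed

lemma has_derivative_shift:
 assumes "(f has_derivative D) (at (x + v))"
 shows "((\<lambda>x. f (x + v)) has_derivative D) (at x)"
proof -
 have "((\<lambda>x. x + v) has_derivative (\<lambda>h. h)) (at x)" by (auto intro!: derivative_eq_intros)
 from has_derivative_compose[OF this assms] show ?thesis .
qed

lemma partial_deriv_shift:
 assumes "f differentiable (at (x + v))"
 shows "partial_deriv j (\<lambda>x. f (x + v)) x = partial_deriv j f (x + v)"
proof -
 have "(f has_derivative frechet_derivative f (at (x + v))) (at (x + v))"
  using assms frechet_derivative_works by blast
 from partial_deriv_eq[OF has_derivative_shift[OF this]] show ?thesis by (simp add: partial_deriv_def)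
qed

lemma periodic_partial:
 assumes "periodic f" "\<And>x. f differentiable (at x)"
 shows "periodic (partial_deriv j f)"
 unfolding periodic_def
proof (intro allI)
 fix x k
 have "(\<lambda>x. f (x + axis k (2 * pi))) = f" using assms(1) by (auto simp: periodic_def)
 then show "partial_deriv j f (x + axis k (2 * pi)) = partial_deriv j f x"
  using partial_deriv_shift[OF assms(2)[of "x + axis k (2 * pi)"], of j] by simp
qed

lemma test_partial: "\<psi> \<in> test_functions \<Longrightarrow> partial_deriv j \<psi> \<in> test_functions"
 by (simp add: test_functions_iff smooth_partial periodic_partial smooth_differentiable)

lemma test_foldr_partial: "\<psi> \<in> test_functions \<Longrightarrow> foldr partial_deriv js \<psi> \<in> test_functions"
 by (induction js) (auto intro: test_partial)

lemma test_funpow_partial: "\<psi> \<in> test_functions \<Longrightarrow> (partial_deriv j ^^ M) \<psi> \<in> test_functions"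
 by (induction M) (auto intro: test_partial)

lemma test_continuous: "\<psi> \<in> test_functions \<Longrightarrow> continuous_on A \<psi>"
 by (simp add: test_functions_iff smooth_continuous)

lemma test_bounded:
 assumes "\<psi> \<in> test_functions" shows "\<exists>B\<ge>0. \<forall>x. norm (\<psi> x) \<le> B"
proof -
 have "periodic \<psi>" using assms by (simp add: test_functions_iff)
 then show ?thesis by (rule periodic_bounded) (rule test_continuous[OF assms])
qed

lemma bdd_above_test: "\<psi> \<in> test_functions \<Longrightarrow> bdd_above (range (\<lambda>x. norm (\<psi> x)))"
 using test_bounded unfolding bdd_above_def by fastforce

lemma partial_deriv_lipschitz:
 assumes d: "\<And>y. f differentiable (at y)" and B: "\<And>y. norm (partial_deriv j f y) \<le> B"
 shows "norm (f (x + axis j t) - f x) \<le> B * \<bar>t\<bar>"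
proof -
 have "norm ((\<lambda>s. f (x + axis j s)) t - (\<lambda>s. f (x + axis j s)) 0) \<le> B * norm (t - 0)"
 proof (rule differentiable_bound[where S = UNIV])
  fix s :: real
  have lin: "((\<lambda>s. x + axis j s) has_derivative (\<lambda>h. axis j h)) (at s)"
  proof -
   have "((\<lambda>s. x + s *\<^sub>R axis j 1) has_derivative (\<lambda>h. h *\<^sub>R axis j 1)) (at s)"
    by (auto intro!: derivative_eq_intros)
   moreover have "s *\<^sub>R axis j 1 = axis j s" for s :: real by (simp add: vec_eq_iff axis_def)
   ultimately show ?thesis by simp
  qed
  let ?D = "frechet_derivative f (at (x + axis j s))"
  have D: "(f has_derivative ?D) (at (x + axis j s))" using d frechet_derivative_works by blast
  show "((\<lambda>s. f (x + axis j s)) has_derivative (\<lambda>h. ?D (axis j h))) (at s within UNIV)"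
   using has_derivative_compose[OF lin D] by simp
  show "onorm (\<lambda>h. ?D (axis j h)) \<le> B"
  proof (rule onorm_bound)
   show "B \<ge> 0" using B[of 0] norm_ge_zero order_trans by blast
   fix h :: real
   have "axis j h = h *\<^sub>R axis j (1::real)" by (simp add: vec_eq_iff axis_def)
   then have "?D (axis j h) = h *\<^sub>R ?D (axis j 1)"
    using linear_cmul[OF has_derivative_linear[OF D]] by simp
   then have "norm (?D (axis j h)) = \<bar>h\<bar> * norm (partial_deriv j f (x + axis j s))"
    by (simp add: partial_deriv_def)
   also have "\<dots> \<le> \<bar>h\<bar> * B" using B by (intro mult_left_mono) auto
   finally show "norm (?D (axis j h)) \<le> B * norm h" by (simp add: mult.commute)
  qed
 qed auto
 then show ?thesis by simp
qed

subsection \<open>Exponentials\<close>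

lemma exp_fun_eq_exp: "exp_fun n x = exp (\<i> * complex_of_real (real_vec n \<bullet> x))"
 by (simp add: exp_fun_def cis_conv_exp)

lemma norm_exp_fun [simp]: "norm (exp_fun n x) = 1"
 by (simp add: exp_fun_def)

lemma exp_fun_zero [simp]: "exp_fun 0 x = 1" "exp_fun n 0 = 1"
 by (simp_all add: exp_fun_def)

lemma exp_fun_add_freq: "exp_fun (n + k) x = exp_fun n x * exp_fun k x"
 by (simp add: exp_fun_def cis_mult inner_add_left)

lemma exp_fun_add: "exp_fun n (x + y) = exp_fun n x * exp_fun n y"
 by (simp add: exp_fun_def cis_mult inner_add_right)

lemma exp_fun_minus: "exp_fun (- n) x = exp_fun n (- x)"
 by (simp add: exp_fun_def inner_minus_left inner_minus_right)

lemma exp_fun_uminus_mult [simp]: "exp_fun (- n) x * exp_fun n x = 1" "exp_fun n x * exp_fun (- n) x = 1"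
 by (simp_all add: exp_fun_add_freq[symmetric])

lemma continuous_exp_fun: "continuous_on A (exp_fun n)"
 unfolding exp_fun_eq_exp[abs_def] by (intro continuous_intros)

lemma exp_fun_axis: "exp_fun n (axis j t) = cis (real_of_int (n $ j) * t)"
 by (simp add: exp_fun_def inner_axis)

lemma periodic_exp_fun: "periodic (exp_fun n)"
proof -
 have "cis (real_of_int k * (2 * pi)) = 1" for k
  using cis_multiple_2pi[of "real_of_int k"] by (simp add: mult.commute mult.left_commute)
 then show ?thesis by (simp add: periodic_def exp_fun_add exp_fun_axis)
qed

lemma has_derivative_exp_fun:
 "(exp_fun n has_derivative (\<lambda>h. \<i> * complex_of_real (real_vec n \<bullet> h) * exp_fun n x)) (at x)"
proof -
 have "((\<lambda>x. \<i> * complex_of_real (real_vec n \<bullet> x)) has_derivative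
   (\<lambda>h. \<i> * complex_of_real (real_vec n \<bullet> h))) (at x)"
  by (intro has_derivative_mult_right has_derivative_of_real has_derivative_inner_right has_derivative_ident)
 moreover have "(exp has_derivative (*) (exp (\<i> * complex_of_real (real_vec n \<bullet> x))))
   (at (\<i> * complex_of_real (real_vec n \<bullet> x)))"
  by (rule has_field_derivative_imp_has_derivative[OF DERIV_exp])
 ultimately show ?thesis
  unfolding exp_fun_eq_exp[abs_def] by (auto dest: has_derivative_compose simp: mult.commute)
qed

lemma partial_deriv_exp_fun:
 "partial_deriv j (\<lambda>x. c * exp_fun n x) = (\<lambda>x. (c * (\<i> * of_int (n $ j))) * exp_fun n x)"
proof
 fix x
 have "((\<lambda>x. c * exp_fun n x) has_derivative
   (\<lambda>h. c * (\<i> * complex_of_real (real_vec n \<bullet> h) * exp_fun n x))) (at x)"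
  by (intro has_derivative_mult_right has_derivative_exp_fun)
 from partial_deriv_eq[OF this]
 show "partial_deriv j (\<lambda>x. c * exp_fun n x) x = (c * (\<i> * of_int (n $ j))) * exp_fun n x"
  by (simp add: inner_axis)
qed

lemma foldr_partial_exp_fun:
 "foldr partial_deriv js (\<lambda>x. c * exp_fun n x) =
   (\<lambda>x. (c * (\<Prod>j\<leftarrow>js. \<i> * of_int (n $ j))) * exp_fun n x)"
proof (induction js)
 case (Cons a js)
 then show ?case by (simp add: partial_deriv_exp_fun) (simp add: algebra_simps)
qed simp

lemma differentiable_exp_fun: "(\<lambda>x. c * exp_fun n x) differentiable (at x)"
 using has_derivative_mult_right[OF has_derivative_exp_fun] differentiableI by blast

lemma test_exp_fun: "exp_fun n \<in> test_functions"
proof -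
 have "foldr partial_deriv js (\<lambda>x. 1 * exp_fun n x) differentiable_on UNIV" for js
  unfolding foldr_partial_exp_fun differentiable_on_def using differentiable_exp_fun by blast
 then show ?thesis by (simp add: test_functions_iff smooth_def periodic_exp_fun)
qed

subsection \<open>Integration over the torus\<close>

lemma set_integrable_torus:
 fixes f :: "real ^ 'd::finite \<Rightarrow> 'b::euclidean_space"
 shows "continuous_on torus_box f \<Longrightarrow> set_integrable lborel torus_box f"
 unfolding set_integrable_def by (intro borel_integrable_compact) auto

lemma torus_integral_eq: "continuous_on torus_box f \<Longrightarrow> torus_integral f = integral torus_box f"
 unfolding torus_integral_def by (intro set_borel_integral_eq_integral set_integrable_torus)

lemma measure_torus_box: "measure lborel (torus_box :: (real ^ 'd::finite) set) = (2 * pi) ^ CARD('d)"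
proof -
 have "(0 :: real ^ 'd) \<in> cbox 0 (\<chi> j. 2 * pi)" by (simp add: mem_box_cart)
 then have "cbox (0 :: real ^ 'd) (\<chi> j. 2 * pi) \<noteq> {}" by blast
 from content_cbox_cart[OF this] show ?thesis by (simp add: torus_box_def)
qed

lemma emeasure_torus_box: "emeasure lborel (torus_box :: (real ^ 'd::finite) set) = ennreal ((2 * pi) ^ CARD('d))"
proof -
 have "emeasure lborel (torus_box :: (real ^ 'd::finite) set) < \<infinity>"
  unfolding torus_box_def by (rule emeasure_lborel_cbox_finite)
 then show ?thesis
  using emeasure_eq_ennreal_measure[of lborel "torus_box :: (real ^ 'd) set"] measure_torus_box[where 'd = 'd] by auto
qed

lemma torus_integral_add:
 "continuous_on torus_box f \<Longrightarrow> continuous_on torus_box g \<Longrightarrow>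
  torus_integral (\<lambda>x. f x + g x) = torus_integral f + torus_integral g"
 unfolding torus_integral_def by (intro set_integral_add set_integrable_torus)

lemma torus_integral_diff:
 "continuous_on torus_box f \<Longrightarrow> continuous_on torus_box g \<Longrightarrow>
  torus_integral (\<lambda>x. f x - g x) = torus_integral f - torus_integral g"
 unfolding torus_integral_def by (intro set_integral_diff set_integrable_torus)

lemma torus_integral_cmult: "torus_integral (\<lambda>x. c * f x) = c * torus_integral f"
 unfolding torus_integral_def by simp

lemma torus_integral_sum:
 "(\<And>i. i \<in> I \<Longrightarrow> continuous_on torus_box (f i)) \<Longrightarrow>
  torus_integral (\<lambda>x. \<Sum>i\<in>I. f i x) = (\<Sum>i\<in>I. torus_integral (f i))"
proof (induction I rule: infinite_finite_induct)
 case (insert i I)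
 then show ?case by (simp add: torus_integral_add continuous_on_sum)
qed (simp_all add: torus_integral_def)

lemma torus_integral_bound:
 fixes f :: "real ^ 'd::finite \<Rightarrow> complex"
 assumes "continuous_on torus_box f" "\<And>x. x \<in> torus_box \<Longrightarrow> norm (f x) \<le> B"
 shows "norm (torus_integral f) \<le> (2 * pi) ^ CARD('d) * B"
proof -
 have "B \<ge> 0" using assms(2)[of 0] order_trans[OF norm_ge_zero[of "f 0"]] by (simp add: mem_torus_box)
 have "norm (integral torus_box f) \<le> B * measure lborel (torus_box :: (real ^ 'd) set)"
  unfolding torus_box_def
  by (rule has_integral_bound[OF \<open>B \<ge> 0\<close> integrable_integral[OF integrable_continuous]])
    (use assms in \<open>auto simp: torus_box_def\<close>)
 then show ?thesis using measure_torus_box[where 'd = 'd] torus_integral_eq[OF assms(1)] by (simp add: mult.commute)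
qed

text \<open>The integral over a period does not depend on the period: the slab that leaves the box on
 one side is the translate of the slab that enters it on the other side.\<close>

lemma torus_integral_shift:
 fixes f :: "real ^ 'd::finite \<Rightarrow> complex"
 assumes per: "periodic f" and c: "continuous_on UNIV f" and t: "0 \<le> t" "t \<le> 2 * pi"
 shows "torus_integral (\<lambda>x. f (x + axis j t)) = torus_integral f"
proof -
 define S where "S p q = cbox (axis j p) (\<chi> i. if i = j then q else 2 * pi)" for p q :: real
 have S: "x \<in> S p q \<longleftrightarrow> p \<le> x $ j \<and> x $ j \<le> q \<and> (\<forall>i. i \<noteq> j \<longrightarrow> 0 \<le> x $ i \<and> x $ i \<le> 2 * pi)" for x p q
  unfolding S_def mem_box_cart by (auto simp: axis_def split: if_splits)
 have int: "f integrable_on S p q" for p q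
  unfolding S_def by (rule integrable_continuous) (use c continuous_on_subset in blast)
 have split: "integral (S p q) f = integral (S p r) f + integral (S r q) f" if "p \<le> r" "r \<le> q" for p q r
 proof -
  have "S p q \<inter> {x. x $ j \<le> r} = S p r" "S p q \<inter> {x. x $ j \<ge> r} = S r q"
   using that by (auto simp: S)
  then show ?thesis
   using integral_split[OF int[of p q, unfolded S_def], of "axis j 1" r]
   by (simp add: inner_axis axis_in_Basis_iff S_def)
 qed
 have shift: "integral (S (p + r) (q + r)) f = integral (S p q) (\<lambda>x. f (x + axis j r))" for p q r
 proof -
  have "axis j p + axis j r = axis j (p + r)"
   "(\<chi> i. if i = j then q else 2 * pi) + axis j r = (\<chi> i. if i = j then q + r else 2 * pi)"
   by (simp_all add: vec_eq_iff axis_def)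
  then show ?thesis
   using integral_shift_cbox_plus[of "axis j p" "\<chi> i. if i = j then q else 2 * pi" f "axis j r"]
   by (simp add: S_def o_def add.commute)
 qed
 have "(\<lambda>x. f (x + axis j (2 * pi))) = f" using per by (auto simp: periodic_def)
 then have "integral (S (2 * pi) (2 * pi + t)) f = integral (S 0 t) f"
  using shift[of 0 "2 * pi" t] by (simp add: add.commute)
 then have "integral (S t (2 * pi + t)) f = integral (S 0 (2 * pi)) f"
  using split[of 0 t "2 * pi + t"] split[of 0 "2 * pi" "2 * pi + t"] t by simp
 then have "integral (S 0 (2 * pi)) (\<lambda>x. f (x + axis j t)) = integral (S 0 (2 * pi)) f"
  using shift[of 0 t "2 * pi"] by simp
 moreover have "S 0 (2 * pi) = torus_box" by (auto simp: S_def torus_box_def)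
 moreover have "continuous_on torus_box (\<lambda>x. f (x + axis j t))"
  by (rule continuous_on_compose2[OF c]) (auto intro!: continuous_intros)
 ultimately show ?thesis
  using torus_integral_eq continuous_on_subset[OF c] by (metis subset_UNIV)
qed

text \<open>The integrals of the difference quotients vanish by translation invariance.\<close>

lemma torus_integral_partial_deriv:
 fixes f :: "real ^ 'd::finite \<Rightarrow> complex"
 assumes per: "periodic f" and d: "\<And>x. f differentiable (at x)"
  and c: "continuous_on UNIV (partial_deriv j f)"
 shows "torus_integral (partial_deriv j f) = 0"
proof -
 obtain B where B: "B \<ge> 0" "\<And>x. norm (partial_deriv j f x) \<le> B"
  using periodic_bounded[OF periodic_partial[OF per d] c] by blast
 have cf: "continuous_on A f" for A
  by (meson continuous_at_imp_continuous_on differentiable_imp_continuous_within d)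
 define t where "t k = inverse (real (Suc k))" for k
 define g where "g k x = of_real (1 / t k) * (f (x + axis j (t k)) - f x)" for k x
 have cs: "continuous_on A (\<lambda>x. f (x + v))" for A v
  by (rule continuous_on_compose2[OF cf[of UNIV]]) (auto intro!: continuous_intros)
 have t: "0 < t k" "t k \<le> 1" for k by (auto simp: t_def field_simps)
 have t2: "t k \<le> 2 * pi" for k using t(2)[of k] pi_gt3 by linarith
 have "torus_integral (g k) = 0" for k
  unfolding g_def torus_integral_cmult
  using torus_integral_diff[OF cs cf] torus_integral_shift[OF per cf, of "t k" j] t[of k] t2 by simp
 moreover have "(\<lambda>k. torus_integral (g k)) \<longlonglongrightarrow> torus_integral (partial_deriv j f)"
  unfolding torus_integral_def set_lebesgue_integral_def
 proof (rule integral_dominated_convergence)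
  show "integrable lborel (\<lambda>x. indicator torus_box x *\<^sub>R B)"
   using set_integrable_torus[of "\<lambda>_. B"] unfolding set_integrable_def by simp
  show "(\<lambda>x. indicator torus_box x *\<^sub>R partial_deriv j f x) \<in> borel_measurable lborel"
   using set_integrable_torus[OF continuous_on_subset[OF c]] unfolding set_integrable_def by auto
  show "(\<lambda>x. indicator torus_box x *\<^sub>R g k x) \<in> borel_measurable lborel" for k
  proof -
   have "continuous_on torus_box (g k)" unfolding g_def by (intro continuous_intros cs cf)
   from set_integrable_torus[OF this] show ?thesis unfolding set_integrable_def by auto
  qed
  show "AE x in lborel. norm (indicator torus_box x *\<^sub>R g k x) \<le> indicator torus_box x *\<^sub>R B" for k
  proof (rule AE_I2)
   fix x
   have "norm (f (x + axis j (t k)) - f x) \<le> B * t k"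
    using partial_deriv_lipschitz[OF d B(2), of x "t k"] t[of k] by simp
   then have "norm (g k x) \<le> B" using t[of k] by (simp add: g_def norm_mult norm_divide field_simps)
   then show "norm (indicator torus_box x *\<^sub>R g k x) \<le> indicator torus_box x *\<^sub>R B"
    by (simp add: indicator_def)
  qed
  show "AE x in lborel. (\<lambda>k. indicator torus_box x *\<^sub>R g k x) \<longlonglongrightarrow> indicator torus_box x *\<^sub>R partial_deriv j f x"
  proof (rule AE_I2)
   fix x
   let ?D = "frechet_derivative f (at x)"
   have D: "(f has_derivative ?D) (at x)" using d frechet_derivative_works by blast
   have na: "norm (axis j r) = \<bar>r\<bar>" for r :: real
    by (simp add: norm_eq_sqrt_inner inner_axis)
   have ax: "axis j r = r *\<^sub>R axis j (1::real)" for r by (simp add: vec_eq_iff axis_def)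
   have "(\<lambda>h. norm (f (x + h) - f x - ?D h) / norm h) \<midarrow>0\<rightarrow> 0"
    using D unfolding has_derivative_at by blast
   moreover have "filterlim (\<lambda>k. axis j (t k)) (at 0) sequentially"
   proof -
    have "(\<lambda>k. t k *\<^sub>R axis j (1::real)) \<longlonglongrightarrow> 0 *\<^sub>R axis j 1"
     unfolding t_def by (intro tendsto_scaleR LIMSEQ_inverse_real_of_nat tendsto_const)
    then have "(\<lambda>k. axis j (t k)) \<longlonglongrightarrow> 0" by (simp add: ax[symmetric])
    moreover have "axis j (t k) \<noteq> 0" for k using t(1)[of k] by (simp add: axis_eq_0_iff)
    ultimately show ?thesis unfolding filterlim_at by simp
   qed
   ultimately have "(\<lambda>k. norm (f (x + axis j (t k)) - f x - ?D (axis j (t k))) / norm (axis j (t k))) \<longlonglongrightarrow> 0"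
    by (rule filterlim_compose)
   moreover have "norm (f (x + axis j (t k)) - f x - ?D (axis j (t k))) / norm (axis j (t k)) = norm (g k x - ?D (axis j 1))" for k
   proof -
    have "?D (axis j (t k)) = t k *\<^sub>R ?D (axis j 1)"
     unfolding ax[of "t k"] using linear_cmul[OF has_derivative_linear[OF D]] by simp
    then have "g k x - ?D (axis j 1) = of_real (1 / t k) * (f (x + axis j (t k)) - f x - ?D (axis j (t k)))"
     using t(1)[of k] by (simp add: g_def scaleR_conv_of_real field_simps)
    then show ?thesis using t(1)[of k] by (simp add: norm_mult norm_divide na)
   qed
   ultimately have "(\<lambda>k. g k x) \<longlonglongrightarrow> ?D (axis j 1)"
    by (intro LIM_zero_cancel[of "\<lambda>k. g k x"] tendsto_norm_zero_cancel[of "\<lambda>k. g k x - ?D (axis j 1)"]) simp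
   then show "(\<lambda>k. indicator torus_box x *\<^sub>R g k x) \<longlonglongrightarrow> indicator torus_box x *\<^sub>R partial_deriv j f x"
    by (intro tendsto_scaleR tendsto_const) (simp add: partial_deriv_def)
  qed
 qed
 ultimately have "(\<lambda>k. 0) \<longlonglongrightarrow> torus_integral (partial_deriv j f)" by simp
 then show ?thesis by (simp add: LIMSEQ_const_iff)
qed

section \<open>Fourier coefficients\<close>

lemma torus_integral_exp_fun:
 "torus_integral (exp_fun n :: real ^ 'd::finite \<Rightarrow> complex) = (if n = 0 then (2 * pi) ^ CARD('d) else 0)"
proof (cases "n = 0")
 case True
 have "torus_integral (\<lambda>x :: real ^ 'd. 1) = measure lborel (torus_box :: (real ^ 'd) set) *\<^sub>R 1"
  unfolding torus_integral_def using emeasure_torus_box[where 'd = 'd]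
  by (subst set_integral_const) (auto simp: torus_box_def)
 moreover have "exp_fun n = (\<lambda>x. 1)" using True by auto
 ultimately show ?thesis using True by (simp add: measure_torus_box scaleR_conv_of_real)
next
 case False
 then obtain j where j: "n $ j \<noteq> 0" by (auto simp: vec_eq_iff)
 have pd: "partial_deriv j (exp_fun n) = (\<lambda>x. (\<i> * of_int (n $ j)) * exp_fun n x)"
  using partial_deriv_exp_fun[of j 1 n] by simp
 have "torus_integral (partial_deriv j (exp_fun n)) = 0"
  by (rule torus_integral_partial_deriv)
    (auto simp: pd periodic_exp_fun intro: smooth_differentiable continuous_intros continuous_exp_fun
     test_exp_fun[unfolded test_functions_iff, THEN conjunct1])
 then show ?thesis using j False unfolding pd torus_integral_cmult by simp
qed

lemma torus_integral_two_exp_fun: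
 fixes n k :: "int ^ 'd::finite"
 shows "torus_integral (\<lambda>x. b * exp_fun n x * exp_fun (- k) x) = (if n = k then b * (2 * pi) ^ CARD('d) else 0)"
proof -
 have "(\<lambda>x. b * exp_fun n x * exp_fun (- k) x) = (\<lambda>x. b * exp_fun (n - k) x)"
  by (simp add: exp_fun_add_freq[symmetric] mult.assoc)
 then show ?thesis by (simp add: torus_integral_cmult torus_integral_exp_fun)
qed

lemma fun_coeff_add:
 "continuous_on torus_box f \<Longrightarrow> continuous_on torus_box g \<Longrightarrow>
  fun_coeff (\<lambda>x. f x + g x) n = fun_coeff f n + fun_coeff g n"
 by (simp add: fun_coeff_def algebra_simps add_divide_distrib[symmetric] torus_integral_add continuous_intros continuous_exp_fun)

lemma fun_coeff_diff:
 "continuous_on torus_box f \<Longrightarrow> continuous_on torus_box g \<Longrightarrow>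
  fun_coeff (\<lambda>x. f x - g x) n = fun_coeff f n - fun_coeff g n"
 by (simp add: fun_coeff_def algebra_simps diff_divide_distrib[symmetric] torus_integral_diff continuous_intros continuous_exp_fun)

lemma fun_coeff_cmult: "fun_coeff (\<lambda>x. c * f x) n = c * fun_coeff f n"
 using torus_integral_cmult[of c "\<lambda>x. f x * exp_fun (- n) x"] by (simp add: fun_coeff_def mult.assoc)

lemma fun_coeff_exp_fun: "fun_coeff (exp_fun n) k = (if n = k then 1 else 0)"
proof -
 have "(\<lambda>x. exp_fun n x * exp_fun (- k) x) = exp_fun (n - k)"
  by (simp add: exp_fun_add_freq[symmetric])
 then show ?thesis by (simp add: fun_coeff_def torus_integral_exp_fun)
qed

lemma fun_coeff_bound:
 fixes f :: "real ^ 'd::finite \<Rightarrow> complex"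
 assumes "continuous_on torus_box f" "\<And>x. x \<in> torus_box \<Longrightarrow> norm (f x) \<le> B"
 shows "norm (fun_coeff f n) \<le> B"
proof -
 have "norm (torus_integral (\<lambda>x. f x * exp_fun (- n) x)) \<le> (2 * pi) ^ CARD('d) * B"
  by (rule torus_integral_bound) (use assms in \<open>auto simp: norm_mult intro!: continuous_intros continuous_exp_fun\<close>)
 moreover have "norm ((2 * complex_of_real pi) ^ CARD('d)) = (2 * pi) ^ CARD('d)"
  by (simp add: norm_power norm_mult)
 ultimately show ?thesis by (simp add: fun_coeff_def norm_divide pos_divide_le_eq mult.commute)
qed

lemma fun_coeff_partial_deriv:
 assumes f: "f \<in> test_functions"
 shows "fun_coeff (partial_deriv j f) n = \<i> * of_int (n $ j) * fun_coeff f n"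
proof -
 let ?e = "exp_fun (- n)"
 have df: "f differentiable (at x)" for x using f by (simp add: test_functions_iff smooth_differentiable)
 have de: "?e differentiable (at x)" for x using differentiable_exp_fun[of 1 "- n"] by simp
 have pd: "partial_deriv j (\<lambda>x. f x * ?e x) = (\<lambda>x. partial_deriv j f x * ?e x - \<i> * of_int (n $ j) * (f x * ?e x))"
 proof
  fix x
  have "partial_deriv j ?e x = - (\<i> * of_int (n $ j)) * ?e x"
   using partial_deriv_exp_fun[of j 1 "- n"] by simp
  then show "partial_deriv j (\<lambda>x. f x * ?e x) x = partial_deriv j f x * ?e x - \<i> * of_int (n $ j) * (f x * ?e x)"
   using partial_deriv_mult[OF df de] by (simp add: algebra_simps)
 qed
 have c: "continuous_on A (\<lambda>x. partial_deriv j f x * ?e x)" "continuous_on A (\<lambda>x. \<i> * of_int (n $ j) * (f x * ?e x))" for A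
  by (intro continuous_intros continuous_exp_fun test_continuous test_partial f)+
 have "torus_integral (partial_deriv j (\<lambda>x. f x * ?e x)) = 0"
 proof (rule torus_integral_partial_deriv)
  show "periodic (\<lambda>x. f x * ?e x)"
   using f periodic_exp_fun[of "- n"] by (simp add: test_functions_iff periodic_def)
  show "(\<lambda>x. f x * ?e x) differentiable (at x)" for x
   by (intro differentiable_mult df de)
  show "continuous_on UNIV (partial_deriv j (\<lambda>x. f x * ?e x))"
   unfolding pd by (intro continuous_on_diff c)
 qed
 then have "torus_integral (\<lambda>x. partial_deriv j f x * ?e x) = \<i> * of_int (n $ j) * torus_integral (\<lambda>x. f x * ?e x)"
  unfolding pd torus_integral_diff[OF c] torus_integral_cmult by simp
 then show ?thesis by (simp add: fun_coeff_def)
qed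

lemma fun_coeff_funpow_partial:
 assumes f: "f \<in> test_functions"
 shows "fun_coeff ((partial_deriv j ^^ M) f) n = (\<i> * of_int (n $ j)) ^ M * fun_coeff f n"
 by (induction M) (simp_all add: fun_coeff_partial_deriv test_funpow_partial f)

lemma jbracket_power_le:
 fixes n :: "int ^ 'd::finite"
 shows "jbracket n ^ M \<le> (real CARD('d) + 1) ^ M * (1 + (\<Sum>j\<in>UNIV. \<bar>real_of_int (n $ j)\<bar> ^ M))"
proof -
 define t where "t = Max (insert 1 (range (\<lambda>j. \<bar>real_of_int (n $ j)\<bar>)))"
 have t: "1 \<le> t" "\<bar>real_of_int (n $ j)\<bar> \<le> t" for j unfolding t_def by (rule Max_ge; simp)+
 have "jbracket n \<le> 1 + norm (real_vec n)" by (rule jbracket_le)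
 also have "\<dots> \<le> 1 + (\<Sum>j\<in>UNIV. \<bar>real_of_int (n $ j)\<bar>)" using norm_le_l1_cart[of "real_vec n"] by simp
 also have "\<dots> \<le> t + (\<Sum>j\<in>(UNIV :: 'd set). t)" by (intro add_mono sum_mono t)
 finally have "jbracket n \<le> (real CARD('d) + 1) * t" by (simp add: algebra_simps)
 then have "jbracket n ^ M \<le> ((real CARD('d) + 1) * t) ^ M" by (intro power_mono) (auto simp: less_imp_le)
 also have "\<dots> = (real CARD('d) + 1) ^ M * t ^ M" by (simp add: power_mult_distrib)
 also have "t ^ M \<le> 1 + (\<Sum>j\<in>UNIV. \<bar>real_of_int (n $ j)\<bar> ^ M)"
 proof -
  have "t \<in> insert 1 (range (\<lambda>j. \<bar>real_of_int (n $ j)\<bar>))" unfolding t_def by (rule Max_in) auto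
  then consider "t = 1" | j where "t = \<bar>real_of_int (n $ j)\<bar>" by auto
  then show ?thesis
  proof cases
   case 1
   then show ?thesis by (simp add: sum_nonneg)
  next
   case 2
   then have "t ^ M \<le> (\<Sum>j\<in>UNIV. \<bar>real_of_int (n $ j)\<bar> ^ M)"
    using member_le_sum[of j UNIV "\<lambda>j. \<bar>real_of_int (n $ j)\<bar> ^ M"] by simp
   then show ?thesis by simp
  qed
 qed
 finally show ?thesis by (simp add: mult_left_mono)
qed

text \<open>Integration by parts in each coordinate separately gives the decay of the coefficients.\<close>

lemma fun_coeff_decay:
 fixes f :: "real ^ 'd::finite \<Rightarrow> complex"
 assumes f: "f \<in> test_functions" and B: "\<And>x. norm (f x) \<le> B"
  "\<And>x j. norm ((partial_deriv j ^^ M) f x) \<le> B"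
 shows "jbracket n ^ M * norm (fun_coeff f n) \<le> (real CARD('d) + 1) ^ (M + 1) * B"
proof -
 have a: "norm (fun_coeff f n) \<le> B"
  by (rule fun_coeff_bound) (use f test_continuous B in auto)
 have b: "\<bar>real_of_int (n $ j)\<bar> ^ M * norm (fun_coeff f n) \<le> B" for j
 proof -
  have "norm (fun_coeff ((partial_deriv j ^^ M) f) n) \<le> B"
   by (rule fun_coeff_bound) (use test_continuous[OF test_funpow_partial[OF f]] B in auto)
  then show ?thesis by (simp add: fun_coeff_funpow_partial f norm_mult norm_power)
 qed
 have "jbracket n ^ M * norm (fun_coeff f n) \<le>
   ((real CARD('d) + 1) ^ M * (1 + (\<Sum>j\<in>UNIV. \<bar>real_of_int (n $ j)\<bar> ^ M))) * norm (fun_coeff f n)"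
  by (intro mult_right_mono jbracket_power_le) auto
 also have "\<dots> = (real CARD('d) + 1) ^ M * (norm (fun_coeff f n) + (\<Sum>j\<in>UNIV. \<bar>real_of_int (n $ j)\<bar> ^ M * norm (fun_coeff f n)))"
  by (simp add: algebra_simps sum_distrib_left sum_distrib_right)
 also have "\<dots> \<le> (real CARD('d) + 1) ^ M * (B + (\<Sum>j\<in>(UNIV::'d set). B))"
  by (intro mult_left_mono add_mono sum_mono a b) auto
 finally show ?thesis by (simp add: algebra_simps)
qed

lemma fun_coeff_rapid_decay:
 assumes f: "f \<in> test_functions"
 shows "\<exists>C\<ge>0. \<forall>n. norm (fun_coeff f n) \<le> C / jbracket n ^ M"
proof -
 obtain B0 where B0: "B0 \<ge> 0" "\<And>x. norm (f x) \<le> B0" using test_bounded[OF f] by blast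
 have "\<forall>j. \<exists>B\<ge>0. \<forall>x. norm ((partial_deriv j ^^ M) f x) \<le> B" using test_bounded[OF test_funpow_partial[OF f]] by blast
 then obtain B where B: "\<And>j. B j \<ge> 0" "\<And>j x. norm ((partial_deriv j ^^ M) f x) \<le> B j" by metis
 define C where "C = B0 + (\<Sum>j\<in>UNIV. B j)"
 have s: "B j \<le> (\<Sum>j\<in>UNIV. B j)" for j using B(1) by (intro member_le_sum) auto
 have "norm (f x) \<le> C" "norm ((partial_deriv j ^^ M) f x) \<le> C" for x j
  using B0(2)[of x] B0(1) B(2)[of j x] s[of j] sum_nonneg[of UNIV B] B(1) by (auto simp: C_def)
 from fun_coeff_decay[OF f this]
 have "norm (fun_coeff f n) \<le> ((real CARD('a) + 1) ^ (M + 1) * C) / jbracket n ^ M" for n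
  by (simp add: pos_le_divide_eq mult.commute)
 moreover have "C \<ge> 0" using B0(1) B(1) by (simp add: C_def sum_nonneg)
 ultimately show ?thesis by (intro exI[of _ "(real CARD('a) + 1) ^ (M + 1) * C"]) auto
qed

subsection \<open>Uniqueness and inversion\<close>

inductive_set trig_polys :: "(real ^ 'd::finite \<Rightarrow> complex) set" where
 monomial: "(\<lambda>x. c * exp_fun n x) \<in> trig_polys"
| add: "f \<in> trig_polys \<Longrightarrow> g \<in> trig_polys \<Longrightarrow> (\<lambda>x. f x + g x) \<in> trig_polys"

lemma trig_polys_const: "(\<lambda>x. c) \<in> trig_polys"
 using trig_polys.monomial[of c 0] by simp

lemma trig_polys_mult:
 assumes "f \<in> trig_polys" "g \<in> trig_polys"
 shows "(\<lambda>x. f x * g x) \<in> trig_polys"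
 using assms(1)
proof induction
 case (monomial c n)
 show ?case
  using assms(2)
 proof induction
  case (monomial c' n')
  then show ?case
   using trig_polys.monomial[of "c * c'" "n + n'"] by (simp add: exp_fun_add_freq algebra_simps)
 next
  case (add f g)
  then show ?case using trig_polys.add[OF add(3,4)] by (simp add: algebra_simps)
 qed
next
 case (add f g)
 then show ?case using trig_polys.add[OF add(3,4)] by (simp add: algebra_simps)
qed

lemma trig_polys_power: "f \<in> trig_polys \<Longrightarrow> (\<lambda>x. f x ^ k) \<in> trig_polys"
 by (induction k) (auto intro: trig_polys_const trig_polys_mult)

lemma trig_polys_prod: "(\<And>i. i \<in> I \<Longrightarrow> f i \<in> trig_polys) \<Longrightarrow> (\<lambda>x. \<Prod>i\<in>I. f i x) \<in> trig_polys"
 by (induction I rule: infinite_finite_induct) (auto intro: trig_polys_const trig_polys_mult)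

lemma continuous_trig_polys: "f \<in> trig_polys \<Longrightarrow> continuous_on A f"
 by (induction rule: trig_polys.induct) (auto intro!: continuous_intros continuous_exp_fun)

lemma trig_polys_orthogonal:
 assumes "p \<in> trig_polys" and h: "continuous_on torus_box h" "\<And>n. fun_coeff h n = 0"
 shows "torus_integral (\<lambda>x. h x * p x) = 0"
 using assms(1)
proof induction
 case (monomial c n)
 have "torus_integral (\<lambda>x. h x * exp_fun n x) = 0" using h(2)[of "- n"] by (simp add: fun_coeff_def)
 then show ?case using torus_integral_cmult[of c "\<lambda>x. h x * exp_fun n x"] by (simp add: algebra_simps)
next
 case (add f g)
 then show ?case
  using torus_integral_add[of "\<lambda>x. h x * f x" "\<lambda>x. h x * g x"]
  by (simp add: algebra_simps continuous_intros continuous_trig_polys h)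
qed

text \<open>The powers of \<open>q + \<eta>\<close>, for a small \<open>\<eta>\<close>, stay at least one near \<open>x0\<close> and tend to zero away from
 \<open>x0\<close>, so the integrals could not vanish if \<open>g\<close> were positive at \<open>x0\<close>.\<close>

lemma peak_powers_detect:
 fixes g q :: "real ^ 'd::finite \<Rightarrow> real"
 assumes g: "continuous_on (cbox a b) g" and q: "continuous_on (cbox a b) q"
  and x0: "x0 \<in> box a b" "q x0 = 1"
  and peak: "\<And>x. x \<in> cbox a b \<Longrightarrow> x \<noteq> x0 \<Longrightarrow> q x < 1" and q0: "\<And>x. x \<in> cbox a b \<Longrightarrow> 0 \<le> q x"
  and zero: "\<And>\<eta> k. (LINT x:cbox a b|lborel. g x * (q x + \<eta>) ^ k) = 0"
 shows "g x0 \<le> 0"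
proof (rule ccontr)
 assume "\<not> g x0 \<le> 0"
 then have g0: "g x0 > 0" by simp
 let ?S = "cbox a b"
 have x0S: "x0 \<in> ?S" using x0 box_subset_cbox by blast
 obtain B where B: "B > 0" "\<And>x. x \<in> ?S \<Longrightarrow> \<bar>g x\<bar> \<le> B"
  using compact_imp_bounded[OF compact_continuous_image[OF g compact_cbox]] by (auto simp: bounded_pos)
 obtain r1 where r1: "r1 > 0" "ball x0 r1 \<subseteq> box a b"
  using open_contains_ball[of "box a b"] x0(1) by auto
 obtain r2 where r2: "r2 > 0" "\<And>x. x \<in> ?S \<Longrightarrow> dist x x0 < r2 \<Longrightarrow> dist (g x) (g x0) < g x0 / 2"
  using g x0S g0 unfolding continuous_on_iff by (metis half_gt_zero)
 define U where "U = ball x0 (min r1 r2)"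
 have U: "U \<subseteq> ?S" "\<And>x. x \<in> U \<Longrightarrow> g x > g x0 / 2" "x0 \<in> U"
 proof -
  show "U \<subseteq> ?S" using r1 box_subset_cbox unfolding U_def by fastforce
  then show "g x > g x0 / 2" if "x \<in> U" for x
   using r2(2)[of x] that by (auto simp: U_def dist_commute dist_real_def abs_if split: if_splits)
  show "x0 \<in> U" using r1 r2 by (simp add: U_def)
 qed
 have "\<exists>\<rho><1. 0 \<le> \<rho> \<and> (\<forall>x\<in>?S - U. q x \<le> \<rho>)"
 proof (cases "?S - U = {}")
  case True
  then show ?thesis by (intro exI[of _ 0]) auto
 next
  case False
  have "compact (?S - U)" unfolding U_def by (intro compact_diff) auto
  moreover have "continuous_on (?S - U) q" using q continuous_on_subset by blast
  ultimately obtain y where y: "y \<in> ?S - U" "\<And>x. x \<in> ?S - U \<Longrightarrow> q x \<le> q y"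
   using continuous_attains_sup[OF _ False] by blast
  then show ?thesis using peak[of y] q0[of y] U(3) by (intro exI[of _ "q y"]) auto
 qed
 then obtain \<rho> where \<rho>: "\<rho> < 1" "0 \<le> \<rho>" "\<And>x. x \<in> ?S - U \<Longrightarrow> q x \<le> \<rho>" by blast
 \<comment> \<open>Half of the gap: \<open>q + \<eta>\<close> is below one off \<open>U\<close> and at least one where \<open>q\<close> is close to \<open>q x0\<close>.\<close>
 define \<eta> where "\<eta> = (1 - \<rho>) / 2"
 have \<eta>: "\<eta> > 0" "\<rho> + \<eta> < 1" using \<rho> by (auto simp: \<eta>_def field_simps)
 obtain r3 where r3: "r3 > 0" "\<And>x. x \<in> ?S \<Longrightarrow> dist x x0 < r3 \<Longrightarrow> dist (q x) (q x0) < \<eta>"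
  using q x0S \<eta>(1) unfolding continuous_on_iff by metis
 define V where "V = ball x0 (min r3 (min r1 r2))"
 have V: "V \<subseteq> U" "\<And>x. x \<in> V \<Longrightarrow> 1 \<le> q x + \<eta>"
 proof -
  show "V \<subseteq> U" by (auto simp: U_def V_def)
  then have "x \<in> ?S" if "x \<in> V" for x using that U(1) by blast
  then show "1 \<le> q x + \<eta>" if "x \<in> V" for x
   using r3(2)[of x] that x0(2) by (auto simp: V_def dist_commute dist_real_def abs_if split: if_splits)
 qed
 have mV: "measure lborel V > 0" unfolding V_def using r1 r2 r3 by (intro content_ball_pos) auto
 have low: "g x * (q x + \<eta>) ^ k \<ge> g x0 / 2 * indicator V x - B * (\<rho> + \<eta>) ^ k" if x: "x \<in> ?S" for x k
 proof (cases "x \<in> U")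
  case True
  have "g x * (q x + \<eta>) ^ k \<ge> g x0 / 2 * indicator V x"
  proof (cases "x \<in> V")
   case True
   then have "1 \<le> (q x + \<eta>) ^ k" using V by (intro one_le_power) auto
   then have "g x0 / 2 * 1 \<le> g x * (q x + \<eta>) ^ k"
    using U(2)[OF \<open>x \<in> U\<close>] g0 by (intro mult_mono) auto
   then show ?thesis using True by simp
  next
   case False
   then show ?thesis using U(2)[OF True] g0 q0[OF x] \<eta> by simp
  qed
  moreover have "0 \<le> B * (\<rho> + \<eta>) ^ k" using B \<rho> \<eta> by simp
  ultimately show ?thesis by linarith
 next
  case False
  have "(q x + \<eta>) ^ k \<le> (\<rho> + \<eta>) ^ k" using \<rho>(3)[of x] x False q0[OF x] \<eta> by (intro power_mono) auto
  then have "\<bar>g x * (q x + \<eta>) ^ k\<bar> \<le> B * (\<rho> + \<eta>) ^ k"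
   unfolding abs_mult using B x q0[OF x] \<eta> by (intro mult_mono) auto
  then show ?thesis using False V(1) by (auto simp: indicator_def)
 qed
 have iV: "integrable lborel (\<lambda>x. indicator ?S x *\<^sub>R (g x0 / 2 * indicator V x))"
 proof -
  have "indicator ?S x *\<^sub>R (g x0 / 2 * indicator V x) = g x0 / 2 * (indicator V x :: real)" for x
   using U(1) V(1) by (cases "x \<in> V") auto
  moreover have "integrable lborel (\<lambda>x. g x0 / 2 * indicator V x :: real)"
   unfolding V_def using emeasure_lborel_ball_finite[of x0 "min r3 (min r1 r2)"]
   by (intro integrable_mult_right integrable_real_indicator) simp_all
  ultimately show ?thesis by (simp only:)
 qed
 have ineq: "g x0 / 2 * measure lborel V \<le> B * measure lborel ?S * (\<rho> + \<eta>) ^ k" for k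
 proof -
  have iB: "set_integrable lborel ?S (\<lambda>x. B * (\<rho> + \<eta>) ^ k)"
   unfolding set_integrable_def by (intro borel_integrable_compact) auto
  have iV': "set_integrable lborel ?S (\<lambda>x. g x0 / 2 * indicator V x)" using iV unfolding set_integrable_def .
  have ig: "set_integrable lborel ?S (\<lambda>x. g x * (q x + \<eta>) ^ k)"
   unfolding set_integrable_def by (intro borel_integrable_compact continuous_intros g q) auto
  have "(LINT x:?S|lborel. g x0 / 2 * indicator V x - B * (\<rho> + \<eta>) ^ k) \<le> (LINT x:?S|lborel. g x * (q x + \<eta>) ^ k)"
   by (rule set_integral_mono) (use low iB iV' ig in auto)
  also have "\<dots> = 0" by (rule zero)
  finally have "(LINT x:?S|lborel. g x0 / 2 * indicator V x) \<le> (LINT x:?S|lborel. B * (\<rho> + \<eta>) ^ k)"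
   using set_integral_diff(2)[OF iV' iB] by simp
  moreover have "(LINT x:?S|lborel. g x0 / 2 * indicator V x) = g x0 / 2 * measure lborel V"
  proof -
   have eq: "indicator ?S x *\<^sub>R (g x0 / 2 * indicator V x) = g x0 / 2 * (indicator V x :: real)" for x
    using U(1) V(1) by (cases "x \<in> V") auto
   show ?thesis unfolding set_lebesgue_integral_def eq by (simp add: V_def)
  qed
  moreover have "(LINT x:?S|lborel. B * (\<rho> + \<eta>) ^ k) = B * measure lborel ?S * (\<rho> + \<eta>) ^ k"
   by (subst set_integral_const) (use emeasure_lborel_cbox_finite[of a b] in \<open>auto simp: less_top[symmetric]\<close>)
  ultimately show ?thesis by (simp only:)
 qed
 have "(\<lambda>k. B * measure lborel ?S * (\<rho> + \<eta>) ^ k) \<longlonglongrightarrow> B * measure lborel ?S * 0"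
  by (intro tendsto_mult_left LIMSEQ_realpow_zero) (use \<rho> \<eta> in auto)
 then have "g x0 / 2 * measure lborel V \<le> 0"
  using ineq by (intro LIMSEQ_le_const[where X = "\<lambda>k. B * measure lborel ?S * (\<rho> + \<eta>) ^ k"]) auto
 then show False using mV g0 by (simp add: mult_le_0_iff)
qed


lemma exp_fun_axis_freq: "exp_fun (axis j 1) x = cis (x $ j)" "exp_fun (- axis j 1) x = cis (- (x $ j))"
 by (simp_all add: exp_fun_def inner_axis')

lemma cos_less_1:
 assumes "0 < \<bar>t\<bar>" "\<bar>t\<bar> < 2 * pi" shows "cos t < 1"
proof -
 have "cos t \<noteq> 1"
 proof
  assume "cos t = 1"
  then obtain n :: int where n: "t = of_int n * 2 * pi" using cos_one_2pi_int[of t] by auto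
  then have "\<bar>t\<bar> = \<bar>real_of_int n\<bar> * (2 * pi)" by (simp add: abs_mult)
  then have "\<bar>real_of_int n\<bar> < 1" "n \<noteq> 0" using assms n by auto
  then show False by linarith
 qed
 then show ?thesis using cos_le_one[of t] by linarith
qed

text \<open>The product of the functions \<open>(1 + cos (x $ j - x0 $ j)) / 2\<close> is a trigonometric polynomial which
 peaks at \<open>x0\<close>. At a boundary point it would peak a second time on the opposite face of the box.\<close>

lemma fourier_unique_interior:
 fixes h :: "real ^ 'd::finite \<Rightarrow> complex"
 assumes h: "continuous_on torus_box h" "\<And>n. fun_coeff h n = 0"
  and x0: "x0 \<in> box 0 (\<chi> j. 2 * pi)"
 shows "h x0 = 0"
proof -
 define g where "g x = Re (cnj (h x0) * h x)" for x
 define w where "w j x = (1 + cos (x $ j - x0 $ j)) / 2" for j and x :: "real ^ 'd"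
 define q where "q x = (\<Prod>j\<in>UNIV. w j x)" for x
 have w: "0 \<le> w j x" "w j x \<le> 1" for j x
 proof -
  have "0 \<le> 1 + cos (x $ j - x0 $ j)" using cos_ge_minus_one[of "x $ j - x0 $ j"] by linarith
  then show "0 \<le> w j x" unfolding w_def by (rule divide_nonneg_pos) simp
  show "w j x \<le> 1" unfolding w_def by auto
 qed
 have trig: "(\<lambda>x. complex_of_real (q x + \<eta>)) \<in> trig_polys" for \<eta>
 proof -
  have "(\<lambda>x. complex_of_real (w j x)) \<in> trig_polys" for j
  proof -
   have "complex_of_real (w j x) = 1 / 2 + (cis (- (x0 $ j)) / 4 * exp_fun (axis j 1) x + cis (x0 $ j) / 4 * exp_fun (- axis j 1) x)" for x
   proof -
    have "cis (- (x0 $ j)) * cis (x $ j) + cis (x0 $ j) * cis (- (x $ j)) = complex_of_real (2 * cos (x $ j - x0 $ j))"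
     by (simp add: cis_mult complex_eq_iff cos_diff sin_diff)
    then show ?thesis by (simp add: exp_fun_axis_freq w_def field_simps)
   qed
   then show ?thesis
    by (simp only:) (rule trig_polys.add[OF trig_polys_const trig_polys.add[OF trig_polys.monomial trig_polys.monomial]])
  qed
  then show ?thesis by (simp add: q_def trig_polys_prod trig_polys.add trig_polys_const)
 qed
 have "g x0 \<le> 0"
 proof (rule peak_powers_detect[where a = 0 and b = "\<chi> j. 2 * pi" and q = q])
  show "continuous_on (cbox 0 (\<chi> j. 2 * pi)) g"
   unfolding g_def using h(1) by (intro continuous_intros) (simp add: torus_box_def)
  show "continuous_on (cbox 0 (\<chi> j. 2 * pi)) q"
   unfolding q_def w_def by (intro continuous_intros) simp
  show "q x0 = 1" by (simp add: q_def w_def)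
  show "0 \<le> q x" for x unfolding q_def by (intro prod_nonneg) (simp add: w)
  show "q x < 1" if x: "x \<in> cbox 0 (\<chi> j. 2 * pi)" "x \<noteq> x0" for x
  proof -
   obtain j where j: "x $ j \<noteq> x0 $ j" using x(2) by (auto simp: vec_eq_iff)
   have "0 \<le> x $ j" "x $ j \<le> 2 * pi" "0 < x0 $ j" "x0 $ j < 2 * pi"
    using x(1) x0 by (auto simp: mem_box_cart)
   then have "cos (x $ j - x0 $ j) < 1" using j by (intro cos_less_1) auto
   then have "w j x < 1" by (simp add: w_def)
   moreover have "q x = w j x * (\<Prod>i\<in>UNIV - {j}. w i x)" unfolding q_def by (rule prod.remove) auto
   moreover have "(\<Prod>i\<in>UNIV - {j}. w i x) \<le> 1" by (intro prod_le_1) (simp add: w)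
   ultimately show ?thesis using w[of j x] mult_left_mono[of "\<Prod>i\<in>UNIV - {j}. w i x" 1 "w j x"] by simp
  qed
  show "(LINT x:cbox 0 (\<chi> j. 2 * pi)|lborel. g x * (q x + \<eta>) ^ k) = 0" for \<eta> k
  proof -
   define F where "F x = cnj (h x0) * (h x * complex_of_real (q x + \<eta>) ^ k)" for x
   have "torus_integral F = 0"
    unfolding F_def torus_integral_cmult
    using trig_polys_orthogonal[OF trig_polys_power[OF trig] h] by simp
   moreover have "integrable lborel (\<lambda>x. indicator torus_box x *\<^sub>R F x)"
   proof -
    have "continuous_on torus_box F"
     unfolding F_def by (intro continuous_intros h continuous_trig_polys[OF trig])
    then show ?thesis using set_integrable_torus unfolding set_integrable_def by blast
   qed
   ultimately have "(LINT x|lborel. Re (indicator torus_box x *\<^sub>R F x)) = 0"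
    unfolding torus_integral_def set_lebesgue_integral_def using integral_Re by (metis zero_complex.sel(1))
   moreover have "Re (indicator torus_box x *\<^sub>R F x) = indicator torus_box x *\<^sub>R (g x * (q x + \<eta>) ^ k)" for x
   proof -
    have "Re (F x) = g x * (q x + \<eta>) ^ k"
    proof -
     have "F x = cnj (h x0) * h x * complex_of_real ((q x + \<eta>) ^ k)" by (simp add: F_def mult.assoc)
     moreover have "Re (z * complex_of_real r) = Re z * r" for z r by simp
     ultimately show ?thesis by (simp only: g_def)
    qed
    then show ?thesis by simp
   qed
   ultimately show ?thesis unfolding set_lebesgue_integral_def torus_box_def by (simp only:)
  qed
 qed (use x0 in auto)
 moreover have "cnj (h x0) * h x0 = complex_of_real ((norm (h x0))\<^sup>2)"
  using complex_norm_square[of "h x0"] by (simp add: mult.commute)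
 ultimately have "(norm (h x0))\<^sup>2 \<le> 0" by (simp only: g_def Re_complex_of_real)
 then show ?thesis by simp
qed

lemma fourier_unique:
 fixes h :: "real ^ 'd::finite \<Rightarrow> complex"
 assumes h: "continuous_on UNIV h" "periodic h" "\<And>n. fun_coeff h n = 0"
 shows "h x = 0"
proof -
 obtain y where y: "y \<in> torus_box" "h x = h y" using torus_box_representative[of x] h(2) by metis
 have ne: "box 0 ((\<chi> j. 2 * pi) :: real ^ 'd) \<noteq> {}"
 proof -
  have "(\<chi> j. pi) \<in> box 0 ((\<chi> j. 2 * pi) :: real ^ 'd)" by (simp add: mem_box_cart)
  then show ?thesis by blast
 qed
 have "closure (box 0 ((\<chi> j. 2 * pi) :: real ^ 'd)) \<subseteq> {z. h z = 0}"
 proof (rule closure_minimal)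
  show "box 0 (\<chi> j. 2 * pi) \<subseteq> {z. h z = 0}"
   using fourier_unique_interior[OF continuous_on_subset[OF h(1)] h(3)] by auto
  show "closed {z. h z = 0}"
   using continuous_closed_preimage_constant[OF h(1) closed_UNIV, of 0] by simp
 qed
 then have "torus_box \<subseteq> {z. h z = 0}" using closure_box[OF ne] by (simp add: torus_box_def)
 then show ?thesis using y by auto
qed

lemma has_sum_torus_integral:
 fixes F :: "'i \<Rightarrow> real ^ 'd::finite \<Rightarrow> complex"
 assumes c: "\<And>i. continuous_on torus_box (F i)"
  and B: "\<And>i x. i \<in> A \<Longrightarrow> x \<in> torus_box \<Longrightarrow> norm (F i x) \<le> B i" "B summable_on A"
 shows "((\<lambda>i. torus_integral (F i)) has_sum torus_integral (\<lambda>x. \<Sum>\<^sub>\<infinity>i\<in>A. F i x)) A"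
proof -
 let ?h = "\<lambda>x. \<Sum>\<^sub>\<infinity>i\<in>A. F i x"
 have u: "uniform_limit torus_box (\<lambda>X x. \<Sum>i\<in>X. F i x) ?h (finite_subsets_at_top A)"
  by (rule Weierstrass_m_test_general[OF B])
 have cs: "continuous_on torus_box (\<lambda>x. \<Sum>i\<in>X. F i x)" for X
  by (intro continuous_on_sum c)
 have ch: "continuous_on torus_box ?h"
  by (rule uniform_limit_theorem[OF always_eventually u]) (use cs in auto)
 have "\<exists>I J. (\<forall>X. ((\<lambda>x. \<Sum>i\<in>X. F i x) has_integral I X) torus_box) \<and>
   (?h has_integral J) torus_box \<and> (I \<longlongrightarrow> J) (finite_subsets_at_top A)"
  unfolding torus_box_def
  by (rule uniform_limit_integral_cbox[OF u[unfolded torus_box_def] cs[unfolded torus_box_def] finite_subsets_at_top_neq_bot]) blast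
 then obtain I J where IJ: "\<And>X. ((\<lambda>x. \<Sum>i\<in>X. F i x) has_integral I X) torus_box"
   "(?h has_integral J) torus_box" "(I \<longlongrightarrow> J) (finite_subsets_at_top A)"
  by blast
 have "I X = (\<Sum>i\<in>X. torus_integral (F i))" for X
  using integral_unique[OF IJ(1)[of X]] torus_integral_eq[OF cs[of X]] torus_integral_sum[of X F, OF c] by simp
 then have "I = sum (\<lambda>i. torus_integral (F i))" by (rule ext)
 moreover have "J = torus_integral ?h"
  using integral_unique[OF IJ(2)] torus_integral_eq[OF ch] by simp
 ultimately show "((\<lambda>i. torus_integral (F i)) has_sum torus_integral ?h) A"
  using IJ(3) unfolding has_sum_def by simp
qed

lemma fun_coeff_summable:
 fixes f :: "real ^ 'd::finite \<Rightarrow> complex"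
 assumes "f \<in> test_functions"
 shows "(\<lambda>n. norm (fun_coeff f n)) summable_on UNIV"
proof -
 obtain C where C: "\<And>n. norm (fun_coeff f n) \<le> C / jbracket n ^ (2 * CARD('d))"
  using fun_coeff_rapid_decay[OF assms, of "2 * CARD('d)"] by blast
 show ?thesis
 proof (rule summable_on_comparison_test)
  show "(\<lambda>n :: int ^ 'd. C * (1 / jbracket n ^ (2 * CARD('d)))) summable_on UNIV"
   by (intro summable_on_cmult_right summable_on_jbracket)
  show "norm (fun_coeff f n) \<le> C * (1 / jbracket n ^ (2 * CARD('d)))" for n using C[of n] by simp
 qed simp
qed

text \<open>The sum of the Fourier series is continuous and has the same coefficients as \<open>f\<close>.\<close>

lemma fourier_inversion:
 fixes f :: "real ^ 'd::finite \<Rightarrow> complex"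
 assumes f: "f \<in> test_functions"
 shows "((\<lambda>n. fun_coeff f n * exp_fun n x) has_sum f x) UNIV"
proof -
 define h where "h x = (\<Sum>\<^sub>\<infinity>n. fun_coeff f n * exp_fun n x)" for x
 note s = fun_coeff_summable[OF f]
 have sx: "(\<lambda>n. fun_coeff f n * exp_fun n x) summable_on UNIV" for x
  by (rule abs_summable_summable) (use s in \<open>simp add: norm_mult\<close>)
 have u: "uniform_limit UNIV (\<lambda>X x. \<Sum>n\<in>X. fun_coeff f n * exp_fun n x) h (finite_subsets_at_top UNIV)"
  unfolding h_def by (rule Weierstrass_m_test_general[OF _ s]) (simp add: norm_mult)
 have ch: "continuous_on UNIV h"
  by (rule uniform_limit_theorem[OF always_eventually u])
    (auto intro!: continuous_intros continuous_exp_fun)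
 have ph: "periodic h" 
 proof -
  have "exp_fun n (x + axis j (2 * pi)) = exp_fun n x" for n :: "int ^ 'd" and x j
   using periodic_exp_fun[of n] by (simp add: periodic_def)
  then show ?thesis by (simp add: periodic_def h_def)
 qed
 have coeff: "fun_coeff h k = fun_coeff f k" for k
 proof -
  have "((\<lambda>n. torus_integral (\<lambda>x. fun_coeff f n * exp_fun n x * exp_fun (- k) x)) has_sum
   torus_integral (\<lambda>x. \<Sum>\<^sub>\<infinity>n. fun_coeff f n * exp_fun n x * exp_fun (- k) x)) UNIV"
   by (rule has_sum_torus_integral[where B = "\<lambda>n. norm (fun_coeff f n)"])
     (auto simp: norm_mult s intro!: continuous_intros continuous_exp_fun)
  moreover have "(\<Sum>\<^sub>\<infinity>n. fun_coeff f n * exp_fun n x * exp_fun (- k) x) = h x * exp_fun (- k) x" for x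
   unfolding h_def by (rule infsum_cmult_left) (use sx in simp)
  ultimately have "((\<lambda>n. if n = k then fun_coeff f n * (2 * pi) ^ CARD('d) else 0) has_sum
    torus_integral (\<lambda>x. h x * exp_fun (- k) x)) UNIV" by (simp only: torus_integral_two_exp_fun)
  then have "torus_integral (\<lambda>x. h x * exp_fun (- k) x) = fun_coeff f k * (2 * pi) ^ CARD('d)"
   by (rule has_sum_unique) (rule has_sum_finite_neutralI[of "{k}"], auto)
  then show ?thesis by (simp add: fun_coeff_def)
 qed
 have "f x - h x = 0" for x
 proof (rule fourier_unique)
  show "continuous_on UNIV (\<lambda>x. f x - h x)" by (intro continuous_intros test_continuous f ch)
  show "periodic (\<lambda>x. f x - h x)" using ph f by (simp add: test_functions_iff periodic_def)
  show "fun_coeff (\<lambda>x. f x - h x) n = 0" for n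
   using coeff fun_coeff_diff[OF test_continuous[OF f] continuous_on_subset[OF ch]] by simp
 qed
 then have "h x = f x" by simp
 then show ?thesis using has_sum_infsum[OF sx[of x]] by (simp add: h_def)
qed

section \<open>Multi-indices in one direction\<close>

lemma coord_list: "set (coord_list :: 'd::finite list) = UNIV" "distinct (coord_list :: 'd list)"
proof -
 have "\<exists>js :: 'd list. set js = UNIV \<and> distinct js"
  using finite_distinct_list[of "UNIV :: 'd set"] by auto
 from someI_ex[OF this] show "set (coord_list :: 'd list) = UNIV" "distinct (coord_list :: 'd list)"
  unfolding coord_list_def by auto
qed

text \<open>Estimates for the powers of a single partial derivative or difference suffice, because decay in
 every coordinate direction is decay in the norm.\<close>

lemma mi_list_axis: "mi_list (axis i M) = replicate M i"
proof -
 have "concat (map (\<lambda>j. replicate (axis i M $ j) j) js) = (if i \<in> set js then replicate M i else [])"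
  if "distinct js" for js
  using that by (induction js) (auto simp: axis_def)
 then show ?thesis using coord_list[where 'd = 'a] by (simp add: mi_list_def)
qed

lemma foldr_replicate: "foldr f (replicate M i) = (f i ^^ M)"
 by (induction M) auto

lemma mi_deriv_axis: "mi_deriv (axis i M) f = (partial_deriv i ^^ M) f"
 by (simp add: mi_deriv_def mi_list_axis foldr_replicate)

lemma mi_diff_axis: "mi_diff (axis i M) g = (forward_diff i ^^ M) g"
 by (simp add: mi_diff_def mi_list_axis foldr_replicate)

lemma abs_mi_axis: "abs_mi (axis i M) = M"
 by (simp add: abs_mi_def axis_def if_distrib[of "\<lambda>f. f _"] sum.delta)

lemma length_mi_list: "length (mi_list \<alpha>) = abs_mi \<alpha>"
proof -
 have "length (mi_list \<alpha>) = sum_list (map (\<lambda>j. \<alpha> $ j) coord_list)"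
  by (simp add: mi_list_def length_concat o_def)
 also have "\<dots> = abs_mi \<alpha>"
  unfolding abs_mi_def using coord_list[where 'd = 'a] by (simp add: sum_list_distinct_conv_sum_set)
 finally show ?thesis .
qed

lemma finite_abs_mi: "finite {\<alpha> :: nat ^ 'd::finite. abs_mi \<alpha> \<le> N}"
proof -
 have "{\<alpha> :: nat ^ 'd. abs_mi \<alpha> \<le> N} \<subseteq> vec_lambda ` (PiE UNIV (\<lambda>_. {..N}))"
 proof
  fix \<alpha> :: "nat ^ 'd" assume "\<alpha> \<in> {\<alpha>. abs_mi \<alpha> \<le> N}"
  then have "\<alpha> $ j \<le> N" for j
   using member_le_sum[of j UNIV "\<lambda>j. \<alpha> $ j"] by (simp add: abs_mi_def)
  then show "\<alpha> \<in> vec_lambda ` (PiE UNIV (\<lambda>_. {..N}))"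
   by (intro image_eqI[of _ _ "vec_nth \<alpha>"]) auto
 qed
 then show ?thesis by (rule finite_subset) (intro finite_imageI finite_PiE; simp)
qed

section \<open>Distributions and their Fourier coefficients\<close>

text \<open>The growth condition that characterizes the coefficients of periodic distributions.\<close>

definition poly_bounded :: "(int ^ 'd::finite \<Rightarrow> complex) \<Rightarrow> bool" where
 "poly_bounded c \<longleftrightarrow> (\<exists>C M. \<forall>n. norm (c n) \<le> C * jbracket n ^ M)"

lemma poly_boundedE:
 assumes "poly_bounded c"
 obtains C M where "C \<ge> 0" "\<And>n. norm (c n) \<le> C * jbracket n ^ M"
proof -
 obtain C M where C: "\<And>n. norm (c n) \<le> C * jbracket n ^ M" using assms by (auto simp: poly_bounded_def)
 have "norm (c n) \<le> max C 0 * jbracket n ^ M" for n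
  by (rule order_trans[OF C]) (intro mult_right_mono zero_le_power; simp add: less_imp_le)
 then show ?thesis using that[of "max C 0" M] by simp
qed

text \<open>Each derivative of an exponential costs one factor of the size of its frequency.\<close>

lemma poly_bounded_dist_coeff:
 assumes "u \<in> distributions"
 shows "poly_bounded (dist_coeff u)"
proof -
 obtain C N where C: "\<And>\<psi>. \<psi> \<in> test_functions \<Longrightarrow>
   norm (u \<psi>) \<le> C * (\<Sum>\<alpha>\<in>{\<alpha>. abs_mi \<alpha> \<le> N}. SUP x. norm (mi_deriv \<alpha> \<psi> x))"
  using assms unfolding distributions_def by blast
 have "norm (dist_coeff u n) \<le> \<bar>C\<bar> * real (card {\<alpha> :: nat ^ 'a. abs_mi \<alpha> \<le> N}) * jbracket n ^ N" for n
 proof -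
  have sup: "(SUP x. norm (mi_deriv \<alpha> (exp_fun (- n)) x)) \<le> jbracket n ^ N" if \<alpha>: "abs_mi \<alpha> \<le> N" for \<alpha>
  proof (rule cSUP_least)
   fix x
   have "norm (\<Prod>j\<leftarrow>js. \<i> * of_int ((- n) $ j) :: complex) \<le> jbracket n ^ length js" for js
   proof (induction js)
    case (Cons a js)
    have "norm (\<i> * of_int ((- n) $ a) :: complex) \<le> jbracket n"
     using component_le_jbracket[of n a] by (simp add: norm_mult)
    then show ?case using Cons by (simp add: norm_mult mult_mono)
   qed simp
   from this[of "mi_list \<alpha>"] have "norm (mi_deriv \<alpha> (\<lambda>x. 1 * exp_fun (- n) x) x) \<le> jbracket n ^ abs_mi \<alpha>"
    unfolding mi_deriv_def foldr_partial_exp_fun by (simp add: norm_mult length_mi_list)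
   also have "\<dots> \<le> jbracket n ^ N" using \<alpha> jbracket_ge_1 by (intro power_increasing) auto
   finally show "norm (mi_deriv \<alpha> (exp_fun (- n)) x) \<le> jbracket n ^ N" by simp
  qed simp
  have pos: "0 \<le> (SUP x. norm (mi_deriv \<alpha> (exp_fun (- n)) x))" for \<alpha>
   unfolding mi_deriv_def
   by (rule cSUP_upper2[OF bdd_above_test[OF test_foldr_partial[OF test_exp_fun]], of 0]) auto
  have "norm (u (exp_fun (- n))) \<le> C * (\<Sum>\<alpha>\<in>{\<alpha>. abs_mi \<alpha> \<le> N}. SUP x. norm (mi_deriv \<alpha> (exp_fun (- n)) x))"
   by (rule C[OF test_exp_fun])
  also have "\<dots> \<le> \<bar>C\<bar> * (\<Sum>\<alpha>\<in>{\<alpha>. abs_mi \<alpha> \<le> N}. SUP x. norm (mi_deriv \<alpha> (exp_fun (- n)) x))"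
   by (intro mult_right_mono sum_nonneg pos) auto
  also have "\<dots> \<le> \<bar>C\<bar> * (\<Sum>\<alpha>\<in>{\<alpha> :: nat ^ 'a. abs_mi \<alpha> \<le> N}. jbracket n ^ N)"
   by (intro mult_left_mono sum_mono sup) auto
  also have "\<dots> = \<bar>C\<bar> * real (card {\<alpha> :: nat ^ 'a. abs_mi \<alpha> \<le> N}) * jbracket n ^ N" by simp
  finally have a: "norm (u (exp_fun (- n))) \<le> \<bar>C\<bar> * real (card {\<alpha> :: nat ^ 'a. abs_mi \<alpha> \<le> N}) * jbracket n ^ N" .
  have "norm (dist_coeff u n) = norm (u (exp_fun (- n))) / (2 * pi) ^ CARD('a)"
   by (simp add: dist_coeff_def norm_divide norm_power norm_mult)
  also have "\<dots> \<le> norm (u (exp_fun (- n))) / 1"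
   by (intro divide_left_mono one_le_power) (use pi_gt3 in auto)
  finally show ?thesis using a by simp
 qed
 then show ?thesis unfolding poly_bounded_def by blast
qed

text \<open>The sum of the trigonometric series with the coefficients \<open>c\<close>. The sign of the frequency comes from
 the bilinear pairing of functions and test functions.\<close>

definition series_dist :: "(int ^ 'd::finite \<Rightarrow> complex) \<Rightarrow> 'd dist" where
 "series_dist c \<psi> = (if \<psi> \<in> test_functions then (2 * pi) ^ CARD('d) * (\<Sum>\<^sub>\<infinity>n. c n * fun_coeff \<psi> (- n)) else 0)"

lemma series_summable:
 fixes c :: "int ^ 'd::finite \<Rightarrow> complex"
 assumes c: "\<And>n. norm (c n) \<le> C * jbracket n ^ M" and C: "C \<ge> 0" and \<psi>: "\<psi> \<in> test_functions"
  and D: "\<And>n. norm (fun_coeff \<psi> n) \<le> D / jbracket n ^ (M + 2 * CARD('d))"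
 shows "(\<lambda>n. norm (c n * fun_coeff \<psi> (- n))) summable_on UNIV"
  and "(\<Sum>\<^sub>\<infinity>n. norm (c n * fun_coeff \<psi> (- n))) \<le> C * D * lattice_sum TYPE(int ^ 'd)"
proof -
 have s: "(\<lambda>n :: int ^ 'd. C * D * (1 / jbracket n ^ (2 * CARD('d)))) summable_on UNIV"
  by (intro summable_on_cmult_right summable_on_jbracket)
 have b: "norm (c n * fun_coeff \<psi> (- n)) \<le> C * D * (1 / jbracket n ^ (2 * CARD('d)))" for n
 proof -
  have "norm (c n * fun_coeff \<psi> (- n)) \<le> (C * jbracket n ^ M) * (D / jbracket (- n) ^ (M + 2 * CARD('d)))"
   unfolding norm_mult using C by (intro mult_mono c D) (auto simp: less_imp_le)
  also have "\<dots> = C * D * (1 / jbracket n ^ (2 * CARD('d)))"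
   using jbracket_pos[of n] by (simp add: power_add field_simps)
  finally show ?thesis .
 qed
 show 1: "(\<lambda>n. norm (c n * fun_coeff \<psi> (- n))) summable_on UNIV"
  by (rule summable_on_comparison_test[OF s b]) simp
 have "(\<Sum>\<^sub>\<infinity>n. norm (c n * fun_coeff \<psi> (- n))) \<le> (\<Sum>\<^sub>\<infinity>n :: int ^ 'd. C * D * (1 / jbracket n ^ (2 * CARD('d))))"
  by (rule infsum_mono[OF 1 s b])
 also have "\<dots> = C * D * lattice_sum TYPE(int ^ 'd)"
  unfolding lattice_sum_def by (intro infsum_cmult_right summable_on_jbracket)
 finally show "(\<Sum>\<^sub>\<infinity>n. norm (c n * fun_coeff \<psi> (- n))) \<le> C * D * lattice_sum TYPE(int ^ 'd)" .
qed

lemma series_summable':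
 assumes c: "poly_bounded c" and \<psi>: "\<psi> \<in> test_functions"
 shows "(\<lambda>n. norm (c n * fun_coeff \<psi> (- n))) summable_on UNIV" "(\<lambda>n. c n * fun_coeff \<psi> (- n)) summable_on UNIV"
proof -
 obtain C M where C: "C \<ge> 0" "\<And>n. norm (c n) \<le> C * jbracket n ^ M" using poly_boundedE[OF c] by blast
 obtain D where "\<And>n. norm (fun_coeff \<psi> n) \<le> D / jbracket n ^ (M + 2 * CARD('a))"
  using fun_coeff_rapid_decay[OF \<psi>, of "M + 2 * CARD('a)"] by blast
 from series_summable(1)[OF C(2) C(1) \<psi> this]
 show s: "(\<lambda>n. norm (c n * fun_coeff \<psi> (- n))) summable_on UNIV" .
 show "(\<lambda>n. c n * fun_coeff \<psi> (- n)) summable_on UNIV" by (rule abs_summable_summable[OF s])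
qed

lemma torus_integral_eq_fun_coeff:
 "torus_integral (\<lambda>x. c * exp_fun n x * \<psi> x) = (2 * pi) ^ CARD('d) * (c * fun_coeff \<psi> (- n))"
 for \<psi> :: "real ^ 'd::finite \<Rightarrow> complex"
 using torus_integral_cmult[of c "\<lambda>x. \<psi> x * exp_fun n x"] by (simp add: fun_coeff_def algebra_simps)

lemma series_dist_has_sum:
 fixes c :: "int ^ 'd::finite \<Rightarrow> complex"
 assumes c: "poly_bounded c" and \<psi>: "\<psi> \<in> test_functions"
 shows "((\<lambda>n. torus_integral (\<lambda>x. c n * exp_fun n x * \<psi> x)) has_sum series_dist c \<psi>) UNIV"
 using has_sum_cmult_right[OF has_sum_infsum[OF series_summable'(2)[OF c \<psi>]], of "(2 * pi) ^ CARD('d)"] \<psi>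
 by (simp add: torus_integral_eq_fun_coeff series_dist_def)

lemma dist_coeff_series_dist:
 fixes c :: "int ^ 'd::finite \<Rightarrow> complex"
 shows "dist_coeff (series_dist c) n = c n"
proof -
 have "(\<Sum>\<^sub>\<infinity>k. c k * fun_coeff (exp_fun (- n)) (- k)) = c n"
  by (rule infsumI, rule has_sum_finite_neutralI[of "{n}"]) (auto simp: fun_coeff_exp_fun)
 then show ?thesis by (simp add: dist_coeff_def series_dist_def test_exp_fun)
qed

lemma test_add:
 assumes "\<psi> \<in> test_functions" "\<eta> \<in> test_functions"
 shows "(\<lambda>x. \<psi> x + \<eta> x) \<in> test_functions"
proof -
 have d: "foldr partial_deriv js \<psi> differentiable (at x)" "foldr partial_deriv js \<eta> differentiable (at x)" for js x
  using assms test_foldr_partial smooth_differentiable test_functions_iff by blast+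
 have eq: "foldr partial_deriv js (\<lambda>x. \<psi> x + \<eta> x) = (\<lambda>x. foldr partial_deriv js \<psi> x + foldr partial_deriv js \<eta> x)" for js
 proof (induction js)
  case (Cons a js)
  show ?case
  proof
   fix x
   have "((\<lambda>x. foldr partial_deriv js \<psi> x + foldr partial_deriv js \<eta> x) has_derivative
     (\<lambda>h. frechet_derivative (foldr partial_deriv js \<psi>) (at x) h + frechet_derivative (foldr partial_deriv js \<eta>) (at x) h)) (at x)"
    by (intro has_derivative_add) (auto simp: frechet_derivative_works[symmetric] d)
   from partial_deriv_eq[OF this, of a, folded partial_deriv_def]
   show "foldr partial_deriv (a # js) (\<lambda>x. \<psi> x + \<eta> x) x = foldr partial_deriv (a # js) \<psi> x + foldr partial_deriv (a # js) \<eta> x"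
    by (simp only: foldr.simps comp_apply Cons)
  qed
 qed simp
 show ?thesis
  using assms by (auto simp: test_functions_iff smooth_def eq differentiable_on_def periodic_def d intro!: differentiable_add)
qed

lemma test_cmult:
 assumes "\<psi> \<in> test_functions"
 shows "(\<lambda>x. c * \<psi> x) \<in> test_functions"
proof -
 have d: "foldr partial_deriv js \<psi> differentiable (at x)" for js x
  using assms test_foldr_partial smooth_differentiable test_functions_iff by blast
 have eq: "foldr partial_deriv js (\<lambda>x. c * \<psi> x) = (\<lambda>x. c * foldr partial_deriv js \<psi> x)" for js
 proof (induction js)
  case (Cons a js)
  show ?case
  proof
   fix x
   have "((\<lambda>x. c * foldr partial_deriv js \<psi> x) has_derivative
     (\<lambda>h. c * frechet_derivative (foldr partial_deriv js \<psi>) (at x) h)) (at x)"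
    by (intro has_derivative_mult_right) (auto simp: frechet_derivative_works[symmetric] d)
   from partial_deriv_eq[OF this, of a, folded partial_deriv_def]
   show "foldr partial_deriv (a # js) (\<lambda>x. c * \<psi> x) x = c * foldr partial_deriv (a # js) \<psi> x"
    by (simp only: foldr.simps comp_apply Cons)
  qed
 qed simp
 show ?thesis
  using assms by (auto simp: test_functions_iff smooth_def eq differentiable_on_def periodic_def d intro!: differentiable_mult)
qed

lemma series_dist_distribution:
 fixes c :: "int ^ 'd::finite \<Rightarrow> complex"
 assumes c: "poly_bounded c"
 shows "series_dist c \<in> distributions"
proof -
 note summ = series_summable'(2)[OF c]
 have cont: "continuous_on torus_box \<psi>" if "\<psi> \<in> test_functions" for \<psi> :: "real ^ 'd \<Rightarrow> complex"
  using test_continuous[OF that] .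
 obtain C M where C: "C \<ge> 0" "\<And>n. norm (c n) \<le> C * jbracket n ^ M" using poly_boundedE[OF c] by blast
 define N where "N = M + 2 * CARD('d)"
 define K where "K = (2 * pi) ^ CARD('d) * (C * (real CARD('d) + 1) ^ (N + 1) * lattice_sum TYPE(int ^ 'd))"
 have bound: "norm (series_dist c \<psi>) \<le> K * (\<Sum>\<alpha>\<in>{\<alpha>. abs_mi \<alpha> \<le> N}. SUP x. norm (mi_deriv \<alpha> \<psi> x))"
  if \<psi>: "\<psi> \<in> test_functions" for \<psi>
 proof -
  define B where "B = (\<Sum>\<alpha>\<in>{\<alpha>. abs_mi \<alpha> \<le> N}. SUP x. norm (mi_deriv \<alpha> \<psi> x))"
  have bdd: "bdd_above (range (\<lambda>x. norm (mi_deriv \<alpha> \<psi> x)))" for \<alpha>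
   unfolding mi_deriv_def by (intro bdd_above_test test_foldr_partial \<psi>)
  have pos: "0 \<le> (SUP x. norm (mi_deriv \<alpha> \<psi> x))" for \<alpha>
   by (rule cSUP_upper2[OF bdd, of 0]) auto
  have B: "norm (mi_deriv \<alpha> \<psi> x) \<le> B" if "abs_mi \<alpha> \<le> N" for \<alpha> x
  proof -
   have "norm (mi_deriv \<alpha> \<psi> x) \<le> (SUP x. norm (mi_deriv \<alpha> \<psi> x))" by (intro cSUP_upper bdd) simp
   also have "\<dots> \<le> B" unfolding B_def
    using that by (intro member_le_sum[of \<alpha> _ "\<lambda>\<alpha>. SUP x. norm (mi_deriv \<alpha> \<psi> x)"] finite_abs_mi pos) auto
   finally show ?thesis .
  qed
  have "norm (\<psi> x) \<le> B" "norm ((partial_deriv j ^^ N) \<psi> x) \<le> B" for x j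
   using B[of "axis j 0" x] B[of "axis j N" x] by (simp_all add: mi_deriv_axis abs_mi_axis del: axis_zero)
  from fun_coeff_decay[OF \<psi> this]
  have "norm (fun_coeff \<psi> n) \<le> ((real CARD('d) + 1) ^ (N + 1) * B) / jbracket n ^ (M + 2 * CARD('d))" for n
   by (simp add: pos_le_divide_eq mult.commute N_def)
  note s = series_summable[OF C(2) C(1) \<psi> this]
  have "norm (series_dist c \<psi>) = (2 * pi) ^ CARD('d) * norm (\<Sum>\<^sub>\<infinity>n. c n * fun_coeff \<psi> (- n))"
   by (simp add: series_dist_def \<psi> norm_mult norm_power)
  also have "\<dots> \<le> (2 * pi) ^ CARD('d) * (\<Sum>\<^sub>\<infinity>n. norm (c n * fun_coeff \<psi> (- n)))"
   by (intro mult_left_mono norm_infsum_bound s(1)) simp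
  also have "\<dots> \<le> (2 * pi) ^ CARD('d) * (C * ((real CARD('d) + 1) ^ (N + 1) * B) * lattice_sum TYPE(int ^ 'd))"
   by (intro mult_left_mono s(2)) simp
  also have "\<dots> = K * B" by (simp add: K_def algebra_simps)
  finally show ?thesis by (simp add: B_def)
 qed
 have add: "series_dist c (\<lambda>x. \<psi> x + \<eta> x) = series_dist c \<psi> + series_dist c \<eta>"
  if "\<psi> \<in> test_functions" "\<eta> \<in> test_functions" for \<psi> \<eta>
  using that test_add[OF that] infsum_add[OF summ[OF that(1)] summ[OF that(2)]]
  by (simp add: series_dist_def fun_coeff_add cont algebra_simps)
 have cmult: "series_dist c (\<lambda>x. d * \<psi> x) = d * series_dist c \<psi>" if "\<psi> \<in> test_functions" for d \<psi>
  using that test_cmult[OF that, of d] infsum_cmult_right[OF summ[OF that], of d]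
  by (simp add: series_dist_def fun_coeff_cmult algebra_simps)
 have zero: "series_dist c \<psi> = 0" if "\<psi> \<notin> test_functions" for \<psi>
  using that by (simp add: series_dist_def)
 show ?thesis
  unfolding distributions_def using zero add cmult bound by blast
qed

subsection \<open>Symbols\<close>

definition symb_coeff :: "(real ^ 'd::finite \<Rightarrow> int ^ 'd \<Rightarrow> complex) \<Rightarrow> int ^ 'd \<Rightarrow> int ^ 'd \<Rightarrow> complex" where
 "symb_coeff a \<nu> n = fun_coeff (\<lambda>x. a x n) \<nu>"

lemma symbols_test: "a \<in> symbols m \<Longrightarrow> (\<lambda>x. a x n) \<in> test_functions"
 by (simp add: symbols_def)

lemma funpow_forward_diff_linear:
 "(forward_diff i ^^ \<beta>) (\<lambda>k. c * g k) n = c * (forward_diff i ^^ \<beta>) g n"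
proof (induction \<beta> arbitrary: n)
 case (Suc \<beta>)
 then show ?case by (simp add: forward_diff_def algebra_simps)
qed simp

lemma funpow_forward_diff_fun_coeff:
 assumes "\<And>k. (\<lambda>x. g x k) \<in> test_functions"
 shows "continuous_on torus_box (\<lambda>x. (forward_diff i ^^ \<beta>) (g x) n) \<and>
  (forward_diff i ^^ \<beta>) (\<lambda>k. fun_coeff (\<lambda>x. g x k) \<nu>) n = fun_coeff (\<lambda>x. (forward_diff i ^^ \<beta>) (g x) n) \<nu>"
proof (induction \<beta> arbitrary: n)
 case 0
 then show ?case using test_continuous[OF assms] by simp
next
 case (Suc \<beta>)
 have c: "continuous_on torus_box (\<lambda>x. (forward_diff i ^^ \<beta>) (g x) n)" for n
  using Suc by blast
 have e: "(forward_diff i ^^ \<beta>) (\<lambda>k. fun_coeff (\<lambda>x. g x k) \<nu>) n = fun_coeff (\<lambda>x. (forward_diff i ^^ \<beta>) (g x) n) \<nu>" for n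
  using Suc by blast
 have "(forward_diff i ^^ Suc \<beta>) (\<lambda>k. fun_coeff (\<lambda>x. g x k) \<nu>) n = fun_coeff (\<lambda>x. (forward_diff i ^^ Suc \<beta>) (g x) n) \<nu>"
  by (simp add: forward_diff_def e fun_coeff_diff[OF c c])
 moreover have "continuous_on torus_box (\<lambda>x. (forward_diff i ^^ Suc \<beta>) (g x) n)"
  by (simp add: forward_diff_def continuous_intros c)
 ultimately show ?case by blast
qed

text \<open>Derivatives in \<open>x\<close> become decay in \<open>\<nu>\<close>, uniformly in \<open>n\<close>; differences in \<open>n\<close> commute with taking
 coefficients in \<open>x\<close>.\<close>

lemma symb_coeff_bound:
 fixes a :: "real ^ 'd::finite \<Rightarrow> int ^ 'd \<Rightarrow> complex"
 assumes a: "a \<in> symbols m"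
 shows "\<exists>C\<ge>0. \<forall>\<nu> n. norm ((forward_diff i ^^ \<beta>) (symb_coeff a \<nu>) n) \<le>
  C * jbracket n powr (m - real \<beta>) / jbracket \<nu> ^ M"
proof -
 have "\<exists>C\<ge>0. \<forall>\<nu> n. \<bar>real_of_int (\<nu> $ j)\<bar> ^ M' * norm ((forward_diff i ^^ \<beta>) (symb_coeff a \<nu>) n) \<le>
   C * jbracket n powr (m - real \<beta>)" for j M'
 proof -
  obtain C where C: "\<And>x n. jbracket n powr (- m + real (abs_mi (axis i \<beta> :: nat ^ 'd))) *
    norm (mi_diff (axis i \<beta>) (\<lambda>k. mi_deriv (axis j M') (\<lambda>y. a y k) x) n) \<le> C"
   using a unfolding symbols_def by blast
  have C': "norm ((forward_diff i ^^ \<beta>) (\<lambda>k. (partial_deriv j ^^ M') (\<lambda>y. a y k) x) n) \<le> C * jbracket n powr (m - real \<beta>)" for x n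
  proof -
   have "jbracket n powr (m - real \<beta>) * (jbracket n powr (- m + real \<beta>) *
     norm ((forward_diff i ^^ \<beta>) (\<lambda>k. (partial_deriv j ^^ M') (\<lambda>y. a y k) x) n)) \<le> jbracket n powr (m - real \<beta>) * C"
    using C[of n x] by (intro mult_left_mono) (simp_all add: mi_diff_axis mi_deriv_axis abs_mi_axis)
   moreover have "jbracket n powr (m - real \<beta>) * (jbracket n powr (- m + real \<beta>) * t) = t" for t
    using less_imp_neq[OF jbracket_pos[of n]] by (simp add: mult.assoc[symmetric] powr_add[symmetric])
   ultimately have "norm ((forward_diff i ^^ \<beta>) (\<lambda>k. (partial_deriv j ^^ M') (\<lambda>y. a y k) x) n) \<le> jbracket n powr (m - real \<beta>) * C"
    by (simp only:)
   then show ?thesis by (simp only: mult.commute)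
  qed
  have "\<bar>real_of_int (\<nu> $ j)\<bar> ^ M' * norm ((forward_diff i ^^ \<beta>) (symb_coeff a \<nu>) n) \<le>
   C * jbracket n powr (m - real \<beta>)" for \<nu> n
  proof -
   note t = test_funpow_partial[OF symbols_test[OF a], of M' j]
   note f = funpow_forward_diff_fun_coeff[of "\<lambda>x k. (partial_deriv j ^^ M') (\<lambda>y. a y k) x", OF t]
   have "norm (fun_coeff (\<lambda>x. (forward_diff i ^^ \<beta>) (\<lambda>k. (partial_deriv j ^^ M') (\<lambda>y. a y k) x) n) \<nu>) \<le>
     C * jbracket n powr (m - real \<beta>)"
    by (rule fun_coeff_bound) (use f C' in auto)
   also have "fun_coeff (\<lambda>x. (forward_diff i ^^ \<beta>) (\<lambda>k. (partial_deriv j ^^ M') (\<lambda>y. a y k) x) n) \<nu> =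
     (forward_diff i ^^ \<beta>) (\<lambda>k. (\<i> * of_int (\<nu> $ j)) ^ M' * symb_coeff a \<nu> k) n"
    using f[of \<beta> i n \<nu>] by (simp add: fun_coeff_funpow_partial[OF symbols_test[OF a]] symb_coeff_def)
   finally show ?thesis
    unfolding funpow_forward_diff_linear by (simp add: norm_mult norm_power)
  qed
  moreover from C'[of 0 0] have "0 \<le> C * jbracket (0 :: int ^ 'd) powr (m - real \<beta>)"
   using norm_ge_zero order_trans by blast
  then have "C \<ge> 0" by (simp add: zero_le_mult_iff jbracket_def)
  ultimately show ?thesis by blast
 qed
 then obtain C where C: "\<And>j M'. C j M' \<ge> 0"
  "\<And>j M' \<nu> n. \<bar>real_of_int (\<nu> $ j)\<bar> ^ M' * norm ((forward_diff i ^^ \<beta>) (symb_coeff a \<nu>) n) \<le>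
   C j M' * jbracket n powr (m - real \<beta>)" by metis
 define D where "D = (real CARD('d) + 1) ^ M * (C i 0 + (\<Sum>j\<in>UNIV. C j M))"
 have "norm ((forward_diff i ^^ \<beta>) (symb_coeff a \<nu>) n) \<le> D * jbracket n powr (m - real \<beta>) / jbracket \<nu> ^ M" for \<nu> n
 proof -
  let ?t = "norm ((forward_diff i ^^ \<beta>) (symb_coeff a \<nu>) n)"
  have "jbracket \<nu> ^ M * ?t \<le> ((real CARD('d) + 1) ^ M * (1 + (\<Sum>j\<in>UNIV. \<bar>real_of_int (\<nu> $ j)\<bar> ^ M))) * ?t"
   by (intro mult_right_mono jbracket_power_le) auto
  also have "\<dots> = (real CARD('d) + 1) ^ M * (?t + (\<Sum>j\<in>UNIV. \<bar>real_of_int (\<nu> $ j)\<bar> ^ M * ?t))"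
   by (simp add: algebra_simps sum_distrib_left sum_distrib_right)
  also have "\<dots> \<le> (real CARD('d) + 1) ^ M * (C i 0 * jbracket n powr (m - real \<beta>) + (\<Sum>j\<in>UNIV. C j M * jbracket n powr (m - real \<beta>)))"
   using C(2)[of \<nu> i 0 n] by (intro mult_left_mono add_mono sum_mono C) auto
  also have "\<dots> = D * jbracket n powr (m - real \<beta>)"
   by (simp add: D_def algebra_simps sum_distrib_left sum_distrib_right)
  finally show ?thesis by (simp add: pos_le_divide_eq mult.commute)
 qed
 moreover have "D \<ge> 0" unfolding D_def using C(1) by (intro mult_nonneg_nonneg add_nonneg_nonneg sum_nonneg) auto
 ultimately show ?thesis by blast
qed

lemma jbracket_neq_0 [simp]: "jbracket n \<noteq> 0"
 using jbracket_pos[of n] by (metis less_irrefl)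

section \<open>The operator on Fourier coefficients\<close>

text \<open>The action of the operator on Fourier coefficients, as an infinite matrix.\<close>

definition quant_coeff ::
  "(real ^ 'd::finite \<Rightarrow> int ^ 'd \<Rightarrow> complex) \<Rightarrow> (int ^ 'd \<Rightarrow> complex) \<Rightarrow> int ^ 'd \<Rightarrow> complex" where
 "quant_coeff a c k = (\<Sum>\<^sub>\<infinity>n. symb_coeff a (k - n) n * c n)"

text \<open>The off-diagonal decay of the symbol coefficients beats the growth of \<open>c\<close>: by Peetre's
 inequality a power of \<open>n\<close> is bounded by the same powers of \<open>k\<close> and of \<open>k - n\<close>.\<close>

lemma quant_matrix_bound:
 fixes a :: "real ^ 'd::finite \<Rightarrow> int ^ 'd \<Rightarrow> complex"
 assumes a: "a \<in> symbols m" and c: "poly_bounded c"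
 shows "\<exists>K A. K \<ge> 0 \<and> (\<forall>n k. norm (symb_coeff a (k - n) n * c n) \<le> K * jbracket k ^ A * (1 / jbracket n ^ (2 * CARD('d))))"
proof -
 obtain C N where C: "C \<ge> 0" "\<And>n. norm (c n) \<le> C * jbracket n ^ N" using poly_boundedE[OF c] by blast
 define L where "L = nat \<lceil>\<bar>m\<bar>\<rceil>"
 define A where "A = L + N + 2 * CARD('d)"
 obtain D where D: "D \<ge> 0" "\<And>\<nu> n. norm (symb_coeff a \<nu> n) \<le> D * jbracket n powr m / jbracket \<nu> ^ A"
  using symb_coeff_bound[OF a, where \<beta> = 0 and M = A and i = undefined] by auto
 have D': "norm (symb_coeff a \<nu> n) \<le> D * jbracket n ^ L / jbracket \<nu> ^ A" for \<nu> n
 proof -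
  have "jbracket n powr m \<le> jbracket n powr (real L)"
   by (intro powr_mono jbracket_ge_1) (simp add: L_def, linarith)
  also have "\<dots> = jbracket n ^ L" by (simp add: powr_realpow)
  finally have "D * jbracket n powr m / jbracket \<nu> ^ A \<le> D * jbracket n ^ L / jbracket \<nu> ^ A"
   using D(1) by (intro divide_right_mono mult_left_mono zero_le_power) (auto simp: less_imp_le)
  then show ?thesis using D(2)[of \<nu> n] by simp
 qed
 have "norm (symb_coeff a (k - n) n * c n) \<le> (D * C * 2 ^ A) * jbracket k ^ A * (1 / jbracket n ^ (2 * CARD('d)))" for n k
 proof -
  have p: "jbracket n > 0" "jbracket (k - n) > 0" by auto
  have "jbracket n ^ A \<le> (2 * jbracket k * jbracket (k - n)) ^ A"
   using jbracket_add_le[of k "n - k"] jbracket_uminus[of "n - k"]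
   by (intro power_mono) (auto simp: less_imp_le)
  then have e: "jbracket n ^ L * jbracket n ^ N * jbracket n ^ (2 * CARD('d)) \<le> 2 ^ A * jbracket k ^ A * jbracket (k - n) ^ A"
   by (simp add: A_def power_add power_mult_distrib mult_ac)
  have "norm (symb_coeff a (k - n) n * c n) \<le> (D * jbracket n ^ L / jbracket (k - n) ^ A) * (C * jbracket n ^ N)"
   unfolding norm_mult using D(1) by (intro mult_mono D' C) (auto simp: less_imp_le)
  also have "\<dots> = D * C * (jbracket n ^ L * jbracket n ^ N * jbracket n ^ (2 * CARD('d))) / (jbracket (k - n) ^ A * jbracket n ^ (2 * CARD('d)))"
   using p by (simp add: field_simps)
  also have "\<dots> \<le> D * C * (2 ^ A * jbracket k ^ A * jbracket (k - n) ^ A) / (jbracket (k - n) ^ A * jbracket n ^ (2 * CARD('d)))"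
   using D(1) C(1) p by (intro divide_right_mono mult_left_mono e) (auto simp: less_imp_le)
  also have "\<dots> = (D * C * 2 ^ A) * jbracket k ^ A * (1 / jbracket n ^ (2 * CARD('d)))"
   using p by (simp add: field_simps)
  finally show ?thesis .
 qed
 then show ?thesis using C(1) D(1) by (intro exI[of _ "D * C * 2 ^ A"] exI[of _ A]) auto
qed

lemma quant_coeff_summable:
 assumes a: "a \<in> symbols m" and c: "poly_bounded c"
 shows "(\<lambda>n. norm (symb_coeff a (k - n) n * c n)) summable_on UNIV"
proof -
 obtain K A where K: "\<And>n k. norm (symb_coeff a (k - n) n * c n) \<le> K * jbracket k ^ A * (1 / jbracket n ^ (2 * CARD('a)))"
  using quant_matrix_bound[OF a c] by blast
 show ?thesis
  by (rule summable_on_comparison_test[OF summable_on_cmult_right[OF summable_on_jbracket] K]) simp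
qed

lemma poly_bounded_quant_coeff:
 fixes a :: "real ^ 'd::finite \<Rightarrow> int ^ 'd \<Rightarrow> complex"
 assumes a: "a \<in> symbols m" and c: "poly_bounded c"
 shows "poly_bounded (quant_coeff a c)"
proof -
 obtain K A where K: "\<And>n k. norm (symb_coeff a (k - n) n * c n) \<le> K * jbracket k ^ A * (1 / jbracket n ^ (2 * CARD('d)))"
  using quant_matrix_bound[OF a c] by blast
 have "norm (quant_coeff a c k) \<le> K * lattice_sum TYPE(int ^ 'd) * jbracket k ^ A" for k
 proof -
  have "norm (quant_coeff a c k) \<le> (\<Sum>\<^sub>\<infinity>n. norm (symb_coeff a (k - n) n * c n))"
   unfolding quant_coeff_def by (intro norm_infsum_bound quant_coeff_summable[OF a c])
  also have "\<dots> \<le> (\<Sum>\<^sub>\<infinity>n :: int ^ 'd. K * jbracket k ^ A * (1 / jbracket n ^ (2 * CARD('d))))"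
   by (intro infsum_mono quant_coeff_summable[OF a c] K summable_on_cmult_right summable_on_jbracket)
  also have "\<dots> = K * jbracket k ^ A * lattice_sum TYPE(int ^ 'd)"
   unfolding lattice_sum_def by (intro infsum_cmult_right summable_on_jbracket)
  finally show ?thesis by (simp add: mult_ac)
 qed
 then show ?thesis unfolding poly_bounded_def by blast
qed

lemma summable_on_product_mult:
 fixes f :: "'i \<Rightarrow> real" and g :: "'j \<Rightarrow> real"
 assumes f: "f summable_on A" "\<And>x. x \<in> A \<Longrightarrow> f x \<ge> 0" and g: "g summable_on B" "\<And>y. y \<in> B \<Longrightarrow> g y \<ge> 0"
 shows "(\<lambda>(x, y). f x * g y) summable_on A \<times> B"
proof -
 let ?h = "\<lambda>(x, y). f x * g y"
 have "(\<lambda>p. norm (?h p)) summable_on Sigma A (\<lambda>_. B)"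
 proof (rule Infinite_Sum.abs_summable_on_Sigma_iff[THEN iffD2], intro conjI ballI)
  fix x assume x: "x \<in> A"
  have "(\<lambda>y. f x * g y) summable_on B" by (intro summable_on_cmult_right g)
  then show "(\<lambda>y. norm (?h (x, y))) summable_on B"
   by (rule summable_on_cong[THEN iffD1, rotated]) (use f g x in auto)
 next
  have "(\<lambda>x. f x * infsum g B) summable_on A" by (intro summable_on_cmult_left f)
  moreover have "norm (\<Sum>\<^sub>\<infinity>y\<in>B. norm (?h (x, y))) = f x * infsum g B" if x: "x \<in> A" for x
  proof -
   have "(\<Sum>\<^sub>\<infinity>y\<in>B. norm (?h (x, y))) = (\<Sum>\<^sub>\<infinity>y\<in>B. f x * g y)"
    by (intro infsum_cong) (use f g x in auto)
   also have "\<dots> = f x * infsum g B" by (intro infsum_cmult_right g)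
   finally have "(\<Sum>\<^sub>\<infinity>y\<in>B. norm (?h (x, y))) = f x * infsum g B" .
   moreover have "0 \<le> infsum g B" by (rule infsum_nonneg[OF g(2)])
   ultimately show ?thesis using f(2)[OF x] by simp
  qed
  ultimately show "(\<lambda>x. norm (\<Sum>\<^sub>\<infinity>y\<in>B. norm (?h (x, y)))) summable_on A"
   by (simp cong: summable_on_cong)
 qed
 then show ?thesis
  by (rule summable_on_iff_abs_summable_on_real[THEN iffD2])
qed

lemma quant_term_eq:
 "quant_term a f \<psi> n = dist_coeff f n * torus_integral (\<lambda>x. a x n * exp_fun n x * \<psi> x)"
 unfolding quant_term_def torus_integral_cmult[symmetric] by (simp add: mult_ac)

text \<open>Expanding \<open>a x n\<close> into its Fourier series and moving the frequency of the expansion to the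
 output frequency \<open>k = n + \<nu>\<close>.\<close>

lemma quant_term_has_sum:
 fixes a :: "real ^ 'd::finite \<Rightarrow> int ^ 'd \<Rightarrow> complex"
 assumes a: "a \<in> symbols m" and \<psi>: "\<psi> \<in> test_functions"
 shows "((\<lambda>k. (2 * pi) ^ CARD('d) * (symb_coeff a (k - n) n * dist_coeff f n * fun_coeff \<psi> (- k))) has_sum quant_term a f \<psi> n) UNIV"
proof -
 obtain B where B: "B \<ge> 0" "\<And>x. norm (\<psi> x) \<le> B" using test_bounded[OF \<psi>] by blast
 let ?F = "\<lambda>\<nu> x. symb_coeff a \<nu> n * exp_fun (n + \<nu>) x * \<psi> x"
 have "((\<lambda>\<nu>. torus_integral (?F \<nu>)) has_sum torus_integral (\<lambda>x. \<Sum>\<^sub>\<infinity>\<nu>. ?F \<nu> x)) UNIV"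
 proof (rule has_sum_torus_integral)
  show "norm (?F \<nu> x) \<le> norm (symb_coeff a \<nu> n) * B" for \<nu> x
   by (simp add: norm_mult mult_left_mono B)
  show "(\<lambda>\<nu>. norm (symb_coeff a \<nu> n) * B) summable_on UNIV"
   unfolding symb_coeff_def by (intro summable_on_cmult_left fun_coeff_summable symbols_test[OF a])
 qed (intro continuous_intros continuous_exp_fun test_continuous \<psi>)
 moreover have "(\<Sum>\<^sub>\<infinity>\<nu>. ?F \<nu> x) = a x n * exp_fun n x * \<psi> x" for x
 proof (rule infsumI)
  have "((\<lambda>\<nu>. symb_coeff a \<nu> n * exp_fun \<nu> x * (exp_fun n x * \<psi> x)) has_sum a x n * (exp_fun n x * \<psi> x)) UNIV"
   unfolding symb_coeff_def by (intro has_sum_cmult_left fourier_inversion[OF symbols_test[OF a]])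
  then show "((\<lambda>\<nu>. ?F \<nu> x) has_sum a x n * exp_fun n x * \<psi> x) UNIV"
   by (simp add: exp_fun_add_freq mult_ac)
 qed
 moreover have "torus_integral (?F \<nu>) = (2 * pi) ^ CARD('d) * (symb_coeff a \<nu> n * fun_coeff \<psi> (- (n + \<nu>)))" for \<nu>
  by (rule torus_integral_eq_fun_coeff)
 ultimately have "((\<lambda>\<nu>. (2 * pi) ^ CARD('d) * (symb_coeff a \<nu> n * fun_coeff \<psi> (- (n + \<nu>)))) has_sum
   torus_integral (\<lambda>x. a x n * exp_fun n x * \<psi> x)) UNIV" by (simp only:)
 then have "((\<lambda>k. (2 * pi) ^ CARD('d) * (symb_coeff a (k - n) n * fun_coeff \<psi> (- k))) has_sum
   torus_integral (\<lambda>x. a x n * exp_fun n x * \<psi> x)) UNIV"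
  by (rule has_sum_reindex_bij_witness[where i = "\<lambda>k. k - n" and j = "\<lambda>\<nu>. n + \<nu>", THEN iffD1, rotated -1]) auto
 from has_sum_cmult_right[OF this, of "dist_coeff f n"] show ?thesis
  by (simp add: quant_term_eq mult_ac)
qed

lemma quant_pair_summable:
 fixes a :: "real ^ 'd::finite \<Rightarrow> int ^ 'd \<Rightarrow> complex"
 assumes a: "a \<in> symbols m" and c: "poly_bounded c" and \<psi>: "\<psi> \<in> test_functions"
 shows "(\<lambda>(n, k). symb_coeff a (k - n) n * c n * fun_coeff \<psi> (- k)) summable_on UNIV \<times> UNIV"
proof -
 obtain K A where K: "K \<ge> 0" "\<And>n k. norm (symb_coeff a (k - n) n * c n) \<le> K * jbracket k ^ A * (1 / jbracket n ^ (2 * CARD('d)))"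
  using quant_matrix_bound[OF a c] by blast
 obtain E where E: "E \<ge> 0" "\<And>n. norm (fun_coeff \<psi> n) \<le> E / jbracket n ^ (A + 2 * CARD('d))"
  using fun_coeff_rapid_decay[OF \<psi>] by blast
 have s: "(\<lambda>(n :: int ^ 'd, k :: int ^ 'd). (K * E * (1 / jbracket n ^ (2 * CARD('d)))) * (1 / jbracket k ^ (2 * CARD('d)))) summable_on UNIV \<times> UNIV"
  using K(1) E(1) by (intro summable_on_product_mult summable_on_cmult_right summable_on_jbracket) (auto simp: less_imp_le)
 have "norm (symb_coeff a (k - n) n * c n * fun_coeff \<psi> (- k)) \<le> (K * E * (1 / jbracket n ^ (2 * CARD('d)))) * (1 / jbracket k ^ (2 * CARD('d)))" for n k
 proof -
  have "norm (symb_coeff a (k - n) n * c n * fun_coeff \<psi> (- k)) \<le>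
    (K * jbracket k ^ A * (1 / jbracket n ^ (2 * CARD('d)))) * (E / jbracket (- k) ^ (A + 2 * CARD('d)))"
   unfolding norm_mult[of "_ * _"] using K(1) by (intro mult_mono K E) (auto simp: less_imp_le)
  also have "\<dots> = (K * E * (1 / jbracket n ^ (2 * CARD('d)))) * (1 / jbracket k ^ (2 * CARD('d)))"
   using jbracket_pos[of k] by (simp add: power_add field_simps)
  finally show ?thesis .
 qed
 then have "(\<lambda>p. norm ((\<lambda>(n, k). symb_coeff a (k - n) n * c n * fun_coeff \<psi> (- k)) p)) summable_on UNIV \<times> UNIV"
  by (intro summable_on_comparison_test[OF s]) auto
 then show ?thesis by (rule abs_summable_summable)
qed

text \<open>Interchanging the sums over input and output frequencies.\<close>

lemma quantization_eq_series_dist: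
 fixes a :: "real ^ 'd::finite \<Rightarrow> int ^ 'd \<Rightarrow> complex"
 assumes a: "a \<in> symbols m" and f: "poly_bounded (dist_coeff f)"
 shows quant_term_summable: "\<psi> \<in> test_functions \<Longrightarrow> quant_term a f \<psi> summable_on UNIV"
  and "quantization a f = series_dist (quant_coeff a (dist_coeff f))"
proof -
 let ?c = "dist_coeff f"
 let ?p = "complex_of_real ((2 * pi) ^ CARD('d))"
 have main: "quant_term a f \<psi> summable_on UNIV \<and>
   (\<Sum>\<^sub>\<infinity>n. quant_term a f \<psi> n) = ?p * (\<Sum>\<^sub>\<infinity>k. quant_coeff a ?c k * fun_coeff \<psi> (- k))"
  if \<psi>: "\<psi> \<in> test_functions" for \<psi>
 proof -
  let ?g = "\<lambda>n k. symb_coeff a (k - n) n * ?c n * fun_coeff \<psi> (- k)"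
  note s = quant_pair_summable[OF a f \<psi>]
  have p: "?p \<noteq> 0" by simp
  have canc: "inverse ?p * (?p * t) = t" for t
   unfolding mult.assoc[symmetric] left_inverse[OF p] by simp
  have canc': "?p * (inverse ?p * t) = t" for t
   unfolding mult.assoc[symmetric] right_inverse[OF p] by simp
  have qt: "quant_term a f \<psi> n = ?p * (\<Sum>\<^sub>\<infinity>k. ?g n k)" for n
  proof -
   have "((\<lambda>k. inverse ?p * (?p * ?g n k)) has_sum inverse ?p * quant_term a f \<psi> n) UNIV"
    by (intro has_sum_cmult_right quant_term_has_sum[OF a \<psi>])
   then have "(\<Sum>\<^sub>\<infinity>k. ?g n k) = inverse ?p * quant_term a f \<psi> n"
    by (intro infsumI) (simp only: canc)
   then show ?thesis by (simp only: canc')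
  qed
  have "(\<lambda>n. \<Sum>\<^sub>\<infinity>k. ?g n k) summable_on UNIV" using summable_on_Sigma_banach[OF s] by simp
  then have 1: "quant_term a f \<psi> summable_on UNIV"
   unfolding qt[abs_def] by (rule summable_on_cmult_right)
  have "(\<Sum>\<^sub>\<infinity>n. quant_term a f \<psi> n) = ?p * (\<Sum>\<^sub>\<infinity>n. \<Sum>\<^sub>\<infinity>k. ?g n k)"
   unfolding qt by (rule infsum_cmult_right) (use summable_on_Sigma_banach[OF s] in simp)
  also have "(\<Sum>\<^sub>\<infinity>n. \<Sum>\<^sub>\<infinity>k. ?g n k) = (\<Sum>\<^sub>\<infinity>k. \<Sum>\<^sub>\<infinity>n. ?g n k)"
   by (rule infsum_swap_banach[OF s])
  also have "\<dots> = (\<Sum>\<^sub>\<infinity>k. quant_coeff a ?c k * fun_coeff \<psi> (- k))"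
   unfolding quant_coeff_def
   by (intro infsum_cong infsum_cmult_left abs_summable_summable[OF quant_coeff_summable[OF a f]])
  finally show ?thesis using 1 by blast
 qed
 then show "\<psi> \<in> test_functions \<Longrightarrow> quant_term a f \<psi> summable_on UNIV" by blast
 show "quantization a f = series_dist (quant_coeff a (dist_coeff f))"
  unfolding quantization_def series_dist_def fun_eq_iff using main by simp
qed

lemma quantization_distribution:
 "a \<in> symbols m \<Longrightarrow> f \<in> distributions \<Longrightarrow> quantization a f \<in> distributions"
 by (simp add: quantization_eq_series_dist poly_bounded_dist_coeff poly_bounded_quant_coeff series_dist_distribution)

lemma dist_coeff_quantization:
 "a \<in> symbols m \<Longrightarrow> f \<in> distributions \<Longrightarrow> dist_coeff (quantization a f) = quant_coeff a (dist_coeff f)"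
 by (simp add: quantization_eq_series_dist poly_bounded_dist_coeff dist_coeff_series_dist fun_eq_iff)

text \<open>If \<open>k\<close> lies outside of the positive orthant, then the entries in row \<open>k\<close> vanish in the columns of the
 orthant by triangularity, and in the other columns they meet the coefficient \<open>0\<close>.\<close>

lemma quant_coeff_plus:
 assumes "a \<in> triangular_symbols m" "\<And>n. n \<notin> nonneg_freqs \<Longrightarrow> c n = 0" "k \<notin> nonneg_freqs"
 shows "quant_coeff a c k = 0"
proof -
 have "symb_coeff a (k - n) n * c n = 0" for n
  using assms by (cases "n \<in> nonneg_freqs") (auto simp: triangular_symbols_def symb_coeff_def)
 then show ?thesis unfolding quant_coeff_def by (rule infsum_0)
qed

lemma quantization_add:
 assumes a: "a \<in> symbols m" and f: "f \<in> distributions" and g: "g \<in> distributions"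
 shows "quantization a (\<lambda>t. f t + g t) = (\<lambda>t. quantization a f t + quantization a g t)"
proof
 fix \<psi>
 note s = quant_term_summable[OF a poly_bounded_dist_coeff[OF f]] quant_term_summable[OF a poly_bounded_dist_coeff[OF g]]
 have "quant_term a (\<lambda>t. f t + g t) \<psi> n = quant_term a f \<psi> n + quant_term a g \<psi> n" for n
  by (simp add: quant_term_eq dist_coeff_def algebra_simps add_divide_distrib)
 then show "quantization a (\<lambda>t. f t + g t) \<psi> = quantization a f \<psi> + quantization a g \<psi>"
  using infsum_add[OF s] by (simp add: quantization_def)
qed

lemma quantization_cmult:
 assumes a: "a \<in> symbols m" and f: "f \<in> distributions"
 shows "quantization a (\<lambda>t. c * f t) = (\<lambda>t. c * quantization a f t)"
proof
 fix \<psi>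
 note s = quant_term_summable[OF a poly_bounded_dist_coeff[OF f]]
 have "quant_term a (\<lambda>t. c * f t) \<psi> n = c * quant_term a f \<psi> n" for n
  by (simp add: quant_term_eq dist_coeff_def algebra_simps)
 then show "quantization a (\<lambda>t. c * f t) \<psi> = c * quantization a f \<psi>"
  using s by (simp add: quantization_def infsum_cmult_right)
qed

section \<open>Vector-valued inequalities for averaging operators\<close>

subsection \<open>Elementary inequalities for powers\<close>

lemma powr_mult_self:
 fixes a t :: real
 assumes "0 \<le> a" shows "a powr (t - 1) * a = a powr t"
proof (cases "a = 0")
 case False
 then have "a powr (t - 1) * a powr 1 = a powr t" by (simp only: powr_add[symmetric]) simp
 then show ?thesis using assms by simp
qed simp

text \<open>A convex function lies above its tangents.\<close>

lemma powr_tangent: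
 fixes u a t :: real
 assumes "0 \<le> u" "0 \<le> a" "1 \<le> t"
 shows "a powr t + t * a powr (t - 1) * (u - a) \<le> u powr t"
proof (cases "t = 1")
 case True
 then show ?thesis using assms by (cases "a = 0") auto
next
 case False
 define t' where "t' = t / (t - 1)"
 have t: "t > 1" "t' > 1" "1 / t + 1 / t' = 1" using False assms by (auto simp: t'_def field_simps)
 have e: "(a powr (t - 1)) powr t' = a powr t" using t by (simp add: powr_powr t'_def)
 have "u * a powr (t - 1) \<le> u powr t / t + a powr t / t'"
  using Youngs_inequality[OF t, of u "a powr (t - 1)"] assms by (simp add: e)
 then have "t * (u * a powr (t - 1)) \<le> t * (u powr t / t + a powr t / t')"
  using t by (intro mult_left_mono) auto
 also have "\<dots> = u powr t + (t - 1) * a powr t" using t by (simp add: t'_def field_simps)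
 finally have 1: "t * (u * a powr (t - 1)) \<le> u powr t + (t - 1) * a powr t" .
 have 2: "a powr (t - 1) * a = a powr t" using assms(2) by (rule powr_mult_self)
 have "t * a powr (t - 1) * (u - a) = t * (u * a powr (t - 1)) - t * (a powr (t - 1) * a)"
  by (simp add: algebra_simps)
 also have "\<dots> = t * (u * a powr (t - 1)) - t * a powr t" by (simp only: 2)
 finally have 3: "t * a powr (t - 1) * (u - a) = t * (u * a powr (t - 1)) - t * a powr t" .
 show ?thesis unfolding 3 using 1 by (simp add: algebra_simps)
qed

text \<open>A crude form of Young's inequality, by comparing \<open>S\<close> with \<open>2 * t * G\<close>. The first term on the right
 will be absorbed into the left-hand side of an estimate for \<open>S\<close>.\<close>

lemma absorb_power:
 fixes G S t :: real
 assumes "0 \<le> G" "0 \<le> S" "1 \<le> t"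
 shows "t * (G * S powr (t - 1)) \<le> S powr t / 2 + (2 * t) powr t / 2 * G powr t"
proof (cases "2 * t * G \<le> S")
 case True
 have "t * (G * S powr (t - 1)) = (2 * t * G) * S powr (t - 1) / 2" by simp
 also have "\<dots> \<le> S * S powr (t - 1) / 2" using True by (intro divide_right_mono mult_right_mono) auto
 also have "\<dots> = S powr t / 2" using powr_mult_self[OF assms(2), of t] by (simp add: mult.commute)
 also have "\<dots> \<le> S powr t / 2 + (2 * t) powr t / 2 * G powr t" by simp
 finally show ?thesis .
next
 case False
 have "t * (G * S powr (t - 1)) \<le> t * (G * (2 * t * G) powr (t - 1))"
  using False assms by (intro mult_left_mono powr_mono2) auto
 also have "\<dots> = ((2 * t * G) powr (t - 1) * (2 * t * G)) / 2" by simp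
 also have "\<dots> = (2 * t * G) powr t / 2" using assms by (subst powr_mult_self) auto
 also have "\<dots> = (2 * t) powr t / 2 * G powr t" by (simp add: powr_mult)
 also have "\<dots> \<le> S powr t / 2 + (2 * t) powr t / 2 * G powr t" by simp
 finally show ?thesis .
qed

lemma powr_convex_sum:
 fixes w a :: "'i \<Rightarrow> real"
 assumes "finite I" "\<And>i. i \<in> I \<Longrightarrow> 0 \<le> w i" "\<And>i. i \<in> I \<Longrightarrow> 0 \<le> a i" "sum w I \<le> 1" "1 \<le> t"
 shows "(\<Sum>i\<in>I. w i * a i) powr t \<le> (\<Sum>i\<in>I. w i * a i powr t)"
proof -
 define A where "A = (\<Sum>i\<in>I. w i * a i)"
 have A: "A \<ge> 0" unfolding A_def using assms by (intro sum_nonneg) auto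
 have "(\<Sum>i\<in>I. w i * (A powr t + t * A powr (t - 1) * (a i - A))) \<le> (\<Sum>i\<in>I. w i * a i powr t)"
  using assms A by (intro sum_mono mult_left_mono powr_tangent) auto
 also have "(\<Sum>i\<in>I. w i * (A powr t + t * A powr (t - 1) * (a i - A))) =
   sum w I * A powr t + t * A powr (t - 1) * (A - sum w I * A)"
 proof -
  have "(\<Sum>i\<in>I. w i * (\<alpha> + c * (a i - b))) = sum w I * \<alpha> + c * ((\<Sum>i\<in>I. w i * a i) - sum w I * b)" for \<alpha> b c
   by (simp add: algebra_simps sum.distrib sum_distrib_left sum_distrib_right sum_subtractf)
  then show ?thesis unfolding A_def[symmetric] .
 qed
 also have "\<dots> = sum w I * A powr t + t * (1 - sum w I) * (A powr (t - 1) * A)" by (simp add: algebra_simps)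
 also have "\<dots> = A powr t * (sum w I + t * (1 - sum w I))" using powr_mult_self[OF A, of t] by (simp add: algebra_simps)
 finally have 1: "A powr t * (sum w I + t * (1 - sum w I)) \<le> (\<Sum>i\<in>I. w i * a i powr t)" .
 have "1 * (1 - sum w I) \<le> t * (1 - sum w I)" using assms by (intro mult_right_mono) auto
 then have "A powr t * 1 \<le> A powr t * (sum w I + t * (1 - sum w I))" by (intro mult_left_mono) auto
 then show ?thesis using 1 by (simp add: A_def)
qed

lemma Holder_sum:
 fixes a b :: "'i \<Rightarrow> real"
 assumes "finite I" "\<And>i. i \<in> I \<Longrightarrow> 0 \<le> a i" "\<And>i. i \<in> I \<Longrightarrow> 0 \<le> b i"
  and pq: "p > 1" "q > 1" "1 / p + 1 / q = 1"
 shows "(\<Sum>i\<in>I. a i * b i) \<le> (\<Sum>i\<in>I. a i powr p) powr (1 / p) * (\<Sum>i\<in>I. b i powr q) powr (1 / q)"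
proof -
 define A where "A = (\<Sum>i\<in>I. a i powr p)"
 define B where "B = (\<Sum>i\<in>I. b i powr q)"
 have AB: "A \<ge> 0" "B \<ge> 0" unfolding A_def B_def by (auto intro: sum_nonneg)
 show ?thesis
 proof (cases "A = 0 \<or> B = 0")
  case True
  then have "a i * b i = 0" if "i \<in> I" for i
   using that assms(1) unfolding A_def B_def by (auto simp: sum_nonneg_eq_0_iff)
  then have "(\<Sum>i\<in>I. a i * b i) = 0" by (intro sum.neutral ballI)
  then show ?thesis by simp
 next
  case False
  then have pos: "A > 0" "B > 0" using AB by auto
  define \<alpha> where "\<alpha> = A powr (1 / p)"
  define \<beta> where "\<beta> = B powr (1 / q)"
  have ab: "\<alpha> > 0" "\<beta> > 0" using pos by (auto simp: \<alpha>_def \<beta>_def)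
  have e: "\<alpha> powr p = A" "\<beta> powr q = B" using pos pq by (simp_all add: \<alpha>_def \<beta>_def powr_powr)
  have "(\<Sum>i\<in>I. (a i / \<alpha>) * (b i / \<beta>)) \<le> (\<Sum>i\<in>I. (a i / \<alpha>) powr p / p + (b i / \<beta>) powr q / q)"
   using assms ab by (intro sum_mono Youngs_inequality[OF pq]) auto
  also have "\<dots> = (\<Sum>i\<in>I. a i powr p) / A / p + (\<Sum>i\<in>I. b i powr q) / B / q"
   using ab by (simp add: powr_divide sum.distrib sum_divide_distrib e)
  also have "\<dots> = 1" using pos pq(3) by (simp add: A_def[symmetric] B_def[symmetric])
  finally have "(\<Sum>i\<in>I. a i * b i) / (\<alpha> * \<beta>) \<le> 1" by (simp add: sum_divide_distrib)
  then have "(\<Sum>i\<in>I. a i * b i) \<le> \<alpha> * \<beta>" using ab by (simp add: pos_divide_le_eq)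
  then show ?thesis by (simp add: \<alpha>_def \<beta>_def A_def B_def)
 qed
qed

subsection \<open>Symmetric sub-Markov kernels\<close>

text \<open>Nonnegative, bounded and measurable functions. This class is closed under all operations that
 occur below, and on a finite measure space its members are integrable.\<close>

definition nbm :: "'a measure \<Rightarrow> ('a \<Rightarrow> real) \<Rightarrow> bool" where
 "nbm M g \<longleftrightarrow> g \<in> borel_measurable M \<and> (\<exists>B. \<forall>x\<in>space M. 0 \<le> g x \<and> g x \<le> B)"

lemma nbm_measurable: "nbm M g \<Longrightarrow> g \<in> borel_measurable M"
 and nbm_nonneg: "nbm M g \<Longrightarrow> x \<in> space M \<Longrightarrow> 0 \<le> g x"
 by (auto simp: nbm_def)

lemma nbm_bound: "nbm M g \<Longrightarrow> \<exists>B\<ge>0. \<forall>x\<in>space M. g x \<le> B"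
 unfolding nbm_def by (meson max.cobounded1 max.cobounded2 order_trans)

lemma nbmI:
 assumes "g \<in> borel_measurable M" "\<And>x. x \<in> space M \<Longrightarrow> 0 \<le> g x" "\<And>x. x \<in> space M \<Longrightarrow> g x \<le> B"
 shows "nbm M g"
 using assms by (auto simp: nbm_def)

lemma nbm_const: "0 \<le> c \<Longrightarrow> nbm M (\<lambda>x. c)" by (rule nbmI[of _ _ c]) auto

lemma nbm_add: assumes "nbm M f" "nbm M g" shows "nbm M (\<lambda>x. f x + g x)"
proof -
 obtain A B where "\<forall>x\<in>space M. f x \<le> A" "\<forall>x\<in>space M. g x \<le> B" using nbm_bound assms by metis
 then show ?thesis
  using assms by (intro nbmI[of _ _ "A + B"]) (auto intro!: add_mono add_nonneg_nonneg borel_measurable_add dest: nbm_measurable nbm_nonneg)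
qed

lemma nbm_mult: assumes "nbm M f" "nbm M g" shows "nbm M (\<lambda>x. f x * g x)"
proof -
 obtain A B where "A \<ge> 0" "\<forall>x\<in>space M. f x \<le> A" "\<forall>x\<in>space M. g x \<le> B" using nbm_bound assms by metis
 then show ?thesis
  using assms by (intro nbmI[of _ _ "A * B"]) (auto intro!: mult_mono mult_nonneg_nonneg borel_measurable_times dest: nbm_measurable nbm_nonneg)
qed

lemma nbm_sum: "(\<And>i. i \<in> I \<Longrightarrow> nbm M (f i)) \<Longrightarrow> nbm M (\<lambda>x. \<Sum>i\<in>I. f i x)"
 by (induction I rule: infinite_finite_induct) (auto intro: nbm_const nbm_add)

lemma nbm_powr: assumes "nbm M f" "0 \<le> t" shows "nbm M (\<lambda>x. f x powr t)"
proof -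
 obtain A where "A \<ge> 0" "\<forall>x\<in>space M. f x \<le> A" using nbm_bound assms by metis
 then show ?thesis
  using assms nbm_nonneg[OF assms(1)] by (intro nbmI[of _ _ "A powr t"]) (auto intro!: powr_mono2 powr_real_measurable dest: nbm_measurable)
qed

lemma (in finite_measure) nbm_integrable:
 assumes "nbm M f" shows "integrable M f"
proof -
 obtain A where "A \<ge> 0" "\<forall>x\<in>space M. f x \<le> A" using nbm_bound assms by metis
 then show ?thesis using assms nbm_nonneg[OF assms]
  by (intro integrable_const_bound[of _ A]) (auto simp: abs_of_nonneg intro: nbm_measurable)
qed

lemma (in finite_measure) nbm_integral_mono:
 assumes "nbm M f" "nbm M g" "\<And>x. x \<in> space M \<Longrightarrow> f x \<le> g x"
 shows "(\<integral>x. f x \<partial>M) \<le> (\<integral>x. g x \<partial>M)"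
 using assms by (intro integral_mono nbm_integrable) auto

lemma (in finite_measure) nbm_integral_nonneg: "nbm M f \<Longrightarrow> 0 \<le> (\<integral>x. f x \<partial>M)"
 by (intro Bochner_Integration.integral_nonneg_AE AE_I2 nbm_nonneg)

definition kernel_op :: "'a measure \<Rightarrow> ('a \<Rightarrow> 'a \<Rightarrow> real) \<Rightarrow> ('a \<Rightarrow> real) \<Rightarrow> 'a \<Rightarrow> real" where
 "kernel_op M k g x = (\<integral>y. k x y * g y \<partial>M)"

text \<open>The total mass may be less than one, since averages only serve as upper bounds.\<close>

definition markov_kernel :: "'a measure \<Rightarrow> ('a \<Rightarrow> 'a \<Rightarrow> real) \<Rightarrow> bool" where
 "markov_kernel M k \<longleftrightarrow> nbm (M \<Otimes>\<^sub>M M) (\<lambda>(x, y). k x y) \<and> (\<forall>x\<in>space M. \<forall>y\<in>space M. k x y = k y x) \<and>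
   (\<forall>x\<in>space M. (\<integral>y. k x y \<partial>M) \<le> 1)"

context finite_measure
begin

lemma kernel_section_nbm:
 assumes "nbm (M \<Otimes>\<^sub>M M) (\<lambda>(x, y). k x y)" "x \<in> space M"
 shows "nbm M (k x)"
proof -
 obtain B where B: "\<And>p. p \<in> space (M \<Otimes>\<^sub>M M) \<Longrightarrow> (\<lambda>(x, y). k x y) p \<le> B" using nbm_bound[OF assms(1)] by blast
 have "0 \<le> k x y" "k x y \<le> B" if "y \<in> space M" for y
  using B[of "(x, y)"] nbm_nonneg[OF assms(1), of "(x, y)"] assms(2) that by (auto simp: space_pair_measure)
 moreover have "k x \<in> borel_measurable M"
  using measurable_compose[OF measurable_Pair1'[OF assms(2)] nbm_measurable[OF assms(1)]] by simp
 ultimately show ?thesis by (intro nbmI) auto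
qed

lemma kernel_op_nbm:
 assumes k: "nbm (M \<Otimes>\<^sub>M M) (\<lambda>(x, y). k x y)" and g: "nbm M g"
 shows "nbm M (kernel_op M k g)"
proof -
 obtain B where B: "B \<ge> 0" "\<And>p. p \<in> space (M \<Otimes>\<^sub>M M) \<Longrightarrow> (\<lambda>(x, y). k x y) p \<le> B" using nbm_bound[OF k] by blast
 obtain A where A: "A \<ge> 0" "\<forall>x\<in>space M. g x \<le> A" using nbm_bound[OF g] by blast
 have "kernel_op M k g x \<le> (\<integral>y. B * A \<partial>M)" if x: "x \<in> space M" for x
  unfolding kernel_op_def
 proof (rule nbm_integral_mono)
  show "nbm M (\<lambda>y. k x y * g y)" by (intro nbm_mult kernel_section_nbm[OF k x] g)
  show "nbm M (\<lambda>y. B * A)" using A B by (intro nbm_const) auto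
  show "k x y * g y \<le> B * A" if "y \<in> space M" for y
   using that A B B(2)[of "(x, y)"] x nbm_nonneg[OF g that] by (intro mult_mono) (auto simp: space_pair_measure)
 qed
 moreover have "0 \<le> kernel_op M k g x" if x: "x \<in> space M" for x
  unfolding kernel_op_def by (intro nbm_integral_nonneg nbm_mult kernel_section_nbm[OF k x] g)
 moreover have "kernel_op M k g \<in> borel_measurable M"
  unfolding kernel_op_def[abs_def]
 proof (rule borel_measurable_lebesgue_integral)
  have "(\<lambda>p. (\<lambda>(x, y). k x y) p * g (snd p)) \<in> borel_measurable (M \<Otimes>\<^sub>M M)"
   by (intro borel_measurable_times nbm_measurable[OF k] measurable_compose[OF measurable_snd nbm_measurable[OF g]])
  then show "(\<lambda>(x, y). k x y * g y) \<in> borel_measurable (M \<Otimes>\<^sub>M M)" by (simp add: case_prod_beta')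
 qed
 ultimately show ?thesis by (intro nbmI) auto
qed

lemma kernel_op_symmetric:
 assumes k: "markov_kernel M k" and g: "nbm M g" and h: "nbm M h"
 shows "(\<integral>x. kernel_op M k g x * h x \<partial>M) = (\<integral>x. g x * kernel_op M k h x \<partial>M)"
proof -
 interpret P: pair_sigma_finite M M by unfold_locales
 have kn: "nbm (M \<Otimes>\<^sub>M M) (\<lambda>(x, y). k x y)" and sym: "\<And>x y. x \<in> space M \<Longrightarrow> y \<in> space M \<Longrightarrow> k x y = k y x"
  using k by (auto simp: markov_kernel_def)
 interpret PM: finite_measure "M \<Otimes>\<^sub>M M" by (rule finite_measure_pair_measure) unfold_locales
 have g2: "nbm (M \<Otimes>\<^sub>M M) (\<lambda>p. g (snd p))" and h1: "nbm (M \<Otimes>\<^sub>M M) (\<lambda>p. h (fst p))"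
  using g h unfolding nbm_def by (auto simp: space_pair_measure intro!: measurable_compose[OF measurable_snd] measurable_compose[OF measurable_fst])
 have int: "integrable (M \<Otimes>\<^sub>M M) (\<lambda>(x, y). k x y * g y * h x)"
  using PM.nbm_integrable[OF nbm_mult[OF nbm_mult[OF kn g2] h1]] by (simp add: case_prod_beta')
 have "(\<integral>x. kernel_op M k g x * h x \<partial>M) = (\<integral>x. (\<integral>y. k x y * g y * h x \<partial>M) \<partial>M)"
  unfolding kernel_op_def by (simp only: integral_mult_left_zero)
 also have "\<dots> = (\<integral>y. (\<integral>x. k x y * g y * h x \<partial>M) \<partial>M)"
  using P.Fubini_integral[OF int] by simp
 also have "\<dots> = (\<integral>y. g y * kernel_op M k h y \<partial>M)"
 proof (rule Bochner_Integration.integral_cong[OF refl])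
  fix y assume y: "y \<in> space M"
  have "(\<integral>x. k x y * g y * h x \<partial>M) = (\<integral>x. g y * (k y x * h x) \<partial>M)"
   by (rule Bochner_Integration.integral_cong) (auto simp: sym y)
  then show "(\<integral>x. k x y * g y * h x \<partial>M) = g y * kernel_op M k h y" by (simp add: kernel_op_def)
 qed
 finally show ?thesis .
qed

text \<open>The tangent inequality for the power \<open>Q\<close> is integrated at the value of the average. A total mass
 \<open>\<kappa>\<close> below one is harmless, as \<open>\<kappa> + Q * (1 - \<kappa>)\<close> is still at least one.\<close>

lemma kernel_op_Jensen:
 assumes k: "markov_kernel M k" and g: "nbm M g" and Q: "1 \<le> Q" and x: "x \<in> space M"
 shows "kernel_op M k g x powr Q \<le> kernel_op M k (\<lambda>y. g y powr Q) x"
proof -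
 have kn: "nbm (M \<Otimes>\<^sub>M M) (\<lambda>(x, y). k x y)" using k by (simp add: markov_kernel_def)
 note kx = kernel_section_nbm[OF kn x]
 define a where "a = kernel_op M k g x"
 define \<kappa> where "\<kappa> = (\<integral>y. k x y \<partial>M)"
 have \<kappa>: "\<kappa> \<le> 1" using k x by (simp add: markov_kernel_def \<kappa>_def)
 have a: "a \<ge> 0" unfolding a_def using nbm_nonneg[OF kernel_op_nbm[OF kn g] x] .
 have i1: "integrable M (k x)" and i2: "integrable M (\<lambda>y. k x y * g y)" and i3: "integrable M (\<lambda>y. k x y * g y powr Q)"
  using Q by (auto intro!: nbm_integrable nbm_mult nbm_powr kx g)
 have i4: "integrable M (\<lambda>y. k x y * (Q * a powr (Q - 1) * (g y - a)))"
 proof -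
  have "(\<lambda>y. k x y * (Q * a powr (Q - 1) * (g y - a))) = (\<lambda>y. Q * a powr (Q - 1) * (k x y * g y) - Q * a powr (Q - 1) * a * k x y)"
   by (auto simp: algebra_simps)
  then show ?thesis using i1 i2 by simp
 qed
 have "(\<integral>y. k x y * (a powr Q + Q * a powr (Q - 1) * (g y - a)) \<partial>M) \<le> kernel_op M k (\<lambda>y. g y powr Q) x"
  unfolding kernel_op_def
 proof (rule integral_mono[OF _ i3])
  show "integrable M (\<lambda>y. k x y * (a powr Q + Q * a powr (Q - 1) * (g y - a)))"
   using i1 i4 by (simp add: distrib_left)
  show "k x y * (a powr Q + Q * a powr (Q - 1) * (g y - a)) \<le> k x y * g y powr Q" if "y \<in> space M" for y
   using nbm_nonneg[OF kx that] nbm_nonneg[OF g that] a Q by (intro mult_left_mono powr_tangent) auto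
 qed
 also have "(\<integral>y. k x y * (a powr Q + Q * a powr (Q - 1) * (g y - a)) \<partial>M) =
   (\<integral>y. a powr Q * k x y + (Q * a powr (Q - 1) * (k x y * g y) - Q * a powr (Q - 1) * a * k x y) \<partial>M)"
  by (simp add: algebra_simps)
 also have "\<dots> = a powr Q * \<kappa> + (Q * a powr (Q - 1) * a - Q * a powr (Q - 1) * a * \<kappa>)"
  using i1 i2 by (simp add: \<kappa>_def a_def kernel_op_def)
 also have "\<dots> = a powr Q * \<kappa> + Q * (a powr (Q - 1) * a) * (1 - \<kappa>)" by (simp add: algebra_simps)
 also have "\<dots> = a powr Q * (\<kappa> + Q * (1 - \<kappa>))" using powr_mult_self[OF a, of Q] by (simp add: algebra_simps)
 finally have 1: "a powr Q * (\<kappa> + Q * (1 - \<kappa>)) \<le> kernel_op M k (\<lambda>y. g y powr Q) x" .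
 have "1 * (1 - \<kappa>) \<le> Q * (1 - \<kappa>)" using \<kappa> Q by (intro mult_right_mono) auto
 then have "a powr Q * 1 \<le> a powr Q * (\<kappa> + Q * (1 - \<kappa>))" by (intro mult_left_mono) auto
 then show ?thesis using 1 by (simp add: a_def)
qed

subsection \<open>The dual form of Doob's inequality\<close>

text \<open>For conditional expectations with respect to a filtration this is the dual form of Doob's maximal
 inequality. It is essential that the constant does not depend on \<open>N\<close>.\<close>

definition dual_doob :: "(nat \<Rightarrow> 'a \<Rightarrow> 'a \<Rightarrow> real) \<Rightarrow> nat \<Rightarrow> bool" where
 "dual_doob k N \<longleftrightarrow> (\<forall>t g. 1 \<le> t \<longrightarrow> (\<forall>l. nbm M (g l)) \<longrightarrow>
   (\<integral>x. (\<Sum>l\<le>N. kernel_op M (k l) (g l) x) powr t \<partial>M) \<le> (2 * t) powr t * (\<integral>x. (\<Sum>l\<le>N. g l x) powr t \<partial>M))"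

text \<open>Nestedness makes the partial sums \<open>S l\<close> constant on the sets over which the kernel \<open>k l\<close> averages.
 In the terms \<open>E l * S l powr (t - 1)\<close> of the telescoped power of \<open>S N\<close>, the average can thus be
 moved from \<open>g l\<close> to the power by symmetry, where it acts as the identity or less. The resulting bound
 contains \<open>S N powr t\<close> again, which is absorbed.\<close>

lemma dual_doob_nested:
 assumes k: "\<And>l. markov_kernel M (k l)"
  and nested: "\<And>i l x y z. i \<le> l \<Longrightarrow> x \<in> space M \<Longrightarrow> y \<in> space M \<Longrightarrow> z \<in> space M \<Longrightarrow> k l x y \<noteq> 0 \<Longrightarrow> k i x z = k i y z"
 shows "dual_doob k N"
 unfolding dual_doob_def
proof (intro allI impI)
 fix t :: real and g :: "nat \<Rightarrow> 'a \<Rightarrow> real"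
 assume t: "1 \<le> t" and "\<forall>l. nbm M (g l)"
 then have g: "nbm M (g l)" for l by blast
 have kn: "nbm (M \<Otimes>\<^sub>M M) (\<lambda>(x, y). k l x y)" for l using k by (simp add: markov_kernel_def)
 define E where "E l = kernel_op M (k l) (g l)" for l
 define S where "S l x = (\<Sum>i\<le>l. E i x)" for l x
 define G where "G x = (\<Sum>l\<le>N. g l x)" for x
 have E: "nbm M (E l)" for l unfolding E_def by (rule kernel_op_nbm[OF kn g])
 have S: "nbm M (S l)" for l unfolding S_def[abs_def] by (intro nbm_sum E)
 have G: "nbm M G" unfolding G_def[abs_def] by (intro nbm_sum g)
 have S_const: "S l x = S l y" if "x \<in> space M" "y \<in> space M" "k l x y \<noteq> 0" for l x y
  unfolding S_def E_def kernel_op_def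
  by (intro sum.cong refl Bochner_Integration.integral_cong) (use nested that in force)
 have S_mono: "S l x \<le> S m x" if "l \<le> m" "x \<in> space M" for l m x
  unfolding S_def using that nbm_nonneg[OF E] by (intro sum_mono2) auto
 \<comment> \<open>The increments of \<open>S l powr t\<close> are bounded by the tangent at the later value.\<close>
 have tele: "S m x powr t \<le> t * (\<Sum>l\<le>m. E l x * S l x powr (t - 1))" if x: "x \<in> space M" for m x
 proof (induction m)
  case 0
  have "0 \<le> E 0 x" using nbm_nonneg[OF E x] .
  then have "E 0 x powr t = E 0 x * E 0 x powr (t - 1)" using powr_mult_self[of "E 0 x" t] by (simp add: mult.commute)
  moreover have "E 0 x * E 0 x powr (t - 1) \<le> t * (E 0 x * E 0 x powr (t - 1))"
   using t mult_right_mono[of 1 t "E 0 x * E 0 x powr (t - 1)"] \<open>0 \<le> E 0 x\<close> by simp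
  ultimately show ?case by (simp add: S_def)
 next
  case (Suc m)
  have Ss: "S (Suc m) x = S m x + E (Suc m) x" by (simp add: S_def)
  have "S (Suc m) x powr t + t * S (Suc m) x powr (t - 1) * (S m x - S (Suc m) x) \<le> S m x powr t"
   using nbm_nonneg[OF S x] t by (intro powr_tangent) auto
  then have "S (Suc m) x powr t \<le> S m x powr t + t * (E (Suc m) x * S (Suc m) x powr (t - 1))"
   by (simp add: Ss algebra_simps)
  then show ?case using Suc by (simp add: distrib_left)
 qed
 have Sp: "nbm M (\<lambda>x. S l x powr (t - 1))" for l using t by (intro nbm_powr S) auto
 have step: "(\<integral>x. E l x * S l x powr (t - 1) \<partial>M) \<le> (\<integral>x. g l x * S l x powr (t - 1) \<partial>M)" for l
 proof -
  have "(\<integral>x. E l x * S l x powr (t - 1) \<partial>M) = (\<integral>x. g l x * kernel_op M (k l) (\<lambda>y. S l y powr (t - 1)) x \<partial>M)"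
   unfolding E_def by (rule kernel_op_symmetric[OF k g Sp])
  also have "\<dots> \<le> (\<integral>x. g l x * S l x powr (t - 1) \<partial>M)"
  proof (rule nbm_integral_mono)
   show "nbm M (\<lambda>x. g l x * kernel_op M (k l) (\<lambda>y. S l y powr (t - 1)) x)"
    by (intro nbm_mult g kernel_op_nbm[OF kn] Sp)
   show "nbm M (\<lambda>x. g l x * S l x powr (t - 1))" by (intro nbm_mult g Sp)
   fix x assume x: "x \<in> space M"
   have "kernel_op M (k l) (\<lambda>y. S l y powr (t - 1)) x = (\<integral>y. k l x y * S l x powr (t - 1) \<partial>M)"
    unfolding kernel_op_def
   proof (rule Bochner_Integration.integral_cong[OF refl])
    fix y assume "y \<in> space M"
    then show "k l x y * S l y powr (t - 1) = k l x y * S l x powr (t - 1)"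
     using S_const[OF x, of y l] by (cases "k l x y = 0") simp_all
   qed
   also have "\<dots> = (\<integral>y. k l x y \<partial>M) * S l x powr (t - 1)" by simp
   also have "\<dots> \<le> 1 * S l x powr (t - 1)"
    using k[of l] x by (intro mult_right_mono) (auto simp: markov_kernel_def)
   finally show "g l x * kernel_op M (k l) (\<lambda>y. S l y powr (t - 1)) x \<le> g l x * S l x powr (t - 1)"
    using nbm_nonneg[OF g x] by (intro mult_left_mono) auto
  qed
  finally show ?thesis .
 qed
 have "(\<integral>x. S N x powr t \<partial>M) \<le> (\<integral>x. t * (\<Sum>l\<le>N. E l x * S l x powr (t - 1)) \<partial>M)"
  using t by (intro nbm_integral_mono nbm_powr S nbm_mult nbm_const nbm_sum E Sp tele) auto
 also have "\<dots> = t * (\<Sum>l\<le>N. \<integral>x. E l x * S l x powr (t - 1) \<partial>M)"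
  by (simp, subst Bochner_Integration.integral_sum) (auto intro!: nbm_integrable nbm_mult E Sp)
 also have "\<dots> \<le> t * (\<Sum>l\<le>N. \<integral>x. g l x * S l x powr (t - 1) \<partial>M)"
  using t by (intro mult_left_mono sum_mono step) auto
 also have "\<dots> = (\<integral>x. t * (\<Sum>l\<le>N. g l x * S l x powr (t - 1)) \<partial>M)"
  by (simp, subst Bochner_Integration.integral_sum) (auto intro!: nbm_integrable nbm_mult g Sp)
 also have "\<dots> \<le> (\<integral>x. S N x powr t / 2 + (2 * t) powr t / 2 * G x powr t \<partial>M)"
 proof (rule nbm_integral_mono)
  show "nbm M (\<lambda>x. t * (\<Sum>l\<le>N. g l x * S l x powr (t - 1)))"
   using t by (intro nbm_mult nbm_const nbm_sum g Sp) auto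
  have "nbm M (\<lambda>x. (1 / 2) * S N x powr t + (2 * t) powr t / 2 * G x powr t)"
   using t by (intro nbm_add nbm_mult nbm_const nbm_powr S G) auto
  then show "nbm M (\<lambda>x. S N x powr t / 2 + (2 * t) powr t / 2 * G x powr t)" by simp
  fix x assume x: "x \<in> space M"
  have "(\<Sum>l\<le>N. g l x * S l x powr (t - 1)) \<le> (\<Sum>l\<le>N. g l x * S N x powr (t - 1))"
   using t S_mono x nbm_nonneg[OF g x] nbm_nonneg[OF S x] by (intro sum_mono mult_left_mono powr_mono2) auto
  also have "\<dots> = G x * S N x powr (t - 1)" by (simp add: G_def sum_distrib_right)
  finally have "t * (\<Sum>l\<le>N. g l x * S l x powr (t - 1)) \<le> t * (G x * S N x powr (t - 1))"
   using t by (intro mult_left_mono) auto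
  also have "\<dots> \<le> S N x powr t / 2 + (2 * t) powr t / 2 * G x powr t"
   by (rule absorb_power[OF nbm_nonneg[OF G x] nbm_nonneg[OF S x] t])
  finally show "t * (\<Sum>l\<le>N. g l x * S l x powr (t - 1)) \<le> S N x powr t / 2 + (2 * t) powr t / 2 * G x powr t" .
 qed
 also have "\<dots> = (\<integral>x. S N x powr t \<partial>M) / 2 + (2 * t) powr t / 2 * (\<integral>x. G x powr t \<partial>M)"
 proof -
  have "integrable M (\<lambda>x. S N x powr t)" "integrable M (\<lambda>x. G x powr t)"
   using t by (auto intro!: nbm_integrable nbm_powr S G)
  then show ?thesis by simp
 qed
 finally have "(\<integral>x. S N x powr t \<partial>M) \<le> (2 * t) powr t * (\<integral>x. G x powr t \<partial>M)" by simp
 then show "(\<integral>x. (\<Sum>l\<le>N. kernel_op M (k l) (g l) x) powr t \<partial>M) \<le> (2 * t) powr t * (\<integral>x. (\<Sum>l\<le>N. g l x) powr t \<partial>M)"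
  by (simp add: S_def E_def G_def)
qed

text \<open>By convexity of the power, a convex combination inherits the inequality from its members.\<close>

lemma dual_doob_dominated:
 assumes P: "\<And>l. markov_kernel M (p l)" and I: "finite I" "\<And>i. i \<in> I \<Longrightarrow> 0 \<le> w i" "sum w I \<le> 1"
  and k: "\<And>i l. i \<in> I \<Longrightarrow> markov_kernel M (k i l)" "\<And>i. i \<in> I \<Longrightarrow> dual_doob (k i) N"
  and dom: "\<And>l x y. l \<le> N \<Longrightarrow> x \<in> space M \<Longrightarrow> y \<in> space M \<Longrightarrow> p l x y \<le> (\<Sum>i\<in>I. w i * k i l x y)"
 shows "dual_doob p N"
 unfolding dual_doob_def
proof (intro allI impI)
 fix t :: real and g :: "nat \<Rightarrow> 'a \<Rightarrow> real"
 assume t: "1 \<le> t" and "\<forall>l. nbm M (g l)"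
 then have g: "nbm M (g l)" for l by blast
 have pn: "nbm (M \<Otimes>\<^sub>M M) (\<lambda>(x, y). p l x y)" for l using P by (simp add: markov_kernel_def)
 have kn: "nbm (M \<Otimes>\<^sub>M M) (\<lambda>(x, y). k i l x y)" if "i \<in> I" for i l using k(1)[OF that] by (simp add: markov_kernel_def)
 define S where "S i x = (\<Sum>l\<le>N. kernel_op M (k i l) (g l) x)" for i x
 have S: "nbm M (S i)" if "i \<in> I" for i unfolding S_def[abs_def] by (intro nbm_sum kernel_op_nbm[OF kn[OF that] g])
 have le: "(\<Sum>l\<le>N. kernel_op M (p l) (g l) x) \<le> (\<Sum>i\<in>I. w i * S i x)" if x: "x \<in> space M" for x
 proof -
  have "kernel_op M (p l) (g l) x \<le> (\<Sum>i\<in>I. w i * kernel_op M (k i l) (g l) x)" if l: "l \<le> N" for l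
  proof -
   have "kernel_op M (p l) (g l) x \<le> (\<integral>y. (\<Sum>i\<in>I. w i * (k i l x y * g l y)) \<partial>M)"
    unfolding kernel_op_def
   proof (rule nbm_integral_mono)
    show "nbm M (\<lambda>y. p l x y * g l y)" by (intro nbm_mult kernel_section_nbm[OF pn x] g)
    show "nbm M (\<lambda>y. \<Sum>i\<in>I. w i * (k i l x y * g l y))"
     using I by (intro nbm_sum nbm_mult nbm_const kernel_section_nbm[OF kn x] g) auto
    fix y assume y: "y \<in> space M"
    show "p l x y * g l y \<le> (\<Sum>i\<in>I. w i * (k i l x y * g l y))"
     using mult_right_mono[OF dom[OF l x y] nbm_nonneg[OF g y]] by (simp add: sum_distrib_right mult.assoc)
   qed
   also have "\<dots> = (\<Sum>i\<in>I. w i * kernel_op M (k i l) (g l) x)"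
    unfolding kernel_op_def
    by (subst Bochner_Integration.integral_sum) (auto intro!: nbm_integrable nbm_mult kernel_section_nbm[OF kn x] g)
   finally show ?thesis .
  qed
  then have "(\<Sum>l\<le>N. kernel_op M (p l) (g l) x) \<le> (\<Sum>l\<le>N. \<Sum>i\<in>I. w i * kernel_op M (k i l) (g l) x)"
   by (intro sum_mono) auto
  also have "\<dots> = (\<Sum>i\<in>I. w i * S i x)" unfolding S_def by (subst sum.swap) (simp add: sum_distrib_left)
  finally show ?thesis .
 qed
 define G where "G = (\<integral>x. (\<Sum>l\<le>N. g l x) powr t \<partial>M)"
 have G: "0 \<le> G" unfolding G_def using t by (intro nbm_integral_nonneg nbm_powr nbm_sum g) auto
 have "(\<integral>x. (\<Sum>l\<le>N. kernel_op M (p l) (g l) x) powr t \<partial>M) \<le> (\<integral>x. (\<Sum>i\<in>I. w i * S i x powr t) \<partial>M)"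
 proof (rule nbm_integral_mono)
  show "nbm M (\<lambda>x. (\<Sum>l\<le>N. kernel_op M (p l) (g l) x) powr t)"
   using t by (intro nbm_powr nbm_sum kernel_op_nbm[OF pn g]) auto
  show "nbm M (\<lambda>x. \<Sum>i\<in>I. w i * S i x powr t)"
   using t I by (intro nbm_sum nbm_mult nbm_const nbm_powr S) auto
  fix x assume x: "x \<in> space M"
  have "(\<Sum>l\<le>N. kernel_op M (p l) (g l) x) powr t \<le> (\<Sum>i\<in>I. w i * S i x) powr t"
   using t le[OF x] nbm_nonneg[OF kernel_op_nbm[OF pn g] x] by (intro powr_mono2 sum_nonneg) auto
  also have "\<dots> \<le> (\<Sum>i\<in>I. w i * S i x powr t)"
   using I t nbm_nonneg[OF S x] by (intro powr_convex_sum) auto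
  finally show "(\<Sum>l\<le>N. kernel_op M (p l) (g l) x) powr t \<le> (\<Sum>i\<in>I. w i * S i x powr t)" .
 qed
 also have "\<dots> = (\<Sum>i\<in>I. w i * (\<integral>x. S i x powr t \<partial>M))"
  using t by (subst Bochner_Integration.integral_sum) (auto intro!: nbm_integrable nbm_powr S)
 also have "\<dots> \<le> (\<Sum>i\<in>I. w i * ((2 * t) powr t * G))"
 proof (intro sum_mono mult_left_mono I(2))
  fix i assume "i \<in> I"
  then show "(\<integral>x. S i x powr t \<partial>M) \<le> (2 * t) powr t * G"
   using k(2)[of i] t g unfolding dual_doob_def S_def G_def by blast
 qed
 also have "\<dots> = sum w I * ((2 * t) powr t * G)" by (simp add: sum_distrib_right)
 also have "\<dots> \<le> 1 * ((2 * t) powr t * G)" using I(3) G by (intro mult_right_mono) auto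
 finally show "(\<integral>x. (\<Sum>l\<le>N. kernel_op M (p l) (g l) x) powr t \<partial>M) \<le> (2 * t) powr t * (\<integral>x. (\<Sum>l\<le>N. g l x) powr t \<partial>M)"
  by (simp add: G_def)
qed

subsection \<open>The vector-valued inequality\<close>

text \<open>Jensen's inequality moves the power \<open>Q\<close> into the averages, and the dual Doob inequality applies with
 the exponent \<open>P / Q\<close>.\<close>

lemma vector_inequality_ge:
 assumes k: "\<And>l. markov_kernel M (k l)" and dd: "dual_doob k N" and g: "\<And>l. nbm M (g l)" and PQ: "1 \<le> Q" "Q \<le> P"
 shows "(\<integral>x. (\<Sum>l\<le>N. kernel_op M (k l) (g l) x powr Q) powr (P / Q) \<partial>M) \<le>
  (2 * (P / Q)) powr (P / Q) * (\<integral>x. (\<Sum>l\<le>N. g l x powr Q) powr (P / Q) \<partial>M)"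
proof -
 have kn: "nbm (M \<Otimes>\<^sub>M M) (\<lambda>(x, y). k l x y)" for l using k by (simp add: markov_kernel_def)
 have t: "1 \<le> P / Q" using PQ by simp
 have gQ: "nbm M (\<lambda>y. g l y powr Q)" for l using PQ by (intro nbm_powr g) auto
 have "(\<integral>x. (\<Sum>l\<le>N. kernel_op M (k l) (g l) x powr Q) powr (P / Q) \<partial>M) \<le>
   (\<integral>x. (\<Sum>l\<le>N. kernel_op M (k l) (\<lambda>y. g l y powr Q) x) powr (P / Q) \<partial>M)"
  using PQ t by (intro nbm_integral_mono nbm_powr nbm_sum kernel_op_nbm[OF kn] gQ g powr_mono2 sum_mono kernel_op_Jensen[OF k g]) (auto intro!: sum_nonneg)
 also have "\<dots> \<le> (2 * (P / Q)) powr (P / Q) * (\<integral>x. (\<Sum>l\<le>N. g l x powr Q) powr (P / Q) \<partial>M)"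
 proof -
  have "\<forall>l. nbm M ((\<lambda>l y. g l y powr Q) l)" using gQ by blast
  from dd[unfolded dual_doob_def, rule_format, OF t this[rule_format]] show ?thesis .
 qed
 finally show ?thesis .
qed

text \<open>The case \<open>P < Q\<close> follows by duality: pairing the left-hand side with its own dual element \<open>h\<close>
 moves the symmetric operators onto \<open>h\<close>, where the conjugate exponents are in the opposite order.
 The constant does not depend on \<open>Q\<close>.\<close>

lemma vector_inequality_less:
 assumes k: "\<And>l. markov_kernel M (k l)" and dd: "dual_doob k N" and g: "\<And>l. nbm M (g l)" and PQ: "1 < P" "P < Q"
 defines "D \<equiv> (2 * (P / (P - 1))) powr (P / (P - 1))"
 shows "(\<integral>x. (\<Sum>l\<le>N. kernel_op M (k l) (g l) x powr Q) powr (P / Q) \<partial>M) \<le>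
  2 * (2 * D) powr (P - 1) * (\<integral>x. (\<Sum>l\<le>N. g l x powr Q) powr (P / Q) \<partial>M)"
proof -
 have kn: "nbm (M \<Otimes>\<^sub>M M) (\<lambda>(x, y). k l x y)" for l using k by (simp add: markov_kernel_def)
 define P' where "P' = P / (P - 1)"
 define Q' where "Q' = Q / (Q - 1)"
 have Q: "Q > 1" using PQ by simp
 have P': "P' > 1" "Q' > 1" "Q' < P'" using PQ Q by (auto simp: P'_def Q'_def field_simps)
 have conj: "1 / Q + 1 / Q' = 1" using Q by (simp add: Q'_def field_simps)
 define A where "A l = kernel_op M (k l) (g l)" for l
 define U where "U x = (\<Sum>l\<le>N. A l x powr Q)" for x
 define V where "V x = (\<Sum>l\<le>N. g l x powr Q)" for x
 \<comment> \<open>The dual element. Where \<open>U\<close> vanishes it is \<open>0\<close>, in spite of the negative exponent, as \<open>0 powr a = 0\<close>.\<close>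
 define h where "h l x = A l x powr (Q - 1) * U x powr ((P - Q) / Q)" for l x
 define W where "W x = (\<Sum>l\<le>N. kernel_op M (k l) (h l) x powr Q')" for x
 have A: "nbm M (A l)" for l unfolding A_def by (rule kernel_op_nbm[OF kn g])
 have U: "nbm M U" unfolding U_def[abs_def] using Q by (intro nbm_sum nbm_powr A) auto
 have V: "nbm M V" unfolding V_def[abs_def] using Q by (intro nbm_sum nbm_powr g) auto
 \<comment> \<open>As \<open>A l powr Q\<close> is a term of \<open>U\<close> for \<open>l \<le> N\<close>, it is bounded by a power of \<open>U\<close> with a positive exponent.\<close>
 have h: "nbm M (\<lambda>x. if l \<le> N then h l x else 0)" for l
 proof (cases "l \<le> N")
  case True
  obtain B where B: "B \<ge> 0" "\<forall>x\<in>space M. U x \<le> B" using nbm_bound[OF U] by blast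
  have "h l x \<le> B powr ((P - 1) / Q)" if x: "x \<in> space M" for x
  proof (cases "U x = 0")
   case True
   then show ?thesis by (simp add: h_def)
  next
   case False
   have "A l x powr Q \<le> U x" unfolding U_def using \<open>l \<le> N\<close>
    by (intro member_le_sum[of l "{..N}" "\<lambda>l. A l x powr Q"]) auto
   then have "(A l x powr Q) powr ((Q - 1) / Q) \<le> U x powr ((Q - 1) / Q)" using Q by (intro powr_mono2) auto
   then have "A l x powr (Q - 1) \<le> U x powr ((Q - 1) / Q)" using Q by (simp add: powr_powr)
   then have "h l x \<le> U x powr ((Q - 1) / Q) * U x powr ((P - Q) / Q)" unfolding h_def by (intro mult_right_mono) auto
   also have "\<dots> = U x powr ((P - 1) / Q)" by (simp add: powr_add[symmetric] add_divide_distrib[symmetric])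
   also have "\<dots> \<le> B powr ((P - 1) / Q)" using B x PQ nbm_nonneg[OF U x] by (intro powr_mono2) auto
   finally show ?thesis .
  qed
  moreover have "h l \<in> borel_measurable M" unfolding h_def[abs_def]
   by (intro borel_measurable_times powr_real_measurable nbm_measurable[OF A] nbm_measurable[OF U]) auto
  ultimately have "nbm M (h l)" by (intro nbmI) (auto simp: h_def)
  then show ?thesis using True by simp
 qed (simp add: nbm_const)
 define h' where "h' l x = (if l \<le> N then h l x else 0)" for l x
 have h': "nbm M (h' l)" for l unfolding h'_def[abs_def] by (rule h)
 have W_eq: "W x = (\<Sum>l\<le>N. kernel_op M (k l) (h' l) x powr Q')" for x
  unfolding W_def h'_def[abs_def] by (intro sum.cong refl) simp
 have W: "nbm M W" unfolding W_eq[abs_def] using P' by (intro nbm_sum nbm_powr kernel_op_nbm[OF kn h']) auto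
 have t: "P / Q > 0" using PQ by simp
 have e1: "U x powr (P / Q) = (\<Sum>l\<le>N. A l x * h' l x)" if x: "x \<in> space M" for x
 proof -
  have "(\<Sum>l\<le>N. A l x * h' l x) = (\<Sum>l\<le>N. A l x powr Q * U x powr ((P - Q) / Q))"
  proof (rule sum.cong[OF refl])
   fix l assume "l \<in> {..N}"
   have "A l x * A l x powr (Q - 1) = A l x powr Q"
    using powr_mult_self[OF nbm_nonneg[OF A[of l] x], of Q] by (simp add: mult.commute)
   then show "A l x * h' l x = A l x powr Q * U x powr ((P - Q) / Q)"
    using \<open>l \<in> {..N}\<close> by (simp add: h'_def h_def mult.assoc[symmetric])
  qed
  also have "\<dots> = U x * U x powr ((P - Q) / Q)" by (simp add: U_def sum_distrib_right)
  also have "\<dots> = U x powr (P / Q)"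
  proof -
   have "(P - Q) / Q = P / Q - 1" using Q by (simp add: field_simps)
   then show ?thesis using powr_mult_self[OF nbm_nonneg[OF U x], of "P / Q"] by (simp add: mult.commute)
  qed
  finally show ?thesis by simp
 qed
 let ?U = "\<integral>x. U x powr (P / Q) \<partial>M" and ?V = "\<integral>x. V x powr (P / Q) \<partial>M"
  and ?W = "\<integral>x. W x powr (P' / Q') \<partial>M"
 have "?U = (\<integral>x. (\<Sum>l\<le>N. A l x * h' l x) \<partial>M)"
  by (intro Bochner_Integration.integral_cong refl e1)
 also have "\<dots> = (\<Sum>l\<le>N. \<integral>x. A l x * h' l x \<partial>M)"
  by (subst Bochner_Integration.integral_sum) (auto intro!: nbm_integrable nbm_mult A h')
 also have "\<dots> = (\<Sum>l\<le>N. \<integral>x. g l x * kernel_op M (k l) (h' l) x \<partial>M)"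
  unfolding A_def by (intro sum.cong refl kernel_op_symmetric[OF k g h'])
 also have "\<dots> = (\<integral>x. (\<Sum>l\<le>N. g l x * kernel_op M (k l) (h' l) x) \<partial>M)"
  by (subst Bochner_Integration.integral_sum) (auto intro!: nbm_integrable nbm_mult g kernel_op_nbm[OF kn h'])
 also have "\<dots> \<le> (\<integral>x. 1 / (2 * D) * W x powr (P' / Q') + (2 * D) powr (P - 1) * V x powr (P / Q) \<partial>M)"
 proof (rule nbm_integral_mono)
  have D: "D > 0" using PQ by (simp add: D_def)
  show "nbm M (\<lambda>x. \<Sum>l\<le>N. g l x * kernel_op M (k l) (h' l) x)"
   by (intro nbm_sum nbm_mult g kernel_op_nbm[OF kn h'])
  show "nbm M (\<lambda>x. 1 / (2 * D) * W x powr (P' / Q') + (2 * D) powr (P - 1) * V x powr (P / Q))"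
   using D P' t by (intro nbm_add nbm_mult nbm_const nbm_powr W V) auto
  fix x assume x: "x \<in> space M"
  define v where "v = V x powr (1 / Q)"
  define w where "w = W x powr (1 / Q')"
  have vw: "v \<ge> 0" "w \<ge> 0" by (auto simp: v_def w_def)
  have "(\<Sum>l\<le>N. g l x * kernel_op M (k l) (h' l) x) \<le> v * w"
   unfolding v_def w_def V_def W_eq
   using nbm_nonneg[OF g x] nbm_nonneg[OF kernel_op_nbm[OF kn h'] x] Q P' conj by (intro Holder_sum) auto
  also have "v * w \<le> 1 / (2 * D) * w powr P' + (2 * D) powr (P - 1) * v powr P"
  proof (cases "2 * D * v \<le> w powr (P' - 1)")
   case True
   have "v * w = 1 / (2 * D) * ((2 * D * v) * w)" using D by simp
   also have "\<dots> \<le> 1 / (2 * D) * (w powr (P' - 1) * w)" using D True vw by (intro mult_left_mono mult_right_mono) auto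
   also have "\<dots> = 1 / (2 * D) * w powr P'" using powr_mult_self[OF vw(2), of P'] by simp
   finally show ?thesis using D by (simp add: add_increasing2)
  next
   case False
   have "(w powr (P' - 1)) powr (P - 1) \<le> (2 * D * v) powr (P - 1)"
    using False PQ by (intro powr_mono2) auto
   moreover have "(P' - 1) * (P - 1) = 1" using PQ by (simp add: P'_def field_simps)
   ultimately have "w \<le> (2 * D * v) powr (P - 1)" using vw by (simp add: powr_powr)
   then have "v * w \<le> v * (2 * D * v) powr (P - 1)" using vw by (intro mult_left_mono) auto
   also have "\<dots> = (2 * D) powr (P - 1) * (v powr (P - 1) * v)" by (simp add: powr_mult)
   also have "\<dots> = (2 * D) powr (P - 1) * v powr P" using powr_mult_self[OF vw(1), of P] by simp
   finally show ?thesis using D by (simp add: add_increasing)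
  qed
  also have "w powr P' = W x powr (P' / Q')" by (simp add: w_def powr_powr)
  also have "v powr P = V x powr (P / Q)" by (simp add: v_def powr_powr)
  finally show "(\<Sum>l\<le>N. g l x * kernel_op M (k l) (h' l) x) \<le> 1 / (2 * D) * W x powr (P' / Q') + (2 * D) powr (P - 1) * V x powr (P / Q)" .
 qed
 also have "\<dots> = 1 / (2 * D) * ?W + (2 * D) powr (P - 1) * ?V"
 proof -
  have "integrable M (\<lambda>x. W x powr (P' / Q'))" "integrable M (\<lambda>x. V x powr (P / Q))"
   using P' t by (auto intro!: nbm_integrable nbm_powr W V)
  then show ?thesis by simp
 qed
 finally have main: "?U \<le>
   1 / (2 * D) * ?W + (2 * D) powr (P - 1) * ?V" .
 have "?W \<le> D * ?U"
 proof -
  have "?W \<le> (2 * (P' / Q')) powr (P' / Q') * (\<integral>x. (\<Sum>l\<le>N. h' l x powr Q') powr (P' / Q') \<partial>M)"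
   unfolding W_eq using P' by (intro vector_inequality_ge[OF k dd h']) auto
  also have "(\<integral>x. (\<Sum>l\<le>N. h' l x powr Q') powr (P' / Q') \<partial>M) = ?U"
  proof (rule Bochner_Integration.integral_cong[OF refl])
   fix x assume x: "x \<in> space M"
   have QQ: "(Q - 1) * Q' = Q" using Q by (simp add: Q'_def)
   have "(\<Sum>l\<le>N. h' l x powr Q') = (\<Sum>l\<le>N. A l x powr Q * U x powr ((P - Q) / Q * Q'))"
    by (intro sum.cong refl) (simp add: h'_def h_def powr_mult powr_powr QQ)
   also have "\<dots> = U x * U x powr ((P - Q) / Q * Q')" by (simp add: U_def sum_distrib_right)
   also have "\<dots> = U x powr (1 + (P - Q) / Q * Q')"
    using powr_mult_self[OF nbm_nonneg[OF U x], of "1 + (P - Q) / Q * Q'"] by (simp add: mult.commute)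
   finally have "(\<Sum>l\<le>N. h' l x powr Q') powr (P' / Q') = U x powr ((1 + (P - Q) / Q * Q') * (P' / Q'))"
    by (simp add: powr_powr)
   also have "(1 + (P - Q) / Q * Q') * (P' / Q') = P / Q"
   proof -
    have "(1 + (P - Q) / Q * Q') * (P' / Q') = P' * (1 / Q' + (P - Q) / Q)" using P' by (simp add: field_simps)
    also have "\<dots> = P' * ((P - 1) / Q)" using Q by (simp add: Q'_def field_simps)
    also have "\<dots> = P / Q" using PQ by (simp add: P'_def)
    finally show ?thesis .
   qed
   finally show "(\<Sum>l\<le>N. h' l x powr Q') powr (P' / Q') = U x powr (P / Q)" .
  qed
  also have "(2 * (P' / Q')) powr (P' / Q') * ?U \<le> D * ?U"
  proof (rule mult_right_mono)
   have "P' / Q' \<le> P'" using P' by (simp add: field_simps)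
   moreover have "1 \<le> P' / Q'" using P' by simp
   ultimately have "(2 * (P' / Q')) powr (P' / Q') \<le> (2 * P') powr P'" by (intro powr_mono_both) auto
   then show "(2 * (P' / Q')) powr (P' / Q') \<le> D" by (simp add: D_def P'_def)
   show "0 \<le> ?U" using t by (intro nbm_integral_nonneg nbm_powr U) auto
  qed
  finally show ?thesis .
 qed
 then have "1 / (2 * D) * ?W \<le> 1 / (2 * D) * (D * ?U)"
  by (intro mult_left_mono) (simp_all add: D_def)
 also have "\<dots> = ?U / 2" using PQ by (simp add: D_def)
 finally have "?U \<le> 2 * (2 * D) powr (P - 1) * ?V"
  using main by simp
 then show ?thesis by (simp add: U_def V_def A_def)
qed

end

section \<open>Averages over the torus\<close>

definition torus :: "(real ^ 'd::finite) measure" where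
 "torus = restrict_space lborel torus_box"

lemma torus_box_sets [measurable]: "torus_box \<in> sets lborel" "torus_box \<in> sets borel"
 by (simp_all add: torus_box_def)

lemma space_torus [simp]: "space torus = torus_box"
 by (simp add: torus_def space_restrict_space)

lemma measurable_torus: "f \<in> borel_measurable borel \<Longrightarrow> f \<in> borel_measurable torus"
 unfolding torus_def by (intro measurable_restrict_space1) simp

lemma emeasure_torus: "A \<in> sets borel \<Longrightarrow> A \<subseteq> torus_box \<Longrightarrow> emeasure torus A = emeasure lborel A"
 unfolding torus_def by (intro emeasure_restrict_space) auto

interpretation torus: finite_measure "torus :: (real ^ 'd::finite) measure"
proof
 show "emeasure (torus :: (real ^ 'd) measure) (space torus) \<noteq> \<infinity>"
  using emeasure_torus[of "torus_box :: (real ^ 'd) set"] emeasure_torus_box[where 'd = 'd] by simp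
qed

text \<open>A substitute for the distance to the lattice of periods, built from the chords \<open>norm (cis t - 1)\<close>
 because these are the factors that summation by parts produces.\<close>

definition rho :: "real ^ 'd::finite \<Rightarrow> real" where
 "rho y = (\<Sum>j\<in>UNIV. norm (cis (y $ j) - 1))"

lemma rho_nonneg [simp]: "0 \<le> rho y"
 by (simp add: rho_def sum_nonneg)

lemma rho_minus: "rho (- y) = rho y"
proof -
 have "norm (cis (- t) - 1) = norm (cis t - 1)" for t
 proof -
  have "cis (- t) - 1 = cnj (cis t - 1)" by (simp add: cis_cnj)
  then show ?thesis by (simp only: complex_mod_cnj)
 qed
 then show ?thesis by (simp add: rho_def)
qed

lemma rho_triangle: "rho (x + y) \<le> rho x + rho y"
proof -
 have "norm (cis (s + t) - 1) \<le> norm (cis s - 1) + norm (cis t - 1)" for s t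
 proof -
  have "cis (s + t) - 1 = cis t * (cis s - 1) + (cis t - 1)" by (simp add: cis_mult[symmetric] algebra_simps)
  then have "norm (cis (s + t) - 1) \<le> norm (cis t * (cis s - 1)) + norm (cis t - 1)"
   by (metis norm_triangle_ineq)
  then show ?thesis by (simp add: norm_mult)
 qed
 then show ?thesis unfolding rho_def by (simp add: sum.distrib[symmetric] sum_mono)
qed

lemma continuous_rho [continuous_intros]:
 "continuous_on A f \<Longrightarrow> continuous_on A (\<lambda>x. rho (f x))"
 unfolding rho_def cis_conv_exp by (intro continuous_intros)

subsection \<open>Two shifted dyadic grids in each coordinate\<close>

text \<open>The cell of \<open>x\<close> in the periodic dyadic grid of generation \<open>i\<close>. In the coordinates selected by \<open>\<sigma>\<close> the
 grid is shifted by a third of the period. In every generation this differs from a multiple of the mesh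
 by a third of the mesh.\<close>

definition cell :: "bool ^ 'd \<Rightarrow> nat \<Rightarrow> real ^ 'd::finite \<Rightarrow> int ^ 'd" where
 "cell \<sigma> i x = (\<chi> j. \<lfloor>2 ^ i * (x $ j / (2 * pi) + (if \<sigma> $ j then 1 / 3 else 0))\<rfloor> mod 2 ^ i)"

lemma cell_nested:
 assumes "i \<le> l" "cell \<sigma> l x = cell \<sigma> l y"
 shows "cell \<sigma> i x = cell \<sigma> i y"
proof -
 define m :: int where "m = 2 ^ (l - i)"
 have m: "m > 0" by (simp add: m_def)
 have fl: "\<lfloor>2 ^ i * t\<rfloor> = \<lfloor>2 ^ l * t\<rfloor> div m" for t :: real
 proof -
  have "(2::real) ^ l = 2 ^ i * real_of_int m" using assms(1) by (simp add: m_def power_add[symmetric])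
  then have "2 ^ i * t = (2 ^ l * t) / real_of_int m" using m by simp
  then show ?thesis using floor_divide_real_eq_div[of m "2 ^ l * t"] m by simp
 qed
 have md: "(A div m) mod 2 ^ i = (A mod 2 ^ l) div m" for A :: int
 proof -
  have l: "(2::int) ^ l = m * 2 ^ i" using assms(1) by (simp add: m_def power_add[symmetric])
  have "A mod 2 ^ l = m * (A div m mod 2 ^ i) + A mod m"
   unfolding l by (rule zmod_zmult2_eq) simp
  then show ?thesis using m by simp
 qed
 have "cell \<sigma> i x $ j = cell \<sigma> i y $ j" for j
  using arg_cong[OF assms(2), of "\<lambda>v. v $ j"] by (simp add: cell_def fl md)
 then show ?thesis by (simp add: vec_eq_iff)
qed

lemma cell_0: "cell \<sigma> 0 x = cell \<sigma> 0 y"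
 by (simp add: cell_def)

text \<open>On \<open>|x| \<le> pi / 2\<close> the cubic Taylor bound gives \<open>|sin x| \<ge> |x| / 2\<close>, and \<open>pi > 3\<close>.\<close>

lemma chord_lower_bound:
 obtains k :: int where "3 * \<bar>s - real_of_int k\<bar> \<le> norm (cis (2 * pi * s) - 1)"
proof
 define k where "k = round s"
 define t where "t = s - real_of_int k"
 have t: "\<bar>t\<bar> \<le> 1 / 2" unfolding t_def k_def using of_int_round_abs_le[of s] by (simp add: abs_minus_commute)
 have "cis (2 * pi * s) = cis (2 * pi * t) * cis (2 * pi * real_of_int k)"
  by (simp add: t_def cis_mult algebra_simps)
 also have "cis (2 * pi * real_of_int k) = 1" by (rule cis_multiple_2pi) simp
 finally have c: "cis (2 * pi * s) = cis (2 * pi * t)" by simp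
 have "cis (2 * pi * t) - 1 = 2 * \<i> * complex_of_real (sin (pi * t)) * cis (pi * t)"
 proof -
  have "cos (2 * (pi * t)) = 1 - 2 * sin (pi * t) ^ 2" by (rule cos_double_sin)
  moreover have "sin (2 * (pi * t)) = 2 * sin (pi * t) * cos (pi * t)" by (rule sin_double)
  ultimately show ?thesis by (simp add: complex_eq_iff power2_eq_square mult.assoc)
 qed
 then have n: "norm (cis (2 * pi * s) - 1) = 2 * \<bar>sin (pi * t)\<bar>" by (simp add: c norm_mult)
 define x where "x = pi * t"
 have pi4: "pi < 4" by (rule pi_less_4)
 have x2: "\<bar>x\<bar> \<le> 2" using t pi4 mult_mono[of pi 4 "\<bar>t\<bar>" "1/2"] by (simp add: x_def abs_mult)
 have xs: "x\<^sup>2 \<le> 3"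
 proof -
  have pi2: "pi \<le> 3.2" using pi_approx(2) by simp
  have "\<bar>x\<bar> \<le> 1.6" using t pi2 mult_mono[of pi "3.2" "\<bar>t\<bar>" "1/2"] by (simp add: x_def abs_mult)
  then have "\<bar>x\<bar>\<^sup>2 \<le> 1.6\<^sup>2" by (intro power_mono) auto
  then show ?thesis by (simp add: power2_eq_square)
 qed
 have "\<bar>sin x - x\<bar> \<le> \<bar>x\<bar> ^ 3 / 6"
  using Maclaurin_sin_bound[of x 3] by (simp add: numeral_3_eq_3 sin_coeff_def fact_numeral)
 also have "\<dots> = \<bar>x\<bar> * x\<^sup>2 / 6" by (simp add: power3_eq_cube power2_eq_square)
 also have "\<dots> \<le> \<bar>x\<bar> * 3 / 6" using xs by (intro divide_right_mono mult_left_mono) auto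
 finally have "\<bar>sin x\<bar> \<ge> \<bar>x\<bar> / 2" by linarith
 moreover have "\<bar>x\<bar> \<ge> 3 * \<bar>t\<bar>" using pi_gt3 by (simp add: x_def abs_mult mult_right_mono)
 ultimately show "3 * \<bar>s - real_of_int k\<bar> \<le> norm (cis (2 * pi * s) - 1)"
  unfolding n using x_def t_def by simp
qed

text \<open>No point of one of the two grids is close to a point of the other, as their distance is a
 multiple of a third that is not an integer. So a short interval meets at most one of the grids.\<close>

lemma one_third_trick:
 fixes a b :: real
 assumes "\<bar>a - b\<bar> < 1 / 3"
 shows "\<lfloor>a\<rfloor> = \<lfloor>b\<rfloor> \<or> \<lfloor>a + 2 ^ i / 3\<rfloor> = \<lfloor>b + 2 ^ i / 3\<rfloor>"
proof -
 have *: "\<lfloor>a\<rfloor> = \<lfloor>b\<rfloor> \<or> \<lfloor>a + 2 ^ i / 3\<rfloor> = \<lfloor>b + 2 ^ i / 3\<rfloor>" if ab: "a \<le> b" "b - a < 1 / 3" for a b :: real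
 proof (rule ccontr)
  assume "\<not> ?thesis"
  then have "\<lfloor>a\<rfloor> < \<lfloor>b\<rfloor>" "\<lfloor>a + 2 ^ i / 3\<rfloor> < \<lfloor>b + 2 ^ i / 3\<rfloor>"
   using floor_mono[OF ab(1)] floor_mono[of "a + 2 ^ i / 3" "b + 2 ^ i / 3"] ab(1) by auto
  then have "a < real_of_int \<lfloor>b\<rfloor>" "a + 2 ^ i / 3 < real_of_int \<lfloor>b + 2 ^ i / 3\<rfloor>"
   by (simp_all add: floor_less_iff)
  moreover have "real_of_int \<lfloor>b\<rfloor> \<le> b" "real_of_int \<lfloor>b + 2 ^ i / 3\<rfloor> \<le> b + 2 ^ i / 3" by simp_all
  ultimately have *: "\<bar>real_of_int \<lfloor>b + 2 ^ i / 3\<rfloor> - real_of_int \<lfloor>b\<rfloor> - 2 ^ i / 3\<bar> < 1 / 3"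
   using ab(2) by linarith
  have "real_of_int (3 * (\<lfloor>b + 2 ^ i / 3\<rfloor> - \<lfloor>b\<rfloor>) - 2 ^ i) = 3 * (real_of_int \<lfloor>b + 2 ^ i / 3\<rfloor> - real_of_int \<lfloor>b\<rfloor> - 2 ^ i / 3)"
   by (simp add: algebra_simps)
  then have "\<bar>real_of_int (3 * (\<lfloor>b + 2 ^ i / 3\<rfloor> - \<lfloor>b\<rfloor>) - 2 ^ i)\<bar> < 1"
   using * by (simp only: abs_mult) simp
  then have "\<bar>3 * (\<lfloor>b + 2 ^ i / 3\<rfloor> - \<lfloor>b\<rfloor>) - 2 ^ i\<bar> < 1" by linarith
  then have "2 ^ i = 3 * (\<lfloor>b + 2 ^ i / 3\<rfloor> - \<lfloor>b\<rfloor>)" by simp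
  then have d: "(3::int) dvd 2 ^ i" by (metis dvd_triv_left)
  have "coprime (3::int) (2 ^ i)" by simp
  then show False using d coprime_common_divisor[of "3::int" "2 ^ i" 3] by simp
 qed
 show ?thesis
 proof (cases "a \<le> b")
  case True
  then show ?thesis using *[of a b] assms by simp
 next
  case False
  then show ?thesis using *[of b a] assms by auto
 qed
qed

text \<open>The one third trick selects one of the two grids in each coordinate; \<open>\<sigma>\<close> collects the choices.\<close>

lemma close_points_share_cell:
 assumes "2 ^ i * rho (x - y) < 1"
 shows "\<exists>\<sigma>. cell \<sigma> i x = cell \<sigma> i y"
proof -
 have "\<exists>s. \<lfloor>2 ^ i * (x $ j / (2 * pi) + (if s then 1 / 3 else 0))\<rfloor> mod 2 ^ i =
   \<lfloor>2 ^ i * (y $ j / (2 * pi) + (if s then 1 / 3 else 0))\<rfloor> mod (2 ^ i :: int)" for j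
 proof -
  define u v where "u = x $ j / (2 * pi)" and "v = y $ j / (2 * pi)"
  obtain k where k: "3 * \<bar>(u - v) - real_of_int k\<bar> \<le> norm (cis (2 * pi * (u - v)) - 1)"
   by (rule chord_lower_bound)
  have "2 * pi * (u - v) = (x - y) $ j" by (simp add: u_def v_def field_simps)
  then have "3 * \<bar>u - v - real_of_int k\<bar> \<le> rho (x - y)"
   using k member_le_sum[of j UNIV "\<lambda>j. norm (cis ((x - y) $ j) - 1)"] by (simp add: rho_def)
  then have "2 ^ i * (3 * \<bar>u - v - real_of_int k\<bar>) \<le> 2 ^ i * rho (x - y)" by (intro mult_left_mono) auto
  then have "2 ^ i * (3 * \<bar>u - v - real_of_int k\<bar>) < 1" using assms by linarith
  moreover have "2 ^ i * u - 2 ^ i * (v + real_of_int k) = 2 ^ i * (u - v - real_of_int k)" by (simp add: algebra_simps)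
  ultimately have "\<bar>2 ^ i * u - 2 ^ i * (v + real_of_int k)\<bar> < 1 / 3" by (simp add: abs_mult)
  from one_third_trick[OF this, of i]
  have "\<exists>s. \<lfloor>2 ^ i * u + (if s then 2 ^ i / 3 else 0)\<rfloor> = \<lfloor>2 ^ i * (v + real_of_int k) + (if s then 2 ^ i / 3 else 0)\<rfloor>"
   by (auto intro: exI[of _ False] exI[of _ True])
  then obtain s where s: "\<lfloor>2 ^ i * u + (if s then 2 ^ i / 3 else 0)\<rfloor> = \<lfloor>2 ^ i * (v + real_of_int k) + (if s then 2 ^ i / 3 else 0)\<rfloor>"
   by blast
  have e1: "2 ^ i * (u + (if s then 1 / 3 else 0)) = 2 ^ i * u + (if s then 2 ^ i / 3 else 0)"
   by (simp add: distrib_left)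
  have e2: "2 ^ i * (v + real_of_int k) + (if s then 2 ^ i / 3 else 0) = 2 ^ i * (v + (if s then 1 / 3 else 0)) + real_of_int (k * 2 ^ i)"
   by (simp add: algebra_simps)
  have "\<lfloor>2 ^ i * (u + (if s then 1 / 3 else 0))\<rfloor> = \<lfloor>2 ^ i * (v + (if s then 1 / 3 else 0))\<rfloor> + k * 2 ^ i"
   unfolding e1 s e2 by (rule floor_add_int[symmetric])
  then show ?thesis unfolding u_def v_def by (intro exI[of _ s]) (simp only: mod_mult_self1)
 qed
 then obtain s where s: "\<And>j. \<lfloor>2 ^ i * (x $ j / (2 * pi) + (if s j then 1 / 3 else 0))\<rfloor> mod 2 ^ i =
   \<lfloor>2 ^ i * (y $ j / (2 * pi) + (if s j then 1 / 3 else 0))\<rfloor> mod (2 ^ i :: int)" by metis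
 show ?thesis by (intro exI[of _ "\<chi> j. s j"]) (simp add: cell_def vec_eq_iff s)
qed

lemma card_bool_vec: "card (UNIV :: (bool ^ 'd::finite) set) = 2 ^ CARD('d)"
 by simp

lemma measurable_cell: "(\<lambda>x. cell \<sigma> i x $ j) \<in> measurable borel (count_space UNIV)"
proof -
 have f: "(\<lambda>x. \<lfloor>2 ^ i * (x $ j / (2 * pi) + (if \<sigma> $ j then 1 / 3 else 0))\<rfloor>) \<in> measurable borel (count_space UNIV)"
  by (rule measurable_compose[OF _ measurable_real_floor]) (intro borel_measurable_continuous_onI continuous_intros; simp)
 show ?thesis unfolding cell_def vec_lambda_beta by (rule measurable_compose[OF f]) simp
qed

lemma cell_sets: "{y. cell \<sigma> i y = c} \<in> sets borel"
proof -
 have s: "(\<lambda>x. cell \<sigma> i x $ j) -` {c $ j} \<in> sets borel" for j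
  using measurable_sets[OF measurable_cell[of \<sigma> i j], of "{c $ j}"] by simp
 have "{y. cell \<sigma> i y = c} = (\<Inter>j. (\<lambda>x. cell \<sigma> i x $ j) -` {c $ j})" by (auto simp: vec_eq_iff)
 also have "\<dots> \<in> sets borel"
  by (rule sets.countable_INT') (use s in \<open>auto intro: countable_finite\<close>)
 finally show ?thesis .
qed

text \<open>A cell may wrap around the boundary of the box, which costs a factor two in each coordinate.\<close>

lemma cell_measure:
 "measure torus ({y. cell \<sigma> i y = c} \<inter> torus_box) \<le> (4 * pi / 2 ^ i) ^ CARD('d)" for c :: "int ^ 'd::finite"
proof -
 let ?s = "\<lambda>j. if \<sigma> $ j then 1 / 3 else 0 :: real"
 \<comment> \<open>The shifted coordinate ranges over less than two periods, and \<open>\<tau>\<close> tells in which of them it lies.\<close>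
 define lo :: "bool ^ 'd \<Rightarrow> real ^ 'd" where
  "lo \<tau> = (\<chi> j. 2 * pi * (real_of_int (c $ j + (if \<tau> $ j then 2 ^ i else 0)) / 2 ^ i - ?s j))" for \<tau>
 define hi :: "bool ^ 'd \<Rightarrow> real ^ 'd" where "hi \<tau> = lo \<tau> + (\<chi> j. 2 * pi / 2 ^ i)" for \<tau>
 have sub: "{y. cell \<sigma> i y = c} \<inter> torus_box \<subseteq> (\<Union>\<tau>\<in>UNIV. cbox (lo \<tau>) (hi \<tau>))"
 proof
  fix y assume y: "y \<in> {y. cell \<sigma> i y = c} \<inter> torus_box"
  define f where "f j = \<lfloor>2 ^ i * (y $ j / (2 * pi) + ?s j)\<rfloor>" for j
  have f: "f j = c $ j \<or> f j = c $ j + 2 ^ i" for j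
  proof -
   have yj: "0 \<le> y $ j / (2 * pi)" "y $ j / (2 * pi) \<le> 1" using y by (auto simp: mem_torus_box)
   then have "0 \<le> y $ j / (2 * pi) + ?s j" "y $ j / (2 * pi) + ?s j < 2"
    by (cases "\<sigma> $ j"; simp only: if_True if_False; linarith)+
   then have "0 \<le> 2 ^ i * (y $ j / (2 * pi) + ?s j)" "2 ^ i * (y $ j / (2 * pi) + ?s j) < real_of_int (2 * 2 ^ i)" by auto
   then have b: "0 \<le> f j" "f j < 2 * 2 ^ i" unfolding f_def by (auto simp: floor_less_iff le_floor_iff simp del: of_int_mult)
   have c: "f j mod 2 ^ i = c $ j" using y by (auto simp: cell_def f_def)
   have "2 ^ i * (f j div 2 ^ i) \<le> f j" unfolding minus_mod_eq_mult_div[symmetric] by simp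
   then have "2 ^ i * (f j div 2 ^ i) < 2 ^ i * 2" using b by linarith
   then have "f j div 2 ^ i < 2" by (simp only: mult_less_cancel_left_pos zero_less_power zero_less_numeral)
   moreover have "0 \<le> f j div 2 ^ i" using b by (simp add: pos_imp_zdiv_nonneg_iff)
   ultimately have "f j div 2 ^ i = 0 \<or> f j div 2 ^ i = 1" by linarith
   then show ?thesis using mult_div_mod_eq[of "2 ^ i" "f j"] c by auto
  qed
  have "y \<in> cbox (lo (\<chi> j. f j \<noteq> c $ j)) (hi (\<chi> j. f j \<noteq> c $ j))"
   unfolding mem_box_cart
  proof
   fix j
   define g where "g = (if f j \<noteq> c $ j then 2 ^ i else 0 :: int)"
   have g: "c $ j + g = f j" using f[of j] by (auto simp: g_def)
   have "real_of_int (f j) \<le> 2 ^ i * (y $ j / (2 * pi) + ?s j)" "2 ^ i * (y $ j / (2 * pi) + ?s j) \<le> real_of_int (f j) + 1"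
    unfolding f_def by linarith+
   then have "real_of_int (f j) / 2 ^ i \<le> y $ j / (2 * pi) + ?s j" "y $ j / (2 * pi) + ?s j \<le> (real_of_int (f j) + 1) / 2 ^ i"
    by (simp_all add: field_simps)
   then have "2 * pi * (real_of_int (f j) / 2 ^ i - ?s j) \<le> y $ j"
    "y $ j \<le> 2 * pi * (real_of_int (f j) / 2 ^ i - ?s j) + 2 * pi / 2 ^ i"
    by (simp_all add: field_simps)
   then show "lo (\<chi> j. f j \<noteq> c $ j) $ j \<le> y $ j \<and> y $ j \<le> hi (\<chi> j. f j \<noteq> c $ j) $ j"
   proof -
    have l: "lo (\<chi> j. f j \<noteq> c $ j) $ j = 2 * pi * (real_of_int (f j) / 2 ^ i - ?s j)"
     by (simp only: lo_def vec_lambda_beta g[unfolded g_def])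
    show ?thesis
     unfolding hi_def vector_add_component vec_lambda_beta l
     using \<open>2 * pi * (real_of_int (f j) / 2 ^ i - ?s j) \<le> y $ j\<close>
      \<open>y $ j \<le> 2 * pi * (real_of_int (f j) / 2 ^ i - ?s j) + 2 * pi / 2 ^ i\<close> by (rule conjI)
   qed
  qed
  then show "y \<in> (\<Union>\<tau>\<in>UNIV. cbox (lo \<tau>) (hi \<tau>))" by blast
 qed
 have vol: "measure lborel (cbox (lo \<tau>) (hi \<tau>)) = (2 * pi / 2 ^ i) ^ CARD('d)" for \<tau>
 proof -
  have "lo \<tau> \<in> cbox (lo \<tau>) (hi \<tau>)" by (simp add: mem_box_cart hi_def)
  then have "cbox (lo \<tau>) (hi \<tau>) \<noteq> {}" by blast
  from content_cbox_cart[OF this] show ?thesis by (simp add: hi_def)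
 qed
 have "measure torus ({y. cell \<sigma> i y = c} \<inter> torus_box) = measure lborel ({y. cell \<sigma> i y = c} \<inter> torus_box)"
  unfolding measure_def by (subst emeasure_torus) (auto intro: cell_sets)
 also have "\<dots> \<le> measure lborel (\<Union>\<tau>\<in>UNIV. cbox (lo \<tau>) (hi \<tau>))"
  by (rule measure_mono_fmeasurable[OF sub]) (auto intro!: cell_sets fmeasurable.finite_UN)
 also have "\<dots> \<le> (\<Sum>\<tau>\<in>UNIV. measure lborel (cbox (lo \<tau>) (hi \<tau>)))"
  by (rule measure_UNION_le) auto
 also have "\<dots> = 2 ^ CARD('d) * (2 * pi / 2 ^ i) ^ CARD('d)"
  by (simp only: vol sum_constant card_bool_vec of_nat_power of_nat_numeral)
 also have "\<dots> = (2 * (2 * pi / 2 ^ i)) ^ CARD('d)" by (simp only: power_mult_distrib)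
 also have "2 * (2 * pi / 2 ^ i) = 4 * pi / 2 ^ i" by simp
 finally show ?thesis .
qed

lemma measurable_torus_pair:
 assumes "(\<lambda>(x, y). f x y) \<in> borel_measurable borel"
 shows "(\<lambda>(x, y). f x y) \<in> borel_measurable (torus \<Otimes>\<^sub>M torus)"
proof -
 have 1: "(\<lambda>(x, y). f x y) \<in> borel_measurable (borel \<Otimes>\<^sub>M borel)" using assms by (simp add: borel_prod)
 have 2: "(\<lambda>p. p) \<in> measurable (torus \<Otimes>\<^sub>M torus) (borel \<Otimes>\<^sub>M borel)"
  unfolding torus_def by (rule measurable_pair) (auto simp: o_def intro!: measurable_compose[OF measurable_fst] measurable_compose[OF measurable_snd] measurable_restrict_space1)
 show ?thesis using measurable_compose[OF 2 1] by simp
qed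

definition cell_kernel :: "bool ^ 'd \<Rightarrow> nat \<Rightarrow> real ^ 'd::finite \<Rightarrow> real ^ 'd \<Rightarrow> real" where
 "cell_kernel \<sigma> i x y = (if cell \<sigma> i x = cell \<sigma> i y then (2 ^ i / (4 * pi)) ^ CARD('d) else 0)"

lemma markov_cell_kernel: "markov_kernel torus (cell_kernel \<sigma> i)"
 unfolding markov_kernel_def
proof (intro conjI ballI)
 fix x y :: "real ^ 'a"
 show "cell_kernel \<sigma> i x y = cell_kernel \<sigma> i y x" by (simp add: cell_kernel_def)
 have "(\<integral>y. cell_kernel \<sigma> i x y \<partial>torus) = (\<integral>y. (2 ^ i / (4 * pi)) ^ CARD('a) * indicator ({y. cell \<sigma> i y = cell \<sigma> i x} \<inter> torus_box) y \<partial>torus)"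
  by (intro Bochner_Integration.integral_cong) (auto simp: cell_kernel_def)
 also have "\<dots> = (2 ^ i / (4 * pi)) ^ CARD('a) * measure torus ({y. cell \<sigma> i y = cell \<sigma> i x} \<inter> torus_box)"
  by (simp add: Int_absorb2)
 also have "\<dots> \<le> (2 ^ i / (4 * pi)) ^ CARD('a) * (4 * pi / 2 ^ i) ^ CARD('a)"
  by (intro mult_left_mono cell_measure) auto
 also have "\<dots> = ((2 ^ i / (4 * pi)) * (4 * pi / 2 ^ i)) ^ CARD('a)" by (simp only: power_mult_distrib)
 also have "(2 ^ i / (4 * pi)) * (4 * pi / 2 ^ i) = 1" by simp
 also have "1 ^ CARD('a) = (1 :: real)" by simp
 finally show "(\<integral>y. cell_kernel \<sigma> i x y \<partial>torus) \<le> 1" .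
next
 have "{p :: (real ^ 'a) \<times> (real ^ 'a). cell \<sigma> i (fst p) = cell \<sigma> i (snd p)} \<in> sets borel"
 proof -
  have m1: "(\<lambda>p :: (real ^ 'a) \<times> (real ^ 'a). real_of_int (cell \<sigma> i (fst p) $ j)) \<in> borel_measurable borel" for j
   by (rule measurable_compose[OF measurable_compose[OF _ measurable_cell]]) (auto intro!: borel_measurable_continuous_onI continuous_intros)
  have m2: "(\<lambda>p :: (real ^ 'a) \<times> (real ^ 'a). real_of_int (cell \<sigma> i (snd p) $ j)) \<in> borel_measurable borel" for j
   by (rule measurable_compose[OF measurable_compose[OF _ measurable_cell]]) (auto intro!: borel_measurable_continuous_onI continuous_intros)
  have "{p :: (real ^ 'a) \<times> (real ^ 'a). cell \<sigma> i (fst p) = cell \<sigma> i (snd p)} =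
    (\<Inter>j. {p \<in> space borel. real_of_int (cell \<sigma> i (fst p) $ j) = real_of_int (cell \<sigma> i (snd p) $ j)})" by (auto simp: vec_eq_iff)
  also have "\<dots> \<in> sets borel"
   by (rule sets.countable_INT') (use borel_measurable_eq[OF m1 m2] in \<open>auto intro: countable_finite\<close>)
  finally show ?thesis .
 qed
 then have "(\<lambda>p :: (real ^ 'a) \<times> (real ^ 'a). if p \<in> {p. cell \<sigma> i (fst p) = cell \<sigma> i (snd p)} then (2 ^ i / (4 * pi)) ^ CARD('a) else 0) \<in> borel_measurable borel"
  by (intro measurable_If_set) auto
 then have "(\<lambda>(x, y). cell_kernel \<sigma> i x y) \<in> borel_measurable borel"
  by (simp add: cell_kernel_def[abs_def] case_prod_beta')
 then have "(\<lambda>(x, y). cell_kernel \<sigma> i x y) \<in> borel_measurable (torus \<Otimes>\<^sub>M torus)"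
  by (rule measurable_torus_pair)
 then show "nbm (torus \<Otimes>\<^sub>M torus) (\<lambda>(x, y). cell_kernel \<sigma> i x y)"
  by (intro nbmI[of _ _ "(2 ^ i / (4 * pi)) ^ CARD('a)"]) (auto simp: cell_kernel_def)
qed

lemma dual_doob_cell_kernel: "torus.dual_doob (\<lambda>l. cell_kernel \<sigma> (l - j)) N"
proof (rule torus.dual_doob_nested)
 fix i l :: nat and x y z :: "real ^ 'a"
 assume "i \<le> l" "cell_kernel \<sigma> (l - j) x y \<noteq> 0"
 then have "cell \<sigma> (i - j) x = cell \<sigma> (i - j) y"
  by (intro cell_nested[of "i - j" "l - j"]) (auto simp: cell_kernel_def split: if_splits)
 then show "cell_kernel \<sigma> (i - j) x z = cell_kernel \<sigma> (i - j) y z" by (simp add: cell_kernel_def)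
qed (rule markov_cell_kernel)

subsection \<open>Averages with polynomially decaying weights\<close>

text \<open>Chosen such that the weights of the dominating combination of cell kernels sum up to at most one.\<close>

definition avg_const :: "'d::finite itself \<Rightarrow> real" where
 "avg_const _ = 1 / (2 ^ (2 * CARD('d) + 2) * (4 * pi) ^ CARD('d))"

definition avg_kernel :: "nat \<Rightarrow> real ^ 'd::finite \<Rightarrow> real ^ 'd \<Rightarrow> real" where
 "avg_kernel l x y = avg_const TYPE('d) * (2 ^ l) ^ CARD('d) / (1 + 2 ^ l * rho (x - y)) ^ (CARD('d) + 1)"

lemma avg_const_pos: "avg_const TYPE('d::finite) > 0"
 by (simp add: avg_const_def)

definition grid_weight :: "nat \<times> (bool ^ 'd::finite) \<Rightarrow> real" where
 "grid_weight p = (1 / 2) ^ (fst p + 1) / 2 ^ CARD('d)"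

lemma sum_grid_weight: "(\<Sum>p\<in>{..N} \<times> (UNIV :: (bool ^ 'd::finite) set). grid_weight p) \<le> 1"
proof -
 have "(\<Sum>p\<in>{..N} \<times> (UNIV :: (bool ^ 'd) set). grid_weight p) = (\<Sum>j\<le>N. \<Sum>\<sigma>\<in>(UNIV :: (bool ^ 'd) set). (1 / 2) ^ (j + 1) / 2 ^ CARD('d))"
  by (simp only: sum.cartesian_product grid_weight_def case_prod_beta' fst_conv)
 also have "\<dots> = (\<Sum>j\<le>N. (1 / 2) ^ (j + 1))" by (simp add: card_bool_vec)
 also have "\<dots> = 1 - (1 / 2) ^ (N + 1)" by (induction N) (auto simp: field_simps)
 also have "\<dots> \<le> 1" by simp
 finally show ?thesis .
qed

text \<open>At the finest generation at which the two points are closer than a cell, the weight is comparable to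
 the density of a common cell, up to a geometric factor in the number \<open>j\<close> of generations skipped.\<close>

lemma avg_kernel_dominated:
 fixes x y :: "real ^ 'd::finite"
 assumes "l \<le> N"
 shows "avg_kernel l x y \<le> (\<Sum>p\<in>{..N} \<times> UNIV. grid_weight p * cell_kernel (snd p) (l - fst p) x y)"
proof -
 let ?r = "rho (x - y)" and ?d = "CARD('d)"
 \<comment> \<open>Skipping all generations is always possible, as there is only one cell in generation \<open>0\<close>.\<close>
 define j where "j = (LEAST j. j = l \<or> 2 ^ (l - j) * ?r < 1)"
 have j: "j = l \<or> 2 ^ (l - j) * ?r < 1" unfolding j_def by (rule LeastI[of _ l]) simp
 have jl: "j \<le> l" unfolding j_def by (rule Least_le) simp
 obtain \<sigma> where \<sigma>: "cell \<sigma> (l - j) x = cell \<sigma> (l - j) y"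
 proof (cases "2 ^ (l - j) * ?r < 1")
  case True
  then show ?thesis using close_points_share_cell that by blast
 next
  case False
  then have "j = l" using j by simp
  then show ?thesis using that cell_0 by (metis diff_self_eq_0)
 qed
 have low: "2 ^ j \<le> 2 * (1 + 2 ^ l * ?r)"
 proof (cases j)
  case (Suc i)
  have "\<not> (i = l \<or> 2 ^ (l - i) * ?r < 1)" using not_less_Least[of i "\<lambda>j. j = l \<or> 2 ^ (l - j) * ?r < 1"] Suc by (simp add: j_def)
  then have "1 \<le> 2 ^ (l - i) * ?r" by simp
  then have "2 ^ i * 1 \<le> 2 ^ i * (2 ^ (l - i) * ?r)" by (intro mult_left_mono) auto
  also have "\<dots> = 2 ^ l * ?r" using jl Suc by (simp add: mult.assoc[symmetric] power_add[symmetric])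
  finally show ?thesis using Suc by simp
 qed simp
 have pos: "1 + 2 ^ l * ?r > 0" by (simp add: add_pos_nonneg)
 have "(2 ^ j) ^ (?d + 1) \<le> (2 * (1 + 2 ^ l * ?r)) ^ (?d + 1)" by (intro power_mono low) auto
 then have p: "(2 ^ j) ^ (?d + 1) \<le> 2 ^ (?d + 1) * (1 + 2 ^ l * ?r) ^ (?d + 1)" by (simp only: power_mult_distrib)
 have "avg_kernel l x y \<le> avg_const TYPE('d) * (2 ^ l) ^ ?d * (2 ^ (?d + 1) / (2 ^ j) ^ (?d + 1))"
 proof -
  have "1 / (1 + 2 ^ l * ?r) ^ (?d + 1) \<le> 2 ^ (?d + 1) / (2 ^ j) ^ (?d + 1)"
   using p pos by (simp add: divide_simps mult.commute)
  then have "avg_const TYPE('d) * (2 ^ l) ^ ?d * (1 / (1 + 2 ^ l * ?r) ^ (?d + 1)) \<le>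
    avg_const TYPE('d) * (2 ^ l) ^ ?d * (2 ^ (?d + 1) / (2 ^ j) ^ (?d + 1))"
   using avg_const_pos[where 'd = 'd] by (intro mult_left_mono) auto
  then show ?thesis by (simp add: avg_kernel_def)
 qed
 also have "\<dots> = grid_weight (j, \<sigma>) * (2 ^ (l - j) / (4 * pi)) ^ ?d"
 proof -
  have l: "((2::real) ^ l) ^ ?d = (2 ^ (l - j)) ^ ?d * (2 ^ j) ^ ?d"
   using jl by (simp add: power_add[symmetric] power_mult_distrib[symmetric])
  have "2 * ?d + 2 = ?d + (?d + 1) + 1" by simp
  then have two: "(2::real) ^ (2 * ?d + 2) = 2 ^ ?d * 2 ^ (?d + 1) * 2" by (simp only: power_add power_one_right)
  have Y: "((2::real) ^ j) ^ (?d + 1) = 2 ^ j * (2 ^ j) ^ ?d" by simp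
  have half: "(1 / 2 :: real) ^ (j + 1) = 1 / (2 * 2 ^ j)" by (simp add: power_divide)
  have "1 / (A * B * 2 * P) * (X * Z) * (B / (Y * Z)) = 1 / (2 * Y) / A * (X / P)"
   if "A \<noteq> 0" "B \<noteq> 0" "P \<noteq> 0" "Y \<noteq> 0" "Z \<noteq> 0" for A B P X Y Z :: real
   using that by (simp add: field_simps)
  then show ?thesis
   unfolding avg_const_def grid_weight_def fst_conv l two Y half power_divide[of "2 ^ (l - j)"] by simp
 qed
 also have "\<dots> = grid_weight (j, \<sigma>) * cell_kernel \<sigma> (l - j) x y" using \<sigma> by (simp add: cell_kernel_def)
 also have "\<dots> \<le> (\<Sum>p\<in>{..N} \<times> UNIV. grid_weight p * cell_kernel (snd p) (l - fst p) x y)"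
  using member_le_sum[of "(j, \<sigma>)" "{..N} \<times> UNIV" "\<lambda>p. grid_weight p * cell_kernel (snd p) (l - fst p) x y"] jl assms
  by (simp add: grid_weight_def cell_kernel_def)
 finally show ?thesis .
qed

lemma markov_avg_kernel: "markov_kernel torus (avg_kernel l :: real ^ 'd::finite \<Rightarrow> real ^ 'd \<Rightarrow> real)"
proof -
 let ?k = "avg_kernel l :: real ^ 'd \<Rightarrow> real ^ 'd \<Rightarrow> real"
 have pos: "1 \<le> 1 + 2 ^ l * rho (x - y)" for x y :: "real ^ 'd" by simp
 have pos': "1 + 2 ^ l * rho (x - y) \<noteq> 0" for x y :: "real ^ 'd" using pos[of x y] by linarith
 have "continuous_on UNIV (\<lambda>p. ?k (fst p) (snd p))"
  unfolding avg_kernel_def by (intro continuous_intros) (use pos' in auto)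
 then have "(\<lambda>(x, y). ?k x y) \<in> borel_measurable borel"
  using borel_measurable_continuous_onI[of "\<lambda>p. ?k (fst p) (snd p)"] by (simp add: case_prod_beta')
 note m = measurable_torus_pair[OF this]
 have n: "nbm (torus \<Otimes>\<^sub>M torus) (\<lambda>(x, y). ?k x y)"
 proof (rule nbmI[OF m])
  fix p :: "(real ^ 'd) \<times> (real ^ 'd)"
  show "0 \<le> (\<lambda>(x, y). ?k x y) p"
   using avg_const_pos[where 'd = 'd] pos by (auto simp: avg_kernel_def case_prod_beta' intro!: divide_nonneg_nonneg mult_nonneg_nonneg)
  have "avg_const TYPE('d) * (2 ^ l) ^ CARD('d) / (1 + 2 ^ l * rho (fst p - snd p)) ^ (CARD('d) + 1) \<le> avg_const TYPE('d) * (2 ^ l) ^ CARD('d) / 1"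
  proof (rule divide_left_mono)
   show 1: "1 \<le> (1 + 2 ^ l * rho (fst p - snd p)) ^ (CARD('d) + 1)" by (rule one_le_power[OF pos])
   show "0 \<le> avg_const TYPE('d) * (2 ^ l) ^ CARD('d)" using avg_const_pos[where 'd = 'd] by simp
   show "0 < (1 + 2 ^ l * rho (fst p - snd p)) ^ (CARD('d) + 1) * 1" using 1 by linarith
  qed
  then show "(\<lambda>(x, y). ?k x y) p \<le> avg_const TYPE('d) * (2 ^ l) ^ CARD('d)" by (simp add: avg_kernel_def case_prod_beta')
 qed
 have mass: "(\<integral>y. ?k x y \<partial>torus) \<le> 1" if x: "x \<in> space torus" for x
 proof -
  let ?I = "{..l} \<times> (UNIV :: (bool ^ 'd) set)"
  have c: "nbm torus (cell_kernel \<sigma> i x)" for \<sigma> i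
   using torus.kernel_section_nbm[OF _ x] markov_cell_kernel[of \<sigma> i] unfolding markov_kernel_def by blast
  have "(\<integral>y. ?k x y \<partial>torus) \<le> (\<integral>y. (\<Sum>p\<in>?I. grid_weight p * cell_kernel (snd p) (l - fst p) x y) \<partial>torus)"
   by (intro torus.nbm_integral_mono torus.kernel_section_nbm[OF n x] nbm_sum nbm_mult nbm_const c avg_kernel_dominated) (auto simp: grid_weight_def)
  also have "\<dots> = (\<Sum>p\<in>?I. grid_weight p * (\<integral>y. cell_kernel (snd p) (l - fst p) x y \<partial>torus))"
   by (subst Bochner_Integration.integral_sum) (auto intro!: torus.nbm_integrable c)
  also have "\<dots> \<le> (\<Sum>p\<in>?I. grid_weight p * 1)"
  proof (intro sum_mono mult_left_mono)
   fix p show "(\<integral>y. cell_kernel (snd p) (l - fst p) x y \<partial>torus) \<le> 1"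
    using markov_cell_kernel x unfolding markov_kernel_def by blast
  qed (simp add: grid_weight_def)
  also have "\<dots> \<le> 1" using sum_grid_weight[of l, where 'd = 'd] by simp
  finally show ?thesis .
 qed
 have "?k x y = ?k y x" for x y
  using rho_minus[of "x - y"] by (simp add: avg_kernel_def)
 then show ?thesis unfolding markov_kernel_def using n mass by blast
qed

lemma dual_doob_avg_kernel: "torus.dual_doob (avg_kernel :: nat \<Rightarrow> real ^ 'd::finite \<Rightarrow> real ^ 'd \<Rightarrow> real) N"
proof (rule torus.dual_doob_dominated[where I = "{..N} \<times> UNIV" and w = grid_weight and k = "\<lambda>p l. cell_kernel (snd p) (l - fst p)"])
 show "sum grid_weight ({..N} \<times> (UNIV :: (bool ^ 'd) set)) \<le> 1" by (rule sum_grid_weight)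
 show "0 \<le> grid_weight p" for p :: "nat \<times> (bool ^ 'd)" by (simp add: grid_weight_def)
 show "torus.dual_doob (\<lambda>l. cell_kernel (snd p) (l - fst p)) N" for p :: "nat \<times> (bool ^ 'd)"
  by (rule dual_doob_cell_kernel)
qed (auto intro: markov_avg_kernel markov_cell_kernel avg_kernel_dominated)

section \<open>Summation by parts\<close>

definition trig_sum :: "(int ^ 'd::finite \<Rightarrow> complex) \<Rightarrow> real ^ 'd \<Rightarrow> complex" where
 "trig_sum G y = (\<Sum>\<^sub>\<infinity>n. G n * exp_fun n y)"

lemma trig_sum_finite:
 assumes "finite S" "\<And>n. n \<notin> S \<Longrightarrow> G n = 0"
 shows "trig_sum G y = (\<Sum>n\<in>S. G n * exp_fun n y)"
 unfolding trig_sum_def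
 by (rule infsumI, rule has_sum_finite_neutralI[of S]) (use assms in auto)

lemma trig_sum_bound:
 assumes "finite S" "\<And>n. n \<notin> S \<Longrightarrow> G n = 0" "\<And>n. norm (G n) \<le> B"
 shows "norm (trig_sum G y) \<le> real (card S) * B"
proof -
 have "norm (\<Sum>n\<in>S. G n * exp_fun n y) \<le> (\<Sum>n\<in>S. B)"
  by (rule sum_norm_le) (simp add: norm_mult assms(3))
 then show ?thesis by (simp add: trig_sum_finite[OF assms(1,2)])
qed

lemma trig_sum_forward_diff:
 assumes S: "finite S" "\<And>n. n \<notin> S \<Longrightarrow> G n = 0"
 shows "trig_sum (forward_diff i G) y = (cis (- (y $ i)) - 1) * trig_sum G y"
proof -
 let ?e = "axis i 1 :: int ^ 'a"
 let ?S = "S \<union> (\<lambda>n. n - ?e) ` S"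
 have fin: "finite ?S" using S by simp
 have z: "G (n + ?e) = 0" if "n \<notin> (\<lambda>n. n - ?e) ` S" for n
 proof (rule S(2))
  show "n + ?e \<notin> S"
  proof
   assume "n + ?e \<in> S"
   then have "(n + ?e) - ?e \<in> (\<lambda>n. n - ?e) ` S" by (rule imageI)
   then show False using that by simp
  qed
 qed
 have "trig_sum (forward_diff i G) y = (\<Sum>n\<in>?S. forward_diff i G n * exp_fun n y)"
  by (rule trig_sum_finite[OF fin]) (use S(2) z in \<open>auto simp: forward_diff_def\<close>)
 also have "\<dots> = (\<Sum>n\<in>?S. G (n + ?e) * exp_fun n y) - (\<Sum>n\<in>?S. G n * exp_fun n y)"
  by (simp add: forward_diff_def algebra_simps sum_subtractf)
 also have "(\<Sum>n\<in>?S. G n * exp_fun n y) = trig_sum G y"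
  by (rule trig_sum_finite[OF fin, symmetric]) (use S(2) in auto)
 also have "(\<Sum>n\<in>?S. G (n + ?e) * exp_fun n y) = (\<Sum>n\<in>(\<lambda>n. n - ?e) ` S. G (n + ?e) * exp_fun n y)"
  by (rule sum.mono_neutral_right[OF fin]) (use z in auto)
 also have "\<dots> = (\<Sum>n\<in>S. G n * exp_fun (n - ?e) y)"
  by (subst sum.reindex) (auto simp: inj_on_def)
 also have "\<dots> = (\<Sum>n\<in>S. cis (- (y $ i)) * (G n * exp_fun n y))"
 proof (rule sum.cong[OF refl])
  fix n
  have "exp_fun (n - ?e) y = exp_fun n y * cis (- (y $ i))"
   using exp_fun_add_freq[of n "- ?e" y] by (simp add: exp_fun_axis_freq)
  then show "G n * exp_fun (n - ?e) y = cis (- (y $ i)) * (G n * exp_fun n y)" by (simp add: mult_ac)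
 qed
 also have "\<dots> = cis (- (y $ i)) * trig_sum G y"
  by (simp add: trig_sum_finite[OF S] sum_distrib_left)
 finally show ?thesis by (simp add: algebra_simps)
qed

text \<open>Differences in one direction only see the values along a line, so that the product rule can be proved
 for sequences.\<close>

definition seq_diff :: "(nat \<Rightarrow> complex) \<Rightarrow> nat \<Rightarrow> complex" where
 "seq_diff u s = u (Suc s) - u s"

definition line :: "'d::finite \<Rightarrow> (int ^ 'd \<Rightarrow> complex) \<Rightarrow> int ^ 'd \<Rightarrow> nat \<Rightarrow> complex" where
 "line i G n s = G (n + axis i (int s))"

lemma axis_Suc: "n + axis i (int (Suc s)) = (n + axis i (int s)) + axis i 1"
 by (simp add: vec_eq_iff axis_def)

lemma line_forward_diff: "line i ((forward_diff i ^^ \<beta>) G) n = (seq_diff ^^ \<beta>) (line i G n)"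
proof (induction \<beta>)
 case (Suc \<beta>)
 have "line i (forward_diff i H) n s = seq_diff (line i H n) s" for H s
  unfolding line_def seq_diff_def forward_diff_def axis_Suc ..
 then have "line i (forward_diff i H) n = seq_diff (line i H n)" for H by (rule ext)
 then show ?case by (simp add: Suc)
qed (simp add: line_def)

lemma forward_diff_eq_seq_diff: "(forward_diff i ^^ \<beta>) G n = (seq_diff ^^ \<beta>) (line i G n) 0"
 using arg_cong[OF line_forward_diff[of i \<beta> G n], of "\<lambda>f. f 0"] by (simp add: line_def)

lemma seq_diff_Suc: "(seq_diff ^^ Suc \<beta>) u s = (seq_diff ^^ \<beta>) u (Suc s) - (seq_diff ^^ \<beta>) u s"
 by (simp only: funpow.simps comp_apply seq_diff_def[of "(seq_diff ^^ \<beta>) u"])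

lemma seq_diff_zero:
 "(\<And>s'. s \<le> s' \<Longrightarrow> s' \<le> s + \<beta> \<Longrightarrow> u s' = 0) \<Longrightarrow> (seq_diff ^^ \<beta>) u s = 0"
proof (induction \<beta> arbitrary: s)
 case (Suc \<beta>)
 have "(seq_diff ^^ \<beta>) u s = 0" by (rule Suc(1)) (use Suc(2) in auto)
 moreover have "(seq_diff ^^ \<beta>) u (Suc s) = 0" by (rule Suc(1)) (use Suc(2) in auto)
 ultimately show ?case by (simp add: seq_diff_Suc del: funpow.simps)
qed simp

lemma seq_diff_add: "(seq_diff ^^ \<beta>) (\<lambda>s. u s + v s) = (\<lambda>s. (seq_diff ^^ \<beta>) u s + (seq_diff ^^ \<beta>) v s)"
proof (induction \<beta>)
 case (Suc \<beta>)
 then show ?case by (simp add: seq_diff_Suc fun_eq_iff del: funpow.simps)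
qed simp

lemma seq_diff_shift: "(seq_diff ^^ \<beta>) (\<lambda>s. u (Suc s)) s = (seq_diff ^^ \<beta>) u (Suc s)"
proof (induction \<beta> arbitrary: s)
 case (Suc \<beta>)
 then show ?case by (simp add: seq_diff_Suc del: funpow.simps)
qed simp

text \<open>Only the values at \<open>0, \<dots>, K\<close> enter, because a difference of order \<open>\<beta>\<close> at \<open>s\<close> looks ahead by \<open>\<beta>\<close>.\<close>

definition diff_bound :: "nat \<Rightarrow> real \<Rightarrow> real \<Rightarrow> (nat \<Rightarrow> complex) \<Rightarrow> bool" where
 "diff_bound K A R u \<longleftrightarrow> (\<forall>\<beta> s. \<beta> + s \<le> K \<longrightarrow> norm ((seq_diff ^^ \<beta>) u s) \<le> A * R ^ \<beta>)"

lemma diff_bound_seq_diff: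
 assumes "diff_bound (Suc K) A R u" shows "diff_bound K (A * R) R (seq_diff u)"
 unfolding diff_bound_def
proof (intro allI impI)
 fix \<beta> s assume "\<beta> + s \<le> K"
 then have "norm ((seq_diff ^^ Suc \<beta>) u s) \<le> A * R ^ Suc \<beta>"
  using assms unfolding diff_bound_def by (metis add_Suc Suc_le_mono)
 then show "norm ((seq_diff ^^ \<beta>) (seq_diff u) s) \<le> A * R * R ^ \<beta>"
  by (simp add: funpow_Suc_right mult.assoc del: funpow.simps)
qed

lemma diff_bound_shift:
 assumes "diff_bound (Suc K) A R u" shows "diff_bound K A R (\<lambda>s. u (Suc s))"
 using assms unfolding diff_bound_def seq_diff_shift by auto

lemma diff_bound_Suc: "diff_bound (Suc K) A R u \<Longrightarrow> diff_bound K A R u"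
 unfolding diff_bound_def by auto

text \<open>Each application of the product rule yields two terms, which doubles \<open>R\<close>.\<close>

lemma seq_diff_mult_bound:
 assumes "diff_bound K A R u" "diff_bound K B R v" "A \<ge> 0" "B \<ge> 0" "R \<ge> 0" "\<beta> + s \<le> K"
 shows "norm ((seq_diff ^^ \<beta>) (\<lambda>s. u s * v s) s) \<le> A * B * (2 * R) ^ \<beta>"
 using assms
proof (induction \<beta> arbitrary: u v A B K)
 case 0
 then have "norm (u s) \<le> A" "norm (v s) \<le> B" unfolding diff_bound_def by (metis funpow_0 power_0 mult_1_right add_0)+
 then show ?case using 0 by (simp add: norm_mult mult_mono)
next
 case (Suc \<beta>)
 obtain K' where K: "K = Suc K'" using Suc.prems(6) by (cases K) auto
 have "seq_diff (\<lambda>s. u s * v s) = (\<lambda>s. seq_diff u s * v (Suc s) + u s * seq_diff v s)"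
  by (simp add: seq_diff_def fun_eq_iff algebra_simps)
 then have "(seq_diff ^^ Suc \<beta>) (\<lambda>s. u s * v s) s =
   (seq_diff ^^ \<beta>) (\<lambda>s. seq_diff u s * v (Suc s)) s + (seq_diff ^^ \<beta>) (\<lambda>s. u s * seq_diff v s) s"
  by (simp add: funpow_Suc_right seq_diff_add del: funpow.simps)
 also have "norm \<dots> \<le> (A * R) * B * (2 * R) ^ \<beta> + A * (B * R) * (2 * R) ^ \<beta>"
 proof (rule order_trans[OF norm_triangle_ineq add_mono])
  show "norm ((seq_diff ^^ \<beta>) (\<lambda>s. seq_diff u s * v (Suc s)) s) \<le> (A * R) * B * (2 * R) ^ \<beta>"
   using Suc.prems unfolding K
   by (intro Suc.IH[where K = K'] diff_bound_seq_diff diff_bound_shift) auto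
  show "norm ((seq_diff ^^ \<beta>) (\<lambda>s. u s * seq_diff v s) s) \<le> A * (B * R) * (2 * R) ^ \<beta>"
   using Suc.prems unfolding K
   by (intro Suc.IH[where K = K'] diff_bound_seq_diff diff_bound_Suc[of K']) auto
 qed
 also have "\<dots> = A * B * (2 * R) ^ Suc \<beta>" by (simp add: algebra_simps)
 finally show ?case .
qed

lemma diff_bound_mult:
 "diff_bound K A R u \<Longrightarrow> diff_bound K B R v \<Longrightarrow> A \<ge> 0 \<Longrightarrow> B \<ge> 0 \<Longrightarrow> R \<ge> 0 \<Longrightarrow> diff_bound K (A * B) (2 * R) (\<lambda>s. u s * v s)"
 using seq_diff_mult_bound unfolding diff_bound_def by blast

lemma diff_bound_mono:
 assumes "diff_bound K A R u" "A \<le> B" "0 \<le> R" "R \<le> S" "0 \<le> A"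
 shows "diff_bound K B S u"
 unfolding diff_bound_def
proof (intro allI impI)
 fix \<beta> s assume "\<beta> + s \<le> K"
 then have "norm ((seq_diff ^^ \<beta>) u s) \<le> A * R ^ \<beta>" using assms(1) by (simp add: diff_bound_def)
 also have "\<dots> \<le> B * S ^ \<beta>" using assms by (intro mult_mono power_mono) auto
 finally show "norm ((seq_diff ^^ \<beta>) u s) \<le> B * S ^ \<beta>" .
qed

lemma power_1_plus_sum_le:
 fixes u :: "'d::finite \<Rightarrow> real"
 assumes "\<And>j. 0 \<le> u j"
 shows "(1 + (\<Sum>j\<in>UNIV. u j)) ^ M \<le> (real CARD('d) + 1) ^ M * (1 + (\<Sum>j\<in>UNIV. u j ^ M))"
proof -
 define t where "t = Max (insert 1 (range u))"
 have t: "1 \<le> t" "u j \<le> t" for j unfolding t_def by (rule Max_ge; simp)+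
 have "1 + (\<Sum>j\<in>UNIV. u j) \<le> t + (\<Sum>j\<in>(UNIV :: 'd set). t)" by (intro add_mono sum_mono t)
 then have "1 + (\<Sum>j\<in>UNIV. u j) \<le> (real CARD('d) + 1) * t" by (simp add: algebra_simps)
 then have "(1 + (\<Sum>j\<in>UNIV. u j)) ^ M \<le> ((real CARD('d) + 1) * t) ^ M"
  using sum_nonneg[of UNIV u] assms by (intro power_mono) auto
 also have "\<dots> = (real CARD('d) + 1) ^ M * t ^ M" by (simp add: power_mult_distrib)
 also have "t ^ M \<le> 1 + (\<Sum>j\<in>UNIV. u j ^ M)"
 proof -
  have "t \<in> insert 1 (range u)" unfolding t_def by (rule Max_in) auto
  then consider "t = 1" | j where "t = u j" by auto
  then show ?thesis
  proof cases
   case 1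
   then show ?thesis using assms by (simp add: sum_nonneg)
  next
   case 2
   then have "t ^ M \<le> (\<Sum>j\<in>UNIV. u j ^ M)"
    using member_le_sum[of j UNIV "\<lambda>j. u j ^ M"] assms by simp
   then show ?thesis by simp
  qed
 qed
 finally show ?thesis by (simp add: mult_left_mono)
qed

lemma funpow_forward_diff_support:
 assumes S: "\<And>n. norm (real_vec n) > R \<Longrightarrow> G n = 0" and n: "norm (real_vec n) > R + real \<beta>"
 shows "(forward_diff i ^^ \<beta>) G n = 0"
 unfolding forward_diff_eq_seq_diff
proof (rule seq_diff_zero)
 fix s :: nat assume "s \<le> 0 + \<beta>"
 have "norm (real_vec (axis i (int s))) = real s"
 proof -
  have "real_vec (axis i (int s)) = axis i (real s)" by (simp add: vec_eq_iff axis_def)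
  then show ?thesis by (simp add: norm_eq_sqrt_inner inner_axis)
 qed
 then have "norm (real_vec n) \<le> norm (real_vec (n + axis i (int s))) + real s"
  using norm_triangle_ineq4[of "real_vec (n + axis i (int s))" "real_vec (axis i (int s))"] by simp
 then have "norm (real_vec (n + axis i (int s))) > R" using n \<open>s \<le> 0 + \<beta>\<close> by simp
 then show "line i G n s = 0" unfolding line_def by (rule S)
qed

text \<open>Summation by parts \<open>K\<close> times in each coordinate: a multiplier that is smooth at scale \<open>2\<^sup>l\<close> has a kernel
 that decays at scale \<open>2\<^sup>-\<^sup>l\<close>. The factor \<open>N * (2 ^ l) ^ CARD('d)\<close> counts the lattice points in the support.\<close>

lemma trig_sum_decay:
 fixes G :: "int ^ 'd::finite \<Rightarrow> complex"
 assumes S: "\<And>n. norm (real_vec n) > R \<Longrightarrow> G n = 0" and R: "R \<ge> 0"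
  and B: "\<And>n. norm (G n) \<le> B" "\<And>n i. norm ((forward_diff i ^^ K) G n) \<le> B / (2 ^ l) ^ K"
  and N: "(2 * (R + real K) + 1) ^ CARD('d) \<le> N * (2 ^ l) ^ CARD('d)"
 shows "norm (trig_sum G y) \<le> (real CARD('d) + 1) ^ (K + 1) * N * B * ((2 ^ l) ^ CARD('d) / (1 + 2 ^ l * rho y) ^ K)"
proof -
 let ?L = "(2::real) ^ l"
 define S' where "S' = {n :: int ^ 'd. norm (real_vec n) \<le> R + real K}"
 have fin: "finite S'" unfolding S'_def by (rule finite_lattice_ball)
 have card: "real (card S') \<le> N * ?L ^ CARD('d)"
  using card_lattice_ball[of "R + real K", where 'd = 'd] N R unfolding S'_def by linarith
 have B0: "B \<ge> 0" using B(1)[of 0] norm_ge_zero order_trans by blast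
 have N0: "0 \<le> N * ?L ^ CARD('d)" using card of_nat_0_le_iff order_trans by blast
 have a: "norm (trig_sum G y) \<le> N * ?L ^ CARD('d) * B"
 proof -
  have "norm (trig_sum G y) \<le> real (card S') * B"
   by (rule trig_sum_bound[OF fin _ B(1)]) (use S in \<open>auto simp: S'_def not_le intro!: S\<close>)
  also have "\<dots> \<le> N * ?L ^ CARD('d) * B" using card B0 by (intro mult_right_mono)
  finally show ?thesis .
 qed
 have b: "norm (cis (y $ i) - 1) ^ K * norm (trig_sum G y) \<le> N * ?L ^ CARD('d) * (B / ?L ^ K)" for i
 proof -
  have ts: "trig_sum ((forward_diff i ^^ \<beta>) G) y = (cis (- (y $ i)) - 1) ^ \<beta> * trig_sum G y" for \<beta>
  proof (induction \<beta>)
   case (Suc \<beta>)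
   have "trig_sum (forward_diff i ((forward_diff i ^^ \<beta>) G)) y = (cis (- (y $ i)) - 1) * trig_sum ((forward_diff i ^^ \<beta>) G) y"
    by (rule trig_sum_forward_diff[OF finite_lattice_ball[of "R + real \<beta>"]])
      (use funpow_forward_diff_support[OF S] in \<open>auto simp: not_le\<close>)
   then show ?case by (simp add: Suc mult.assoc)
  qed simp
  have "norm (trig_sum ((forward_diff i ^^ K) G) y) \<le> real (card S') * (B / ?L ^ K)"
   by (rule trig_sum_bound[OF fin _ B(2)]) (use funpow_forward_diff_support[OF S] in \<open>auto simp: S'_def not_le\<close>)
  also have "\<dots> \<le> N * ?L ^ CARD('d) * (B / ?L ^ K)" using card B0 by (intro mult_right_mono) auto
  finally have "norm ((cis (- (y $ i)) - 1) ^ K * trig_sum G y) \<le> N * ?L ^ CARD('d) * (B / ?L ^ K)" by (simp only: ts)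
  moreover have "norm (cis (- (y $ i)) - 1) = norm (cis (y $ i) - 1)"
  proof -
   have "cis (- (y $ i)) - 1 = cnj (cis (y $ i) - 1)" by (simp add: cis_cnj)
   then show ?thesis by (simp only: complex_mod_cnj)
  qed
  ultimately show ?thesis by (simp add: norm_mult norm_power)
 qed
 have b': "(?L * norm (cis (y $ i) - 1)) ^ K * norm (trig_sum G y) \<le> N * ?L ^ CARD('d) * B" for i
 proof -
  have "(?L * norm (cis (y $ i) - 1)) ^ K * norm (trig_sum G y) = ?L ^ K * (norm (cis (y $ i) - 1) ^ K * norm (trig_sum G y))"
   by (simp add: power_mult_distrib)
  also have "\<dots> \<le> ?L ^ K * (N * ?L ^ CARD('d) * (B / ?L ^ K))" by (intro mult_left_mono b) auto
  finally show ?thesis by simp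
 qed
 let ?t = "norm (trig_sum G y)"
 have "(1 + ?L * rho y) ^ K * ?t \<le> ((real CARD('d) + 1) ^ K * (1 + (\<Sum>i\<in>UNIV. (?L * norm (cis (y $ i) - 1)) ^ K))) * ?t"
  unfolding rho_def sum_distrib_left by (intro mult_right_mono power_1_plus_sum_le) auto
 also have "\<dots> = (real CARD('d) + 1) ^ K * (?t + (\<Sum>i\<in>UNIV. (?L * norm (cis (y $ i) - 1)) ^ K * ?t))"
  by (simp only: mult.assoc distrib_right mult_1 sum_distrib_right)
 also have "\<dots> \<le> (real CARD('d) + 1) ^ K * (N * ?L ^ CARD('d) * B + (\<Sum>i\<in>(UNIV::'d set). N * ?L ^ CARD('d) * B))"
  by (intro mult_left_mono add_mono sum_mono a b') auto
 also have "\<dots> = (real CARD('d) + 1) ^ (K + 1) * N * B * ?L ^ CARD('d)" by (simp add: algebra_simps)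
 finally have main: "(1 + ?L * rho y) ^ K * ?t \<le> (real CARD('d) + 1) ^ (K + 1) * N * B * ?L ^ CARD('d)" .
 have "1 + ?L * rho y > 0" by (simp add: add_pos_nonneg)
 then have "(1 + ?L * rho y) ^ K > 0" by simp
 then have "?t \<le> (real CARD('d) + 1) ^ (K + 1) * N * B * ?L ^ CARD('d) / (1 + ?L * rho y) ^ K"
  using main by (simp only: pos_le_divide_eq mult.commute)
 then show ?thesis by simp
qed

definition direction_smooth :: "'d::finite \<Rightarrow> (real ^ 'd \<Rightarrow> complex) \<Rightarrow> bool" where
 "direction_smooth i f \<longleftrightarrow> (\<forall>\<beta> x. (partial_deriv i ^^ \<beta>) f differentiable (at x))"

definition real_diff :: "'d::finite \<Rightarrow> (real ^ 'd \<Rightarrow> complex) \<Rightarrow> real ^ 'd \<Rightarrow> complex" where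
 "real_diff i f x = f (x + axis i 1) - f x"

lemma smooth_direction_smooth: "smooth f \<Longrightarrow> direction_smooth i f"
 by (simp add: direction_smooth_def smooth_funpow_partial smooth_differentiable)

lemma differentiable_shift: "f differentiable (at (x + v)) \<Longrightarrow> (\<lambda>x. f (x + v)) differentiable (at x)"
 using has_derivative_shift unfolding differentiable_def by blast

lemma partial_deriv_real_diff:
 assumes "\<And>x. f differentiable (at x)"
 shows "partial_deriv i (real_diff i f) = real_diff i (partial_deriv i f)"
proof
 fix x
 let ?v = "axis i 1 :: real ^ 'a"
 have "((\<lambda>x. f (x + ?v) - f x) has_derivative
   (\<lambda>h. frechet_derivative (\<lambda>x. f (x + ?v)) (at x) h - frechet_derivative f (at x) h)) (at x)"
  by (intro has_derivative_diff) (auto simp: frechet_derivative_works[symmetric] assms differentiable_shift)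
 from partial_deriv_eq[OF this, of i] show "partial_deriv i (real_diff i f) x = real_diff i (partial_deriv i f) x"
  using partial_deriv_shift[OF assms, of i ?v x] by (simp add: real_diff_def[abs_def] partial_deriv_def)
qed

lemma funpow_partial_real_diff:
 assumes "direction_smooth i f"
 shows "(partial_deriv i ^^ \<beta>) (real_diff i f) = real_diff i ((partial_deriv i ^^ \<beta>) f)"
proof (induction \<beta>)
 case (Suc \<beta>)
 have "partial_deriv i (real_diff i ((partial_deriv i ^^ \<beta>) f)) = real_diff i (partial_deriv i ((partial_deriv i ^^ \<beta>) f))"
  by (rule partial_deriv_real_diff) (use assms in \<open>simp add: direction_smooth_def\<close>)
 then show ?case by (simp add: Suc)
qed simp

lemma direction_smooth_real_diff:
 assumes "direction_smooth i f" shows "direction_smooth i (real_diff i f)"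
proof -
 have "real_diff i g differentiable (at x)" if "\<And>x. g differentiable (at x)" for g :: "real ^ 'a \<Rightarrow> complex" and x
  unfolding real_diff_def[abs_def] by (intro differentiable_diff differentiable_shift that)
 then show ?thesis
  using assms by (simp add: direction_smooth_def funpow_partial_real_diff[OF assms])
qed

text \<open>The mean value inequality, applied once for each difference.\<close>

lemma funpow_real_diff_bound:
 assumes "direction_smooth i f" "\<And>x. norm ((partial_deriv i ^^ \<beta>) f x) \<le> B"
 shows "norm ((real_diff i ^^ \<beta>) f x) \<le> B"
 using assms
proof (induction \<beta> arbitrary: f)
 case (Suc \<beta>)
 have "norm ((partial_deriv i ^^ \<beta>) (real_diff i f) x) \<le> B" for x
 proof -
  have "norm ((partial_deriv i ^^ \<beta>) f (x + axis i 1) - (partial_deriv i ^^ \<beta>) f x) \<le> B * \<bar>1\<bar>"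
   by (rule partial_deriv_lipschitz) (use Suc.prems in \<open>auto simp: direction_smooth_def\<close>)
  then show ?thesis unfolding funpow_partial_real_diff[OF Suc.prems(1)] by (simp add: real_diff_def)
 qed
 then have "norm ((real_diff i ^^ \<beta>) (real_diff i f) x) \<le> B"
  by (rule Suc.IH[OF direction_smooth_real_diff[OF Suc.prems(1)]])
 then show ?case by (simp add: funpow_Suc_right del: funpow.simps)
qed simp

lemma funpow_forward_diff_real:
 "(forward_diff i ^^ \<beta>) (\<lambda>n. f (real_vec n)) n = (real_diff i ^^ \<beta>) f (real_vec n)"
proof (induction \<beta> arbitrary: n)
 case (Suc \<beta>)
 then show ?case by (simp add: forward_diff_def real_diff_def)
qed simp

lemma partial_deriv_scale:
 assumes "\<And>x. f differentiable (at x)"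
 shows "partial_deriv i (\<lambda>x. c * f (t *\<^sub>R x)) = (\<lambda>x. (c * of_real t) * partial_deriv i f (t *\<^sub>R x))"
  and "(\<lambda>x. c * f (t *\<^sub>R x)) differentiable (at x)"
proof -
 have D: "((\<lambda>x. c * f (t *\<^sub>R x)) has_derivative (\<lambda>h. c * frechet_derivative f (at (t *\<^sub>R x)) (t *\<^sub>R h))) (at x)" for x
 proof -
  have "((\<lambda>x. t *\<^sub>R x) has_derivative (\<lambda>h. t *\<^sub>R h)) (at x)" by (auto intro!: derivative_eq_intros)
  from has_derivative_compose[OF this, of f "frechet_derivative f (at (t *\<^sub>R x))"] assms
  show ?thesis by (intro has_derivative_mult_right) (auto simp: frechet_derivative_works[symmetric])
 qed
 then show "(\<lambda>x. c * f (t *\<^sub>R x)) differentiable (at x)" unfolding differentiable_def by blast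
 show "partial_deriv i (\<lambda>x. c * f (t *\<^sub>R x)) = (\<lambda>x. (c * of_real t) * partial_deriv i f (t *\<^sub>R x))"
 proof
  fix x
  have "linear (frechet_derivative f (at (t *\<^sub>R x)))"
   using assms has_derivative_linear frechet_derivative_works by blast
  then have lin: "frechet_derivative f (at (t *\<^sub>R x)) (t *\<^sub>R axis i 1) = t *\<^sub>R frechet_derivative f (at (t *\<^sub>R x)) (axis i 1)"
   by (rule linear_cmul)
  show "partial_deriv i (\<lambda>x. c * f (t *\<^sub>R x)) x = (c * of_real t) * partial_deriv i f (t *\<^sub>R x)"
   unfolding partial_deriv_eq[OF D] lin partial_deriv_def by (simp only: scaleR_conv_of_real mult.assoc)
 qed
qed

lemma funpow_partial_scale:
 assumes "direction_smooth i f"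
 shows "(partial_deriv i ^^ \<beta>) (\<lambda>x. f (t *\<^sub>R x)) = (\<lambda>x. of_real (t ^ \<beta>) * (partial_deriv i ^^ \<beta>) f (t *\<^sub>R x))"
proof (induction \<beta>)
 case (Suc \<beta>)
 have "partial_deriv i (\<lambda>x. of_real (t ^ \<beta>) * (partial_deriv i ^^ \<beta>) f (t *\<^sub>R x)) =
   (\<lambda>x. (of_real (t ^ \<beta>) * of_real t) * partial_deriv i ((partial_deriv i ^^ \<beta>) f) (t *\<^sub>R x))"
  by (rule partial_deriv_scale(1)) (use assms in \<open>simp add: direction_smooth_def\<close>)
 then show ?case by (simp add: Suc mult.commute)
qed simp

lemma partial_deriv_zero_outside:
 assumes "\<And>x. norm x > r \<Longrightarrow> f x = 0" "norm x > r"
 shows "partial_deriv i f x = 0"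
proof -
 have o: "open {x :: real ^ 'a. norm x > r}" by (intro open_Collect_less continuous_intros)
 have "(f has_derivative (\<lambda>h. 0)) (at x)"
  by (rule has_derivative_transform_within_open[OF has_derivative_const o]) (use assms in auto)
 from partial_deriv_eq[OF this] show ?thesis .
qed

lemma compact_support_partial_bounded:
 assumes "smooth f" "\<And>x. norm x > r \<Longrightarrow> f x = 0"
 shows "\<exists>B\<ge>0. \<forall>x. norm ((partial_deriv i ^^ \<beta>) f x) \<le> B"
proof -
 let ?g = "(partial_deriv i ^^ \<beta>) f"
 have z: "(partial_deriv i ^^ \<beta>) f x = 0" if "norm x > r" for x and \<beta>
  using that by (induction \<beta> arbitrary: x) (auto intro: assms(2) partial_deriv_zero_outside)
 have "compact (?g ` cball 0 r)"
  by (intro compact_continuous_image smooth_continuous smooth_funpow_partial assms) simp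
 from compact_imp_bounded[OF this]
 obtain B where B: "B > 0" "\<And>x. x \<in> cball 0 r \<Longrightarrow> norm (?g x) \<le> B"
  by (auto simp: bounded_pos)
 have "norm (?g x) \<le> B" for x
  using B z[of x \<beta>] by (cases "norm x \<le> r") auto
 then show ?thesis using B(1) less_imp_le by blast
qed

section \<open>Weighted averages and Fourier multipliers\<close>

definition scale_dist :: "nat \<Rightarrow> nat \<Rightarrow> nat" where
 "scale_dist j k = (j - k) + (k - j)"

lemma scale_dist_le: "(2::real) ^ j \<le> 2 ^ k * 2 ^ scale_dist j k" "(2::real) ^ k \<le> 2 ^ j * 2 ^ scale_dist j k"
 unfolding power_add[symmetric] by (rule power_increasing; simp add: scale_dist_def)+

lemma scale_dist_triangle: "scale_dist j l \<le> scale_dist j k + scale_dist k l"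
 by (auto simp: scale_dist_def)

lemma powr_comparable:
 assumes "2 ^ k / c \<le> t" "t \<le> c * 2 ^ k" "1 \<le> c" "\<bar>e\<bar> \<le> E"
 shows "t powr e \<le> c powr E * 2 powr (real k * e)"
proof -
 have "0 < 2 ^ k / c" using assms(3) by simp
 then have t: "t > 0" using assms(1) by linarith
 have "t powr e \<le> c powr \<bar>e\<bar> * (2 ^ k) powr e"
 proof (cases "0 \<le> e")
  case True
  have "t powr e \<le> (c * 2 ^ k) powr e" using True t assms by (intro powr_mono2) auto
  then show ?thesis using True by (simp add: powr_mult)
 next
  case False
  have "t powr e \<le> (2 ^ k / c) powr e" using False assms by (intro powr_mono2') auto
  also have "\<dots> = c powr \<bar>e\<bar> * (2 ^ k) powr e" using False assms by (simp add: powr_divide powr_minus_divide)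
  finally show ?thesis .
 qed
 also have "(2 ^ k :: real) powr e = 2 powr (real k * e)" by (simp add: powr_powr[symmetric] powr_realpow)
 also have "c powr \<bar>e\<bar> * 2 powr (real k * e) \<le> c powr E * 2 powr (real k * e)"
  using assms by (intro mult_right_mono powr_mono) auto
 finally show ?thesis .
qed

lemma real_vec_axis_int: "real_vec (axis i t) = axis i (real_of_int t)"
 by (simp add: vec_eq_iff axis_def)

lemma norm_axis_real: "norm (axis i t :: real ^ 'd::finite) = \<bar>t\<bar>"
 by (simp add: norm_eq_sqrt_inner inner_axis)

lemma ball_count: "(2 * (2 * 2 ^ k + real K) + 1) ^ d \<le> (5 + 2 * real K) ^ d * (2 ^ k) ^ d"
proof -
 define t where "t = (2::real) ^ k"
 have t: "1 \<le> t" by (simp add: t_def)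
 have "real K * 1 \<le> real K * t" using t by (intro mult_left_mono) auto
 then have "2 * (2 * t + real K) + 1 \<le> (5 + 2 * real K) * t" using t by (simp add: algebra_simps)
 then have "(2 * (2 * t + real K) + 1) ^ d \<le> ((5 + 2 * real K) * t) ^ d" using t by (intro power_mono) auto
 then show ?thesis unfolding t_def[symmetric] by (simp only: power_mult_distrib)
qed

lemma torus_integral_torus: "torus_integral f = (\<integral>z. f z \<partial>torus)"
 unfolding torus_integral_def torus_def set_lebesgue_integral_def
 by (rule integral_restrict_space[symmetric]) simp

lemma trig_sum_continuous:
 assumes "finite S" "\<And>n. n \<notin> S \<Longrightarrow> G n = 0"
 shows "continuous_on A (trig_sum G)"
proof -
 have "trig_sum G = (\<lambda>y. \<Sum>n\<in>S. G n * exp_fun n y)" by (rule ext) (rule trig_sum_finite[OF assms])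
 then show ?thesis by (simp only:) (intro continuous_intros continuous_exp_fun)
qed

lemma multiplier_eq_convolution:
 fixes H G :: "int ^ 'd::finite \<Rightarrow> complex"
 assumes S: "finite S" "\<And>n. n \<notin> S \<Longrightarrow> H n = 0" "\<And>n. n \<notin> S \<Longrightarrow> G n = 0"
 shows "trig_sum (\<lambda>n. H n * G n) x = torus_integral (\<lambda>z. trig_sum H z * trig_sum G (x - z)) / (2 * pi) ^ CARD('d)"
proof -
 have e: "trig_sum H z * trig_sum G (x - z) = (\<Sum>n\<in>S. \<Sum>k\<in>S. (H n * G k * exp_fun k x) * exp_fun (n - k) z)" for z
 proof -
  have "trig_sum H z * trig_sum G (x - z) = (\<Sum>n\<in>S. \<Sum>k\<in>S. (H n * exp_fun n z) * (G k * exp_fun k (x - z)))"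
   by (simp add: trig_sum_finite[OF S(1,2)] trig_sum_finite[OF S(1,3)] sum_product)
  also have "\<dots> = (\<Sum>n\<in>S. \<Sum>k\<in>S. (H n * G k * exp_fun k x) * exp_fun (n - k) z)"
  proof (intro sum.cong refl)
   fix n k
   have "exp_fun (n - k) z = exp_fun n z * exp_fun k (- z)"
    using exp_fun_add_freq[of n "- k" z] by (simp add: exp_fun_minus)
   moreover have "exp_fun k (x - z) = exp_fun k x * exp_fun k (- z)"
    using exp_fun_add[of k x "- z"] by simp
   ultimately show "(H n * exp_fun n z) * (G k * exp_fun k (x - z)) = (H n * G k * exp_fun k x) * exp_fun (n - k) z"
    by (simp add: mult_ac)
  qed
  finally show ?thesis .
 qed
 have "torus_integral (\<lambda>z. trig_sum H z * trig_sum G (x - z)) =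
   (\<Sum>n\<in>S. \<Sum>k\<in>S. (H n * G k * exp_fun k x) * torus_integral (exp_fun (n - k)))"
  unfolding e by (subst torus_integral_sum, (intro continuous_intros continuous_exp_fun)[1],
   subst torus_integral_sum, (intro continuous_intros continuous_exp_fun)[1], simp add: torus_integral_cmult)
 also have "\<dots> = (\<Sum>n\<in>S. H n * G n * exp_fun n x * (2 * pi) ^ CARD('d))"
 proof (rule sum.cong[OF refl])
  fix n assume n: "n \<in> S"
  have "(\<Sum>k\<in>S. (H n * G k * exp_fun k x) * torus_integral (exp_fun (n - k) :: real ^ 'd \<Rightarrow> complex)) =
    (\<Sum>k\<in>S. if k = n then H n * G n * exp_fun n x * (2 * pi) ^ CARD('d) else 0)"
   by (intro sum.cong refl) (auto simp: torus_integral_exp_fun)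
  also have "\<dots> = H n * G n * exp_fun n x * (2 * pi) ^ CARD('d)" using n S(1) by simp
  finally show "(\<Sum>k\<in>S. (H n * G k * exp_fun k x) * torus_integral (exp_fun (n - k) :: real ^ 'd \<Rightarrow> complex)) = H n * G n * exp_fun n x * (2 * pi) ^ CARD('d)" .
 qed
 also have "\<dots> = trig_sum (\<lambda>n. H n * G n) x * (2 * pi) ^ CARD('d)"
  by (subst trig_sum_finite[OF S(1)]) (auto simp: S(2) sum_distrib_right)
 finally show ?thesis by simp
qed

lemma nbm_torus_continuous:
 fixes g :: "real ^ 'd::finite \<Rightarrow> real"
 assumes "continuous_on UNIV g" "\<And>x. 0 \<le> g x"
 shows "nbm torus g"
proof -
 have "compact (g ` torus_box)"
  by (rule compact_continuous_image) (use assms(1) continuous_on_subset in auto)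
 from compact_imp_bounded[OF this] obtain B where "\<And>x. x \<in> torus_box \<Longrightarrow> norm (g x) \<le> B" by (auto simp: bounded_pos)
 then show ?thesis
  using assms by (intro nbmI[of _ _ B] measurable_torus borel_measurable_continuous_onI) (auto simp: abs_le_iff)
qed

text \<open>The average of \<open>g\<close> at scale \<open>2\<^sup>-\<^sup>l\<close>, with weights that decay of order \<open>K\<close>.\<close>

definition wavg :: "nat \<Rightarrow> nat \<Rightarrow> (real ^ 'd::finite \<Rightarrow> real) \<Rightarrow> real ^ 'd \<Rightarrow> real" where
 "wavg K l g x = (2 ^ l) ^ CARD('d) * (\<integral>z. g z / (1 + 2 ^ l * rho (x - z)) ^ K \<partial>torus)"

lemma rho_weight_ge_1: "1 \<le> 1 + 2 ^ l * rho y" by simp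

lemma rho_weight_pos: "0 < 1 + 2 ^ l * rho y" by (simp add: add_pos_nonneg)

lemma continuous_rho_weight:
 "continuous_on A f \<Longrightarrow> continuous_on A (\<lambda>z. g z) \<Longrightarrow> continuous_on A (\<lambda>z. g z / (1 + 2 ^ l * rho (f z)) ^ K)"
 by (intro continuous_intros) (auto simp: less_imp_neq[OF rho_weight_pos, symmetric])

lemma wavg_integrand_nbm:
 assumes "continuous_on UNIV g" "\<And>x. 0 \<le> g x"
 shows "nbm torus (\<lambda>z. g z / (1 + 2 ^ l * rho (x - z)) ^ K)"
 by (intro nbm_torus_continuous continuous_rho_weight continuous_intros assms divide_nonneg_nonneg) (simp add: assms)+

lemma wavg_nonneg:
 assumes "continuous_on UNIV g" "\<And>x. 0 \<le> g x"
 shows "0 \<le> wavg K l g x"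
 unfolding wavg_def by (intro mult_nonneg_nonneg torus.nbm_integral_nonneg wavg_integrand_nbm assms) simp

lemma convolution_le_wavg:
 fixes f k :: "real ^ 'd::finite \<Rightarrow> complex"
 assumes f: "continuous_on UNIV f" and k: "continuous_on UNIV k"
  and le: "\<And>y. norm (k y) \<le> B * ((2 ^ l) ^ CARD('d) / (1 + 2 ^ l * rho y) ^ K)"
 shows "norm (torus_integral (\<lambda>z. f z * k (x - z))) \<le> B * wavg K l (\<lambda>z. norm (f z)) x"
proof -
 have ck: "continuous_on UNIV (\<lambda>z. k (x - z))"
  by (rule continuous_on_compose2[OF k]) (auto intro!: continuous_intros)
 have "0 \<le> B * ((2 ^ l) ^ CARD('d) / (1 + 2 ^ l * rho (0 :: real ^ 'd)) ^ K)" by (rule order_trans[OF norm_ge_zero le])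
 then have "0 \<le> B * (2 ^ l) ^ CARD('d)" by (simp add: rho_def)
 then have B: "B \<ge> 0" using mult_le_cancel_right_pos[of "(2 ^ l) ^ CARD('d)" 0 B] by simp
 have "norm (torus_integral (\<lambda>z. f z * k (x - z))) \<le> (\<integral>z. norm (f z * k (x - z)) \<partial>torus)"
  unfolding torus_integral_torus by (rule integral_norm_bound)
 also have "\<dots> \<le> (\<integral>z. B * (2 ^ l) ^ CARD('d) * (norm (f z) / (1 + 2 ^ l * rho (x - z)) ^ K) \<partial>torus)"
 proof (rule torus.nbm_integral_mono)
  show "nbm torus (\<lambda>z. norm (f z * k (x - z)))"
   by (intro nbm_torus_continuous continuous_intros f ck) simp
  show "nbm torus (\<lambda>z. B * (2 ^ l) ^ CARD('d) * (norm (f z) / (1 + 2 ^ l * rho (x - z)) ^ K))"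
   using B by (intro nbm_mult nbm_const wavg_integrand_nbm continuous_intros f) auto
  fix z
  have "norm (f z) * norm (k (x - z)) \<le> norm (f z) * (B * ((2 ^ l) ^ CARD('d) / (1 + 2 ^ l * rho (x - z)) ^ K))"
   by (intro mult_left_mono le) simp
  then show "norm (f z * k (x - z)) \<le> B * (2 ^ l) ^ CARD('d) * (norm (f z) / (1 + 2 ^ l * rho (x - z)) ^ K)"
   by (simp add: norm_mult mult_ac)
 qed
 also have "\<dots> = B * wavg K l (\<lambda>z. norm (f z)) x"
  by (simp only: integral_mult_right_zero wavg_def mult.assoc)
 finally show ?thesis .
qed

text \<open>The reproducing formula bounds \<open>f\<close> pointwise by its own average. So \<open>|f|\<close> to the power \<open>1 - r\<close> can be
 extracted from the average and cancelled against the left-hand side.\<close>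

lemma wavg_power_le:
 fixes f \<Phi> :: "real ^ 'd::finite \<Rightarrow> complex"
 assumes f: "continuous_on UNIV f" and \<Phi>: "continuous_on UNIV \<Phi>"
  and le: "\<And>y. norm (\<Phi> y) \<le> B * ((2 ^ l) ^ CARD('d) / (1 + 2 ^ l * rho y) ^ K)"
  and rep: "\<And>y. norm (f y) \<le> norm (torus_integral (\<lambda>z. f z * \<Phi> (y - z)))"
  and r: "0 < r" "r \<le> 1" and Kr: "real CARD('d) + 1 \<le> real K * r" and B: "B > 0"
 shows "wavg K l (\<lambda>z. norm (f z)) x powr r \<le> B powr (1 - r) / avg_const TYPE('d) * kernel_op torus (avg_kernel l) (\<lambda>z. norm (f z) powr r) x"
proof -
 let ?N = "wavg K l (\<lambda>z. norm (f z)) x"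
 let ?w = "\<lambda>z. 1 + 2 ^ l * rho (x - z)"
 have w: "1 \<le> ?w z" "0 < ?w z" "0 \<le> ?w z" for z by (auto simp: add_pos_nonneg)
 have cn: "continuous_on UNIV (\<lambda>z. norm (f z))" by (intro continuous_intros f)
 have N: "?N \<ge> 0" by (rule wavg_nonneg[OF cn]) simp
 \<comment> \<open>Averages around \<open>x\<close> and \<open>y\<close> are compared by submultiplicativity of the weight.\<close>
 have pt: "norm (f y) \<le> B * ?w y ^ K * ?N" for y
 proof -
  have "norm (f y) \<le> B * wavg K l (\<lambda>z. norm (f z)) y"
   using rep[of y] convolution_le_wavg[OF f \<Phi> le, of y] by linarith
  also have "wavg K l (\<lambda>z. norm (f z)) y \<le> ?w y ^ K * ?N"
  proof -
   have "(\<integral>z. norm (f z) / (1 + 2 ^ l * rho (y - z)) ^ K \<partial>torus) \<le> (\<integral>z. ?w y ^ K * (norm (f z) / ?w z ^ K) \<partial>torus)"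
   proof (rule torus.nbm_integral_mono)
    show "nbm torus (\<lambda>z. norm (f z) / (1 + 2 ^ l * rho (y - z)) ^ K)" by (intro wavg_integrand_nbm cn) simp
    show "nbm torus (\<lambda>z. ?w y ^ K * (norm (f z) / ?w z ^ K))"
     using w by (intro nbm_mult nbm_const wavg_integrand_nbm cn) (auto intro: zero_le_power)
    fix z
    have "rho (x - z) \<le> rho (x - y) + rho (y - z)" using rho_triangle[of "x - y" "y - z"] by simp
    then have "2 ^ l * rho (x - z) \<le> 2 ^ l * (rho (x - y) + rho (y - z))" by (intro mult_left_mono) auto
    moreover have "0 \<le> (2 ^ l * rho (x - y)) * (2 ^ l * rho (y - z))" by simp
    ultimately have "?w z \<le> ?w y * (1 + 2 ^ l * rho (y - z))" by (simp only: distrib_left distrib_right mult_1 mult_1_right)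
    then have "?w z ^ K \<le> (?w y * (1 + 2 ^ l * rho (y - z))) ^ K" using w(3) by (intro power_mono)
    then have p: "?w z ^ K \<le> ?w y ^ K * (1 + 2 ^ l * rho (y - z)) ^ K" by (simp only: power_mult_distrib)
    have pz: "0 < ?w z ^ K" "0 < (1 + 2 ^ l * rho (y - z)) ^ K" using w(2) rho_weight_pos by (auto intro: zero_less_power)
    have "1 / c \<le> b / a" if "a \<le> b * c" "0 < a" "0 < c" for a b c :: real
     using that by (simp add: field_simps)
    then have "1 / (1 + 2 ^ l * rho (y - z)) ^ K \<le> ?w y ^ K / ?w z ^ K" using p pz by blast
    then have "norm (f z) * (1 / (1 + 2 ^ l * rho (y - z)) ^ K) \<le> norm (f z) * (?w y ^ K / ?w z ^ K)" by (intro mult_left_mono) auto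
    then show "norm (f z) / (1 + 2 ^ l * rho (y - z)) ^ K \<le> ?w y ^ K * (norm (f z) / ?w z ^ K)" by (simp add: mult.commute)
   qed
   also have "\<dots> = ?w y ^ K * (\<integral>z. norm (f z) / ?w z ^ K \<partial>torus)" by (rule integral_mult_right_zero)
   finally have "(2 ^ l) ^ CARD('d) * (\<integral>z. norm (f z) / (1 + 2 ^ l * rho (y - z)) ^ K \<partial>torus) \<le>
     (2 ^ l) ^ CARD('d) * (?w y ^ K * (\<integral>z. norm (f z) / ?w z ^ K \<partial>torus))" by (intro mult_left_mono) auto
   then show ?thesis by (simp only: wavg_def mult.left_commute)
  qed
  finally show ?thesis using B by (simp add: mult_left_mono mult.assoc)
 qed
 let ?J = "kernel_op torus (avg_kernel l) (\<lambda>z. norm (f z) powr r) x"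
 have cr: "nbm torus (\<lambda>z. norm (f z) powr r)" using r by (intro nbm_powr nbm_torus_continuous cn) auto
 have ck: "continuous_on UNIV (\<lambda>z. avg_kernel l x z)"
  unfolding avg_kernel_def by (rule continuous_rho_weight) (intro continuous_intros)+
 have ak: "0 \<le> avg_kernel l x z" for z
  unfolding avg_kernel_def using w avg_const_pos[where 'd = 'd] by (intro divide_nonneg_nonneg mult_nonneg_nonneg zero_le_power) (auto simp: less_imp_le)
 have J: "?J \<ge> 0"
  unfolding kernel_op_def by (intro torus.nbm_integral_nonneg nbm_mult nbm_torus_continuous[OF ck ak] cr)
 have main: "?N \<le> (B * ?N) powr (1 - r) * (1 / avg_const TYPE('d) * ?J)"
 proof -
  have "(2 ^ l) ^ CARD('d) * (\<integral>z. norm (f z) / ?w z ^ K \<partial>torus) = (\<integral>z. (2 ^ l) ^ CARD('d) * (norm (f z) / ?w z ^ K) \<partial>torus)"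
   by (rule integral_mult_right_zero[symmetric])
  also have "\<dots> \<le> (\<integral>z. (B * ?N) powr (1 - r) * (1 / avg_const TYPE('d) * (avg_kernel l x z * norm (f z) powr r)) \<partial>torus)"
  proof (rule torus.nbm_integral_mono)
   show "nbm torus (\<lambda>z. (2 ^ l) ^ CARD('d) * (norm (f z) / ?w z ^ K))"
    by (intro nbm_mult nbm_const wavg_integrand_nbm cn) auto
   show "nbm torus (\<lambda>z. (B * ?N) powr (1 - r) * (1 / avg_const TYPE('d) * (avg_kernel l x z * norm (f z) powr r)))"
    using avg_const_pos[where 'd = 'd] by (intro nbm_mult nbm_const cr nbm_torus_continuous[OF ck ak]) auto
   fix z
   have "norm (f z) = norm (f z) powr (1 - r) * norm (f z) powr r"
    by (cases "f z = 0") (simp_all add: powr_add[symmetric])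
   also have "\<dots> \<le> (B * ?w z ^ K * ?N) powr (1 - r) * norm (f z) powr r"
    using r by (intro mult_right_mono powr_mono2 pt) auto
   also have "(B * ?w z ^ K * ?N) powr (1 - r) = (B * ?N) powr (1 - r) * (?w z ^ K) powr (1 - r)"
    by (simp only: powr_mult mult_ac)
   finally have "norm (f z) / ?w z ^ K \<le> (B * ?N) powr (1 - r) * (?w z ^ K) powr (1 - r) * norm (f z) powr r / ?w z ^ K"
    by (rule divide_right_mono) (use w(3) in \<open>intro zero_le_power\<close>)
   also have "\<dots> = (B * ?N) powr (1 - r) * norm (f z) powr r * ((?w z ^ K) powr (1 - r) / ?w z ^ K)" by simp
   also have "(?w z ^ K) powr (1 - r) / ?w z ^ K \<le> 1 / ?w z ^ (CARD('d) + 1)"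
   proof -
    have pw: "?w z ^ n = ?w z powr real n" for n using w(2)[of z] by (simp only: powr_realpow)
    have "(?w z ^ K) powr (1 - r) / ?w z ^ K = ?w z powr (real K * (1 - r) - real K)"
     by (simp only: pw powr_powr powr_diff[symmetric])
    also have "\<dots> \<le> ?w z powr (- real (CARD('d) + 1))"
     using w(1)[of z] Kr by (intro powr_mono) (simp_all add: algebra_simps)
    also have "\<dots> = 1 / ?w z ^ (CARD('d) + 1)" by (simp only: powr_minus_divide pw)
    finally show ?thesis .
   qed
   finally have 1: "norm (f z) / ?w z ^ K \<le> (B * ?N) powr (1 - r) * norm (f z) powr r * (1 / ?w z ^ (CARD('d) + 1))"
    by (simp add: mult_left_mono)
   have "(2 ^ l) ^ CARD('d) * (norm (f z) / ?w z ^ K) \<le> (2 ^ l) ^ CARD('d) * ((B * ?N) powr (1 - r) * norm (f z) powr r * (1 / ?w z ^ (CARD('d) + 1)))"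
    by (intro mult_left_mono 1) simp
   also have "\<dots> = (B * ?N) powr (1 - r) * (1 / avg_const TYPE('d) * (avg_kernel l x z * norm (f z) powr r))"
    using avg_const_pos[where 'd = 'd] by (simp add: avg_kernel_def)
   finally show "(2 ^ l) ^ CARD('d) * (norm (f z) / ?w z ^ K) \<le> (B * ?N) powr (1 - r) * (1 / avg_const TYPE('d) * (avg_kernel l x z * norm (f z) powr r))" .
  qed
  also have "\<dots> = (B * ?N) powr (1 - r) * (1 / avg_const TYPE('d) * ?J)"
   by (simp only: integral_mult_right_zero kernel_op_def)
  finally show ?thesis by (simp only: wavg_def)
 qed
 show ?thesis
 proof (cases "?N = 0")
  case True
  then show ?thesis using J avg_const_pos[where 'd = 'd] by simp
 next
  case False
  then have Np: "?N > 0" using N by simp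
  have "?N powr (1 - r) * ?N powr r = ?N" using Np by (simp add: powr_add[symmetric])
  then have "?N powr (1 - r) * ?N powr r \<le> ?N powr (1 - r) * (B powr (1 - r) / avg_const TYPE('d) * ?J)"
   using main by (simp add: powr_mult mult_ac)
  then show ?thesis using Np mult_left_le_imp_le[of "?N powr (1 - r)"] by (simp only: powr_gt_zero)
 qed
qed
definition freq_ball :: "real \<Rightarrow> (int ^ 'd::finite) set" where
 "freq_ball R = {n. norm (real_vec n) \<le> R}"

lemma finite_freq_ball [simp]: "finite (freq_ball R)"
 unfolding freq_ball_def by (rule finite_lattice_ball)

lemma near_scale_weight:
 fixes y :: "real ^ 'd::finite"
 assumes "k \<in> {l - 2..l + 2}"
 shows "(2 ^ k) ^ CARD('d) / (1 + 2 ^ k * rho y) ^ K \<le> 4 ^ (CARD('d) + K) * ((2 ^ l) ^ CARD('d) / (1 + 2 ^ l * rho y) ^ K)"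
proof -
 have "(2::real) ^ k \<le> 2 ^ (l + 2)" using assms by (intro power_increasing) auto
 then have 1: "(2::real) ^ k \<le> 4 * 2 ^ l" by (simp add: power_add)
 have "(2::real) ^ l \<le> 2 ^ (k + 2)" using assms by (intro power_increasing) auto
 then have 2: "(2::real) ^ l \<le> 4 * 2 ^ k" by (simp add: power_add)
 have "2 ^ l * rho y \<le> 4 * 2 ^ k * rho y" using 2 by (intro mult_right_mono) auto
 then have "1 + 2 ^ l * rho y \<le> 4 * (1 + 2 ^ k * rho y)" by (simp add: algebra_simps)
 then have "(1 + 2 ^ l * rho y) ^ K \<le> (4 * (1 + 2 ^ k * rho y)) ^ K" using rho_weight_pos[of l y] by (intro power_mono) auto
 then have w: "(1 + 2 ^ l * rho y) ^ K \<le> 4 ^ K * (1 + 2 ^ k * rho y) ^ K" by (simp only: power_mult_distrib)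
 have p: "0 < (1 + 2 ^ l * rho y) ^ K" "0 < (1 + 2 ^ k * rho y) ^ K" by (intro zero_less_power rho_weight_pos)+
 have "1 / b \<le> c / a" if "a \<le> c * b" "0 < a" "0 < b" for a b c :: real
  using that by (simp add: field_simps)
 then have i: "1 / (1 + 2 ^ k * rho y) ^ K \<le> 4 ^ K / (1 + 2 ^ l * rho y) ^ K" using w p by blast
 have "((2::real) ^ k) ^ CARD('d) \<le> (4 * 2 ^ l) ^ CARD('d)" using 1 by (intro power_mono) auto
 then have "((2::real) ^ k) ^ CARD('d) * (1 / (1 + 2 ^ k * rho y) ^ K) \<le> (4 * 2 ^ l) ^ CARD('d) * (4 ^ K / (1 + 2 ^ l * rho y) ^ K)"
  using i p by (intro mult_mono) (auto simp: less_imp_le)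
 then show ?thesis by (simp add: power_mult_distrib power_add mult_ac)
qed

lemma trig_sum_sum:
 assumes "finite S" "\<And>i n. i \<in> I \<Longrightarrow> n \<notin> S \<Longrightarrow> G i n = 0"
 shows "trig_sum (\<lambda>n. \<Sum>i\<in>I. b i * G i n) y = (\<Sum>i\<in>I. b i * trig_sum (G i) y)"
proof -
 have "trig_sum (\<lambda>n. \<Sum>i\<in>I. b i * G i n) y = (\<Sum>n\<in>S. \<Sum>i\<in>I. b i * (G i n * exp_fun n y))"
  by (subst trig_sum_finite[OF assms(1)]) (auto simp: assms(2) sum_distrib_right mult.assoc)
 also have "\<dots> = (\<Sum>i\<in>I. b i * (\<Sum>n\<in>S. G i n * exp_fun n y))"
  by (subst sum.swap) (simp add: sum_distrib_left)
 also have "\<dots> = (\<Sum>i\<in>I. b i * trig_sum (G i) y)"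
  by (intro sum.cong refl arg_cong2[where f = "(*)"] trig_sum_finite[OF assms(1), symmetric] assms(2))
 finally show ?thesis .
qed

lemma two_pi_power_ge_1: "1 \<le> (2 * pi) ^ n"
 using pi_gt3 by (intro one_le_power) simp

lemma wavg_measurable_bounded:
 fixes g :: "real ^ 'd::finite \<Rightarrow> real"
 assumes "continuous_on UNIV g" "\<And>x. 0 \<le> g x"
 shows "nbm torus (wavg K l g)"
proof -
 have gn: "nbm torus g" by (rule nbm_torus_continuous[OF assms])
 have "nbm (torus \<Otimes>\<^sub>M torus) (\<lambda>(x :: real ^ 'd, z). 1 / (1 + 2 ^ l * rho (x - z)) ^ K)"
 proof (rule nbmI[of _ _ 1])
  have "continuous_on UNIV (\<lambda>p :: (real ^ 'd) \<times> (real ^ 'd). 1 / (1 + 2 ^ l * rho (fst p - snd p)) ^ K)"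
   by (intro continuous_rho_weight continuous_intros)
  from borel_measurable_continuous_onI[OF this]
  show "(\<lambda>(x :: real ^ 'd, z). 1 / (1 + 2 ^ l * rho (x - z)) ^ K) \<in> borel_measurable (torus \<Otimes>\<^sub>M torus)"
   by (intro measurable_torus_pair) (simp add: case_prod_beta')
  fix p :: "(real ^ 'd) \<times> (real ^ 'd)"
  have "1 \<le> (1 + 2 ^ l * rho (fst p - snd p)) ^ K" by (rule one_le_power[OF rho_weight_ge_1])
  then show "(\<lambda>(x, z). 1 / (1 + 2 ^ l * rho (x - z)) ^ K) p \<le> 1"
   unfolding case_prod_beta' by (simp only: divide_le_eq_1) (rule disjI1, blast intro: order.strict_trans2[OF zero_less_one])
  show "0 \<le> (\<lambda>(x, z). 1 / (1 + 2 ^ l * rho (x - z)) ^ K) p"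
   unfolding case_prod_beta' by (intro divide_nonneg_nonneg zero_le_power) auto
 qed
 from torus.kernel_op_nbm[OF this gn]
 have "nbm torus (\<lambda>x. (2 ^ l) ^ CARD('d) * kernel_op torus (\<lambda>x z. 1 / (1 + 2 ^ l * rho (x - z)) ^ K) g x)"
  by (intro nbm_mult nbm_const) auto
 moreover have "wavg K l g = (\<lambda>x. (2 ^ l) ^ CARD('d) * kernel_op torus (\<lambda>x z. 1 / (1 + 2 ^ l * rho (x - z)) ^ K) g x)"
  by (simp add: fun_eq_iff wavg_def kernel_op_def)
 ultimately show ?thesis by simp
qed

lemma weighted_sum_power_mono:
 fixes w v :: "nat \<Rightarrow> real"
 assumes "\<And>l. 0 \<le> w l" "\<And>l. w l powr r \<le> C * v l" "\<And>l. 0 \<le> v l" "0 \<le> C" "0 < r" "0 < q" "0 < p"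
 shows "(\<Sum>l\<le>N. w l powr q) powr (p / q) \<le> C powr (p / r) * (\<Sum>l\<le>N. v l powr (q / r)) powr ((p / r) / (q / r))"
proof -
 have "w l powr q \<le> C powr (q / r) * v l powr (q / r)" for l
 proof -
  have "w l powr q = (w l powr r) powr (q / r)" using assms by (simp add: powr_powr)
  also have "\<dots> \<le> (C * v l) powr (q / r)" using assms by (intro powr_mono2) auto
  finally show ?thesis by (simp add: powr_mult)
 qed
 then have "(\<Sum>l\<le>N. w l powr q) \<le> C powr (q / r) * (\<Sum>l\<le>N. v l powr (q / r))"
  unfolding sum_distrib_left by (intro sum_mono)
 then have "(\<Sum>l\<le>N. w l powr q) powr (p / q) \<le> (C powr (q / r) * (\<Sum>l\<le>N. v l powr (q / r))) powr (p / q)"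
  using assms by (intro powr_mono2 sum_nonneg) auto
 also have "\<dots> = C powr (p / r) * (\<Sum>l\<le>N. v l powr (q / r)) powr ((p / r) / (q / r))"
  using assms by (simp add: powr_mult powr_powr)
 finally show ?thesis .
qed

lemma exists_decay_order:
 assumes "0 < r" shows "\<exists>K. d \<le> real K * r"
proof -
 obtain K :: nat where "d / r \<le> real K" using real_arch_simple by blast
 then show ?thesis using assms by (auto simp: pos_divide_le_eq)
qed

section \<open>Powers and norms with values in the extended reals\<close>

lemma epow_ennreal: "0 \<le> x \<Longrightarrow> epow (ennreal x) r = ennreal (x powr r)"
 by (simp add: epow_def)

lemma epow_top [simp]: "epow top r = top"
 by (simp add: epow_def)

lemma epow_zero [simp]: "epow 0 r = 0"
 by (simp add: epow_def)

lemma epow_mono: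
 assumes "0 < r" "a \<le> b" shows "epow a r \<le> epow b r"
proof (cases b rule: ennreal_cases)
 case b: (real y)
 with assms(2) obtain x where "0 \<le> x" "a = ennreal x" by (cases a rule: ennreal_cases) (auto simp: top_unique)
 then show ?thesis using b assms by (simp add: epow_ennreal ennreal_leI powr_mono2)
qed simp

lemma epow_epow:
 assumes "0 < r" "0 < s" shows "epow (epow a r) s = epow a (r * s)"
 by (cases a rule: ennreal_cases) (simp_all add: epow_ennreal powr_powr)

lemma epow_one [simp]: "epow a 1 = a"
 by (cases a rule: ennreal_cases) (simp_all add: epow_ennreal)

lemma epow_mult:
 assumes "0 < r" shows "epow (a * b) r = epow a r * epow b r"
proof -
 have z: "epow t r = 0 \<longleftrightarrow> t = 0" for t
  by (cases t rule: ennreal_cases) (auto simp: epow_ennreal)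
 show ?thesis
 proof (cases a rule: ennreal_cases)
  case a: (real x)
  show ?thesis
  proof (cases b rule: ennreal_cases)
   case b: (real y)
   then show ?thesis using a by (simp add: epow_ennreal ennreal_mult[symmetric] powr_mult)
  next
   case top
   then show ?thesis using z[of a] by (simp add: ennreal_mult_top)
  qed
 next
  case top
  then show ?thesis using z[of b] by (simp add: ennreal_top_mult)
 qed
qed

text \<open>The two powers are adjoint to each other, hence compatible with suprema.\<close>

lemma epow_le_iff:
 assumes "0 < r" shows "epow a r \<le> c \<longleftrightarrow> a \<le> epow c (1 / r)"
proof
 assume "epow a r \<le> c"
 then have "epow (epow a r) (1 / r) \<le> epow c (1 / r)" using assms by (intro epow_mono) auto
 then show "a \<le> epow c (1 / r)" using assms by (simp add: epow_epow)
next
 assume "a \<le> epow c (1 / r)"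
 then have "epow a r \<le> epow (epow c (1 / r)) r" using assms by (intro epow_mono) auto
 then show "epow a r \<le> c" using assms by (simp add: epow_epow)
qed

lemma epow_SUP:
 assumes "0 < r" shows "epow (SUP i\<in>I. f i) r = (SUP i\<in>I. epow (f i) r)"
proof (rule antisym)
 show "epow (SUP i\<in>I. f i) r \<le> (SUP i\<in>I. epow (f i) r)"
  unfolding epow_le_iff[OF assms]
  by (rule SUP_least, subst epow_le_iff[OF assms, symmetric], rule SUP_upper)
 show "(SUP i\<in>I. epow (f i) r) \<le> epow (SUP i\<in>I. f i) r"
  by (intro SUP_least epow_mono[OF assms] SUP_upper)
qed

lemma measurable_epow:
 assumes [measurable]: "g \<in> borel_measurable M" shows "(\<lambda>x. epow (g x) r) \<in> borel_measurable M"
 unfolding epow_def by measurable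

lemma le_suminf_ennreal: "f i \<le> (\<Sum>l. f l :: ennreal)"
 using sum_le_suminf[of f "{i}"] by simp

lemma SUP_le_suminf: "(SUP i. f i) \<le> (\<Sum>i. f i :: ennreal)"
 by (rule SUP_least) (rule le_suminf_ennreal)

lemma epow_SUP_le:
 assumes "0 < r" shows "epow (SUP l. f l) r \<le> (\<Sum>l. epow (f l) r)"
 unfolding epow_SUP[OF assms] by (rule SUP_le_suminf)

lemma suminf_le_SUP: "(\<Sum>l. w l * b l) \<le> (\<Sum>l. w l) * (SUP l. b l :: ennreal)"
proof -
 have "(\<Sum>l. w l * b l) \<le> (\<Sum>l. w l * (SUP l. b l))"
  by (intro suminf_le mult_left_mono SUP_upper) auto
 then show ?thesis by simp
qed

lemma suminf_swap_ennreal: "(\<Sum>j. \<Sum>l. g j l) = (\<Sum>l. \<Sum>j. g j l :: ennreal)"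
proof -
 have "(\<Sum>j. \<Sum>l. g j l) = (\<integral>\<^sup>+j. (\<Sum>l. g j l) \<partial>count_space UNIV)" by (rule nn_integral_count_space_nat[symmetric])
 also have "\<dots> = (\<Sum>l. \<integral>\<^sup>+j. g j l \<partial>count_space UNIV)" by (rule nn_integral_suminf) simp
 finally show ?thesis by (simp only: nn_integral_count_space_nat)
qed

lemma suminf_eq_SUP_atMost: "(\<Sum>l. f l) = (SUP N. \<Sum>l\<le>N. f l :: ennreal)"
proof (rule antisym)
 have "(\<Sum>l<n. f l) \<le> (SUP N. \<Sum>l\<le>N. f l)" for n
  by (rule order_trans[OF sum_mono2 SUP_upper[OF UNIV_I, of "\<lambda>N. \<Sum>l\<le>N. f l" n]]) auto
 then show "(\<Sum>l. f l) \<le> (SUP N. \<Sum>l\<le>N. f l)" by (intro suminf_le_const) auto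
 show "(SUP N. \<Sum>l\<le>N. f l) \<le> (\<Sum>l. f l)" by (intro SUP_least sum_le_suminf) auto
qed

lemma ell_norm_top: "ell_norm \<infinity> b = (SUP j. b j)"
 by (simp add: ell_norm_def)

lemma ell_norm_real: "0 < r \<Longrightarrow> ell_norm (ennreal r) b = epow (\<Sum>j. epow (b j) r) (1 / r)"
 by (simp add: ell_norm_def)

lemma Lp_norm_top: "Lp_norm \<infinity> g = esssup torus g"
 by (simp add: Lp_norm_def torus_def)

lemma Lp_norm_real: "0 < r \<Longrightarrow> Lp_norm (ennreal r) g = epow (\<integral>\<^sup>+x. epow (g x) r \<partial>torus) (1 / r)"
 by (simp add: Lp_norm_def torus_def nn_integral_restrict_space)

lemma positive_exponent_cases:
 assumes "0 < (p :: ennreal)"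
 obtains "p = \<infinity>" | r where "0 < r" "p = ennreal r"
 using assms by (cases p rule: ennreal_cases) auto

lemma ell_norm_mono:
 assumes "0 < q" "\<And>j. b j \<le> b' j" shows "ell_norm q b \<le> ell_norm q b'"
 using assms(1)
proof (cases q rule: positive_exponent_cases)
 case 1
 show ?thesis unfolding 1 ell_norm_top by (rule SUP_mono) (use assms(2) in auto)
next
 case (2 r)
 then show ?thesis unfolding 2(2) ell_norm_real[OF 2(1)]
  by (intro epow_mono suminf_le assms(2)) auto
qed

lemma ell_norm_cmult:
 assumes "0 < q" shows "ell_norm q (\<lambda>j. k * b j) = k * ell_norm q b"
 using assms
proof (cases q rule: positive_exponent_cases)
 case 1
 show ?thesis unfolding 1 ell_norm_top by (rule SUP_mult_left_ennreal[symmetric])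
next
 case (2 r)
 then show ?thesis unfolding 2(2) ell_norm_real[OF 2(1)] by (simp add: epow_mult epow_epow)
qed

lemma measurable_ell_norm:
 assumes "\<And>j. b j \<in> borel_measurable M" "0 < q"
 shows "(\<lambda>x. ell_norm q (\<lambda>j. b j x)) \<in> borel_measurable M"
 using assms(2)
proof (cases q rule: positive_exponent_cases)
 case 1
 have "(\<lambda>x. SUP j. b j x) \<in> borel_measurable M" by (intro borel_measurable_SUP assms) auto
 then show ?thesis unfolding 1 ell_norm_top by simp
next
 case (2 r)
 show ?thesis unfolding 2(2) ell_norm_real[OF 2(1)]
  by (intro measurable_epow borel_measurable_suminf_order assms)
qed

lemma Lp_norm_mono:
 fixes g :: "real ^ 'd::finite \<Rightarrow> ennreal"
 assumes "0 < p" "g \<in> borel_measurable torus" "\<And>x. g x \<le> h x"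
 shows "Lp_norm p g \<le> Lp_norm p h"
 using assms(1)
proof (cases p rule: positive_exponent_cases)
 case 1
 show ?thesis unfolding 1 Lp_norm_top by (intro esssup_mono assms)
next
 case (2 r)
 then show ?thesis unfolding 2(2) Lp_norm_real[OF 2(1)]
  by (intro epow_mono nn_integral_mono assms(3)) auto
qed

text \<open>One inequality suffices: the reverse one follows for the inverse factor.\<close>

lemma Lp_norm_cmult_le:
 fixes g :: "real ^ 'd::finite \<Rightarrow> ennreal"
 assumes "0 < p" and g[measurable]: "g \<in> borel_measurable torus"
 shows "Lp_norm p (\<lambda>x. k * g x) \<le> k * Lp_norm p g"
 using assms(1)
proof (cases p rule: positive_exponent_cases)
 case 1
 have "AE x in torus. k * g x \<le> k * esssup torus g"
  using esssup_AE[of g torus] by eventually_elim (rule mult_left_mono, auto)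
 then show ?thesis unfolding 1 Lp_norm_top by (intro esssup_I) auto
next
 case (2 r)
 then show ?thesis unfolding 2(2) Lp_norm_real[OF 2(1)]
  by (simp add: epow_mult epow_epow nn_integral_cmult measurable_epow)
qed

lemma sum_power_inj:
 fixes \<theta> :: real
 assumes "0 \<le> \<theta>" "\<theta> < 1" "finite A" "inj_on f A"
 shows "(\<Sum>l\<in>A. \<theta> ^ f l) \<le> 1 / (1 - \<theta>)"
proof -
 obtain M where M: "f ` A \<subseteq> {..<M}" using finite_nat_iff_bounded[of "f ` A"] assms(3) by auto
 have "(\<Sum>l\<in>A. \<theta> ^ f l) = (\<Sum>k\<in>f ` A. \<theta> ^ k)" using assms(4) by (simp add: sum.reindex)
 also have "\<dots> \<le> (\<Sum>k<M. \<theta> ^ k)" using M assms by (intro sum_mono2) auto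
 also have "\<dots> = (1 - \<theta> ^ M) / (1 - \<theta>)" using assms by (simp add: sum_gp_strict)
 also have "\<dots> \<le> 1 / (1 - \<theta>)" using assms by (intro divide_right_mono) auto
 finally show ?thesis .
qed

lemma suminf_scale_dist_le:
 assumes "0 \<le> \<theta>" "\<theta> < 1"
 shows "(\<Sum>l. ennreal (\<theta> ^ scale_dist j l)) \<le> ennreal (2 / (1 - \<theta>))"
  "(\<Sum>l. ennreal (\<theta> ^ scale_dist l j)) \<le> ennreal (2 / (1 - \<theta>))"
proof -
 have "(\<Sum>l<N. \<theta> ^ scale_dist j l) \<le> 2 / (1 - \<theta>)" for N
 proof -
  have "(\<Sum>l<N. \<theta> ^ scale_dist j l) = (\<Sum>l\<in>{..<N} \<inter> {..j}. \<theta> ^ scale_dist j l) + (\<Sum>l\<in>{..<N} - {..j}. \<theta> ^ scale_dist j l)"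
   by (rule sum.Int_Diff) simp
  also have "\<dots> \<le> 1 / (1 - \<theta>) + 1 / (1 - \<theta>)"
   by (intro add_mono sum_power_inj assms) (auto simp: inj_on_def scale_dist_def)
  finally show ?thesis by simp
 qed
 then have "(\<Sum>l<N. ennreal (\<theta> ^ scale_dist j l)) \<le> ennreal (2 / (1 - \<theta>))" for N
  using assms by (simp add: sum_ennreal ennreal_leI)
 then show 1: "(\<Sum>l. ennreal (\<theta> ^ scale_dist j l)) \<le> ennreal (2 / (1 - \<theta>))" by (intro suminf_le_const) auto
 have "scale_dist l j = scale_dist j l" for l by (simp add: scale_dist_def)
 then show "(\<Sum>l. ennreal (\<theta> ^ scale_dist l j)) \<le> ennreal (2 / (1 - \<theta>))" using 1 by simp
qed

definition scale_weight :: "nat \<Rightarrow> nat \<Rightarrow> nat \<Rightarrow> ennreal" where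
 "scale_weight e j l = ennreal ((1 / 2) ^ (e * scale_dist j l))"

lemma scale_weight_add: "scale_weight (e + f) j l = scale_weight e j l * scale_weight f j l"
 by (simp add: scale_weight_def ennreal_mult[symmetric] add_mult_distrib power_add)

lemma suminf_scale_weight: "(\<Sum>l. scale_weight 1 j l) \<le> 4"
proof -
 have "(\<Sum>l. ennreal ((1 / 2) ^ scale_dist j l)) \<le> ennreal (2 / (1 - 1 / 2))" by (rule suminf_scale_dist_le) auto
 also have "\<dots> = 4" by simp
 finally show ?thesis by (simp only: scale_weight_def mult_1)
qed

lemma epow_scale_weight:
 assumes "0 < r"
 shows "epow (scale_weight 1 j l) r = ennreal (((1 / 2) powr r) ^ scale_dist j l)"
 unfolding scale_weight_def
 by (subst epow_ennreal) (auto simp: powr_realpow[symmetric] powr_powr mult.commute)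

text \<open>Giving away one power of the decay, a weighted sum is bounded by a weighted supremum. This
 reduces all exponents, below or above one, to the trivial estimate of a supremum by a sum.\<close>

lemma scale_sum_le_SUP: "(\<Sum>l. scale_weight (e + 1) j l * b l) \<le> 4 * (SUP l. scale_weight e j l * b l)"
proof -
 have "(\<Sum>l. scale_weight (e + 1) j l * b l) = (\<Sum>l. scale_weight 1 j l * (scale_weight e j l * b l))"
  by (simp only: scale_weight_add mult_ac)
 also have "\<dots> \<le> (\<Sum>l. scale_weight 1 j l) * (SUP l. scale_weight e j l * b l)" by (rule suminf_le_SUP)
 also have "\<dots> \<le> 4 * (SUP l. scale_weight e j l * b l)" by (intro mult_right_mono suminf_scale_weight) simp
 finally show ?thesis .
qed

lemma epow_scale_sum_le:
 assumes "0 < r"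
 shows "epow (\<Sum>l. scale_weight (e + 1) j l * b l) r \<le> epow 4 r * (\<Sum>l. epow (scale_weight e j l * b l) r)"
proof -
 have "epow (\<Sum>l. scale_weight (e + 1) j l * b l) r \<le> epow (4 * (SUP l. scale_weight e j l * b l)) r"
  by (rule epow_mono[OF assms scale_sum_le_SUP])
 also have "\<dots> = epow 4 r * epow (SUP l. scale_weight e j l * b l) r" by (rule epow_mult[OF assms])
 also have "\<dots> \<le> epow 4 r * (\<Sum>l. epow (scale_weight e j l * b l) r)"
  by (intro mult_left_mono epow_SUP_le assms) simp
 finally show ?thesis .
qed

lemma half_powr_less_1: "0 < r \<Longrightarrow> (1 / 2 :: real) powr r < 1"
 using powr_less_mono2[of r "1 / 2" 1] by simp

lemma finite_constant: "a < \<infinity> \<Longrightarrow> \<exists>C\<ge>0. a = ennreal C"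
 by (cases a rule: ennreal_cases) auto

lemma epow_finite: "a < \<infinity> \<Longrightarrow> epow a r < \<infinity>"
 by (simp add: epow_def)

text \<open>One power of the decay is spent on passing to a supremum, the other one on summing over \<open>j\<close>.\<close>

lemma ell_norm_almost_diagonal:
 assumes "0 < q"
 shows "\<exists>C\<ge>0. \<forall>b. ell_norm q (\<lambda>j. \<Sum>l. scale_weight 2 j l * b l) \<le> ennreal C * ell_norm q b"
 using assms
proof (cases q rule: positive_exponent_cases)
 case 1
 have "(\<Sum>l. scale_weight 2 j l * b l) \<le> ennreal 4 * (SUP l. b l)" for j b
 proof -
  have "scale_weight 1 j l \<le> 1" for l unfolding scale_weight_def by (simp add: power_le_one)
  then have "(SUP l. scale_weight 1 j l * b l) \<le> (SUP l. b l)"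
   by (intro SUP_mono) (metis UNIV_I mult_right_mono mult_1 zero_le)
  then have "4 * (SUP l. scale_weight 1 j l * b l) \<le> ennreal 4 * (SUP l. b l)" by (simp add: mult_left_mono)
  then show ?thesis using scale_sum_le_SUP[of 1 j b] by (simp add: numeral_2_eq_2 order_trans)
 qed
 then show ?thesis unfolding 1 ell_norm_top by (intro exI[of _ 4]) (auto intro!: SUP_least)
next
 case (2 r)
 let ?\<theta> = "(1 / 2) powr r"
 define k where "k = epow 4 r * ennreal (2 / (1 - ?\<theta>))"
 have k: "k < \<infinity>"
 proof -
  have "epow 4 r < \<infinity>" by (rule epow_finite) simp
  then show ?thesis unfolding k_def by (simp add: ennreal_mult_less_top)
 qed
 have "epow (\<Sum>j. epow (\<Sum>l. scale_weight 2 j l * b l) r) (1 / r) \<le> epow k (1 / r) * epow (\<Sum>l. epow (b l) r) (1 / r)" for b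
 proof -
  have "(\<Sum>j. epow (\<Sum>l. scale_weight 2 j l * b l) r) \<le> (\<Sum>j. epow 4 r * (\<Sum>l. epow (scale_weight 1 j l * b l) r))"
   using epow_scale_sum_le[OF 2(1), of 1] by (intro suminf_le) (auto simp: numeral_2_eq_2)
  also have "\<dots> = epow 4 r * (\<Sum>l. \<Sum>j. epow (scale_weight 1 j l * b l) r)"
   by (simp only: ennreal_suminf_cmult suminf_swap_ennreal[of "\<lambda>j l. epow (scale_weight 1 j l * b l) r"])
  also have "\<dots> = epow 4 r * (\<Sum>l. (\<Sum>j. ennreal (?\<theta> ^ scale_dist j l)) * epow (b l) r)"
   by (simp only: epow_mult[OF 2(1)] epow_scale_weight[OF 2(1)] ennreal_suminf_multc)
  also have "\<dots> \<le> epow 4 r * (\<Sum>l. ennreal (2 / (1 - ?\<theta>)) * epow (b l) r)"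
   using half_powr_less_1[OF 2(1)] by (intro mult_left_mono suminf_le mult_right_mono suminf_scale_dist_le) auto
  also have "\<dots> = k * (\<Sum>l. epow (b l) r)" by (simp only: k_def ennreal_suminf_cmult mult.assoc)
  finally have "epow (\<Sum>j. epow (\<Sum>l. scale_weight 2 j l * b l) r) (1 / r) \<le> epow (k * (\<Sum>l. epow (b l) r)) (1 / r)"
   using 2(1) by (intro epow_mono) auto
  then show ?thesis using 2(1) by (simp add: epow_mult)
 qed
 moreover obtain C where "C \<ge> 0" "epow k (1 / r) = ennreal C" using finite_constant[OF epow_finite[OF k]] by blast
 ultimately show ?thesis unfolding 2(2) ell_norm_real[OF 2(1)] by auto
qed

text \<open>Of the four powers of decay, one is spent on passing to a supremum, so that \<open>p\<close>-th powers can be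
 integrated term by term, and one on summing the \<open>p\<close>-th powers.\<close>

lemma Lp_norm_almost_diagonal:
 assumes "0 < p"
 shows "\<exists>C\<ge>0. \<forall>j (G :: nat \<Rightarrow> real ^ 'd::finite \<Rightarrow> ennreal). (\<forall>l. G l \<in> borel_measurable torus) \<longrightarrow>
  Lp_norm p (\<lambda>x. \<Sum>l. scale_weight 4 j l * G l x) \<le> ennreal C * (\<Sum>l. scale_weight 2 j l * Lp_norm p (G l))"
 using assms
proof (cases p rule: positive_exponent_cases)
 case 1
 have "esssup torus (\<lambda>x. \<Sum>l. scale_weight 4 j l * G l x) \<le> ennreal 1 * (\<Sum>l. scale_weight 2 j l * esssup torus (G l))"
  if G: "\<forall>l. G l \<in> borel_measurable torus" for j and G :: "nat \<Rightarrow> real ^ 'd \<Rightarrow> ennreal"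
 proof (rule esssup_I)
  note [measurable] = G[rule_format]
  show "(\<lambda>x. \<Sum>l. scale_weight 4 j l * G l x) \<in> borel_measurable torus" by measurable
  have w: "scale_weight 4 j l \<le> scale_weight 2 j l" for l
   unfolding scale_weight_def by (intro ennreal_leI power_decreasing) auto
  have "AE x in torus. \<forall>l. G l x \<le> esssup torus (G l)" by (simp add: AE_all_countable esssup_AE)
  then show "AE x in torus. (\<Sum>l. scale_weight 4 j l * G l x) \<le> ennreal 1 * (\<Sum>l. scale_weight 2 j l * esssup torus (G l))"
   by eventually_elim (auto intro!: suminf_le mult_mono w)
 qed
 then show ?thesis unfolding 1 Lp_norm_top by (intro exI[of _ 1]) auto
next
 case (2 r)
 let ?\<theta> = "(1 / 2) powr r"
 define k where "k = epow 4 r * ennreal (2 / (1 - ?\<theta>))"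
 have k: "k < \<infinity>"
 proof -
  have "epow 4 r < \<infinity>" by (rule epow_finite) simp
  then show ?thesis unfolding k_def by (simp add: ennreal_mult_less_top)
 qed
 have "Lp_norm p (\<lambda>x. \<Sum>l. scale_weight 4 j l * G l x) \<le> epow k (1 / r) * (\<Sum>l. scale_weight 2 j l * Lp_norm p (G l))"
  if G: "\<forall>l. G l \<in> borel_measurable torus" for j and G :: "nat \<Rightarrow> real ^ 'd \<Rightarrow> ennreal"
 proof -
  note [measurable] = G[rule_format]
  let ?S = "SUP l. scale_weight 2 j l * Lp_norm p (G l)"
  have four: "(3::nat) + 1 = 4" by simp
  have int: "(\<integral>\<^sup>+x. epow (G l x) r \<partial>torus) = epow (Lp_norm p (G l)) r" for l
   using 2(1) by (simp add: 2(2) Lp_norm_real epow_epow)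
  have "(\<integral>\<^sup>+x. epow (\<Sum>l. scale_weight 4 j l * G l x) r \<partial>torus) \<le>
    (\<integral>\<^sup>+x. epow 4 r * (\<Sum>l. epow (scale_weight 3 j l) r * epow (G l x) r) \<partial>torus)"
   by (intro nn_integral_mono order_trans[OF epow_scale_sum_le[OF 2(1), of 3 j, unfolded four]] eq_refl) (simp only: epow_mult[OF 2(1)])
  also have "\<dots> = epow 4 r * (\<Sum>l. epow (scale_weight 3 j l) r * epow (Lp_norm p (G l)) r)"
  proof -
   have m[measurable]: "(\<lambda>x. epow (G l x) r) \<in> borel_measurable torus" for l by (rule measurable_epow) (rule G[rule_format])
   have "(\<integral>\<^sup>+x. epow (scale_weight 3 j l) r * epow (G l x) r \<partial>torus) = epow (scale_weight 3 j l) r * epow (Lp_norm p (G l)) r" for l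
    unfolding int[symmetric] by (rule nn_integral_cmult[OF m])
   moreover have m2: "(\<lambda>x. epow (scale_weight 3 j l) r * epow (G l x) r) \<in> borel_measurable torus" for l by measurable
   ultimately show ?thesis by (simp only: nn_integral_cmult[OF borel_measurable_suminf_order[OF m2]] nn_integral_suminf[OF m2])
  qed
  also have "(\<Sum>l. epow (scale_weight 3 j l) r * epow (Lp_norm p (G l)) r) =
    (\<Sum>l. ennreal (?\<theta> ^ scale_dist j l) * epow (scale_weight 2 j l * Lp_norm p (G l)) r)"
  proof -
   have three: "(3::nat) = 1 + 2" by simp
   show ?thesis by (simp only: three scale_weight_add epow_mult[OF 2(1)] epow_scale_weight[OF 2(1)] mult.assoc)
  qed
  also have "\<dots> \<le> (\<Sum>l. ennreal (?\<theta> ^ scale_dist j l)) * (SUP l. epow (scale_weight 2 j l * Lp_norm p (G l)) r)"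
   by (rule suminf_le_SUP)
  also have "\<dots> \<le> ennreal (2 / (1 - ?\<theta>)) * epow ?S r"
   unfolding epow_SUP[OF 2(1)] using half_powr_less_1[OF 2(1)]
   by (intro mult_right_mono suminf_scale_dist_le) auto
  finally have "(\<integral>\<^sup>+x. epow (\<Sum>l. scale_weight 4 j l * G l x) r \<partial>torus) \<le> k * epow ?S r"
   by (simp add: k_def mult_left_mono mult.assoc)
  \<comment> \<open>The supremum is passed back to a sum; the two remaining powers are left for the summation over the scales.\<close>
  then have "Lp_norm p (\<lambda>x. \<Sum>l. scale_weight 4 j l * G l x) \<le> epow (k * epow ?S r) (1 / r)"
   unfolding 2(2) Lp_norm_real[OF 2(1)] using 2(1) by (intro epow_mono) auto
  also have "\<dots> = epow k (1 / r) * ?S" using 2(1) by (simp add: epow_mult epow_epow)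
  also have "\<dots> \<le> epow k (1 / r) * (\<Sum>l. scale_weight 2 j l * Lp_norm p (G l))"
   by (intro mult_left_mono SUP_le_suminf) simp
  finally show ?thesis .
 qed
 moreover obtain C where "C \<ge> 0" "epow k (1 / r) = ennreal C" using finite_constant[OF epow_finite[OF k]] by blast
 ultimately show ?thesis by auto
qed

lemma measurable_ennreal_nbm: "nbm M g \<Longrightarrow> (\<lambda>x. ennreal (g x)) \<in> borel_measurable M"
 using nbm_measurable by measurable

lemma nn_integral_nbm: "nbm torus g \<Longrightarrow> (\<integral>\<^sup>+x. ennreal (g x) \<partial>torus) = ennreal (\<integral>x. g x \<partial>torus)"
 by (intro nn_integral_eq_integral torus.nbm_integrable AE_I2 nbm_nonneg)

lemma epow_sum_ennreal:
 assumes "\<And>l. 0 \<le> w l"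
 shows "epow (\<Sum>l\<le>N. epow (ennreal (w l)) q) t = ennreal ((\<Sum>l\<le>N. w l powr q) powr t)"
proof -
 have "(\<Sum>l\<le>N. epow (ennreal (w l)) q) = ennreal (\<Sum>l\<le>N. w l powr q)" using assms by (simp add: epow_ennreal sum_ennreal)
 then show ?thesis by (simp add: epow_ennreal sum_nonneg)
qed

lemma nn_integral_vector_inequality:
 fixes w b :: "nat \<Rightarrow> real ^ 'd::finite \<Rightarrow> real"
 assumes w: "\<And>l. nbm torus (w l)" "\<And>l x. 0 \<le> w l x" and b: "\<And>l. nbm torus (b l)" "\<And>l x. 0 \<le> b l x"
  and pq: "0 < q" "0 < p" and C: "0 \<le> C"
  and le: "(\<integral>x. (\<Sum>l\<le>N. w l x powr q) powr (p / q) \<partial>torus) \<le> C * (\<integral>x. (\<Sum>l\<le>N. b l x powr q) powr (p / q) \<partial>torus)"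
 shows "(\<integral>\<^sup>+x. epow (\<Sum>l\<le>N. epow (ennreal (w l x)) q) (p / q) \<partial>torus) \<le>
  ennreal C * (\<integral>\<^sup>+x. epow (\<Sum>l\<le>N. epow (ennreal (b l x)) q) (p / q) \<partial>torus)"
proof -
 have n: "nbm torus (\<lambda>x. (\<Sum>l\<le>N. v l x powr q) powr (p / q))" if "\<And>l. nbm torus (v l)" for v :: "nat \<Rightarrow> real ^ 'd \<Rightarrow> real"
  using pq that by (intro nbm_powr nbm_sum) auto
 show ?thesis
  unfolding epow_sum_ennreal[OF w(2)] epow_sum_ennreal[OF b(2)] nn_integral_nbm[OF n[of w, OF w(1)]] nn_integral_nbm[OF n[of b, OF b(1)]]
  using le C by (subst ennreal_mult[symmetric]) (auto intro: ennreal_leI torus.nbm_integral_nonneg n b)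
qed

text \<open>The finite inequalities pass to the full sequence by monotone convergence.\<close>

lemma Lp_ell_norm_le:
 fixes w b :: "nat \<Rightarrow> real ^ 'd::finite \<Rightarrow> ennreal"
 assumes w: "\<And>l. w l \<in> borel_measurable torus" and pq: "0 < p" "0 < q"
  and le: "\<And>N. (\<integral>\<^sup>+x. epow (\<Sum>l\<le>N. epow (w l x) q) (p / q) \<partial>torus) \<le>
   C * (\<integral>\<^sup>+x. epow (\<Sum>l\<le>N. epow (b l x) q) (p / q) \<partial>torus)"
 shows "Lp_norm (ennreal p) (\<lambda>x. ell_norm (ennreal q) (\<lambda>l. w l x)) \<le>
  epow C (1 / p) * Lp_norm (ennreal p) (\<lambda>x. ell_norm (ennreal q) (\<lambda>l. b l x))"
proof -
 have E: "epow (ell_norm (ennreal q) v) p = epow (\<Sum>l. epow (v l) q) (p / q)" for v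
  using pq by (simp add: ell_norm_real epow_epow)
 have pq': "0 < p / q" using pq by simp
 have "(\<integral>\<^sup>+x. epow (\<Sum>l. epow (w l x) q) (p / q) \<partial>torus) = (\<integral>\<^sup>+x. (SUP N. epow (\<Sum>l\<le>N. epow (w l x) q) (p / q)) \<partial>torus)"
  by (simp only: suminf_eq_SUP_atMost epow_SUP[OF pq'])
 also have "\<dots> = (SUP N. \<integral>\<^sup>+x. epow (\<Sum>l\<le>N. epow (w l x) q) (p / q) \<partial>torus)"
 proof (rule nn_integral_monotone_convergence_SUP)
  show "incseq (\<lambda>N x. epow (\<Sum>l\<le>N. epow (w l x) q) (p / q))"
   by (intro incseq_SucI le_funI epow_mono[OF pq']) simp
  show "(\<lambda>x. epow (\<Sum>l\<le>N. epow (w l x) q) (p / q)) \<in> borel_measurable torus" for N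
   by (intro measurable_epow borel_measurable_sum w)
 qed
 also have "\<dots> \<le> C * (\<integral>\<^sup>+x. epow (\<Sum>l. epow (b l x) q) (p / q) \<partial>torus)"
 proof (rule SUP_least)
  fix N
  have "(\<integral>\<^sup>+x. epow (\<Sum>l\<le>N. epow (b l x) q) (p / q) \<partial>torus) \<le> (\<integral>\<^sup>+x. epow (\<Sum>l. epow (b l x) q) (p / q) \<partial>torus)"
   by (intro nn_integral_mono epow_mono[OF pq'] sum_le_suminf) auto
  then show "(\<integral>\<^sup>+x. epow (\<Sum>l\<le>N. epow (w l x) q) (p / q) \<partial>torus) \<le> C * (\<integral>\<^sup>+x. epow (\<Sum>l. epow (b l x) q) (p / q) \<partial>torus)"
   by (rule order_trans[OF le mult_left_mono]) simp
 qed
 finally have "epow (\<integral>\<^sup>+x. epow (\<Sum>l. epow (w l x) q) (p / q) \<partial>torus) (1 / p) \<le> epow (C * (\<integral>\<^sup>+x. epow (\<Sum>l. epow (b l x) q) (p / q) \<partial>torus)) (1 / p)"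
  using pq by (intro epow_mono) auto
 then show ?thesis using pq by (simp add: Lp_norm_real E epow_mult)
qed

text \<open>On the first \<open>N + 1\<close> terms the supremum is replaced by the norm with the exponent \<open>p * (N + 2)\<close>. The
 loss in this comparison is \<open>(N + 1) powr (1 / (N + 2))\<close>, which is at most \<open>2\<close>.\<close>

lemma Lp_SUP_norm_le:
 fixes w b :: "nat \<Rightarrow> real ^ 'd::finite \<Rightarrow> ennreal"
 assumes w: "\<And>l. w l \<in> borel_measurable torus" and p: "0 < p" and b: "\<And>l. b l \<in> borel_measurable torus"
  and le: "\<And>N q. p < q \<Longrightarrow> (\<integral>\<^sup>+x. epow (\<Sum>l\<le>N. epow (w l x) q) (p / q) \<partial>torus) \<le>
   C * (\<integral>\<^sup>+x. epow (\<Sum>l\<le>N. epow (b l x) q) (p / q) \<partial>torus)"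
 shows "Lp_norm (ennreal p) (\<lambda>x. ell_norm \<infinity> (\<lambda>l. w l x)) \<le>
  epow (C * 2) (1 / p) * Lp_norm (ennreal p) (\<lambda>x. ell_norm \<infinity> (\<lambda>l. b l x))"
proof -
 have S: "(SUP l. v l) = (SUP N. SUP l\<in>{..N}. v l)" for v :: "nat \<Rightarrow> ennreal"
 proof (rule antisym)
  show "(SUP l. v l) \<le> (SUP N. SUP l\<in>{..N}. v l)" by (rule SUP_least, rule SUP_upper2[OF UNIV_I], rule SUP_upper) auto
  show "(SUP N. SUP l\<in>{..N}. v l) \<le> (SUP l. v l)" by (intro SUP_least SUP_upper) auto
 qed
 have "(\<integral>\<^sup>+x. epow (SUP l. w l x) p \<partial>torus) = (\<integral>\<^sup>+x. (SUP N. epow (SUP l\<in>{..N}. w l x) p) \<partial>torus)"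
  by (simp only: S[of "\<lambda>l. w l _"] epow_SUP[OF p])
 also have "\<dots> = (SUP N. \<integral>\<^sup>+x. epow (SUP l\<in>{..N}. w l x) p \<partial>torus)"
 proof (rule nn_integral_monotone_convergence_SUP)
  show "incseq (\<lambda>N x. epow (SUP l\<in>{..N}. w l x) p)"
   by (intro incseq_SucI le_funI epow_mono[OF p] SUP_subset_mono) auto
  show "(\<lambda>x. epow (SUP l\<in>{..N}. w l x) p) \<in> borel_measurable torus" for N
   by (intro measurable_epow borel_measurable_SUP w) auto
 qed
 also have "\<dots> \<le> (C * 2) * (\<integral>\<^sup>+x. epow (SUP l. b l x) p \<partial>torus)"
 proof (rule SUP_least)
  fix N :: nat
  define q where "q = p * (real N + 2)"
  have q: "p < q" "0 < q" "0 < p / q" using p by (auto simp: q_def add_nonneg_pos)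
  have pq: "q * (p / q) = p" using q by simp
  have "(\<integral>\<^sup>+x. epow (SUP l\<in>{..N}. w l x) p \<partial>torus) \<le> (\<integral>\<^sup>+x. epow (\<Sum>l\<le>N. epow (w l x) q) (p / q) \<partial>torus)"
  proof (rule nn_integral_mono)
   fix x
   have "epow (SUP l\<in>{..N}. w l x) q \<le> (\<Sum>l\<le>N. epow (w l x) q)"
    unfolding epow_SUP[OF q(2)] by (intro SUP_least member_le_sum) auto
   then have "epow (epow (SUP l\<in>{..N}. w l x) q) (p / q) \<le> epow (\<Sum>l\<le>N. epow (w l x) q) (p / q)" by (rule epow_mono[OF q(3)])
   then show "epow (SUP l\<in>{..N}. w l x) p \<le> epow (\<Sum>l\<le>N. epow (w l x) q) (p / q)" by (simp only: epow_epow[OF q(2,3)] pq)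
  qed
  also have "\<dots> \<le> C * (\<integral>\<^sup>+x. epow (\<Sum>l\<le>N. epow (b l x) q) (p / q) \<partial>torus)" by (rule le[OF q(1)])
  also have "\<dots> \<le> C * (\<integral>\<^sup>+x. 2 * epow (SUP l. b l x) p \<partial>torus)"
  proof (intro mult_left_mono nn_integral_mono)
   fix x
   have "(\<Sum>l\<le>N. epow (b l x) q) \<le> (\<Sum>l\<le>N. epow (SUP l. b l x) q)"
    by (intro sum_mono epow_mono[OF q(2)] SUP_upper) simp
   also have "\<dots> = ennreal (real N + 1) * epow (SUP l. b l x) q" by (simp add: ennreal_of_nat_eq_real_of_nat add.commute)
   finally have "epow (\<Sum>l\<le>N. epow (b l x) q) (p / q) \<le> epow (ennreal (real N + 1) * epow (SUP l. b l x) q) (p / q)"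
    by (rule epow_mono[OF q(3)])
   also have "\<dots> = epow (ennreal (real N + 1)) (p / q) * epow (SUP l. b l x) p"
    by (simp only: epow_mult[OF q(3)] epow_epow[OF q(2,3)] pq)
   also have "epow (ennreal (real N + 1)) (p / q) \<le> 2"
   proof -
    have "real N + 1 \<le> 2 ^ (N + 2)" using less_exp[of N] by (induction N) auto
    then have "(real N + 1) powr (1 / (real N + 2)) \<le> (2 ^ (N + 2)) powr (1 / (real N + 2))" by (intro powr_mono2) auto
    also have "\<dots> = (2 powr real (N + 2)) powr (1 / (real N + 2))" by (subst powr_realpow) auto
    also have "\<dots> = 2" unfolding powr_powr by (simp add: add.commute[of 2])
    also have "1 / (real N + 2) = p / q" using p by (simp add: q_def)
    finally have "ennreal ((real N + 1) powr (p / q)) \<le> ennreal 2" by (rule ennreal_leI)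
    then show ?thesis by (subst epow_ennreal) simp_all
   qed
   finally show "epow (\<Sum>l\<le>N. epow (b l x) q) (p / q) \<le> 2 * epow (SUP l. b l x) p" by (simp add: mult_right_mono)
  qed simp
  also have "\<dots> = (C * 2) * (\<integral>\<^sup>+x. epow (SUP l. b l x) p \<partial>torus)"
  proof -
   have "(\<lambda>x. epow (SUP l. b l x) p) \<in> borel_measurable torus" by (intro measurable_epow borel_measurable_SUP b) auto
   then show ?thesis by (simp add: nn_integral_cmult mult.assoc)
  qed
  finally show "(\<integral>\<^sup>+x. epow (SUP l\<in>{..N}. w l x) p \<partial>torus) \<le> (C * 2) * (\<integral>\<^sup>+x. epow (SUP l. b l x) p \<partial>torus)" .
 qed
 finally have "epow (\<integral>\<^sup>+x. epow (SUP l. w l x) p \<partial>torus) (1 / p) \<le> epow ((C * 2) * (\<integral>\<^sup>+x. epow (SUP l. b l x) p \<partial>torus)) (1 / p)"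
  using p by (intro epow_mono) auto
 then show ?thesis unfolding ell_norm_top Lp_norm_real[OF p] using p by (simp add: epow_mult)
qed

lemma wavg_le_bound:
 fixes g :: "real ^ 'd::finite \<Rightarrow> real"
 assumes g: "continuous_on UNIV g" "\<And>x. 0 \<le> g x" and S: "AE x in torus. g x \<le> S" "0 \<le> S"
  and x: "x \<in> torus_box"
 shows "wavg (CARD('d) + 1) l g x \<le> 1 / avg_const TYPE('d) * S"
proof -
 let ?K = "CARD('d) + 1"
 have c: "avg_const TYPE('d) \<noteq> 0" using avg_const_pos[where 'd = 'd] by simp
 have n: "nbm torus (\<lambda>z. h z / (1 + 2 ^ l * rho (x - z)) ^ ?K)" if "continuous_on UNIV h" "\<And>x. 0 \<le> h x" for h
  by (rule wavg_integrand_nbm[OF that])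
 have "(\<integral>z. g z / (1 + 2 ^ l * rho (x - z)) ^ ?K \<partial>torus) \<le> (\<integral>z. S / (1 + 2 ^ l * rho (x - z)) ^ ?K \<partial>torus)"
 proof (rule integral_mono_AE)
  show "integrable torus (\<lambda>z. g z / (1 + 2 ^ l * rho (x - z)) ^ ?K)" by (intro torus.nbm_integrable n g)
  show "integrable torus (\<lambda>z. S / (1 + 2 ^ l * rho (x - z)) ^ ?K)" by (intro torus.nbm_integrable n S) auto
  show "AE z in torus. g z / (1 + 2 ^ l * rho (x - z)) ^ ?K \<le> S / (1 + 2 ^ l * rho (x - z)) ^ ?K"
   using S(1) by eventually_elim (intro divide_right_mono zero_le_power, auto)
 qed
 then have "wavg ?K l g x \<le> (2 ^ l) ^ CARD('d) * (\<integral>z. S / (1 + 2 ^ l * rho (x - z)) ^ ?K \<partial>torus)"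
  unfolding wavg_def by (intro mult_left_mono) auto
 also have "\<dots> = (\<integral>z. (1 / avg_const TYPE('d) * S) * avg_kernel l x z \<partial>torus)"
  unfolding integral_mult_right_zero[symmetric] avg_kernel_def using c by (simp add: mult.commute[of S])
 also have "\<dots> = (1 / avg_const TYPE('d) * S) * (\<integral>z. avg_kernel l x z \<partial>torus)" by (rule integral_mult_right_zero)
 also have "\<dots> \<le> (1 / avg_const TYPE('d) * S) * 1"
  using markov_avg_kernel[of l] x S(2) avg_const_pos[where 'd = 'd] unfolding markov_kernel_def space_torus
  by (intro mult_left_mono) auto
 finally show ?thesis by simp
qed

section \<open>The Littlewood--Paley cutoffs\<close>

locale littlewood_paley =
 fixes \<phi>0 \<phi> :: "real ^ 'd::finite \<Rightarrow> complex"
 assumes lp: "lp_partition \<phi>0 \<phi>"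
begin

lemma lp_support:
 shows "norm x > 2 \<Longrightarrow> \<phi>0 x = 0" "norm x > 2 \<Longrightarrow> \<phi> x = 0" "norm x < 1 / 2 \<Longrightarrow> \<phi> x = 0"
proof -
 have 1: "{\<xi>. \<phi>0 \<xi> \<noteq> 0} \<subseteq> {\<xi>. norm \<xi> \<le> 2}" "{\<xi>. \<phi> \<xi> \<noteq> 0} \<subseteq> {\<xi>. 1 / 2 \<le> norm \<xi> \<and> norm \<xi> \<le> 2}"
  using lp closure_subset[of "{\<xi>. \<phi>0 \<xi> \<noteq> 0}"] closure_subset[of "{\<xi>. \<phi> \<xi> \<noteq> 0}"] by (auto simp: lp_partition_def)
 show "norm x > 2 \<Longrightarrow> \<phi>0 x = 0" using 1(1) by force
 show "norm x > 2 \<Longrightarrow> \<phi> x = 0" using 1(2) by force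
 show "norm x < 1 / 2 \<Longrightarrow> \<phi> x = 0" using 1(2) by force
qed

abbreviation cutoff :: "nat \<Rightarrow> int ^ 'd \<Rightarrow> complex" where
 "cutoff l n \<equiv> lp_cutoff \<phi>0 \<phi> l (real_vec n)"

lemma lp_cutoff_support:
 assumes nz: "lp_cutoff \<phi>0 \<phi> j \<xi> \<noteq> 0"
 shows "norm \<xi> \<le> 2 * 2 ^ j" "j \<noteq> 0 \<Longrightarrow> 2 ^ j / 2 \<le> norm \<xi>"
proof -
 have n: "norm (\<xi> /\<^sub>R 2 ^ j) = norm \<xi> / 2 ^ j" by (simp add: divide_inverse mult.commute)
 show "norm \<xi> \<le> 2 * 2 ^ j"
 proof (cases "j = 0")
  case True
  then show ?thesis using nz lp_support(1)[of \<xi>] by (force simp: lp_cutoff_def not_less)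
 next
  case False
  then have "\<not> norm (\<xi> /\<^sub>R 2 ^ j) > 2" using nz lp_support(2) by (auto simp: lp_cutoff_def)
  then show ?thesis unfolding n by (simp add: not_less field_simps)
 qed
 show "2 ^ j / 2 \<le> norm \<xi>" if "j \<noteq> 0"
 proof -
  have "\<not> norm (\<xi> /\<^sub>R 2 ^ j) < 1 / 2" using nz that lp_support(3) by (auto simp: lp_cutoff_def)
  then show ?thesis unfolding n by (simp add: not_less field_simps)
 qed
qed

text \<open>Differences are bounded by derivatives, and each derivative of a dilated cutoff gains \<open>2\<^sup>-\<^sup>j\<close>.\<close>

lemma lp_cutoff_diff_bound:
 "\<exists>C\<ge>0. \<forall>j i n. norm ((forward_diff i ^^ \<beta>) (cutoff j) n) \<le> C / (2 ^ j) ^ \<beta>"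
proof -
 have sm: "smooth \<phi>0" "smooth \<phi>" using lp by (auto simp: lp_partition_def)
 have "\<forall>i. \<exists>B\<ge>0. \<forall>x. norm ((partial_deriv i ^^ \<beta>) \<phi>0 x) \<le> B" "\<forall>i. \<exists>B\<ge>0. \<forall>x. norm ((partial_deriv i ^^ \<beta>) \<phi> x) \<le> B"
  using compact_support_partial_bounded[OF sm(1) lp_support(1)]
   compact_support_partial_bounded[OF sm(2) lp_support(2)] by blast+
 then obtain B0 B1 where B: "\<And>i. B0 i \<ge> 0" "\<And>i x. norm ((partial_deriv i ^^ \<beta>) \<phi>0 x) \<le> B0 i"
  "\<And>i. B1 i \<ge> 0" "\<And>i x. norm ((partial_deriv i ^^ \<beta>) \<phi> x) \<le> B1 i" by metis
 define C where "C = (\<Sum>i\<in>UNIV. B0 i + B1 i)"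
 have le: "B0 i \<le> C" "B1 i \<le> C" for i
 proof -
  have "B0 i + B1 i \<le> C" unfolding C_def using B(1,3) by (intro member_le_sum) auto
  then show "B0 i \<le> C" "B1 i \<le> C" using B(1)[of i] B(3)[of i] by auto
 qed
 have "C \<ge> 0" unfolding C_def using B(1,3) by (intro sum_nonneg add_nonneg_nonneg) auto
 moreover have "norm ((forward_diff i ^^ \<beta>) (cutoff j) n) \<le> C / (2 ^ j) ^ \<beta>" for j i n
 proof (cases "j = 0")
  case True
  have "norm ((real_diff i ^^ \<beta>) \<phi>0 (real_vec n)) \<le> C"
   by (rule funpow_real_diff_bound[OF smooth_direction_smooth[OF sm(1)]]) (use B(2) le(1) order_trans in blast)
  then show ?thesis using True by (simp add: lp_cutoff_def funpow_forward_diff_real)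
 next
  case False
  let ?t = "inverse (2 ^ j) :: real"
  have ds: "direction_smooth i \<phi>" by (rule smooth_direction_smooth[OF sm(2)])
  have "direction_smooth i (\<lambda>x. \<phi> (?t *\<^sub>R x))"
   unfolding direction_smooth_def funpow_partial_scale[OF ds]
   using ds by (intro allI partial_deriv_scale(2)) (simp add: direction_smooth_def)
  then have "norm ((real_diff i ^^ \<beta>) (\<lambda>x. \<phi> (?t *\<^sub>R x)) (real_vec n)) \<le> C / (2 ^ j) ^ \<beta>"
  proof (rule funpow_real_diff_bound)
   fix x
   have "norm ((partial_deriv i ^^ \<beta>) (\<lambda>x. \<phi> (?t *\<^sub>R x)) x) = ?t ^ \<beta> * norm ((partial_deriv i ^^ \<beta>) \<phi> (?t *\<^sub>R x))"
    unfolding funpow_partial_scale[OF ds] by (simp add: norm_mult norm_power del: of_real_power)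
   also have "\<dots> \<le> ?t ^ \<beta> * C" using B(4)[of i "?t *\<^sub>R x"] le(2)[of i] by (intro mult_left_mono) auto
   also have "\<dots> = C / (2 ^ j) ^ \<beta>" by (simp add: power_inverse divide_inverse mult.commute)
   finally show "norm ((partial_deriv i ^^ \<beta>) (\<lambda>x. \<phi> (?t *\<^sub>R x)) x) \<le> C / (2 ^ j) ^ \<beta>" .
  qed
  moreover have "(cutoff j) = (\<lambda>n. (\<lambda>x. \<phi> (?t *\<^sub>R x)) (real_vec n))"
   using False by (simp add: lp_cutoff_def)
  ultimately show ?thesis by (simp only: funpow_forward_diff_real[where f = "\<lambda>x. \<phi> (?t *\<^sub>R x)"])
 qed
 ultimately show ?thesis by blast
qed

text \<open>The terms of the partition beyond \<open>J\<close> vanish on this ball.\<close>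

lemma lp_cutoff_sum:
 assumes "norm \<xi> < 2 ^ J"
 shows "(\<Sum>j\<le>J. lp_cutoff \<phi>0 \<phi> j \<xi>) = 1"
proof -
 have "\<phi> (\<xi> /\<^sub>R 2 ^ Suc j) = 0" if "j \<ge> J" for j
 proof -
  have "(2::real) ^ J \<le> 2 ^ j" using that by (intro power_increasing) auto
  have "lp_cutoff \<phi>0 \<phi> (Suc j) \<xi> = 0"
  proof (rule ccontr)
   assume "lp_cutoff \<phi>0 \<phi> (Suc j) \<xi> \<noteq> 0"
   from lp_cutoff_support(2)[OF this] have "2 ^ j \<le> norm \<xi>" by simp
   then show False using \<open>(2::real) ^ J \<le> 2 ^ j\<close> assms by linarith
  qed
  then show ?thesis by (simp add: lp_cutoff_def)
 qed
 then have "(\<lambda>j. \<phi> (\<xi> /\<^sub>R 2 ^ Suc j)) sums (\<Sum>j<J. \<phi> (\<xi> /\<^sub>R 2 ^ Suc j))"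
  by (intro sums_finite) auto
 moreover have "(\<lambda>j. \<phi> (\<xi> /\<^sub>R 2 ^ Suc j)) sums (1 - \<phi>0 \<xi>)" using lp by (simp add: lp_partition_def)
 ultimately have "(\<Sum>j<J. \<phi> (\<xi> /\<^sub>R 2 ^ Suc j)) = 1 - \<phi>0 \<xi>" by (rule sums_unique2)
 moreover have "(\<Sum>j\<le>J. lp_cutoff \<phi>0 \<phi> j \<xi>) = \<phi>0 \<xi> + (\<Sum>j<J. \<phi> (\<xi> /\<^sub>R 2 ^ Suc j))"
  unfolding lessThan_Suc_atMost[symmetric] by (subst sum.lessThan_Suc_shift) (simp add: lp_cutoff_def)
 ultimately show ?thesis by simp
qed
section \<open>Kernels of the localized operators\<close>

lemma jbracket_lp_support:
 assumes "cutoff k n \<noteq> 0"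
 shows "jbracket n \<le> 3 * 2 ^ k" "2 ^ k \<le> 2 * jbracket n"
proof -
 note s = lp_cutoff_support[OF assms]
 have "(1::real) \<le> 2 ^ k" by simp
 then show "jbracket n \<le> 3 * 2 ^ k" using jbracket_le[of n] s(1) by linarith
 show "2 ^ k \<le> 2 * jbracket n"
 proof (cases "k = 0")
  case True
  then show ?thesis using jbracket_ge_1[of n] by simp
 next
  case False
  then show ?thesis using s(2) norm_le_jbracket[of n] by linarith
 qed
qed

text \<open>The multiplier that takes the part of scale \<open>k\<close> of the input to the part of scale \<open>j\<close> of the output by
 the shift \<open>\<nu>\<close> of the frequency.\<close>

definition piece ::
  "(real ^ 'd \<Rightarrow> int ^ 'd \<Rightarrow> complex) \<Rightarrow>
   nat \<Rightarrow> nat \<Rightarrow> int ^ 'd \<Rightarrow> int ^ 'd \<Rightarrow> complex" where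
 "piece a j k \<nu> n =
   cutoff k n * cutoff j (n + \<nu>) * symb_coeff a \<nu> n"

text \<open>If both cutoffs are active then \<open>\<nu>\<close> is at least of size \<open>2\<^bsup>|j - k|\<^esup>\<close>, by Peetre's inequality.
 The rapid decay in \<open>\<nu>\<close> then pays for the distance of the scales and for the differences that
 hit the cutoff at the wrong scale \<open>j\<close>.\<close>

lemma piece_diff_bound:
 fixes a :: "real ^ 'd \<Rightarrow> int ^ 'd \<Rightarrow> complex"
 assumes a: "a \<in> symbols m"
 shows "\<exists>C\<ge>0. \<forall>j k \<nu> n i. \<forall>\<beta>\<le>K. norm ((forward_diff i ^^ \<beta>) (piece a j k \<nu>) n) \<le>
  C * 2 powr (real k * m) / (2 ^ k) ^ \<beta> / (2 ^ scale_dist j k) ^ D / jbracket \<nu> ^ (2 * CARD('d))"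
proof -
 let ?f = "\<lambda>j n. cutoff j n"
 have "\<forall>\<beta>. \<exists>C\<ge>0. \<forall>j i n. norm ((forward_diff i ^^ \<beta>) (?f j) n) \<le> C / (2 ^ j) ^ \<beta>"
  using lp_cutoff_diff_bound by blast
 then obtain c1 where c1: "\<And>\<beta>. c1 \<beta> \<ge> 0" "\<And>\<beta> j i n. norm ((forward_diff i ^^ \<beta>) (?f j) n) \<le> c1 \<beta> / (2 ^ j) ^ \<beta>" by metis
 define C1 where "C1 = (\<Sum>\<beta>\<le>K. c1 \<beta>)"
 have C1: "C1 \<ge> 0" "norm ((forward_diff i ^^ \<beta>) (?f j) n) \<le> C1 * (1 / 2 ^ j) ^ \<beta>" if "\<beta> \<le> K" for \<beta> j i n
 proof -
  show "C1 \<ge> 0" unfolding C1_def using c1(1) by (intro sum_nonneg) auto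
  have "c1 \<beta> \<le> C1" unfolding C1_def using c1(1) that by (intro member_le_sum) auto
  then have "c1 \<beta> / (2 ^ j) ^ \<beta> \<le> C1 / (2 ^ j) ^ \<beta>" by (intro divide_right_mono) auto
  then show "norm ((forward_diff i ^^ \<beta>) (?f j) n) \<le> C1 * (1 / 2 ^ j) ^ \<beta>"
   using c1(2)[where \<beta> = \<beta> and j = j and i = i and n = n] by (simp add: power_one_over)
 qed
 \<comment> \<open>Decay of order \<open>2 * CARD('d)\<close> is kept for the sum over \<open>\<nu>\<close>, \<open>D\<close> is gained for the scales, and \<open>K\<close> pays for the differences.\<close>
 define M where "M = 2 * CARD('d) + (D + K)"
 have "\<forall>i \<beta>. \<exists>C\<ge>0. \<forall>\<nu> n. norm ((forward_diff i ^^ \<beta>) (symb_coeff a \<nu>) n) \<le> C * jbracket n powr (m - real \<beta>) / jbracket \<nu> ^ M"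
  using symb_coeff_bound[OF a] by blast
 then obtain c2 where c2: "\<And>i \<beta>. c2 i \<beta> \<ge> 0"
  "\<And>i \<beta> \<nu> n. norm ((forward_diff i ^^ \<beta>) (symb_coeff a \<nu>) n) \<le> c2 i \<beta> * jbracket n powr (m - real \<beta>) / jbracket \<nu> ^ M" by metis
 define C2 where "C2 = (\<Sum>p\<in>UNIV \<times> {..K}. c2 (fst p) (snd p))"
 have C2: "C2 \<ge> 0" unfolding C2_def using c2(1) by (intro sum_nonneg) auto
 have c2_le: "c2 i \<beta> \<le> C2" if "\<beta> \<le> K" for i \<beta>
  unfolding C2_def using c2(1) that member_le_sum[of "(i, \<beta>)" "UNIV \<times> {..K}" "\<lambda>p. c2 (fst p) (snd p)"] by simp
 \<comment> \<open>Up to this factor, \<open>jbracket\<close> is \<open>2 ^ k\<close> at all points of the line within \<open>K\<close> steps of the support.\<close>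
 define c where "c = 6 * (1 + real K)"
 have c: "c \<ge> 6" by (simp add: c_def)
 define E where "E = \<bar>m\<bar> + real K"
 define C where "C = C1 * C1 * (C2 * c powr E) * 4 ^ K * 12 ^ (D + K)"
 have C: "C \<ge> 0" unfolding C_def using C1(1)[of 0] C2 by simp
 have main: "norm ((forward_diff i ^^ \<beta>) (piece a j k \<nu>) n) \<le>
   C * 2 powr (real k * m) / (2 ^ k) ^ \<beta> / (2 ^ scale_dist j k) ^ D / jbracket \<nu> ^ (2 * CARD('d))"
  if \<beta>: "\<beta> \<le> K" for j k \<nu> n i \<beta>
 proof -
  let ?q = "(2::real) ^ scale_dist j k"
  define u v w where "u = line i (?f k) n" and "v = line i (?f j) (n + \<nu>)" and "w = line i (symb_coeff a \<nu>) n"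
  have lin: "line i (piece a j k \<nu>) n = (\<lambda>s. u s * v s * w s)"
   by (simp add: fun_eq_iff line_def piece_def u_def v_def w_def ac_simps)
  show ?thesis
  proof (cases "\<exists>s\<le>K. u s * v s \<noteq> 0")
   case False
   have "(seq_diff ^^ \<beta>) (\<lambda>s. u s * v s * w s) 0 = 0"
    by (rule seq_diff_zero) (use False \<beta> in auto)
   then show ?thesis unfolding forward_diff_eq_seq_diff lin using C by simp
  next
   case True
   then obtain s0 where s0: "s0 \<le> K" "u s0 \<noteq> 0" "v s0 \<noteq> 0" by auto
   define n0 where "n0 = n + axis i (int s0)"
   have n0: "jbracket n0 \<le> 3 * 2 ^ k" "2 ^ k \<le> 2 * jbracket n0"
    using jbracket_lp_support[of k n0] s0(2) by (auto simp: u_def line_def n0_def)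
   have v0: "jbracket (n0 + \<nu>) \<le> 3 * 2 ^ j" "2 ^ j \<le> 2 * jbracket (n0 + \<nu>)"
    using jbracket_lp_support[of j "n0 + \<nu>"] s0(3) by (auto simp: v_def line_def n0_def ac_simps)
   have nb: "2 ^ k / c \<le> jbracket (n + axis i (int s))" "jbracket (n + axis i (int s)) \<le> c * 2 ^ k" if s: "s \<le> K" for s
   proof -
    let ?n = "n + axis i (int s)"
    let ?d = "axis i (int s - int s0) :: int ^ 'd"
    have "?n = n0 + ?d" "n0 = ?n + - ?d" by (auto simp: n0_def vec_eq_iff axis_def)
    then have 1: "jbracket ?n \<le> 2 * jbracket n0 * jbracket ?d" "jbracket n0 \<le> 2 * jbracket ?n * jbracket ?d"
     using jbracket_add_le[of n0 ?d] jbracket_add_le[of ?n "- ?d"] by (simp_all only: jbracket_uminus)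
    have "jbracket ?d \<le> 1 + real K"
    proof -
     have "jbracket ?d \<le> 1 + \<bar>real_of_int (int s - int s0)\<bar>"
      using jbracket_le[of ?d] by (simp only: real_vec_axis_int norm_axis_real)
     also have "\<dots> \<le> 1 + real K" using s s0(1) by simp
     finally show ?thesis .
    qed
    then have d: "jbracket n0 * jbracket ?d \<le> jbracket n0 * (1 + real K)" "jbracket ?n * jbracket ?d \<le> jbracket ?n * (1 + real K)"
     by (auto intro!: mult_left_mono simp: less_imp_le)
    have "jbracket n0 * (1 + real K) \<le> (3 * 2 ^ k) * (1 + real K)" using n0(1) by (intro mult_right_mono) auto
    then show "jbracket ?n \<le> c * 2 ^ k" using 1(1) d(1) by (simp add: c_def algebra_simps)
    have "2 ^ k \<le> 4 * (jbracket ?n * (1 + real K))" using 1(2) d(2) n0(2) by linarith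
    also have "\<dots> \<le> jbracket ?n * c"
    proof -
     have "jbracket ?n * c = 6 * (jbracket ?n * (1 + real K))" by (simp add: c_def)
     moreover have "0 \<le> jbracket ?n * (1 + real K)" by (simp add: less_imp_le)
     ultimately show ?thesis by linarith
    qed
    finally show "2 ^ k / c \<le> jbracket ?n" using c by (simp add: pos_divide_le_eq)
   qed
   have \<nu>: "?q \<le> 12 * jbracket \<nu>"
   proof -
    have 1: "jbracket (n0 + \<nu>) \<le> 2 * jbracket n0 * jbracket \<nu>" by (rule jbracket_add_le)
    have 2: "jbracket n0 \<le> 2 * jbracket (n0 + \<nu>) * jbracket \<nu>" using jbracket_add_le[of "n0 + \<nu>" "- \<nu>"] by simp
    have "2 ^ j \<le> 2 ^ k * (12 * jbracket \<nu>)"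
    proof -
     have "jbracket n0 * jbracket \<nu> \<le> 3 * 2 ^ k * jbracket \<nu>" using n0(1) by (intro mult_right_mono) (auto simp: less_imp_le)
     then show ?thesis using v0(2) 1 by linarith
    qed
    moreover have "2 ^ k \<le> 2 ^ j * (12 * jbracket \<nu>)"
    proof -
     have "jbracket (n0 + \<nu>) * jbracket \<nu> \<le> 3 * 2 ^ j * jbracket \<nu>" using v0(1) by (intro mult_right_mono) (auto simp: less_imp_le)
     then show ?thesis using n0(2) 2 by linarith
    qed
    moreover have "?q * 2 ^ k = 2 ^ j \<or> ?q * 2 ^ j = 2 ^ k"
     unfolding power_add[symmetric] by (cases "j \<le> k") (auto simp: scale_dist_def)
    ultimately have "?q * 2 ^ k \<le> (12 * jbracket \<nu>) * 2 ^ k \<or> ?q * 2 ^ j \<le> (12 * jbracket \<nu>) * 2 ^ j"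
     by (metis mult.commute)
    then show ?thesis
     using mult_right_le_imp_le[of ?q "2 ^ k" "12 * jbracket \<nu>"] mult_right_le_imp_le[of ?q "2 ^ j" "12 * jbracket \<nu>"]
      zero_less_power[of "2::real"] by fastforce
   qed
   define A where "A = C2 * c powr E * 2 powr (real k * m) / jbracket \<nu> ^ M"
   have A: "A \<ge> 0" unfolding A_def using C2 by (simp add: less_imp_le)
   \<comment> \<open>All three factors are smooth at the scale \<open>1 / R\<close>, since \<open>2 ^ k \<le> 2 ^ j * ?q\<close>.\<close>
   define R where "R = ?q / 2 ^ k"
   have R: "0 \<le> R" "1 / 2 ^ k \<le> R" "1 / 2 ^ j \<le> R"
    unfolding R_def using scale_dist_le(2)[of k j] by (auto simp: field_simps)
   have "diff_bound K C1 (1 / 2 ^ k) u"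
    unfolding diff_bound_def u_def line_forward_diff[symmetric] using C1(2) by (auto simp: line_def)
   then have u: "diff_bound K C1 R u" by (rule diff_bound_mono) (use R C1(1)[of 0] in auto)
   have "diff_bound K C1 (1 / 2 ^ j) v"
    unfolding diff_bound_def v_def line_forward_diff[symmetric] using C1(2) by (auto simp: line_def)
   then have v: "diff_bound K C1 R v" by (rule diff_bound_mono) (use R C1(1)[of 0] in auto)
   have "diff_bound K A (1 / 2 ^ k) w"
    unfolding diff_bound_def w_def line_forward_diff[symmetric]
   proof (intro allI impI)
    fix \<beta> s assume bs: "\<beta> + s \<le> K"
    let ?n = "n + axis i (int s)"
    have "norm ((forward_diff i ^^ \<beta>) (symb_coeff a \<nu>) ?n) \<le> c2 i \<beta> * jbracket ?n powr (m - real \<beta>) / jbracket \<nu> ^ M"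
     by (rule c2)
    also have "\<dots> \<le> C2 * (c powr E * 2 powr (real k * (m - real \<beta>))) / jbracket \<nu> ^ M"
    proof (intro divide_right_mono mult_mono)
     show "c2 i \<beta> \<le> C2" using bs by (intro c2_le) simp
     show "jbracket ?n powr (m - real \<beta>) \<le> c powr E * 2 powr (real k * (m - real \<beta>))"
      using nb[of s] bs c by (intro powr_comparable) (auto simp: E_def)
    qed (use C2 in \<open>auto simp: less_imp_le\<close>)
    also have "2 powr (real k * (m - real \<beta>)) = 2 powr (real k * m) * (1 / 2 ^ k) ^ \<beta>"
    proof -
     have "2 powr (real k * (m - real \<beta>)) = 2 powr (real k * m) / 2 powr (real (k * \<beta>))"
      by (simp add: right_diff_distrib powr_diff)
     also have "2 powr (real (k * \<beta>)) = (2::real) ^ (k * \<beta>)" by (simp only: powr_realpow zero_less_numeral)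
     finally show ?thesis by (simp add: power_mult power_one_over)
    qed
    also have "C2 * (c powr E * (2 powr (real k * m) * (1 / 2 ^ k) ^ \<beta>)) / jbracket \<nu> ^ M = A * (1 / 2 ^ k) ^ \<beta>"
     by (simp add: A_def)
    finally show "norm (line i ((forward_diff i ^^ \<beta>) (symb_coeff a \<nu>)) n s) \<le> A * (1 / 2 ^ k) ^ \<beta>" by (simp add: line_def)
   qed
   then have w: "diff_bound K A (2 * R) w" by (rule diff_bound_mono) (use R A in auto)
   have "diff_bound K (C1 * C1 * A) (2 * (2 * R)) (\<lambda>s. u s * v s * w s)"
    using C1(1)[of 0] A R by (intro diff_bound_mult u v w) auto
   then have "norm ((forward_diff i ^^ \<beta>) (piece a j k \<nu>) n) \<le> C1 * C1 * A * (2 * (2 * R)) ^ \<beta>"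
    unfolding forward_diff_eq_seq_diff lin using \<beta> by (simp add: diff_bound_def)
   also have "\<dots> = C1 * C1 * A * (4 ^ \<beta> * ?q ^ \<beta>) / (2 ^ k) ^ \<beta>"
   proof -
    have "2 * (2 * R) = 4 * ?q / 2 ^ k" by (simp add: R_def)
    then show ?thesis by (simp only: power_divide power_mult_distrib times_divide_eq_right)
   qed
   also have "\<dots> \<le> C1 * C1 * A * (4 ^ K * ?q ^ K) / (2 ^ k) ^ \<beta>"
    using C1(1)[of 0] A \<beta> by (intro divide_right_mono mult_left_mono mult_mono power_increasing) auto
   also have "\<dots> \<le> C1 * C1 * (C2 * c powr E * 2 powr (real k * m) * (12 ^ (D + K) / ?q ^ (D + K)) / jbracket \<nu> ^ (2 * CARD('d))) * (4 ^ K * ?q ^ K) / (2 ^ k) ^ \<beta>"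
   proof (intro divide_right_mono mult_right_mono mult_left_mono)
    have "?q ^ (D + K) \<le> (12 * jbracket \<nu>) ^ (D + K)" by (intro power_mono \<nu>) auto
    then have "1 / jbracket \<nu> ^ (D + K) \<le> 12 ^ (D + K) / ?q ^ (D + K)"
     by (simp add: power_mult_distrib field_simps)
    then have "C2 * c powr E * 2 powr (real k * m) * (1 / jbracket \<nu> ^ (D + K)) / jbracket \<nu> ^ (2 * CARD('d)) \<le>
      C2 * c powr E * 2 powr (real k * m) * (12 ^ (D + K) / ?q ^ (D + K)) / jbracket \<nu> ^ (2 * CARD('d))"
     using C2 by (intro divide_right_mono mult_left_mono) (auto simp: less_imp_le)
    moreover have "A = C2 * c powr E * 2 powr (real k * m) * (1 / jbracket \<nu> ^ (D + K)) / jbracket \<nu> ^ (2 * CARD('d))"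
     by (simp add: A_def M_def power_add mult.commute)
    ultimately show "A \<le> C2 * c powr E * 2 powr (real k * m) * (12 ^ (D + K) / ?q ^ (D + K)) / jbracket \<nu> ^ (2 * CARD('d))" by simp
   qed (use C1(1)[of 0] in auto)
   also have "\<dots> = C * 2 powr (real k * m) / (2 ^ k) ^ \<beta> / ?q ^ D / jbracket \<nu> ^ (2 * CARD('d))"
    by (simp add: C_def power_add[of ?q] mult_ac)
   finally show ?thesis .
  qed
 qed
 then show ?thesis using C by blast
qed

lemma piece_kernel_bound:
 fixes a :: "real ^ 'd \<Rightarrow> int ^ 'd \<Rightarrow> complex"
 assumes a: "a \<in> symbols m"
 shows "\<exists>C\<ge>0. \<forall>j k \<nu> y. norm (trig_sum (piece a j k \<nu>) y) \<le>
  C * 2 powr (real k * m) / (2 ^ scale_dist j k) ^ D / jbracket \<nu> ^ (2 * CARD('d)) * ((2 ^ k) ^ CARD('d) / (1 + 2 ^ k * rho y) ^ K)"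
proof -
 obtain C where C: "C \<ge> 0" "\<And>j k \<nu> n i \<beta>. \<beta> \<le> K \<Longrightarrow> norm ((forward_diff i ^^ \<beta>) (piece a j k \<nu>) n) \<le>
  C * 2 powr (real k * m) / (2 ^ k) ^ \<beta> / (2 ^ scale_dist j k) ^ D / jbracket \<nu> ^ (2 * CARD('d))"
  using piece_diff_bound[OF a, of K D] by blast
 define C' where "C' = (real CARD('d) + 1) ^ (K + 1) * (5 + 2 * real K) ^ CARD('d)"
 have "norm (trig_sum (piece a j k \<nu>) y) \<le>
  (C' * C) * 2 powr (real k * m) / (2 ^ scale_dist j k) ^ D / jbracket \<nu> ^ (2 * CARD('d)) * ((2 ^ k) ^ CARD('d) / (1 + 2 ^ k * rho y) ^ K)" for j k \<nu> y
 proof -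
  let ?B = "C * 2 powr (real k * m) / (2 ^ scale_dist j k) ^ D / jbracket \<nu> ^ (2 * CARD('d))"
  have "norm (trig_sum (piece a j k \<nu>) y) \<le>
   (real CARD('d) + 1) ^ (K + 1) * (5 + 2 * real K) ^ CARD('d) * ?B * ((2 ^ k) ^ CARD('d) / (1 + 2 ^ k * rho y) ^ K)"
  proof (rule trig_sum_decay[where R = "2 * 2 ^ k"])
   show "piece a j k \<nu> n = 0" if "norm (real_vec n) > 2 * 2 ^ k" for n
    using lp_cutoff_support(1)[of k "real_vec n"] that by (auto simp: piece_def not_less[symmetric])
   show "norm (piece a j k \<nu> n) \<le> ?B" for n using C(2)[where \<beta> = 0] by simp
   show "norm ((forward_diff i ^^ K) (piece a j k \<nu>) n) \<le> ?B / (2 ^ k) ^ K" for n i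
    using C(2)[where \<beta> = K and i = i and n = n and j = j and k = k and \<nu> = \<nu>] by (simp add: mult_ac)
   show "(2 * (2 * 2 ^ k + real K) + 1) ^ CARD('d) \<le> (5 + 2 * real K) ^ CARD('d) * (2 ^ k) ^ CARD('d)" by (rule ball_count)
  qed simp
  then show ?thesis by (simp add: C'_def mult_ac)
 qed
 moreover have "C' * C \<ge> 0" using C(1) by (simp add: C'_def)
 ultimately show ?thesis by blast
qed

lemma cutoff_kernel_bound:
 shows "\<exists>C\<ge>0. \<forall>k y. norm (trig_sum (cutoff k) y) \<le>
  C * ((2 ^ k) ^ CARD('d) / (1 + 2 ^ k * rho y) ^ K)"
proof -
 obtain c0 where c0: "c0 \<ge> 0" "\<And>j i n. norm ((forward_diff i ^^ 0) (cutoff j) n) \<le> c0 / (2 ^ j) ^ 0"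
  using lp_cutoff_diff_bound[of 0] by blast
 obtain c1 where c1: "c1 \<ge> 0" "\<And>j i n. norm ((forward_diff i ^^ K) (cutoff j) n) \<le> c1 / (2 ^ j) ^ K"
  using lp_cutoff_diff_bound[of K] by blast
 have "norm (trig_sum (cutoff k) y) \<le>
  (real CARD('d) + 1) ^ (K + 1) * (5 + 2 * real K) ^ CARD('d) * (c0 + c1) * ((2 ^ k) ^ CARD('d) / (1 + 2 ^ k * rho y) ^ K)" for k y
 proof (rule trig_sum_decay[where R = "2 * 2 ^ k"])
  show "cutoff k n = 0" if "norm (real_vec n) > 2 * 2 ^ k" for n
   using lp_cutoff_support(1)[of k "real_vec n"] that by (auto simp: not_less[symmetric])
  show "norm (cutoff k n) \<le> c0 + c1" for n using c0(2)[of undefined k n] c1(1) by simp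
  have "c1 / (2 ^ k) ^ K \<le> (c0 + c1) / (2 ^ k) ^ K" using c0(1) by (intro divide_right_mono) auto
  then show "norm ((forward_diff i ^^ K) (cutoff k) n) \<le> (c0 + c1) / (2 ^ k) ^ K" for n i
   using c1(2)[of i k n] by linarith
  show "(2 * (2 * 2 ^ k + real K) + 1) ^ CARD('d) \<le> (5 + 2 * real K) ^ CARD('d) * (2 ^ k) ^ CARD('d)" by (rule ball_count)
 qed simp
 moreover have "(real CARD('d) + 1) ^ (K + 1) * (5 + 2 * real K) ^ CARD('d) * (c0 + c1) \<ge> 0" using c0(1) c1(1) by simp
 ultimately show ?thesis by blast
qed

section \<open>Almost diagonal decomposition of the operator\<close>

definition block ::
  "nat \<Rightarrow> (int ^ 'd \<Rightarrow> complex) \<Rightarrow> real ^ 'd \<Rightarrow> complex" where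
 "block l c = trig_sum (\<lambda>n. cutoff l n * c n)"

abbreviation amp :: "nat \<Rightarrow> (int ^ 'd \<Rightarrow> complex) \<Rightarrow> real ^ 'd \<Rightarrow> real" where
 "amp l c x \<equiv> norm (block l c x)"

abbreviation wamp :: "nat \<Rightarrow> nat \<Rightarrow> (int ^ 'd \<Rightarrow> complex) \<Rightarrow> real ^ 'd \<Rightarrow> real" where
 "wamp K l c \<equiv> wavg K l (amp l c)"

lemma lp_block_eq: "lp_block \<phi>0 \<phi> l f = block l (dist_coeff f)"
 by (simp add: fun_eq_iff lp_block_def block_def trig_sum_def)

lemma lp_cutoff_outside:
 assumes "n \<notin> freq_ball R" "2 * 2 ^ l \<le> R"
 shows "cutoff l n = 0"
proof (rule ccontr)
 assume "cutoff l n \<noteq> 0"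
 from lp_cutoff_support(1)[OF this] show False using assms by (simp add: freq_ball_def)
qed

lemma block_eq_sum: "block l c x = (\<Sum>n\<in>freq_ball (2 * 2 ^ l). cutoff l n * c n * exp_fun n x)"
 unfolding block_def by (rule trig_sum_finite) (auto simp: lp_cutoff_outside)

lemma continuous_block: "continuous_on A (block l c)"
 unfolding block_def
 by (rule trig_sum_continuous[of "freq_ball (2 * 2 ^ l)"]) (auto simp: lp_cutoff_outside)

text \<open>Equal to one on the support of the cutoff \<open>l\<close>, hence the multiplier of a reproducing formula.\<close>

definition fat_cutoff ::
  "nat \<Rightarrow> int ^ 'd \<Rightarrow> complex" where
 "fat_cutoff l n = (\<Sum>k\<in>{l - 2..l + 2}. cutoff k n)"

lemma fat_cutoff_eq_1:
 assumes nz: "cutoff l n \<noteq> 0"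
 shows "fat_cutoff l n = 1"
proof -
 have n: "norm (real_vec n) \<le> 2 * 2 ^ l" by (rule lp_cutoff_support(1)[OF nz])
 have "2 * 2 ^ l < (2::real) ^ (l + 2)" by (simp add: power_add)
 then have "norm (real_vec n) < 2 ^ (l + 2)" using n by linarith
 from lp_cutoff_sum[OF this] have "(\<Sum>k\<le>l + 2. cutoff k n) = 1" .
 moreover have "(\<Sum>k\<le>l + 2. cutoff k n) = fat_cutoff l n"
  unfolding fat_cutoff_def
 proof (rule sum.mono_neutral_right)
  show "\<forall>k\<in>{..l + 2} - {l - 2..l + 2}. cutoff k n = 0"
  proof
   fix k assume "k \<in> {..l + 2} - {l - 2..l + 2}"
   then have k: "k + 3 \<le> l" by auto
   show "cutoff k n = 0"
   proof (rule ccontr)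
    assume "cutoff k n \<noteq> 0"
    then have "norm (real_vec n) \<le> 2 * 2 ^ k" by (rule lp_cutoff_support(1))
    moreover have "2 ^ l / 2 \<le> norm (real_vec n)" using k by (intro lp_cutoff_support(2)[OF nz]) auto
    moreover have "(2::real) ^ (k + 3) \<le> 2 ^ l" using k by (intro power_increasing) auto
    then have "8 * (2::real) ^ k \<le> 2 ^ l" by (simp add: power_add)
    ultimately have "8 * (2::real) ^ k \<le> 4 * 2 ^ k" by linarith
    then show False by simp
   qed
  qed
 qed auto
 ultimately show ?thesis by simp
qed

text \<open>Five kernels of neighbouring scales, each comparable to scale \<open>l\<close>.\<close>

lemma fat_kernel_bound:
 shows "\<exists>C>0. \<forall>l y. norm (trig_sum (fat_cutoff l) y) \<le> C * ((2 ^ l) ^ CARD('d) / (1 + 2 ^ l * rho y) ^ K)"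
proof -
 obtain C where C: "C \<ge> 0" "\<And>k y. norm (trig_sum (cutoff k) y) \<le>
  C * ((2 ^ k) ^ CARD('d) / (1 + 2 ^ k * rho y) ^ K)" using cutoff_kernel_bound by blast
 have "norm (trig_sum (fat_cutoff l) y) \<le> (5 * (C + 1) * 4 ^ (CARD('d) + K)) * ((2 ^ l) ^ CARD('d) / (1 + 2 ^ l * rho y) ^ K)" for l y
 proof -
  let ?W = "(2 ^ l) ^ CARD('d) / (1 + 2 ^ l * rho y) ^ K"
  have W: "?W \<ge> 0" using rho_weight_pos[of l y] by (intro divide_nonneg_nonneg zero_le_power) auto
  have "trig_sum (\<lambda>n. \<Sum>k\<in>{l - 2..l + 2}. 1 * cutoff k n) y =
    (\<Sum>k\<in>{l - 2..l + 2}. 1 * trig_sum (cutoff k) y)"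
  proof (rule trig_sum_sum[of "freq_ball (2 * 2 ^ (l + 2))"])
   fix k and n :: "int ^ 'd" assume "k \<in> {l - 2..l + 2}" "n \<notin> freq_ball (2 * 2 ^ (l + 2))"
   moreover have "(2::real) ^ k \<le> 2 ^ (l + 2)" using \<open>k \<in> {l - 2..l + 2}\<close> by (intro power_increasing) auto
   ultimately show "cutoff k n = 0" by (intro lp_cutoff_outside) auto
  qed simp
  then have "trig_sum (fat_cutoff l) y = (\<Sum>k\<in>{l - 2..l + 2}. trig_sum (cutoff k) y)"
   unfolding fat_cutoff_def[abs_def] by (simp only: mult_1)
  then have "norm (trig_sum (fat_cutoff l) y) \<le> (\<Sum>k\<in>{l - 2..l + 2}. norm (trig_sum (cutoff k) y))"
   by (simp only: norm_sum)
  also have "\<dots> \<le> (\<Sum>k\<in>{l - 2..l + 2}. C * (4 ^ (CARD('d) + K) * ?W))"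
   by (rule sum_mono, rule order_trans[OF C(2)]) (intro mult_left_mono near_scale_weight C(1))
  also have "\<dots> = real (card {l - 2..l + 2}) * (C * (4 ^ (CARD('d) + K) * ?W))" by simp
  also have "\<dots> \<le> 5 * ((C + 1) * (4 ^ (CARD('d) + K) * ?W))"
   using C(1) W by (intro mult_mono mult_right_mono) auto
  finally show ?thesis by (simp only: mult.assoc)
 qed
 then show ?thesis using C(1) by (intro exI[of _ "5 * (C + 1) * 4 ^ (CARD('d) + K)"]) auto
qed

lemma fat_cutoff_outside:
 assumes "n \<notin> freq_ball (2 * 2 ^ (l + 2))"
 shows "fat_cutoff l n = 0"
 unfolding fat_cutoff_def
proof (rule sum.neutral, rule ballI)
 fix k assume "k \<in> {l - 2..l + 2}"
 then have "(2::real) ^ k \<le> 2 ^ (l + 2)" by (intro power_increasing) auto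
 then show "cutoff k n = 0" by (intro lp_cutoff_outside[OF assms]) auto
qed

text \<open>A product of multipliers is a convolution of kernels; the factor \<open>(2 * pi) ^ CARD('d)\<close> is dropped.\<close>

lemma block_convolution:
 assumes G: "\<And>n. n \<notin> freq_ball (2 * 2 ^ (l + 2)) \<Longrightarrow> G n = 0"
 shows "norm (trig_sum (\<lambda>n. cutoff l n * c n * G n) y) \<le>
  norm (torus_integral (\<lambda>z. block l c z * trig_sum G (y - z)))"
proof -
 have "trig_sum (\<lambda>n. cutoff l n * c n * G n) y =
   torus_integral (\<lambda>z. block l c z * trig_sum G (y - z)) / (2 * pi) ^ CARD('d)"
  unfolding block_def
 proof (rule multiplier_eq_convolution[of "freq_ball (2 * 2 ^ (l + 2))"])
  have "(2::real) ^ l \<le> 2 ^ (l + 2)" by (intro power_increasing) auto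
  then show "cutoff l n * c n = 0" if "n \<notin> freq_ball (2 * 2 ^ (l + 2))" for n
   using lp_cutoff_outside[OF that, of l] by simp
 qed (use G in auto)
 then have "norm (trig_sum (\<lambda>n. cutoff l n * c n * G n) y) =
   norm (torus_integral (\<lambda>z. block l c z * trig_sum G (y - z))) / (2 * pi) ^ CARD('d)"
  by (simp add: norm_divide norm_power norm_mult)
 also have "\<dots> \<le> norm (torus_integral (\<lambda>z. block l c z * trig_sum G (y - z))) / 1"
  by (rule divide_left_mono) (use two_pi_power_ge_1[of "CARD('d)"] in auto)
 finally show ?thesis by simp
qed

text \<open>The fat cutoff provides the reproducing formula.\<close>

lemma wavg_block_power:
 assumes r: "0 < r" "r \<le> 1" "real CARD('d) + 1 \<le> real K * r"
 shows "\<exists>C>0. \<forall>l c x. wamp K l c x powr r \<le>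
  C * kernel_op torus (avg_kernel l) (\<lambda>z. amp l c z powr r) x"
proof -
 obtain B where B: "B > 0" "\<And>l y. norm (trig_sum (fat_cutoff l) y) \<le> B * ((2 ^ l) ^ CARD('d) / (1 + 2 ^ l * rho y) ^ K)"
  using fat_kernel_bound by blast
 have "wamp K l c x powr r \<le>
  B powr (1 - r) / avg_const TYPE('d) * kernel_op torus (avg_kernel l) (\<lambda>z. amp l c z powr r) x" for l c x
 proof (rule wavg_power_le[OF continuous_block _ B(2) _ r B(1)])
  show "continuous_on UNIV (trig_sum (fat_cutoff l))"
   by (rule trig_sum_continuous[OF finite_freq_ball fat_cutoff_outside])
  show "amp l c y \<le> norm (torus_integral (\<lambda>z. block l c z * trig_sum (fat_cutoff l) (y - z)))" for y
  proof -
   have "(\<lambda>n. cutoff l n * c n * fat_cutoff l n) = (\<lambda>n. cutoff l n * c n)"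
    using fat_cutoff_eq_1 by (intro ext) (metis mult_1_right mult_zero_left)
   moreover have "norm (trig_sum (\<lambda>n. cutoff l n * c n * fat_cutoff l n) y) \<le>
     norm (torus_integral (\<lambda>z. block l c z * trig_sum (fat_cutoff l) (y - z)))"
    by (rule block_convolution) (rule fat_cutoff_outside)
   ultimately show ?thesis by (simp only: block_def)
  qed
 qed
 then show ?thesis using B(1) avg_const_pos[where 'd = 'd] by (intro exI[of _ "B powr (1 - r) / avg_const TYPE('d)"]) auto
qed

text \<open>At a fixed point \<open>x\<close>, the operator followed by the output cutoff \<open>j\<close> multiplies the exponential of
 frequency \<open>n\<close> by this number.\<close>

definition out_symbol ::
  "(real ^ 'd \<Rightarrow> int ^ 'd \<Rightarrow> complex) \<Rightarrow>
   nat \<Rightarrow> real ^ 'd \<Rightarrow> int ^ 'd \<Rightarrow> complex" where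
 "out_symbol a j x n =
   (\<Sum>k\<in>freq_ball (2 * 2 ^ j). cutoff j k * symb_coeff a (k - n) n * exp_fun (k - n) x)"

definition local_op ::
  "(real ^ 'd \<Rightarrow> int ^ 'd \<Rightarrow> complex) \<Rightarrow>
   nat \<Rightarrow> nat \<Rightarrow> (int ^ 'd \<Rightarrow> complex) \<Rightarrow> real ^ 'd \<Rightarrow> complex" where
 "local_op a j l c x = trig_sum (\<lambda>n. cutoff l n * c n * out_symbol a j x n) x"

text \<open>The substitution \<open>k = n + \<nu>\<close>. The cutoffs confine \<open>\<nu>\<close> to a finite set.\<close>

lemma fat_out_symbol:
 shows "fat_cutoff l n * out_symbol a j x n =
  (\<Sum>p\<in>{l - 2..l + 2} \<times> freq_ball (2 * 2 ^ j + 2 * 2 ^ (l + 2)). exp_fun (snd p) x * piece a j (fst p) (snd p) n)"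
proof -
 let ?V = "freq_ball (2 * 2 ^ j + 2 * 2 ^ (l + 2)) :: (int ^ 'd) set"
 have one: "cutoff k n * out_symbol a j x n = (\<Sum>\<nu>\<in>?V. exp_fun \<nu> x * piece a j k \<nu> n)"
  if k: "k \<in> {l - 2..l + 2}" for k
 proof (cases "cutoff k n = 0")
  case True
  then show ?thesis by (simp add: piece_def)
 next
  case False
  have "(2::real) ^ k \<le> 2 ^ (l + 2)" using k by (intro power_increasing) auto
  then have n: "norm (real_vec n) \<le> 2 * 2 ^ (l + 2)" using lp_cutoff_support(1)[OF False] by simp
  let ?h = "\<lambda>\<mu>. cutoff j \<mu> * symb_coeff a (\<mu> - n) n * exp_fun (\<mu> - n) x"
  have "out_symbol a j x n = (\<Sum>\<mu>\<in>(\<lambda>\<nu>. \<nu> + n) ` ?V. ?h \<mu>)"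
   unfolding out_symbol_def
  proof (rule sum.mono_neutral_left)
   show "freq_ball (2 * 2 ^ j) \<subseteq> (\<lambda>\<nu>. \<nu> + n) ` ?V"
   proof
    fix \<mu> :: "int ^ 'd" assume "\<mu> \<in> freq_ball (2 * 2 ^ j)"
    then have "norm (real_vec (\<mu> - n)) \<le> 2 * 2 ^ j + 2 * 2 ^ (l + 2)"
     using n norm_triangle_ineq4[of "real_vec \<mu>" "real_vec n"] by (simp add: freq_ball_def)
    then have "\<mu> - n \<in> ?V" by (simp add: freq_ball_def)
    then have "(\<lambda>\<nu>. \<nu> + n) (\<mu> - n) \<in> (\<lambda>\<nu>. \<nu> + n) ` ?V" by (rule imageI)
    then show "\<mu> \<in> (\<lambda>\<nu>. \<nu> + n) ` ?V" by simp
   qed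
   show "\<forall>\<mu>\<in>(\<lambda>\<nu>. \<nu> + n) ` ?V - freq_ball (2 * 2 ^ j). ?h \<mu> = 0"
   proof
    fix \<mu> assume "\<mu> \<in> (\<lambda>\<nu>. \<nu> + n) ` ?V - freq_ball (2 * 2 ^ j)"
    then have "cutoff j \<mu> = 0" by (intro lp_cutoff_outside) auto
    then show "?h \<mu> = 0" by simp
   qed
  qed simp
  also have "\<dots> = (\<Sum>\<nu>\<in>?V. ?h (\<nu> + n))" by (subst sum.reindex) (auto simp: inj_on_def)
  finally have "cutoff k n * out_symbol a j x n = (\<Sum>\<nu>\<in>?V. cutoff k n * ?h (\<nu> + n))"
   by (simp only: sum_distrib_left)
  then show ?thesis by (simp only: piece_def add.commute[of _ n] add_diff_cancel_left' mult_ac)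
 qed
 have "fat_cutoff l n * out_symbol a j x n = (\<Sum>k\<in>{l - 2..l + 2}. \<Sum>\<nu>\<in>?V. exp_fun \<nu> x * piece a j k \<nu> n)"
  unfolding fat_cutoff_def sum_distrib_right by (intro sum.cong refl one)
 then show ?thesis by (simp only: sum.cartesian_product case_prod_beta')
qed

text \<open>For each fixed \<open>x\<close> this is a Fourier multiplier, evaluated at \<open>x\<close>. Its kernel is a sum of kernels of
 pieces, and the decay in \<open>\<nu>\<close> makes the sum over the shifts converge.\<close>

lemma local_op_bound:
 fixes a :: "real ^ 'd \<Rightarrow> int ^ 'd \<Rightarrow> complex"
 assumes a: "a \<in> symbols m"
 shows "\<exists>C\<ge>0. \<forall>j l c x. norm (local_op a j l c x) \<le>
  C * (2 powr (real l * m) / (2 ^ scale_dist j l) ^ D) * wamp K l c x"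
proof -
 obtain C where C: "C \<ge> 0" "\<And>j k \<nu> y. norm (trig_sum (piece a j k \<nu>) y) \<le>
  C * 2 powr (real k * m) / (2 ^ scale_dist j k) ^ D / jbracket \<nu> ^ (2 * CARD('d)) * ((2 ^ k) ^ CARD('d) / (1 + 2 ^ k * rho y) ^ K)"
  using piece_kernel_bound[OF a] by blast
 define E where "E = C * 2 powr (2 * \<bar>m\<bar>) * 4 ^ D * 4 ^ (CARD('d) + K)"
 have E: "E \<ge> 0" using C(1) by (simp add: E_def)
 define L where "L = lattice_sum TYPE(int ^ 'd)"
 have L: "L \<ge> 0" unfolding L_def lattice_sum_def by (rule infsum_nonneg) (simp add: less_imp_le)
 have "norm (local_op a j l c x) \<le>
  (5 * E * L) * (2 powr (real l * m) / (2 ^ scale_dist j l) ^ D) * wamp K l c x" for j l c x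
 proof -
  define G where "G n = fat_cutoff l n * out_symbol a j x n" for n
  let ?V = "freq_ball (2 * 2 ^ j + 2 * 2 ^ (l + 2)) :: (int ^ 'd) set"
  let ?B = "2 powr (real l * m) / (2 ^ scale_dist j l) ^ D"
  have Gout: "G n = 0" if "n \<notin> freq_ball (2 * 2 ^ (l + 2))" for n
   using fat_cutoff_outside[OF that] by (simp add: G_def)
  have kernel: "norm (trig_sum G y) \<le> (5 * E * L * ?B) * ((2 ^ l) ^ CARD('d) / (1 + 2 ^ l * rho y) ^ K)" for y
  proof -
   let ?W = "(2 ^ l) ^ CARD('d) / (1 + 2 ^ l * rho y) ^ K"
   have W: "?W \<ge> 0" using rho_weight_pos[of l y] by (intro divide_nonneg_nonneg zero_le_power) auto
   have pb: "norm (trig_sum (piece a j k \<nu>) y) \<le> E * ?B * ?W * (1 / jbracket \<nu> ^ (2 * CARD('d)))"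
    if k: "k \<in> {l - 2..l + 2}" for k \<nu>
   proof -
    have kl: "\<bar>real k - real l\<bar> \<le> 2" using k by auto
    have "2 powr (real k * m) \<le> 2 powr (2 * \<bar>m\<bar> + real l * m)"
    proof (rule powr_mono)
     have "(real k - real l) * m \<le> \<bar>real k - real l\<bar> * \<bar>m\<bar>" by (simp add: abs_mult[symmetric])
     also have "\<dots> \<le> 2 * \<bar>m\<bar>" using kl by (intro mult_right_mono) auto
     finally show "real k * m \<le> 2 * \<bar>m\<bar> + real l * m" by (simp add: algebra_simps)
    qed simp
    then have 1: "2 powr (real k * m) \<le> 2 powr (2 * \<bar>m\<bar>) * 2 powr (real l * m)" by (simp add: powr_add)
    have 2: "1 / (2 ^ scale_dist j k) ^ D \<le> (4::real) ^ D / (2 ^ scale_dist j l) ^ D"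
    proof -
     have "scale_dist k l \<le> 2" using k by (auto simp: scale_dist_def)
     then have "scale_dist j l \<le> scale_dist j k + 2" using scale_dist_triangle[of j l k] by linarith
     then have "(2::real) ^ scale_dist j l \<le> 2 ^ (scale_dist j k + 2)" by (intro power_increasing) auto
     then have "((2::real) ^ scale_dist j l) ^ D \<le> (4 * 2 ^ scale_dist j k) ^ D" by (intro power_mono) (auto simp: power_add)
     then have "((2::real) ^ scale_dist j l) ^ D \<le> 4 ^ D * (2 ^ scale_dist j k) ^ D" by (simp only: power_mult_distrib)
     then show ?thesis by (simp add: field_simps)
    qed
    have "norm (trig_sum (piece a j k \<nu>) y) \<le>
      C * (2 powr (real k * m) * (1 / (2 ^ scale_dist j k) ^ D) * (1 / jbracket \<nu> ^ (2 * CARD('d))) * ((2 ^ k) ^ CARD('d) / (1 + 2 ^ k * rho y) ^ K))"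
     using C(2)[of j k \<nu> y] by simp
    also have "\<dots> \<le> C * ((2 powr (2 * \<bar>m\<bar>) * 2 powr (real l * m)) * ((4::real) ^ D / (2 ^ scale_dist j l) ^ D) *
      (1 / jbracket \<nu> ^ (2 * CARD('d))) * (4 ^ (CARD('d) + K) * ?W))"
     using rho_weight_pos[of k y] by (intro mult_left_mono mult_mono 1 2 near_scale_weight[OF k] C(1)) (auto simp: less_imp_le intro!: divide_nonneg_nonneg zero_le_power)
    also have "\<dots> = E * ?B * ?W * (1 / jbracket \<nu> ^ (2 * CARD('d)))" by (simp add: E_def mult_ac)
    finally show ?thesis .
   qed
   have "trig_sum G y = (\<Sum>p\<in>{l - 2..l + 2} \<times> ?V. exp_fun (snd p) x * trig_sum (piece a j (fst p) (snd p)) y)"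
    unfolding G_def[abs_def] fat_out_symbol
   proof (rule trig_sum_sum[OF finite_freq_ball[of "2 * 2 ^ (l + 2)"]])
    fix p and n :: "int ^ 'd" assume "p \<in> {l - 2..l + 2} \<times> ?V" "n \<notin> freq_ball (2 * 2 ^ (l + 2))"
    moreover from this(1) have "(2::real) ^ fst p \<le> 2 ^ (l + 2)" by (intro power_increasing) auto
    ultimately show "piece a j (fst p) (snd p) n = 0" using lp_cutoff_outside[of n _ "fst p"] by (auto simp: piece_def)
   qed
   then have "norm (trig_sum G y) \<le> (\<Sum>p\<in>{l - 2..l + 2} \<times> ?V. norm (trig_sum (piece a j (fst p) (snd p)) y))"
    by (simp only:) (rule sum_norm_le, simp add: norm_mult)
   also have "\<dots> \<le> (\<Sum>p\<in>{l - 2..l + 2} \<times> ?V. E * ?B * ?W * (1 / jbracket (snd p) ^ (2 * CARD('d))))"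
    by (rule sum_mono, rule pb) auto
   also have "\<dots> = real (card {l - 2..l + 2}) * (E * ?B * ?W * (\<Sum>\<nu>\<in>?V. 1 / jbracket \<nu> ^ (2 * CARD('d))))"
    by (simp only: sum.cartesian_product[symmetric] case_prod_beta'[symmetric] sum_distrib_left[symmetric] sum_constant fst_conv snd_conv sum.cartesian_product')
     (simp only: mult_ac)
   also have "\<dots> \<le> 5 * (E * ?B * ?W * L)"
   proof (rule mult_mono)
    have sum_le: "(\<Sum>\<nu>\<in>?V. 1 / jbracket \<nu> ^ (2 * CARD('d))) \<le> L"
     unfolding L_def lattice_sum_def by (rule finite_sum_le_infsum[OF summable_on_jbracket]) (auto simp: less_imp_le)
    have EBW: "0 \<le> E * ?B * ?W" using E W by (intro mult_nonneg_nonneg) auto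
    show "E * ?B * ?W * (\<Sum>\<nu>\<in>?V. 1 / jbracket \<nu> ^ (2 * CARD('d))) \<le> E * ?B * ?W * L"
     by (intro mult_left_mono sum_le EBW)
    show "0 \<le> E * ?B * ?W * (\<Sum>\<nu>\<in>?V. 1 / jbracket \<nu> ^ (2 * CARD('d)))"
     by (intro mult_nonneg_nonneg[OF EBW] sum_nonneg) (simp add: less_imp_le)
   qed auto
   finally show ?thesis by (simp add: mult_ac)
  qed
  have cG: "continuous_on UNIV (trig_sum G)" by (rule trig_sum_continuous[OF finite_freq_ball Gout])
  have "(\<lambda>n. cutoff l n * c n * out_symbol a j x n) = (\<lambda>n. cutoff l n * c n * G n)"
  proof
   fix n
   show "cutoff l n * c n * out_symbol a j x n = cutoff l n * c n * G n"
    using fat_cutoff_eq_1[of l n] by (cases "cutoff l n = 0") (simp_all add: G_def)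
  qed
  then have "norm (local_op a j l c x) \<le> norm (torus_integral (\<lambda>z. block l c z * trig_sum G (x - z)))"
   unfolding local_op_def using block_convolution[OF Gout, where c = c and y = x] by (simp only:)
  also have "\<dots> \<le> (5 * E * L * ?B) * wamp K l c x"
   by (rule convolution_le_wavg[OF continuous_block cG kernel])
  finally show ?thesis by (simp add: mult_ac)
 qed
 moreover have "5 * E * L \<ge> 0" using E L by simp
 ultimately show ?thesis by blast
qed
lemma lp_cutoff_partial_sum_bound:
 assumes c: "\<And>l. norm (cutoff l n) \<le> c0"
  and n: "2 ^ L \<le> norm (real_vec n)"
 shows "norm (\<Sum>l\<le>L. cutoff l n) \<le> 2 * c0"
proof -
 have c0: "c0 \<ge> 0" using c norm_ge_zero order_trans by blast
 have z: "cutoff l n = 0" if "l + 2 \<le> L" for l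
 proof (rule ccontr)
  assume "cutoff l n \<noteq> 0"
  then have "norm (real_vec n) \<le> 2 * 2 ^ l" by (rule lp_cutoff_support(1))
  moreover have "(2::real) ^ (l + 2) \<le> 2 ^ L" using that by (intro power_increasing) auto
  then have "4 * (2::real) ^ l \<le> 2 ^ L" by (simp add: power_add)
  ultimately have "4 * (2::real) ^ l \<le> 2 * 2 ^ l" using n by linarith
  then show False by simp
 qed
 have "(\<Sum>l\<le>L. cutoff l n) = (\<Sum>l\<in>{L - 1..L}. cutoff l n)"
  by (rule sum.mono_neutral_right) (use z in auto)
 also have "norm \<dots> \<le> real (card {L - 1..L}) * c0"
  by (rule order_trans[OF sum_norm_le[where g = "\<lambda>_. c0"]]) (use c in auto)
 also have "\<dots> \<le> 2 * c0" using c0 by (intro mult_right_mono) auto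
 finally show ?thesis .
qed

text \<open>The partial sums of the partition of unity are bounded, and equal to one on larger and larger balls.
 As the series over the input frequencies converges absolutely, the contributions of the input scales
 up to \<open>L\<close> therefore tend to the whole.\<close>

lemma block_quant_le:
 fixes a :: "real ^ 'd \<Rightarrow> int ^ 'd \<Rightarrow> complex"
 assumes a: "a \<in> symbols m" and c: "poly_bounded c"
 shows "ennreal (amp j (quant_coeff a c) x) \<le> (\<Sum>l. ennreal (norm (local_op a j l c x)))"
proof -
 let ?S = "freq_ball (2 * 2 ^ j) :: (int ^ 'd) set"
 define b where "b n = c n * out_symbol a j x n * exp_fun n x" for n
 define h where "h k n = cutoff j k * exp_fun k x * (symb_coeff a (k - n) n * c n)" for k n
 have b_eq: "b n = (\<Sum>k\<in>?S. h k n)" for n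
 proof -
  have "exp_fun (k - n) x * exp_fun n x = exp_fun k x" for k by (simp add: exp_fun_add_freq[symmetric])
  then have "c n * (cutoff j k * symb_coeff a (k - n) n * exp_fun (k - n) x) * exp_fun n x = h k n" for k
   by (simp add: h_def mult_ac)
  then show ?thesis by (simp only: b_def out_symbol_def sum_distrib_left sum_distrib_right)
 qed
 have hs: "(\<lambda>n. norm (h k n)) summable_on UNIV" for k
 proof -
  have "(\<lambda>n. norm (cutoff j k) * norm (symb_coeff a (k - n) n * c n)) summable_on UNIV"
   by (intro summable_on_cmult_right quant_coeff_summable[OF a c])
  then show ?thesis by (simp add: h_def norm_mult mult_ac)
 qed
 have bs: "(\<lambda>n. norm (b n)) summable_on UNIV"
 proof (rule summable_on_comparison_test)
  have "(\<lambda>n. \<Sum>k\<in>F. norm (h k n)) summable_on UNIV" if "finite F" for F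
   using that by (induction F rule: finite_induct) (simp_all add: summable_on_add hs)
  then show "(\<lambda>n. \<Sum>k\<in>?S. norm (h k n)) summable_on UNIV" by simp
  show "norm (b n) \<le> (\<Sum>k\<in>?S. norm (h k n))" for n unfolding b_eq by (rule norm_sum)
 qed simp
 have bh: "(b has_sum block j (quant_coeff a c) x) UNIV"
 proof -
  have hk: "(h k has_sum cutoff j k * exp_fun k x * quant_coeff a c k) UNIV" for k
   unfolding h_def[abs_def] quant_coeff_def
   by (intro has_sum_cmult_right has_sum_infsum abs_summable_summable[OF quant_coeff_summable[OF a c]])
  have "((\<lambda>n. \<Sum>k\<in>F. h k n) has_sum (\<Sum>k\<in>F. cutoff j k * exp_fun k x * quant_coeff a c k)) UNIV" if "finite F" for F
   using that by (induction F rule: finite_induct) (auto intro: has_sum_add hk)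
  from this[of ?S] have "((\<lambda>n. \<Sum>k\<in>?S. h k n) has_sum (\<Sum>k\<in>?S. cutoff j k * exp_fun k x * quant_coeff a c k)) UNIV" by simp
  then show ?thesis unfolding block_eq_sum b_eq[abs_def] by (simp only: mult_ac)
 qed
 let ?B = "block j (quant_coeff a c) x"
 obtain c0 where c0: "c0 \<ge> 0" "\<And>j n. norm (cutoff j n) \<le> c0"
  using lp_cutoff_diff_bound[of 0] by auto
 define \<psi> where "\<psi> L n = (\<Sum>l\<le>L. cutoff l n)" for L and n :: "int ^ 'd"
 define S where "S L = {n :: int ^ 'd. norm (real_vec n) < 2 ^ L}" for L
 have finS: "finite (S L)" for L
  by (rule finite_subset[OF _ finite_lattice_ball[of "2 ^ L"]]) (auto simp: S_def)
 define total where "total = (\<Sum>\<^sub>\<infinity>n. norm (b n))"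
 have partial: "norm ?B \<le> (\<Sum>l\<le>L. norm (local_op a j l c x)) + (1 + 2 * c0) * (total - (\<Sum>n\<in>S L. norm (b n)))" for L
 proof -
  have T: "((\<lambda>n. cutoff l n * b n) has_sum local_op a j l c x) UNIV" for l
  proof (rule has_sum_finite_neutralI[of "freq_ball (2 * 2 ^ l)"])
   show "local_op a j l c x = (\<Sum>n\<in>freq_ball (2 * 2 ^ l). cutoff l n * b n)"
    unfolding local_op_def b_def
    by (subst trig_sum_finite[OF finite_freq_ball[of "2 * 2 ^ l"]]) (auto simp: lp_cutoff_outside mult_ac)
  qed (auto simp: lp_cutoff_outside)
  have "((\<lambda>n. \<Sum>l\<in>F. cutoff l n * b n) has_sum (\<Sum>l\<in>F. local_op a j l c x)) UNIV" if "finite F" for F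
   using that by (induction F rule: finite_induct) (auto intro: has_sum_add T)
  from this[of "{..L}"] have "((\<lambda>n. \<psi> L n * b n) has_sum (\<Sum>l\<le>L. local_op a j l c x)) UNIV"
   by (simp add: \<psi>_def sum_distrib_right)
  from has_sum_add[OF bh has_sum_cmult_right[OF this, of "- 1"]]
  have d: "((\<lambda>n. b n - \<psi> L n * b n) has_sum (?B - (\<Sum>l\<le>L. local_op a j l c x))) UNIV" by simp
  have tail: "((\<lambda>n. norm (b n)) has_sum (total - (\<Sum>n\<in>S L. norm (b n)))) (UNIV - S L)"
   unfolding total_def by (intro has_sum_Diff has_sum_infsum bs has_sum_finite finS) auto
  have pt: "norm (b n - \<psi> L n * b n) \<le> (if n \<in> S L then 0 else (1 + 2 * c0) * norm (b n))" for n
  proof (cases "n \<in> S L")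
   case True
   then have "\<psi> L n = 1" unfolding \<psi>_def by (intro lp_cutoff_sum) (simp add: S_def)
   then show ?thesis using True by simp
  next
   case False
   have "norm (\<psi> L n) \<le> 2 * c0" unfolding \<psi>_def
    by (rule lp_cutoff_partial_sum_bound[OF c0(2)]) (use False in \<open>simp add: S_def\<close>)
   then have "norm (1 - \<psi> L n) \<le> 1 + 2 * c0" using norm_triangle_ineq4[of 1 "\<psi> L n"] by simp
   moreover have "b n - \<psi> L n * b n = (1 - \<psi> L n) * b n" by (simp add: algebra_simps)
   ultimately show ?thesis using False by (simp add: norm_mult mult_right_mono)
  qed
  have major: "((\<lambda>n. if n \<in> S L then 0 else (1 + 2 * c0) * norm (b n)) has_sum (1 + 2 * c0) * (total - (\<Sum>n\<in>S L. norm (b n)))) UNIV"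
  proof -
   have "((\<lambda>n. (1 + 2 * c0) * norm (b n)) has_sum (1 + 2 * c0) * (total - (\<Sum>n\<in>S L. norm (b n)))) (UNIV - S L)"
    by (rule has_sum_cmult_right[OF tail])
   then show ?thesis by (rule has_sum_cong_neutral[THEN iffD1, rotated -1]) auto
  qed
  have ns: "(\<lambda>n. norm (b n - \<psi> L n * b n)) summable_on UNIV"
   by (rule summable_on_comparison_test[OF has_sum_imp_summable[OF major] pt]) simp
  have "norm (?B - (\<Sum>l\<le>L. local_op a j l c x)) \<le> (\<Sum>\<^sub>\<infinity>n. norm (b n - \<psi> L n * b n))"
   using norm_infsum_bound[OF ns] infsumI[OF d] by simp
  also have "\<dots> \<le> (1 + 2 * c0) * (total - (\<Sum>n\<in>S L. norm (b n)))"
   by (rule has_sum_mono[OF has_sum_infsum[OF ns] major pt])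
  finally have "norm ?B \<le> norm (\<Sum>l\<le>L. local_op a j l c x) + (1 + 2 * c0) * (total - (\<Sum>n\<in>S L. norm (b n)))"
   using norm_triangle_sub[of ?B "\<Sum>l\<le>L. local_op a j l c x"] by linarith
  then show ?thesis using norm_sum[of "\<lambda>l. local_op a j l c x" "{..L}"] by linarith
 qed
 have "filterlim S (finite_subsets_at_top UNIV) sequentially"
  unfolding filterlim_finite_subsets_at_top
 proof (intro allI impI)
  fix X :: "(int ^ 'd) set" assume X: "finite X \<and> X \<subseteq> UNIV"
  define R where "R = (\<Sum>n\<in>X. norm (real_vec n))"
  obtain L0 where L0: "R < 2 ^ L0" using real_arch_pow[of 2 R] by auto
  have "X \<subseteq> S L" if "L \<ge> L0" for L
  proof
   fix n assume "n \<in> X"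
   then have "norm (real_vec n) \<le> R" unfolding R_def using X by (intro member_le_sum) auto
   moreover have "(2::real) ^ L0 \<le> 2 ^ L" using that by (intro power_increasing) auto
   ultimately have "norm (real_vec n) < 2 ^ L" using L0 by (meson order.strict_trans1 order.strict_trans2)
   then show "n \<in> S L" by (simp add: S_def)
  qed
  then show "\<forall>\<^sub>F L in sequentially. finite (S L) \<and> X \<subseteq> S L \<and> S L \<subseteq> UNIV"
   using finS unfolding eventually_sequentially by blast
 qed
 then have lim: "(\<lambda>L. \<Sum>n\<in>S L. norm (b n)) \<longlonglongrightarrow> total"
  using filterlim_compose[OF has_sum_infsum[OF bs, unfolded has_sum_def]] unfolding total_def by blast
 define X where "X = (\<Sum>l. ennreal (norm (local_op a j l c x)))"
 have "ennreal (norm ?B) \<le> X"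
 proof (cases X rule: ennreal_cases)
  case s: (real s)
  have "(\<Sum>l\<le>L. norm (local_op a j l c x)) \<le> s" for L
  proof -
   have "ennreal (\<Sum>l\<le>L. norm (local_op a j l c x)) = (\<Sum>l\<le>L. ennreal (norm (local_op a j l c x)))" by simp
   also have "\<dots> \<le> ennreal s" unfolding s(2)[symmetric] X_def by (rule sum_le_suminf) auto
   finally show ?thesis using s(1) by simp
  qed
  then have "norm ?B \<le> s + (1 + 2 * c0) * (total - (\<Sum>n\<in>S L. norm (b n)))" for L
   by (rule order_trans[OF partial add_right_mono])
  moreover have "(\<lambda>L. s + (1 + 2 * c0) * (total - (\<Sum>n\<in>S L. norm (b n)))) \<longlonglongrightarrow> s + (1 + 2 * c0) * (total - total)"
   by (intro tendsto_intros lim)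
  ultimately have "norm ?B \<le> s + (1 + 2 * c0) * (total - total)"
   by (intro LIMSEQ_le_const) auto
  then have "norm ?B \<le> s" by simp
  then show ?thesis unfolding s(2) by (rule ennreal_leI)
 next
  case top
  then show ?thesis by simp
 qed
 then show ?thesis by (simp only: X_def)
qed

text \<open>The decay in the distance of the scales is of arbitrary order, so it pays for the exchange of the
 weight of scale \<open>j\<close> for the weight of scale \<open>l\<close> and still leaves the order \<open>e\<close>.\<close>

lemma block_quant_pointwise:
 fixes a :: "real ^ 'd \<Rightarrow> int ^ 'd \<Rightarrow> complex"
 assumes a: "a \<in> symbols m"
 shows "\<exists>C\<ge>0. \<forall>c j x. poly_bounded c \<longrightarrow>
  ennreal (2 powr (real j * s) * amp j (quant_coeff a c) x) \<le>
  (\<Sum>l. ennreal ((1 / 2) ^ (e * scale_dist j l)) *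
   ennreal (C * (2 powr (real l * (s + m)) * wamp K l c x)))"
proof -
 define D where "D = nat \<lceil>\<bar>s\<bar>\<rceil> + e"
 obtain C where C: "C \<ge> 0" "\<And>j l c x. norm (local_op a j l c x) \<le>
  C * (2 powr (real l * m) / (2 ^ scale_dist j l) ^ D) * wamp K l c x"
  using local_op_bound[OF a] by blast
 have "ennreal (2 powr (real j * s) * amp j (quant_coeff a c) x) \<le>
  (\<Sum>l. ennreal ((1 / 2) ^ (e * scale_dist j l)) *
   ennreal (C * (2 powr (real l * (s + m)) * wamp K l c x)))" if c: "poly_bounded c" for c j x
 proof -
  let ?W = "\<lambda>l. wamp K l c x"
  have W: "0 \<le> ?W l" for l by (intro wavg_nonneg continuous_intros continuous_block) simp
  have sc: "2 powr (real j * s) * (2 powr (real l * m) / (2 ^ scale_dist j l) ^ D) \<le> (1 / 2) ^ (e * scale_dist j l) * 2 powr (real l * (s + m))" for l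
  proof -
   let ?q = "scale_dist j l"
   have "real j * s \<le> real l * s + real ?q * real (nat \<lceil>\<bar>s\<bar>\<rceil>)"
   proof -
    have "(real j - real l) * s \<le> \<bar>real j - real l\<bar> * \<bar>s\<bar>" by (simp add: abs_mult[symmetric])
    also have "\<bar>real j - real l\<bar> = real ?q" by (auto simp: scale_dist_def)
    also have "real ?q * \<bar>s\<bar> \<le> real ?q * real (nat \<lceil>\<bar>s\<bar>\<rceil>)" by (intro mult_left_mono real_nat_ceiling_ge) auto
    finally show ?thesis by (simp add: algebra_simps)
   qed
   then have "2 powr (real j * s) \<le> 2 powr (real l * s + real ?q * real (nat \<lceil>\<bar>s\<bar>\<rceil>))" by (intro powr_mono) auto
   also have "\<dots> = 2 powr (real l * s) * 2 powr real (?q * nat \<lceil>\<bar>s\<bar>\<rceil>)" by (simp add: powr_add)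
   also have "2 powr real (?q * nat \<lceil>\<bar>s\<bar>\<rceil>) = (2::real) ^ (?q * nat \<lceil>\<bar>s\<bar>\<rceil>)" by (rule powr_realpow) simp
   finally have "2 powr (real j * s) \<le> 2 powr (real l * s) * 2 ^ (?q * nat \<lceil>\<bar>s\<bar>\<rceil>)" .
   then have "2 powr (real j * s) * (2 powr (real l * m) / (2 ^ ?q) ^ D) \<le>
     (2 powr (real l * s) * 2 ^ (?q * nat \<lceil>\<bar>s\<bar>\<rceil>)) * (2 powr (real l * m) / (2 ^ ?q) ^ D)"
    by (intro mult_right_mono) auto
   moreover have two: "((2::real) ^ ?q) ^ D = 2 ^ (?q * nat \<lceil>\<bar>s\<bar>\<rceil>) * 2 ^ (e * ?q)"
    unfolding D_def power_mult[symmetric] add_mult_distrib2 power_add by (simp only: mult.commute[of e])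
   have "(2 powr (real l * s) * 2 ^ (?q * nat \<lceil>\<bar>s\<bar>\<rceil>)) * (2 powr (real l * m) / (2 ^ ?q) ^ D) =
     (1 / 2) ^ (e * ?q) * (2 powr (real l * s) * 2 powr (real l * m))"
    unfolding two by (simp add: power_one_over)
   ultimately have "2 powr (real j * s) * (2 powr (real l * m) / (2 ^ ?q) ^ D) \<le>
     (1 / 2) ^ (e * ?q) * (2 powr (real l * s) * 2 powr (real l * m))" by simp
   also have "2 powr (real l * s) * 2 powr (real l * m) = 2 powr (real l * (s + m))" by (simp add: powr_add distrib_left)
   finally show ?thesis .
  qed
  have "ennreal (2 powr (real j * s) * amp j (quant_coeff a c) x) =
    ennreal (2 powr (real j * s)) * ennreal (amp j (quant_coeff a c) x)" by (simp add: ennreal_mult)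
  also have "\<dots> \<le> ennreal (2 powr (real j * s)) * (\<Sum>l. ennreal (norm (local_op a j l c x)))"
   by (intro mult_left_mono block_quant_le[OF a c]) simp
  also have "\<dots> = (\<Sum>l. ennreal (2 powr (real j * s)) * ennreal (norm (local_op a j l c x)))" by simp
  also have "\<dots> \<le> (\<Sum>l. ennreal ((1 / 2) ^ (e * scale_dist j l)) * ennreal (C * (2 powr (real l * (s + m)) * ?W l)))"
  proof (rule suminf_le)
   fix l
   have "2 powr (real j * s) * norm (local_op a j l c x) \<le>
     2 powr (real j * s) * (C * (2 powr (real l * m) / (2 ^ scale_dist j l) ^ D) * ?W l)"
    by (intro mult_left_mono C(2)) simp
   also have "\<dots> = (2 powr (real j * s) * (2 powr (real l * m) / (2 ^ scale_dist j l) ^ D)) * (C * ?W l)" by (simp only: mult_ac)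
   also have "\<dots> \<le> ((1 / 2) ^ (e * scale_dist j l) * 2 powr (real l * (s + m))) * (C * ?W l)"
    using C(1) W by (intro mult_right_mono sc) auto
   also have "\<dots> = (1 / 2) ^ (e * scale_dist j l) * (C * (2 powr (real l * (s + m)) * ?W l))" by (simp only: mult_ac)
   finally show "ennreal (2 powr (real j * s)) * ennreal (norm (local_op a j l c x)) \<le>
     ennreal ((1 / 2) ^ (e * scale_dist j l)) * ennreal (C * (2 powr (real l * (s + m)) * ?W l))"
    using C(1) W by (simp add: ennreal_mult[symmetric] ennreal_leI)
  qed auto
  finally show ?thesis .
 qed
 then show ?thesis using C(1) by blast
qed

section \<open>Maximal inequalities for spectrally localized functions\<close>

abbreviation mixed_integral ::
  "real \<Rightarrow> real \<Rightarrow> nat \<Rightarrow> real \<Rightarrow> (nat \<Rightarrow> real ^ 'd \<Rightarrow> real) \<Rightarrow> real" where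
 "mixed_integral p q N \<sigma> F \<equiv>
   (\<integral>x. (\<Sum>l\<le>N. (2 powr (real l * \<sigma>) * F l x) powr q) powr (p / q) \<partial>torus)"

lemma block_power_nbm:
 assumes "0 \<le> r" "0 \<le> t"
 shows "nbm torus (\<lambda>x. (t * amp l c x) powr r)"
 using assms by (intro nbm_powr nbm_mult nbm_const nbm_torus_continuous continuous_intros continuous_block) auto

text \<open>The \<open>r\<close>-th powers of the averages are dominated by averages of \<open>r\<close>-th powers, to which the vector-valued
 inequality applies with the exponents divided by \<open>r\<close>.\<close>

lemma block_vector_inequality:
 assumes r: "0 < r" "r \<le> 1" "real CARD('d) + 1 \<le> real K * r" and p: "0 < p"
  and Q: "\<And>q. q \<in> Q \<Longrightarrow> 0 < q"
  and vec: "\<And>N q g. q \<in> Q \<Longrightarrow> (\<And>l. nbm torus (g l)) \<Longrightarrow>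
   (\<integral>x. (\<Sum>l\<le>N. kernel_op torus (avg_kernel l :: real ^ 'd \<Rightarrow> real ^ 'd \<Rightarrow> real) (g l) x powr (q / r)) powr ((p / r) / (q / r)) \<partial>torus) \<le>
   A * (\<integral>x. (\<Sum>l\<le>N. g l x powr (q / r)) powr ((p / r) / (q / r)) \<partial>torus)"
 shows "\<exists>C\<ge>0. \<forall>q\<in>Q. \<forall>N \<sigma> c.
  mixed_integral p q N \<sigma> (\<lambda>l. wamp K l c) \<le>
  C * mixed_integral p q N \<sigma> (\<lambda>l. amp l c)"
proof -
 obtain C where C: "C > 0" "\<And>l c x. wamp K l c x powr r \<le>
  C * kernel_op torus (avg_kernel l) (\<lambda>z. amp l c z powr r) x"
  using wavg_block_power[OF r] by blast
 have "mixed_integral p q N \<sigma> (\<lambda>l. wamp K l c) \<le>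
  max 0 (C powr (p / r) * A) * mixed_integral p q N \<sigma> (\<lambda>l. amp l c)"
  if q: "q \<in> Q" for q N \<sigma> c
 proof -
  define w where "w l x = 2 powr (real l * \<sigma>) * wamp K l c x" for l x
  define g where "g l x = (2 powr (real l * \<sigma>) * amp l c x) powr r" for l x
  have qp: "0 < q" using Q q by blast
  have bn: "continuous_on UNIV (amp l c)" for l by (intro continuous_intros continuous_block)
  have wn: "nbm torus (w l)" for l unfolding w_def[abs_def]
   by (intro nbm_mult nbm_const wavg_measurable_bounded bn) auto
  have gn: "nbm torus (g l)" for l unfolding g_def[abs_def] using r by (intro block_power_nbm) auto
  have kn: "nbm torus (kernel_op torus (avg_kernel l) (g l))" for l
   using torus.kernel_op_nbm[OF _ gn] markov_avg_kernel[of l] unfolding markov_kernel_def by blast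
  have le: "w l x powr r \<le> C * kernel_op torus (avg_kernel l) (g l) x" for l x
  proof -
   have "w l x powr r = (2 powr (real l * \<sigma>)) powr r * wamp K l c x powr r"
    by (simp only: w_def powr_mult)
   also have "\<dots> \<le> (2 powr (real l * \<sigma>)) powr r * (C * kernel_op torus (avg_kernel l) (\<lambda>z. amp l c z powr r) x)"
    by (intro mult_left_mono C(2)) simp
   also have "\<dots> = C * kernel_op torus (avg_kernel l) (g l) x"
    unfolding kernel_op_def g_def powr_mult by (simp only: mult.left_commute[of _ "(2 powr (real l * \<sigma>)) powr r"] integral_mult_right_zero)
   finally show ?thesis .
  qed
  have "(\<integral>x. (\<Sum>l\<le>N. w l x powr q) powr (p / q) \<partial>torus) \<le>
    (\<integral>x. C powr (p / r) * (\<Sum>l\<le>N. kernel_op torus (avg_kernel l) (g l) x powr (q / r)) powr ((p / r) / (q / r)) \<partial>torus)"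
  proof (rule torus.nbm_integral_mono)
   show "nbm torus (\<lambda>x. (\<Sum>l\<le>N. w l x powr q) powr (p / q))" using p qp by (intro nbm_powr nbm_sum wn) auto
   show "nbm torus (\<lambda>x. C powr (p / r) * (\<Sum>l\<le>N. kernel_op torus (avg_kernel l) (g l) x powr (q / r)) powr ((p / r) / (q / r)))"
    using p qp r by (intro nbm_mult nbm_const nbm_powr nbm_sum kn) auto
   fix x :: "real ^ 'd" assume x: "x \<in> space torus"
   show "(\<Sum>l\<le>N. w l x powr q) powr (p / q) \<le> C powr (p / r) * (\<Sum>l\<le>N. kernel_op torus (avg_kernel l) (g l) x powr (q / r)) powr ((p / r) / (q / r))"
    by (rule weighted_sum_power_mono) (use nbm_nonneg[OF wn x] nbm_nonneg[OF kn x] le C(1) r qp p in auto)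
  qed
  also have "\<dots> = C powr (p / r) * (\<integral>x. (\<Sum>l\<le>N. kernel_op torus (avg_kernel l) (g l) x powr (q / r)) powr ((p / r) / (q / r)) \<partial>torus)"
   by (rule integral_mult_right_zero)
  also have "\<dots> \<le> C powr (p / r) * (A * (\<integral>x. (\<Sum>l\<le>N. g l x powr (q / r)) powr ((p / r) / (q / r)) \<partial>torus))"
   by (intro mult_left_mono vec q gn) simp
  also have "\<dots> = (C powr (p / r) * A) * mixed_integral p q N \<sigma> (\<lambda>l. amp l c)"
  proof -
   have "g l x powr (q / r) = (2 powr (real l * \<sigma>) * amp l c x) powr q" for l x
    using r by (simp add: g_def powr_powr)
   moreover have "(p / r) / (q / r) = p / q" using r by simp
   ultimately show ?thesis by (simp only: mult.assoc)
  qed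
  also have "\<dots> \<le> max 0 (C powr (p / r) * A) * mixed_integral p q N \<sigma> (\<lambda>l. amp l c)"
   using p qp by (intro mult_right_mono torus.nbm_integral_nonneg nbm_powr[OF nbm_sum] block_power_nbm) auto
  finally show ?thesis by (simp only: w_def)
 qed
 then show ?thesis by (intro exI[of _ "max 0 (C powr (p / r) * A)"]) auto
qed

lemma triebel_inequality_ge:
 assumes pq: "0 < q" "q \<le> p"
 shows "\<exists>K C. C \<ge> 0 \<and> (\<forall>N \<sigma> c.
  mixed_integral p q N \<sigma> (\<lambda>l. wamp K l c) \<le>
  C * mixed_integral p q N \<sigma> (\<lambda>l. amp l c))"
proof -
 \<comment> \<open>Then \<open>p / r\<close> and \<open>q / r\<close> are at least one.\<close>
 define r where "r = min 1 q"
 have r: "0 < r" "r \<le> 1" "r \<le> q" using pq by (auto simp: r_def)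
 obtain K where K: "real CARD('d) + 1 \<le> real K * r" using exists_decay_order[OF r(1)] by blast
 have "\<exists>C\<ge>0. \<forall>q\<in>{q}. \<forall>N \<sigma> c.
  mixed_integral p q N \<sigma> (\<lambda>l. wamp K l c) \<le>
  C * mixed_integral p q N \<sigma> (\<lambda>l. amp l c)"
 proof (rule block_vector_inequality[OF r(1,2) K])
  fix N q' and g :: "nat \<Rightarrow> real ^ 'd \<Rightarrow> real"
  assume q': "q' \<in> {q}" and g: "\<And>l. nbm torus (g l)"
  show "(\<integral>x. (\<Sum>l\<le>N. kernel_op torus (avg_kernel l) (g l) x powr (q' / r)) powr ((p / r) / (q' / r)) \<partial>torus) \<le>
   (2 * ((p / r) / (q / r))) powr ((p / r) / (q / r)) * (\<integral>x. (\<Sum>l\<le>N. g l x powr (q' / r)) powr ((p / r) / (q' / r)) \<partial>torus)"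
   using torus.vector_inequality_ge[OF markov_avg_kernel dual_doob_avg_kernel g, where Q = "q / r" and P = "p / r" and N = N] q' pq r
   by (simp add: divide_right_mono)
 qed (use pq in auto)
 then show ?thesis by blast
qed

lemma triebel_inequality_less:
 assumes p: "0 < p"
 shows "\<exists>K C. C \<ge> 0 \<and> (\<forall>q N \<sigma> c. p < q \<longrightarrow>
  mixed_integral p q N \<sigma> (\<lambda>l. wamp K l c) \<le>
  C * mixed_integral p q N \<sigma> (\<lambda>l. amp l c))"
proof -
 \<comment> \<open>Independent of \<open>q\<close>, so that \<open>K\<close> and \<open>C\<close> are uniform in \<open>q\<close>.\<close>
 define r where "r = min 1 p / 2"
 have r: "0 < r" "r \<le> 1" "r < p" using p by (auto simp: r_def)
 obtain K where K: "real CARD('d) + 1 \<le> real K * r" using exists_decay_order[OF r(1)] by blast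
 let ?P = "p / r"
 let ?D = "(2 * (?P / (?P - 1))) powr (?P / (?P - 1))"
 have "\<exists>C\<ge>0. \<forall>q\<in>{p<..}. \<forall>N \<sigma> c.
  mixed_integral p q N \<sigma> (\<lambda>l. wamp K l c) \<le>
  C * mixed_integral p q N \<sigma> (\<lambda>l. amp l c)"
 proof (rule block_vector_inequality[OF r(1,2) K p])
  fix N q and g :: "nat \<Rightarrow> real ^ 'd \<Rightarrow> real"
  assume q: "q \<in> {p<..}" and g: "\<And>l. nbm torus (g l)"
  have "1 < ?P" "?P < q / r" using q r by (auto simp: divide_strict_right_mono)
  from torus.vector_inequality_less[OF markov_avg_kernel dual_doob_avg_kernel g this]
  show "(\<integral>x. (\<Sum>l\<le>N. kernel_op torus (avg_kernel l) (g l) x powr (q / r)) powr (?P / (q / r)) \<partial>torus) \<le>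
   2 * (2 * ?D) powr (?P - 1) * (\<integral>x. (\<Sum>l\<le>N. g l x powr (q / r)) powr (?P / (q / r)) \<partial>torus)" .
 qed (use p in auto)
 then show ?thesis unfolding Ball_def greaterThan_iff by blast
qed

text \<open>For a single block Jensen's inequality and the mass of the transposed kernel suffice.\<close>

lemma besov_inequality:
 assumes p: "0 < p"
 shows "\<exists>K C. C \<ge> 0 \<and> (\<forall>l c. (\<integral>x. wamp K l c x powr p \<partial>torus) \<le>
  C * (\<integral>x. amp l c x powr p \<partial>torus))"
proof -
 define r where "r = min 1 p"
 have r: "0 < r" "r \<le> 1" "r \<le> p" using p by (auto simp: r_def)
 obtain K where K: "real CARD('d) + 1 \<le> real K * r" using exists_decay_order[OF r(1)] by blast
 obtain C where C: "C > 0" "\<And>l c x. wamp K l c x powr r \<le>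
  C * kernel_op torus (avg_kernel l) (\<lambda>z. amp l c z powr r) x"
  using wavg_block_power[OF r(1,2) K] by blast
 have "(\<integral>x. wamp K l c x powr p \<partial>torus) \<le>
  C powr (p / r) * (\<integral>x. amp l c x powr p \<partial>torus)" for l c
 proof -
  let ?f = "\<lambda>z. amp l c z"
  have bn: "continuous_on UNIV ?f" by (intro continuous_intros continuous_block)
  have kn: "nbm (torus \<Otimes>\<^sub>M torus) (\<lambda>(x, y). avg_kernel l x y :: real)" using markov_avg_kernel unfolding markov_kernel_def by blast
  have fr: "nbm torus (\<lambda>x. ?f x powr t)" if "t \<ge> 0" for t using that by (intro nbm_powr nbm_torus_continuous bn) auto
  have on: "nbm torus (kernel_op torus (avg_kernel l) (\<lambda>x. ?f x powr t))" if "t \<ge> 0" for t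
   by (rule torus.kernel_op_nbm[OF kn fr[OF that]])
  have "(\<integral>x. wavg K l ?f x powr p \<partial>torus) \<le> (\<integral>x. C powr (p / r) * (kernel_op torus (avg_kernel l) (\<lambda>x. ?f x powr p) x * 1) \<partial>torus)"
  proof (rule torus.nbm_integral_mono)
   show "nbm torus (\<lambda>x. wavg K l ?f x powr p)" using p by (intro nbm_powr wavg_measurable_bounded bn) auto
   show "nbm torus (\<lambda>x. C powr (p / r) * (kernel_op torus (avg_kernel l) (\<lambda>x. ?f x powr p) x * 1))"
    using p by (intro nbm_mult nbm_const on) auto
   fix x :: "real ^ 'd" assume x: "x \<in> space torus"
   have "wavg K l ?f x powr p = (wavg K l ?f x powr r) powr (p / r)" using r by (simp add: powr_powr)
   also have "\<dots> \<le> (C * kernel_op torus (avg_kernel l) (\<lambda>z. ?f z powr r) x) powr (p / r)"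
    using r by (intro powr_mono2 C(2)) auto
   also have "\<dots> = C powr (p / r) * kernel_op torus (avg_kernel l) (\<lambda>z. ?f z powr r) x powr (p / r)" by (rule powr_mult)
   also have "\<dots> \<le> C powr (p / r) * kernel_op torus (avg_kernel l) (\<lambda>z. (?f z powr r) powr (p / r)) x"
    using r x by (intro mult_left_mono torus.kernel_op_Jensen[OF markov_avg_kernel] fr) auto
   also have "(\<lambda>z. (?f z powr r) powr (p / r)) = (\<lambda>z. ?f z powr p)" using r by (simp add: powr_powr)
   finally show "wavg K l ?f x powr p \<le> C powr (p / r) * (kernel_op torus (avg_kernel l) (\<lambda>x. ?f x powr p) x * 1)" by simp
  qed
  also have "\<dots> = C powr (p / r) * (\<integral>x. ?f x powr p * kernel_op torus (avg_kernel l) (\<lambda>x. 1) x \<partial>torus)"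
   using p by (simp only: integral_mult_right_zero torus.kernel_op_symmetric[OF markov_avg_kernel fr nbm_const[of 1]])
  also have "\<dots> \<le> C powr (p / r) * (\<integral>x. ?f x powr p \<partial>torus)"
  proof (intro mult_left_mono torus.nbm_integral_mono)
   show "nbm torus (\<lambda>x. ?f x powr p * kernel_op torus (avg_kernel l) (\<lambda>x. 1) x)"
    using p by (intro nbm_mult fr torus.kernel_op_nbm[OF kn] nbm_const) auto
   show "nbm torus (\<lambda>x. ?f x powr p)" using p by (intro fr) auto
   fix x :: "real ^ 'd" assume x: "x \<in> space torus"
   have "kernel_op torus (avg_kernel l) (\<lambda>x. 1) x \<le> 1"
    using markov_avg_kernel[of l, unfolded markov_kernel_def, THEN conjunct2, THEN conjunct2, rule_format, OF x]
    unfolding kernel_op_def mult_1_right .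
   then show "?f x powr p * kernel_op torus (avg_kernel l) (\<lambda>x. 1) x \<le> ?f x powr p"
    using mult_left_mono[of "kernel_op torus (avg_kernel l) (\<lambda>x. 1) x" 1 "?f x powr p"] by simp
  qed simp
  finally show ?thesis .
 qed
 then show ?thesis using C(1) by (intro exI[of _ K] exI[of _ "C powr (p / r)"]) auto
qed
section \<open>Boundedness in terms of Fourier coefficients\<close>

lemma wavg_Lp_bound:
 assumes p: "0 < p"
 shows "\<exists>K C. C \<ge> 0 \<and> (\<forall>l c. Lp_norm p (\<lambda>x. ennreal (wamp K l c x)) \<le>
  ennreal C * Lp_norm p (\<lambda>x. ennreal (amp l c x)))"
 using p
proof (cases p rule: positive_exponent_cases)
 case 1
 let ?K = "CARD('d) + 1" and ?C = "1 / avg_const TYPE('d)"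
 have C: "0 < ?C" using avg_const_pos[where 'd = 'd] by simp
 have "esssup torus (\<lambda>x. ennreal (wavg ?K l (amp l c) x)) \<le>
  ennreal ?C * esssup torus (\<lambda>x. ennreal (amp l c x))" for l c
 proof (cases "esssup torus (\<lambda>x. ennreal (amp l c x))" rule: ennreal_cases)
  case s: (real s)
  have bn: "continuous_on UNIV (amp l c)" by (intro continuous_intros continuous_block)
  have ae: "AE x in torus. amp l c x \<le> s"
   using esssup_AE[of "\<lambda>x. ennreal (amp l c x)" torus] unfolding s(2)
   by eventually_elim (simp add: s(1))
  show ?thesis unfolding s(2)
  proof (rule esssup_I)
   show "(\<lambda>x. ennreal (wavg ?K l (amp l c) x)) \<in> borel_measurable torus"
    by (intro measurable_ennreal_nbm wavg_measurable_bounded bn) simp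
   have "ennreal (wavg ?K l (amp l c) x) \<le> ennreal ?C * ennreal s" if "x \<in> space torus" for x
    using wavg_le_bound[OF bn _ ae s(1), of x l] that C s(1)
    by (subst ennreal_mult[symmetric]) (auto intro: ennreal_leI)
   then show "AE x in torus. ennreal (wavg ?K l (amp l c) x) \<le> ennreal ?C * ennreal s" by (rule AE_I2)
  qed
 next
  case top
  then show ?thesis using C by (simp add: ennreal_mult_top)
 qed
 then show ?thesis unfolding 1 Lp_norm_top using C by (intro exI[of _ ?K] exI[of _ ?C]) auto
next
 case (2 r)
 obtain K C where C: "C \<ge> 0" "\<And>l c. (\<integral>x. wamp K l c x powr r \<partial>torus) \<le>
  C * (\<integral>x. amp l c x powr r \<partial>torus)" using besov_inequality[OF 2(1)] by blast
 have "Lp_norm p (\<lambda>x. ennreal (wamp K l c x)) \<le>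
  ennreal (C powr (1 / r)) * Lp_norm p (\<lambda>x. ennreal (amp l c x))" for l c
 proof -
  let ?f = "\<lambda>z. amp l c z"
  have bn: "continuous_on UNIV ?f" by (intro continuous_intros continuous_block)
  have w0: "0 \<le> wavg K l ?f x" for x by (intro wavg_nonneg bn) simp
  have wn: "nbm torus (\<lambda>x. wavg K l ?f x powr r)" using 2(1) by (intro nbm_powr wavg_measurable_bounded bn) auto
  have fn: "nbm torus (\<lambda>x. ?f x powr r)" using 2(1) by (intro nbm_powr nbm_torus_continuous bn) auto
  have "(\<integral>\<^sup>+x. epow (ennreal (wavg K l ?f x)) r \<partial>torus) = ennreal (\<integral>x. wavg K l ?f x powr r \<partial>torus)"
   by (simp only: epow_ennreal[OF w0] nn_integral_nbm[OF wn])
  also have "\<dots> \<le> ennreal (C * (\<integral>x. ?f x powr r \<partial>torus))" by (rule ennreal_leI[OF C(2)])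
  also have "\<dots> = ennreal C * (\<integral>\<^sup>+x. epow (ennreal (?f x)) r \<partial>torus)"
   by (simp only: epow_ennreal[OF norm_ge_zero] nn_integral_nbm[OF fn] ennreal_mult'[OF C(1)])
  finally have "epow (\<integral>\<^sup>+x. epow (ennreal (wavg K l ?f x)) r \<partial>torus) (1 / r) \<le>
    epow (ennreal C * (\<integral>\<^sup>+x. epow (ennreal (?f x)) r \<partial>torus)) (1 / r)" using 2(1) by (intro epow_mono) auto
  then show ?thesis unfolding 2(2) Lp_norm_real[OF 2(1)] using 2(1) by (simp add: epow_mult epow_ennreal[OF C(1)])
 qed
 then show ?thesis by (intro exI[of _ K] exI[of _ "C powr (1 / r)"]) auto
qed

abbreviation triebel_size ::
  "ennreal \<Rightarrow> ennreal \<Rightarrow> real \<Rightarrow> (nat \<Rightarrow> real ^ 'd \<Rightarrow> real) \<Rightarrow> ennreal" where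
 "triebel_size p q s F \<equiv> Lp_norm p (\<lambda>x. ell_norm q (\<lambda>j. ennreal (2 powr (real j * s) * F j x)))"

abbreviation besov_size :: "ennreal \<Rightarrow> ennreal \<Rightarrow> real \<Rightarrow> (int ^ 'd \<Rightarrow> complex) \<Rightarrow> ennreal" where
 "besov_size p q s c \<equiv>
   ell_norm q (\<lambda>j. ennreal (2 powr (real j * s)) * Lp_norm p (\<lambda>x. ennreal (amp j c x)))"

lemma triebel_maximal_bound:
 assumes p: "0 < p" and q: "0 < q"
 shows "\<exists>K C. C \<ge> 0 \<and> (\<forall>\<sigma> c.
  triebel_size (ennreal p) q \<sigma> (\<lambda>l. wamp K l c) \<le>
  ennreal C * triebel_size (ennreal p) q \<sigma> (\<lambda>l. amp l c))"
proof -
 have bn: "continuous_on UNIV (amp l c)" for l c by (intro continuous_intros continuous_block)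
 have wn: "nbm torus (\<lambda>x. 2 powr (real l * \<sigma>) * wamp K l c x)" for l \<sigma> c K
  by (intro nbm_mult nbm_const wavg_measurable_bounded bn) auto
 have w0: "0 \<le> 2 powr (real l * \<sigma>) * wamp K l c x" for l \<sigma> c x K
  by (intro mult_nonneg_nonneg wavg_nonneg bn) auto
 have fn: "nbm torus (\<lambda>x. 2 powr (real l * \<sigma>) * amp l c x)" for l \<sigma> c
  by (intro nbm_mult nbm_const nbm_torus_continuous bn) auto
 have f0: "0 \<le> 2 powr (real l * \<sigma>) * amp l c x" for l \<sigma> c x by simp
 have fin: "\<exists>C'\<ge>0. epow (ennreal C * D) (1 / p) = ennreal C'" if "D < \<infinity>" for C D
  using that by (intro finite_constant epow_finite) (simp add: ennreal_mult_less_top)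
 from q show ?thesis
 proof (cases q rule: positive_exponent_cases)
  case 1
  obtain K C where C: "C \<ge> 0" "\<And>q N \<sigma> c. p < q \<Longrightarrow>
   mixed_integral p q N \<sigma> (\<lambda>l. wamp K l c) \<le>
   C * mixed_integral p q N \<sigma> (\<lambda>l. amp l c)"
   using triebel_inequality_less[OF p] by blast
  have fin2: "(\<integral>\<^sup>+x. epow (\<Sum>l\<le>N. epow (ennreal (2 powr (real l * \<sigma>) * wamp K l c x)) t) (p / t) \<partial>torus) \<le>
   ennreal C * (\<integral>\<^sup>+x. epow (\<Sum>l\<le>N. epow (ennreal (2 powr (real l * \<sigma>) * amp l c x)) t) (p / t) \<partial>torus)"
   if "p < t" for N t \<sigma> c
  proof -
   have "0 < t" using that p by simp
   from nn_integral_vector_inequality[OF wn w0 fn f0 this p C(1) C(2)[OF that]] show ?thesis .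
  qed
  obtain C' where C': "C' \<ge> 0" "epow (ennreal C * 2) (1 / p) = ennreal C'" using fin[of 2 C] by auto
  show ?thesis unfolding 1
   using Lp_SUP_norm_le[OF measurable_ennreal_nbm[OF wn] p measurable_ennreal_nbm[OF fn] fin2, unfolded C'(2)] C'(1)
   by (intro exI[of _ K] exI[of _ C']) blast
 next
  case (2 r)
  have "\<exists>K C. C \<ge> 0 \<and> (\<forall>N \<sigma> c.
   mixed_integral p r N \<sigma> (\<lambda>l. wamp K l c) \<le>
   C * mixed_integral p r N \<sigma> (\<lambda>l. amp l c))"
  proof (cases "r \<le> p")
   case True
   show ?thesis by (rule triebel_inequality_ge[OF 2(1) True])
  next
   case False
   then have "p < r" by simp
   then show ?thesis using triebel_inequality_less[OF p] by blast
  qed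
  then obtain K C where C: "C \<ge> 0" "\<And>N \<sigma> c.
   mixed_integral p r N \<sigma> (\<lambda>l. wamp K l c) \<le>
   C * mixed_integral p r N \<sigma> (\<lambda>l. amp l c)" by blast
  note fin2 = nn_integral_vector_inequality[OF wn w0 fn f0 2(1) p C(1) C(2)]
  obtain C' where C': "C' \<ge> 0" "epow (ennreal C) (1 / p) = ennreal C'" using fin[of 1 C] by auto
  show ?thesis unfolding 2(2)
   using Lp_ell_norm_le[OF measurable_ennreal_nbm[OF wn] p 2(1) fin2, unfolded C'(2)] C'(1)
   by (intro exI[of _ K] exI[of _ C']) blast
 qed
qed

text \<open>The operator is reduced to an almost diagonal matrix of scales, acting on averages of the blocks.\<close>

lemma triebel_bound:
 assumes a: "a \<in> symbols m" and p: "0 < p" and q: "0 < q"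
 shows "\<exists>C\<ge>0. \<forall>c. poly_bounded c \<longrightarrow>
  triebel_size (ennreal p) q s (\<lambda>j. amp j (quant_coeff a c)) \<le>
  ennreal C * triebel_size (ennreal p) q (s + m) (\<lambda>j. amp j c)"
proof -
 obtain K C1 where C1: "C1 \<ge> 0" "\<And>\<sigma> c.
  triebel_size (ennreal p) q \<sigma> (\<lambda>l. wamp K l c) \<le>
  ennreal C1 * triebel_size (ennreal p) q \<sigma> (\<lambda>l. amp l c)"
  using triebel_maximal_bound[OF p q] by blast
 obtain C where C: "C \<ge> 0" "\<And>c j x. poly_bounded c \<Longrightarrow>
  ennreal (2 powr (real j * s) * amp j (quant_coeff a c) x) \<le>
  (\<Sum>l. scale_weight 2 j l * ennreal (C * (2 powr (real l * (s + m)) * wamp K l c x)))"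
  using block_quant_pointwise[OF a, of s 2 K] unfolding scale_weight_def by blast
 obtain C2 where C2: "C2 \<ge> 0" "\<And>b. ell_norm q (\<lambda>j. \<Sum>l. scale_weight 2 j l * b l) \<le> ennreal C2 * ell_norm q b"
  using ell_norm_almost_diagonal[OF q] by blast
 have "triebel_size (ennreal p) q s (\<lambda>j. amp j (quant_coeff a c)) \<le>
  ennreal (C2 * C * C1) * triebel_size (ennreal p) q (s + m) (\<lambda>j. amp j c)"
  if c: "poly_bounded c" for c
 proof -
  define W where "W l x = ennreal (2 powr (real l * (s + m)) * wamp K l c x)" for l x
  have bn: "continuous_on UNIV (amp l c)" for l c by (intro continuous_intros continuous_block)
  have Wm: "W l \<in> borel_measurable torus" for l unfolding W_def[abs_def]
   by (intro measurable_ennreal_nbm nbm_mult nbm_const wavg_measurable_bounded bn) auto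
  have p': "0 < ennreal p" using p by simp
  have "triebel_size (ennreal p) q s (\<lambda>j. amp j (quant_coeff a c)) \<le>
    Lp_norm (ennreal p) (\<lambda>x. (ennreal C2 * ennreal C) * ell_norm q (\<lambda>l. W l x))"
  proof (rule Lp_norm_mono[OF p'])
   show "(\<lambda>x. ell_norm q (\<lambda>j. ennreal (2 powr (real j * s) * amp j (quant_coeff a c) x))) \<in> borel_measurable torus"
    by (intro measurable_ell_norm q measurable_ennreal_nbm nbm_mult nbm_const nbm_torus_continuous bn) auto
   fix x
   have "ell_norm q (\<lambda>j. ennreal (2 powr (real j * s) * amp j (quant_coeff a c) x)) \<le>
     ell_norm q (\<lambda>j. \<Sum>l. scale_weight 2 j l * (ennreal C * W l x))"
    unfolding W_def ennreal_mult'[OF C(1), symmetric] by (rule ell_norm_mono[OF q C(2)[OF c]])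
   also have "\<dots> \<le> ennreal C2 * ell_norm q (\<lambda>l. ennreal C * W l x)" by (rule C2(2))
   also have "\<dots> = (ennreal C2 * ennreal C) * ell_norm q (\<lambda>l. W l x)" by (simp only: ell_norm_cmult[OF q] mult.assoc)
   finally show "ell_norm q (\<lambda>j. ennreal (2 powr (real j * s) * amp j (quant_coeff a c) x)) \<le>
    (ennreal C2 * ennreal C) * ell_norm q (\<lambda>l. W l x)" .
  qed
  also have "\<dots> \<le> (ennreal C2 * ennreal C) * Lp_norm (ennreal p) (\<lambda>x. ell_norm q (\<lambda>l. W l x))"
   by (intro Lp_norm_cmult_le p' measurable_ell_norm q Wm)
  also have "\<dots> \<le> (ennreal C2 * ennreal C) * (ennreal C1 *
    triebel_size (ennreal p) q (s + m) (\<lambda>j. amp j c))"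
   unfolding W_def by (intro mult_left_mono C1(2)) simp
  finally show ?thesis using C(1) C1(1) C2(1) by (simp add: ennreal_mult mult.assoc)
 qed
 then show ?thesis using C(1) C1(1) C2(1) by (intro exI[of _ "C2 * C * C1"]) auto
qed

lemma besov_bound:
 assumes a: "a \<in> symbols m" and p: "0 < p" and q: "0 < q"
 shows "\<exists>C\<ge>0. \<forall>c. poly_bounded c \<longrightarrow>
  besov_size p q s (quant_coeff a c) \<le>
  ennreal C * besov_size p q (s + m) c"
proof -
 obtain K C1 where C1: "C1 \<ge> 0" "\<And>l c. Lp_norm p (\<lambda>x. ennreal (wamp K l c x)) \<le>
  ennreal C1 * Lp_norm p (\<lambda>x. ennreal (amp l c x))"
  using wavg_Lp_bound[OF p] by blast
 obtain C where C: "C \<ge> 0" "\<And>c j x. poly_bounded c \<Longrightarrow>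
  ennreal (2 powr (real j * s) * amp j (quant_coeff a c) x) \<le>
  (\<Sum>l. scale_weight 4 j l * ennreal (C * (2 powr (real l * (s + m)) * wamp K l c x)))"
  using block_quant_pointwise[OF a, of s 4 K] unfolding scale_weight_def by blast
 obtain C2 where C2: "C2 \<ge> 0" "\<And>j (G :: nat \<Rightarrow> real ^ 'd \<Rightarrow> ennreal). \<forall>l. G l \<in> borel_measurable torus \<Longrightarrow>
  Lp_norm p (\<lambda>x. \<Sum>l. scale_weight 4 j l * G l x) \<le> ennreal C2 * (\<Sum>l. scale_weight 2 j l * Lp_norm p (G l))"
  using Lp_norm_almost_diagonal[OF p, where 'd = 'd] by blast
 obtain C3 where C3: "C3 \<ge> 0" "\<And>b. ell_norm q (\<lambda>j. \<Sum>l. scale_weight 2 j l * b l) \<le> ennreal C3 * ell_norm q b"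
  using ell_norm_almost_diagonal[OF q] by blast
 have "besov_size p q s (quant_coeff a c) \<le>
  ennreal (C2 * C3 * C * C1) * besov_size p q (s + m) c"
  if c: "poly_bounded c" for c
 proof -
  define B where "B l = ennreal (2 powr (real l * (s + m))) * Lp_norm p (\<lambda>x. ennreal (amp l c x))" for l
  define W where "W l x = ennreal (wamp K l c x)" for l x
  define G where "G l x = (ennreal C * ennreal (2 powr (real l * (s + m)))) * W l x" for l x
  have bn: "continuous_on UNIV (amp l c)" for l c by (intro continuous_intros continuous_block)
  have Wm[measurable]: "W l \<in> borel_measurable torus" for l unfolding W_def[abs_def]
   by (intro measurable_ennreal_nbm wavg_measurable_bounded bn) auto
  have Gm: "\<forall>l. G l \<in> borel_measurable torus" unfolding G_def[abs_def] by measurable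
  have GL: "Lp_norm p (G l) \<le> (ennreal C * ennreal C1) * B l" for l
  proof -
   have "Lp_norm p (G l) \<le> (ennreal C * ennreal (2 powr (real l * (s + m)))) * Lp_norm p (W l)"
    unfolding G_def[abs_def] by (rule Lp_norm_cmult_le[OF p Wm])
   also have "\<dots> \<le> (ennreal C * ennreal (2 powr (real l * (s + m)))) * (ennreal C1 * Lp_norm p (\<lambda>x. ennreal (amp l c x)))"
    unfolding W_def[abs_def] by (intro mult_left_mono C1(2)) simp
   also have "\<dots> = (ennreal C * ennreal C1) * B l" by (simp only: B_def mult_ac)
   finally show ?thesis .
  qed
  have step: "ennreal (2 powr (real j * s)) * Lp_norm p (\<lambda>x. ennreal (amp j (quant_coeff a c) x)) \<le>
    (ennreal C2 * (ennreal C * ennreal C1)) * (\<Sum>l. scale_weight 2 j l * B l)" for j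
  proof -
   let ?u = "2 powr (real j * s)" and ?f = "\<lambda>x. amp j (quant_coeff a c) x"
   have fm: "(\<lambda>x. ennreal (?u * ?f x)) \<in> borel_measurable torus"
    by (intro measurable_ennreal_nbm nbm_mult nbm_const nbm_torus_continuous bn) auto
   have inv: "ennreal ?u * ennreal (1 / ?u) = 1" by (simp add: ennreal_mult[symmetric])
   have "Lp_norm p (\<lambda>x. ennreal (?f x)) = Lp_norm p (\<lambda>x. ennreal (1 / ?u) * ennreal (?u * ?f x))"
    by (simp add: ennreal_mult[symmetric])
   also have "\<dots> \<le> ennreal (1 / ?u) * Lp_norm p (\<lambda>x. ennreal (?u * ?f x))" by (rule Lp_norm_cmult_le[OF p fm])
   finally have "ennreal ?u * Lp_norm p (\<lambda>x. ennreal (?f x)) \<le> ennreal ?u * (ennreal (1 / ?u) * Lp_norm p (\<lambda>x. ennreal (?u * ?f x)))"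
    by (rule mult_left_mono) simp
   also have "\<dots> = Lp_norm p (\<lambda>x. ennreal (?u * ?f x))" by (simp only: mult.assoc[symmetric] inv mult_1)
   also have "\<dots> \<le> Lp_norm p (\<lambda>x. \<Sum>l. scale_weight 4 j l * G l x)"
   proof (rule Lp_norm_mono[OF p fm])
    fix x
    have "ennreal (C * (2 powr (real l * (s + m)) * wamp K l c x)) = G l x" for l
     unfolding G_def W_def using C(1) by (simp add: ennreal_mult' mult.assoc)
    then show "ennreal (?u * ?f x) \<le> (\<Sum>l. scale_weight 4 j l * G l x)" using C(2)[OF c, of j x] by simp
   qed
   also have "\<dots> \<le> ennreal C2 * (\<Sum>l. scale_weight 2 j l * Lp_norm p (G l))" by (rule C2(2)[OF Gm])
   also have "\<dots> \<le> ennreal C2 * (\<Sum>l. scale_weight 2 j l * ((ennreal C * ennreal C1) * B l))"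
    by (intro mult_left_mono suminf_le GL) auto
   also have "\<dots> = (ennreal C2 * (ennreal C * ennreal C1)) * (\<Sum>l. scale_weight 2 j l * B l)"
    by (simp only: mult.left_commute[of "scale_weight 2 j _"] ennreal_suminf_cmult mult.assoc)
   finally show ?thesis .
  qed
  have "besov_size p q s (quant_coeff a c) \<le>
    ell_norm q (\<lambda>j. (ennreal C2 * (ennreal C * ennreal C1)) * (\<Sum>l. scale_weight 2 j l * B l))" by (rule ell_norm_mono[OF q step])
  also have "\<dots> = (ennreal C2 * (ennreal C * ennreal C1)) * ell_norm q (\<lambda>j. \<Sum>l. scale_weight 2 j l * B l)" by (rule ell_norm_cmult[OF q])
  also have "\<dots> \<le> (ennreal C2 * (ennreal C * ennreal C1)) * (ennreal C3 * ell_norm q B)" by (intro mult_left_mono C3(2)) simp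
  also have "\<dots> = ennreal (C2 * C3 * C * C1) * ell_norm q B"
   using C(1) C1(1) C2(1) C3(1) by (simp add: ennreal_mult mult_ac)
  finally show ?thesis unfolding B_def[abs_def] .
 qed
 then show ?thesis using C(1) C1(1) C2(1) C3(1) by (intro exI[of _ "C2 * C3 * C * C1"]) auto
qed
end

section \<open>Power series on the polydisc\<close>

definition monomial :: "complex ^ 'd::finite \<Rightarrow> int ^ 'd \<Rightarrow> complex" where
 "monomial z n = (\<Prod>j\<in>UNIV. (z $ j) ^ nat (n $ j))"

definition power_sum :: "(int ^ 'd::finite \<Rightarrow> complex) \<Rightarrow> complex ^ 'd \<Rightarrow> complex" where
 "power_sum c z = (if z \<in> polydisc then \<Sum>\<^sub>\<infinity>n\<in>nonneg_freqs. c n * monomial z n else 0)"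

text \<open>The coefficients of the derivatives of the geometric series dominate the powers of the index.\<close>

lemma summable_poly_geometric:
 fixes R :: real
 assumes "0 \<le> R" "R < 1"
 shows "summable (\<lambda>k. (1 + real k) ^ M * R ^ k)"
proof -
 define c where "c M = (diffs ^^ M) (\<lambda>_. 1 :: real)" for M
 have s: "norm x < 1 \<Longrightarrow> summable (\<lambda>k. c M k * x ^ k)" for M and x :: real
 proof (induction M arbitrary: x)
  case 0
  then show ?case by (simp add: c_def summable_geometric)
 next
  case (Suc M)
  show ?case using termdiff_converges[OF Suc.prems Suc.IH] by (simp add: c_def)
 qed
 have le: "(1 + real k) ^ M \<le> c M k" for k M
 proof (induction M arbitrary: k)
  case (Suc M)
  have "(1 + real k) ^ Suc M \<le> (1 + real k) * (1 + real (Suc k)) ^ M"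
   unfolding power_Suc by (intro mult_left_mono power_mono) auto
  also have "\<dots> \<le> (1 + real k) * c M (Suc k)" by (intro mult_left_mono Suc.IH) simp
  also have "\<dots> = c (Suc M) k" by (simp add: c_def diffs_def algebra_simps)
  finally show ?case .
 qed (simp add: c_def)
 show ?thesis
 proof (rule summable_comparison_test'[where N = 0])
  show "summable (\<lambda>k. c M k * R ^ k)" using s[of R M] assms by simp
  show "norm ((1 + real k) ^ M * R ^ k) \<le> c M k * R ^ k" for k
   using le[where k = k and M = M] assms by (simp add: abs_mult mult_right_mono)
 qed
qed

lemma jbracket_le_prod:
 assumes "n \<in> nonneg_freqs"
 shows "jbracket n \<le> (\<Prod>j\<in>UNIV. 1 + real_of_int (n $ j))"
proof -
 have nn: "0 \<le> real_of_int (n $ j)" for j using assms by (simp add: nonneg_freqs_def)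
 have "norm (real_vec n) \<le> (\<Sum>j\<in>UNIV. \<bar>real_vec n $ j\<bar>)" by (rule norm_le_l1_cart)
 also have "\<dots> = (\<Sum>j\<in>UNIV. real_of_int (n $ j))" using nn by (simp add: real_vec_def)
 finally have "jbracket n \<le> 1 + (\<Sum>j\<in>UNIV. real_of_int (n $ j))" using jbracket_le[of n] by linarith
 also have "1 + (\<Sum>j\<in>I. real_of_int (n $ j)) \<le> (\<Prod>j\<in>I. 1 + real_of_int (n $ j))" if "finite I" for I
  using that
 proof (induction I rule: finite_induct)
  case (insert j I)
  have "1 \<le> (\<Prod>j\<in>I. 1 + real_of_int (n $ j))" by (rule prod_ge_1) (use nn in auto)
  then have "real_of_int (n $ j) * 1 \<le> real_of_int (n $ j) * (\<Prod>j\<in>I. 1 + real_of_int (n $ j))"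
   by (intro mult_left_mono nn)
  then show ?case using insert by (simp add: algebra_simps)
 qed simp
 from this[of UNIV] have "1 + (\<Sum>j\<in>UNIV. real_of_int (n $ j)) \<le> (\<Prod>j\<in>UNIV. 1 + real_of_int (n $ j))" by simp
 finally show ?thesis .
qed

lemma norm_monomial_le:
 assumes "\<And>j. norm (z $ j) \<le> R"
 shows "norm (monomial z n) \<le> (\<Prod>j\<in>UNIV. R ^ nat (n $ j))"
 unfolding monomial_def prod_norm[symmetric]
 by (rule prod_mono) (use assms in \<open>auto simp: norm_power intro: power_mono\<close>)

lemma summable_power_series:
 fixes c :: "int ^ 'd::finite \<Rightarrow> complex"
 assumes c: "poly_bounded c" and R: "0 \<le> R" "R < 1"
 shows "(\<lambda>n. norm (c n) * (\<Prod>j\<in>UNIV. R ^ nat (n $ j))) summable_on nonneg_freqs"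
proof -
 obtain C M where C: "C \<ge> 0" "\<And>n. norm (c n) \<le> C * jbracket n ^ M" using poly_boundedE[OF c] by blast
 define g where "g k = (1 + real_of_int k) ^ M * R ^ nat k" for k :: int
 have g0: "0 \<le> g k" if "k \<in> {0..}" for k using that R by (simp add: g_def)
 have "summable (\<lambda>k. g (int k))" using summable_poly_geometric[OF R, of M] by (simp add: g_def)
 then have "(\<lambda>k. g (int k)) summable_on UNIV"
  by (subst summable_on_UNIV_nonneg_real_iff) (auto intro: g0)
 moreover have "bij_betw int UNIV {0..}" by (rule bij_betw_byWitness[where f' = nat]) auto
 ultimately have "g summable_on {0..}" by (simp only: summable_on_reindex_bij_betw)
 from summable_on_prod_vec[OF this g0] have s: "(\<lambda>n :: int ^ 'd. \<Prod>j\<in>UNIV. g (n $ j)) summable_on nonneg_freqs"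
  by (simp add: nonneg_freqs_def)
 show ?thesis
 proof (rule summable_on_comparison_test)
  show "(\<lambda>n :: int ^ 'd. C * (\<Prod>j\<in>UNIV. g (n $ j))) summable_on nonneg_freqs" by (rule summable_on_cmult_right[OF s])
  fix n :: "int ^ 'd" assume n: "n \<in> nonneg_freqs"
  have R0: "0 \<le> (\<Prod>j\<in>UNIV. R ^ nat (n $ j))" using R by (intro prod_nonneg) auto
  have "norm (c n) \<le> C * (\<Prod>j\<in>UNIV. 1 + real_of_int (n $ j)) ^ M"
   by (rule order_trans[OF C(2)]) (intro mult_left_mono power_mono jbracket_le_prod n C(1), simp add: less_imp_le)
  from mult_right_mono[OF this R0]
  show "norm (c n) * (\<Prod>j\<in>UNIV. R ^ nat (n $ j)) \<le> C * (\<Prod>j\<in>UNIV. g (n $ j))"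
   by (simp add: g_def prod.distrib prod_power_distrib mult.assoc)
  show "0 \<le> norm (c n) * (\<Prod>j\<in>UNIV. R ^ nat (n $ j))" using R0 by simp
 qed
qed

lemma polydisc_radius:
 fixes z :: "complex ^ 'd::finite"
 assumes "z \<in> polydisc"
 shows "\<exists>m. 0 \<le> m \<and> m < 1 \<and> (\<forall>j. norm (z $ j) \<le> m)"
proof (intro exI conjI allI)
 let ?m = "Max (range (\<lambda>j. norm (z $ j)))"
 have f: "finite (range (\<lambda>j. norm (z $ j)))" by simp
 show le: "norm (z $ j) \<le> ?m" for j by (rule Max_ge[OF f]) simp
 show "0 \<le> ?m" by (rule order_trans[OF norm_ge_zero le])
 show "?m < 1" using assms by (subst Max_less_iff[OF f]) (auto simp: polydisc_def)
qed

lemma power_series_has_sum: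
 assumes c: "poly_bounded c" and z: "z \<in> polydisc"
 shows "((\<lambda>n. c n * monomial z n) has_sum power_sum c z) nonneg_freqs"
proof -
 obtain R where R: "0 \<le> R" "R < 1" "\<And>j. norm (z $ j) \<le> R" using polydisc_radius[OF z] by blast
 have "(\<lambda>n. norm (c n * monomial z n)) summable_on nonneg_freqs"
 proof (rule summable_on_comparison_test[OF summable_power_series[OF c R(1,2)]])
  show "norm (c n * monomial z n) \<le> norm (c n) * (\<Prod>j\<in>UNIV. R ^ nat (n $ j))" for n
   unfolding norm_mult by (intro mult_left_mono norm_monomial_le R) simp
 qed simp
 then show ?thesis using z unfolding power_sum_def by (simp add: has_sum_infsum abs_summable_summable)
qed

definition monomial_deriv :: "complex ^ 'd::finite \<Rightarrow> int ^ 'd \<Rightarrow> complex ^ 'd \<Rightarrow> complex" where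
 "monomial_deriv z n h = (\<Sum>j\<in>UNIV. (of_nat (nat (n $ j)) * (z $ j) ^ (nat (n $ j) - 1) * h $ j) *
   (\<Prod>i\<in>UNIV - {j}. (z $ i) ^ nat (n $ i)))"

lemma has_derivative_monomial: "((\<lambda>z. monomial z n) has_derivative monomial_deriv z n) (at z within S)"
proof -
 have "((\<lambda>z. (z $ j) ^ k) has_derivative (\<lambda>h. of_nat k * (z $ j) ^ (k - 1) * h $ j)) (at z within S)" for j k
 proof -
  have "((\<lambda>z :: complex ^ 'a. z $ j) has_derivative (\<lambda>h. h $ j)) (at z within S)"
   by (rule bounded_linear.has_derivative[OF bounded_linear_vec_nth has_derivative_ident])
  from has_derivative_power[OF this, of k] show ?thesis by (simp add: mult_ac)
 qed
 then show ?thesis unfolding monomial_def monomial_deriv_def[abs_def] by (rule has_derivative_prod)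
qed

lemma monomial_deriv_scale: "monomial_deriv z n (c *s h) = c * monomial_deriv z n h"
 unfolding monomial_deriv_def sum_distrib_left by (rule sum.cong) (simp_all add: mult_ac)

text \<open>The bound \<open>1 / 2 \<le> R\<close> restores the power of \<open>R\<close> lost by differentiation at the cost of a factor two.\<close>

lemma norm_monomial_deriv_le:
 assumes z: "\<And>j. norm (z $ j) \<le> R" and R: "1 / 2 \<le> R"
 shows "norm (monomial_deriv z n h) \<le> 2 * (\<Sum>j\<in>UNIV. real (nat (n $ j))) * (\<Prod>j\<in>UNIV. R ^ nat (n $ j)) * norm h"
proof -
 have "norm ((of_nat (nat (n $ j)) * (z $ j) ^ (nat (n $ j) - 1) * h $ j) * (\<Prod>i\<in>UNIV - {j}. (z $ i) ^ nat (n $ i))) \<le>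
   2 * real (nat (n $ j)) * (\<Prod>j\<in>UNIV. R ^ nat (n $ j)) * norm h" for j
 proof -
  let ?k = "nat (n $ j)"
  have "real ?k * R ^ (?k - 1) \<le> 2 * real ?k * R ^ ?k"
  proof (cases ?k)
   case (Suc k)
   have "R ^ k * 1 \<le> R ^ k * (2 * R)" using R by (intro mult_left_mono) auto
   then have "real ?k * R ^ k \<le> real ?k * (R ^ k * (2 * R))" by (intro mult_left_mono) auto
   then show ?thesis by (simp add: Suc algebra_simps)
  qed simp
  moreover have "norm ((z $ j) ^ (?k - 1)) \<le> R ^ (?k - 1)" unfolding norm_power by (intro power_mono z) simp
  ultimately have 1: "real ?k * norm ((z $ j) ^ (?k - 1)) \<le> 2 * real ?k * R ^ ?k"
   by (meson mult_left_mono of_nat_0_le_iff order_trans)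
  have 2: "norm (\<Prod>i\<in>UNIV - {j}. (z $ i) ^ nat (n $ i)) \<le> (\<Prod>i\<in>UNIV - {j}. R ^ nat (n $ i))"
   unfolding prod_norm[symmetric] by (rule prod_mono) (use z in \<open>auto simp: norm_power intro: power_mono\<close>)
  have 3: "norm (h $ j) \<le> norm h" by (rule Finite_Cartesian_Product.norm_nth_le)
  have "norm ((of_nat ?k * (z $ j) ^ (?k - 1) * h $ j) * (\<Prod>i\<in>UNIV - {j}. (z $ i) ^ nat (n $ i))) =
    (real ?k * norm ((z $ j) ^ (?k - 1))) * norm (h $ j) * norm (\<Prod>i\<in>UNIV - {j}. (z $ i) ^ nat (n $ i))"
   by (simp add: norm_mult)
  also have "\<dots> \<le> (2 * real ?k * R ^ ?k) * norm h * (\<Prod>i\<in>UNIV - {j}. R ^ nat (n $ i))"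
   using R by (intro mult_mono 1 2 3) auto
  also have "\<dots> = 2 * real ?k * (R ^ ?k * (\<Prod>i\<in>UNIV - {j}. R ^ nat (n $ i))) * norm h" by (simp only: mult_ac)
  also have "R ^ ?k * (\<Prod>i\<in>UNIV - {j}. R ^ nat (n $ i)) = (\<Prod>j\<in>UNIV. R ^ nat (n $ j))"
   by (rule prod.remove[symmetric]) auto
  finally show ?thesis .
 qed
 then have "norm (monomial_deriv z n h) \<le> (\<Sum>j\<in>UNIV. 2 * real (nat (n $ j)) * (\<Prod>j\<in>UNIV. R ^ nat (n $ j)) * norm h)"
  unfolding monomial_deriv_def by (rule sum_norm_le)
 then show ?thesis by (simp only: sum_distrib_left sum_distrib_right)
qed

lemma infinite_nonneg_freqs: "infinite (nonneg_freqs :: (int ^ 'd::finite) set)"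
proof -
 have "inj (\<lambda>k :: nat. (\<chi> j. int k) :: int ^ 'd)" by (rule injI) (simp add: vec_eq_iff)
 then have "infinite (range (\<lambda>k :: nat. (\<chi> j. int k) :: int ^ 'd))" by (rule range_inj_infinite)
 then show ?thesis by (rule infinite_super[rotated]) (auto simp: nonneg_freqs_def)
qed

text \<open>On a ball around \<open>z\<close> inside of a smaller polydisc, the series may be differentiated term by term:
 multiplied by the degrees, the coefficients still have polynomial growth.\<close>

lemma power_sum_holomorphic:
 fixes c :: "int ^ 'd::finite \<Rightarrow> complex"
 assumes c: "poly_bounded c"
 shows "power_sum c \<in> polydisc_holomorphic"
 unfolding polydisc_holomorphic_def
proof (intro CollectI conjI allI impI ballI)
 show "power_sum c z = 0" if "z \<notin> polydisc" for z using that by (simp add: power_sum_def)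
 fix z :: "complex ^ 'd" assume z: "z \<in> polydisc"
 obtain m where m: "0 \<le> m" "m < 1" "\<And>j. norm (z $ j) \<le> m" using polydisc_radius[OF z] by blast
 define R where "R = (1 + m) / 2"
 define S where "S = ball z ((1 - m) / 2)"
 have R: "1 / 2 \<le> R" "0 \<le> R" "R < 1" using m by (auto simp: R_def)
 have S: "norm (w $ j) \<le> R" if "w \<in> S" for w j
 proof -
  have "norm ((w - z) $ j) \<le> (1 - m) / 2"
   using that Finite_Cartesian_Product.norm_nth_le[of "w - z" j] by (simp add: S_def dist_norm norm_minus_commute)
  moreover have "norm (w $ j) \<le> norm (z $ j) + norm ((w - z) $ j)" using norm_triangle_ineq[of "z $ j" "(w - z) $ j"] by simp
  ultimately show ?thesis using m(3)[of j] by (simp add: R_def field_simps)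
 qed
 have SD: "S \<subseteq> polydisc"
 proof
  fix w assume "w \<in> S"
  then show "w \<in> polydisc" using S[where w = w] R(3) by (auto simp: polydisc_def intro: le_less_trans)
 qed
 define b where "b n = c n * complex_of_real (2 * (\<Sum>j\<in>UNIV. real (nat (n $ j))))" for n
 have bb: "poly_bounded b"
 proof -
  obtain C M where C: "C \<ge> 0" "\<And>n. norm (c n) \<le> C * jbracket n ^ M" using poly_boundedE[OF c] by blast
  have "norm (b n) \<le> (C * (2 * real CARD('d))) * jbracket n ^ Suc M" for n
  proof -
   have "(\<Sum>j\<in>UNIV. real (nat (n $ j))) \<le> (\<Sum>j\<in>(UNIV :: 'd set). jbracket n)"
   proof (rule sum_mono)
    fix j
    have "real (nat (n $ j)) \<le> \<bar>real_of_int (n $ j)\<bar>" by linarith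
    then show "real (nat (n $ j)) \<le> jbracket n" using component_le_jbracket[of n j] by linarith
   qed
   then have s: "(\<Sum>j\<in>UNIV. real (nat (n $ j))) \<le> real CARD('d) * jbracket n" by simp
   have "norm (b n) = norm (c n) * (2 * (\<Sum>j\<in>UNIV. real (nat (n $ j))))"
    unfolding b_def norm_mult norm_of_real by (simp add: sum_nonneg)
   also have "\<dots> \<le> (C * jbracket n ^ M) * (2 * (real CARD('d) * jbracket n))"
    using C(1) s by (intro mult_mono C(2) mult_left_mono) (auto simp: sum_nonneg less_imp_le)
   finally show ?thesis by (simp add: mult_ac)
  qed
  then show ?thesis unfolding poly_bounded_def by blast
 qed
 define e where "e = from_nat_into (nonneg_freqs :: (int ^ 'd) set)"
 have e: "bij_betw e UNIV nonneg_freqs" unfolding e_def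
  by (rule bij_betw_from_nat_into[OF countableI_type infinite_nonneg_freqs])
 define Q where "Q i = norm (b (e i)) * (\<Prod>j\<in>UNIV. R ^ nat (e i $ j))" for i
 define f' where "f' i w h = c (e i) * monomial_deriv w (e i) h" for i w h
 have Q0: "0 \<le> Q i" for i unfolding Q_def using R by (intro mult_nonneg_nonneg prod_nonneg) auto
 have Qs: "summable Q"
  using summable_on_reindex_bij_betw[OF e, of "\<lambda>n. norm (b n) * (\<Prod>j\<in>UNIV. R ^ nat (n $ j))"]
   summable_power_series[OF bb R(2,3)] summable_on_UNIV_nonneg_real_iff[of Q] Q0
  unfolding Q_def[abs_def] by blast
 have f'Q: "norm (f' i w h) \<le> Q i * norm h" if "w \<in> S" for i w h
 proof -
  have "norm (f' i w h) \<le> norm (c (e i)) * (2 * (\<Sum>j\<in>UNIV. real (nat (e i $ j))) * (\<Prod>j\<in>UNIV. R ^ nat (e i $ j)) * norm h)"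
   unfolding f'_def norm_mult by (intro mult_left_mono norm_monomial_deriv_le S that R) simp
  also have "\<dots> = Q i * norm h" unfolding Q_def b_def norm_mult norm_of_real by (simp add: sum_nonneg)
  finally show ?thesis .
 qed
 have f's: "summable (\<lambda>i. f' i w h)" if "w \<in> S" for w h
  by (rule summable_comparison_test'[where N = 0, OF summable_mult2[OF Qs, of "norm h"]]) (rule f'Q[OF that])
 have sums: "(\<lambda>i. c (e i) * monomial w (e i)) sums power_sum c w" if "w \<in> S" for w
 proof -
  have "((\<lambda>n. c n * monomial w n) has_sum power_sum c w) nonneg_freqs" using that SD by (intro power_series_has_sum c) auto
  then have "((\<lambda>i. c (e i) * monomial w (e i)) has_sum power_sum c w) UNIV"
   using has_sum_reindex_bij_betw[OF e, of "\<lambda>n. c n * monomial w n"] by simp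
  then show ?thesis by (rule has_sum_imp_sums)
 qed
 have zS: "z \<in> S" using m by (simp add: S_def)
 have "\<exists>g. \<forall>w\<in>S. (\<lambda>i. c (e i) * monomial w (e i)) sums g w \<and> (g has_derivative (\<lambda>h. \<Sum>i. f' i w h)) (at w within S)"
 proof (rule has_derivative_series[where f' = f', OF _ _ _ zS, where l = "power_sum c z"])
  show "convex S" by (simp add: S_def)
  show "((\<lambda>w. c (e i) * monomial w (e i)) has_derivative f' i w) (at w within S)" for i w
   unfolding f'_def[abs_def] by (rule has_derivative_mult_right[OF has_derivative_monomial])
  show "(\<lambda>i. c (e i) * monomial z (e i)) sums power_sum c z" by (rule sums[OF zS])
  fix \<epsilon> :: real assume "\<epsilon> > 0"
  obtain N where N: "\<And>k. k \<ge> N \<Longrightarrow> norm (\<Sum>i. Q (i + k)) < \<epsilon>" using suminf_exist_split[OF \<open>\<epsilon> > 0\<close> Qs] by blast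
  show "\<forall>\<^sub>F k in sequentially. \<forall>w\<in>S. \<forall>h. norm ((\<Sum>i<k. f' i w h) - (\<Sum>i. f' i w h)) \<le> \<epsilon> * norm h"
   unfolding eventually_sequentially
  proof (intro exI[of _ N] allI impI ballI)
   fix k w h assume k: "N \<le> k" and w: "w \<in> S"
   have "(\<Sum>i<k. f' i w h) - (\<Sum>i. f' i w h) = - (\<Sum>i. f' (i + k) w h)"
    using suminf_split_initial_segment[OF f's[OF w, of h], of k] by simp
   then have "norm ((\<Sum>i<k. f' i w h) - (\<Sum>i. f' i w h)) = norm (\<Sum>i. f' (i + k) w h)" by simp
   also have "\<dots> \<le> (\<Sum>i. Q (i + k) * norm h)"
    by (rule norm_suminf_le[OF f'Q[OF w]]) (intro summable_mult2 summable_ignore_initial_segment Qs)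
   also have "\<dots> = (\<Sum>i. Q (i + k)) * norm h"
    by (rule suminf_mult2[symmetric]) (intro summable_ignore_initial_segment Qs)
   also have "\<dots> \<le> \<epsilon> * norm h" using N[OF k] by (intro mult_right_mono) auto
   finally show "norm ((\<Sum>i<k. f' i w h) - (\<Sum>i. f' i w h)) \<le> \<epsilon> * norm h" .
  qed
 qed
 then obtain g where g: "\<And>w. w \<in> S \<Longrightarrow> (\<lambda>i. c (e i) * monomial w (e i)) sums g w"
  "(g has_derivative (\<lambda>h. \<Sum>i. f' i z h)) (at z within S)" using zS by blast
 have op: "open S" by (simp add: S_def)
 have "(g has_derivative (\<lambda>h. \<Sum>i. f' i z h)) (at z)" using g(2) at_within_open[OF zS op] by simp
 then have d: "(power_sum c has_derivative (\<lambda>h. \<Sum>i. f' i z h)) (at z)"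
  by (rule has_derivative_transform_within_open[OF _ op zS]) (rule sums_unique2[OF g(1) sums])
 have "(\<Sum>i. f' i z (t *s h)) = t * (\<Sum>i. f' i z h)" for t h
  unfolding f'_def monomial_deriv_scale using suminf_mult[OF f's[OF zS, of h], of t] by (simp add: f'_def mult.left_commute)
 then show "\<exists>L. (power_sum c has_derivative L) (at z) \<and> (\<forall>t v. L (t *s v) = t * L v)" using d by blast
qed

section \<open>Boundary values\<close>

lemma prod_cis: "(\<Prod>j\<in>I. cis (f j)) = cis (\<Sum>j\<in>I. f j)"
 by (induction I rule: infinite_finite_induct) (auto simp: cis_mult)

lemma monomial_on_torus:
 fixes n :: "int ^ 'd::finite"
 assumes "n \<in> nonneg_freqs"
 shows "monomial (\<chi> j. cis (x $ j) / 2) n = (\<Prod>j\<in>UNIV. (1 / 2) ^ nat (n $ j)) * exp_fun n x"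
proof -
 have "(cis (x $ j) / 2) ^ nat (n $ j) = (1 / 2) ^ nat (n $ j) * cis (real_of_int (n $ j) * x $ j)" for j
 proof -
  have "cis (x $ j) ^ nat (n $ j) = cis (real (nat (n $ j)) * x $ j)" by (rule Complex.DeMoivre)
  moreover have "real (nat (n $ j)) = real_of_int (n $ j)" using assms by (simp add: nonneg_freqs_def)
  ultimately show ?thesis by (simp add: power_divide)
 qed
 then have "monomial (\<chi> j. cis (x $ j) / 2) n = (\<Prod>j\<in>UNIV. (1 / 2) ^ nat (n $ j)) * (\<Prod>j\<in>UNIV. cis (real_of_int (n $ j) * x $ j))"
  by (simp add: monomial_def prod.distrib)
 then show ?thesis by (simp add: prod_cis exp_fun_def real_vec_def inner_vec_def)
qed

text \<open>Cauchy's formula: the Taylor coefficients are Fourier coefficients on the torus of radius one half.\<close>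

lemma power_series_coeff:
 fixes c :: "int ^ 'd::finite \<Rightarrow> complex"
 assumes F: "power_series_of F c" and k: "k \<in> nonneg_freqs"
 shows "fun_coeff (\<lambda>x. F (\<chi> j. cis (x $ j) / 2)) k = c k * (\<Prod>j\<in>UNIV. (1 / 2) ^ nat (k $ j))"
proof -
 define b where "b n = c n * (\<Prod>j\<in>UNIV. (1 / 2) ^ nat (n $ j))" for n
 let ?P = "\<lambda>x :: real ^ 'd. (\<chi> j. cis (x $ j) / 2)"
 have hs: "((\<lambda>n. b n * exp_fun n x) has_sum F (?P x)) nonneg_freqs" for x
 proof -
  have "?P x \<in> polydisc" by (simp add: polydisc_def norm_divide)
  then have "((\<lambda>n. c n * monomial (?P x) n) has_sum F (?P x)) nonneg_freqs"
   using F unfolding power_series_of_def monomial_def by blast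
  moreover have "c n * monomial (?P x) n = b n * exp_fun n x" if "n \<in> nonneg_freqs" for n
   using monomial_on_torus[OF that, of x] by (simp add: b_def mult.assoc)
  ultimately show ?thesis by (simp cong: has_sum_cong)
 qed
 have "b summable_on nonneg_freqs" using has_sum_imp_summable[OF hs[of 0]] by simp
 then have s: "(\<lambda>n. norm (b n)) summable_on nonneg_freqs" by (simp only: summable_on_iff_abs_summable_on_complex)
 have "((\<lambda>n. torus_integral (\<lambda>x. b n * exp_fun n x * exp_fun (- k) x)) has_sum
   torus_integral (\<lambda>x. \<Sum>\<^sub>\<infinity>n\<in>nonneg_freqs. b n * exp_fun n x * exp_fun (- k) x)) nonneg_freqs"
  by (rule has_sum_torus_integral[where B = "\<lambda>n. norm (b n)"])
    (auto simp: norm_mult s intro!: continuous_intros continuous_exp_fun)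
 moreover have "(\<Sum>\<^sub>\<infinity>n\<in>nonneg_freqs. b n * exp_fun n x * exp_fun (- k) x) = F (?P x) * exp_fun (- k) x" for x
  by (rule infsumI) (rule has_sum_cmult_left[OF hs])
 ultimately have "((\<lambda>n. if n = k then b n * (2 * pi) ^ CARD('d) else 0) has_sum torus_integral (\<lambda>x. F (?P x) * exp_fun (- k) x)) nonneg_freqs"
  by (simp only: torus_integral_two_exp_fun)
 moreover have "((\<lambda>n. if n = k then b n * (2 * pi) ^ CARD('d) else 0) has_sum b k * (2 * pi) ^ CARD('d)) nonneg_freqs"
  by (rule has_sum_finite_neutralI[of "{k}"]) (use k in auto)
 ultimately have "torus_integral (\<lambda>x. F (?P x) * exp_fun (- k) x) = b k * (2 * pi) ^ CARD('d)" by (rule has_sum_unique)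
 then show ?thesis by (simp add: fun_coeff_def b_def)
qed

lemma power_series_unique:
 assumes "power_series_of F c" "power_series_of F d" "k \<in> nonneg_freqs"
 shows "c k = d k"
proof -
 have "(\<Prod>j\<in>UNIV. (1 / 2 :: complex) ^ nat (k $ j)) \<noteq> 0" by simp
 then show ?thesis using power_series_coeff[OF assms(1,3)] power_series_coeff[OF assms(2,3)] by simp
qed

lemma power_series_of_power_sum: "poly_bounded c \<Longrightarrow> power_series_of (power_sum c) c"
 using power_series_has_sum[of c] by (simp add: power_series_of_def monomial_def)

lemma holomorphic_eqI:
 assumes "F \<in> polydisc_holomorphic" "G \<in> polydisc_holomorphic" "power_series_of F c" "power_series_of G d"
  and "\<And>n. n \<in> nonneg_freqs \<Longrightarrow> c n = d n"
 shows "F = G"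
proof
 fix z
 show "F z = G z"
 proof (cases "z \<in> polydisc")
  case True
  have "((\<lambda>n. c n * (\<Prod>j\<in>UNIV. (z $ j) ^ nat (n $ j))) has_sum F z) nonneg_freqs"
   using assms(3) True by (simp add: power_series_of_def)
  moreover have "((\<lambda>n. d n * (\<Prod>j\<in>UNIV. (z $ j) ^ nat (n $ j))) has_sum G z) nonneg_freqs"
   using assms(4) True by (simp add: power_series_of_def)
  ultimately show ?thesis using assms(5) by (simp cong: has_sum_cong add: has_sum_unique)
 next
  case False
  then show ?thesis using assms(1,2) by (simp add: polydisc_holomorphic_def)
 qed
qed

lemma boundary_value_of_series:
 fixes c :: "int ^ 'd::finite \<Rightarrow> complex"
 assumes c: "poly_bounded c" and v: "\<And>n. n \<notin> nonneg_freqs \<Longrightarrow> c n = 0"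
 shows "has_boundary_value (power_sum c) (series_dist c)"
proof -
 have "((\<lambda>n. torus_integral (\<lambda>x. c n * exp_fun n x * \<psi> x)) has_sum series_dist c \<psi>) nonneg_freqs"
  if "\<psi> \<in> test_functions" for \<psi>
 proof (rule has_sum_cong_neutral[THEN iffD1, OF _ _ _ series_dist_has_sum[OF c that]])
  fix n :: "int ^ 'd"
  assume "n \<in> UNIV - nonneg_freqs"
  then have "c n = 0" using v by blast
  then show "torus_integral (\<lambda>x. c n * exp_fun n x * \<psi> x) = 0" unfolding torus_integral_eq_fun_coeff by simp
 qed auto
 then show ?thesis
  unfolding has_boundary_value_def using power_sum_holomorphic[OF c] series_dist_distribution[OF c] power_series_of_power_sum[OF c] by blast
qed

text \<open>Testing against the exponentials recovers the Taylor coefficients.\<close>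

lemma boundary_value_coeff:
 fixes F :: "complex ^ 'd::finite \<Rightarrow> complex"
 assumes "has_boundary_value F u"
 shows "power_series_of F (dist_coeff u)" "\<And>n. n \<notin> nonneg_freqs \<Longrightarrow> dist_coeff u n = 0"
proof -
 obtain c where c: "power_series_of F c" "\<And>\<psi>. \<psi> \<in> test_functions \<Longrightarrow>
  ((\<lambda>n. torus_integral (\<lambda>x. c n * exp_fun n x * \<psi> x)) has_sum u \<psi>) nonneg_freqs"
  using assms unfolding has_boundary_value_def by blast
 have d: "dist_coeff u k = (if k \<in> nonneg_freqs then c k else 0)" for k
 proof -
  have "((\<lambda>n. if n = k then c n * (2 * pi) ^ CARD('d) else 0) has_sum u (exp_fun (- k))) nonneg_freqs"
   using c(2)[OF test_exp_fun[of "- k"]] by (simp only: torus_integral_two_exp_fun)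
  moreover have "((\<lambda>n. if n = k then c n * (2 * pi) ^ CARD('d) else 0) has_sum
    (if k \<in> nonneg_freqs then c k * (2 * pi) ^ CARD('d) else 0)) nonneg_freqs"
   by (rule has_sum_finite_neutralI[of "{k} \<inter> nonneg_freqs"]) auto
  ultimately have "u (exp_fun (- k)) = (if k \<in> nonneg_freqs then c k * (2 * pi) ^ CARD('d) else 0)" by (rule has_sum_unique)
  then show ?thesis by (simp add: dist_coeff_def)
 qed
 show "dist_coeff u n = 0" if "n \<notin> nonneg_freqs" for n using d that by simp
 show "power_series_of F (dist_coeff u)" using c(1) unfolding power_series_of_def d by (simp cong: has_sum_cong)
qed

lemma boundary_value_unique:
 assumes u: "has_boundary_value F u" and v: "has_boundary_value F v"
 shows "u = v"
proof
 obtain c where c: "power_series_of F c" "\<And>\<psi>. \<psi> \<in> test_functions \<Longrightarrow>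
  ((\<lambda>n. torus_integral (\<lambda>x. c n * exp_fun n x * \<psi> x)) has_sum u \<psi>) nonneg_freqs"
  using u unfolding has_boundary_value_def by blast
 obtain d where d: "power_series_of F d" "\<And>\<psi>. \<psi> \<in> test_functions \<Longrightarrow>
  ((\<lambda>n. torus_integral (\<lambda>x. d n * exp_fun n x * \<psi> x)) has_sum v \<psi>) nonneg_freqs"
  using v unfolding has_boundary_value_def by blast
 fix \<psi>
 show "u \<psi> = v \<psi>"
 proof (cases "\<psi> \<in> test_functions")
  case True
  have "((\<lambda>n. torus_integral (\<lambda>x. c n * exp_fun n x * \<psi> x)) has_sum v \<psi>) nonneg_freqs"
   using d(2)[OF True] power_series_unique[OF c(1) d(1)] by (simp cong: has_sum_cong)
  then show ?thesis using c(2)[OF True] by (rule has_sum_unique[rotated])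
 next
  case False
  then show ?thesis using u v by (simp add: has_boundary_value_def distributions_def)
 qed
qed

lemma extension_unique:
 assumes "has_boundary_value F u" "has_boundary_value G u"
 shows "F = G"
 using assms by (intro holomorphic_eqI[where c = "dist_coeff u" and d = "dist_coeff u"] boundary_value_coeff)
  (auto simp: has_boundary_value_def)

lemma boundary_value_eq: "has_boundary_value F u \<Longrightarrow> boundary_value F = u"
 unfolding boundary_value_def by (rule the_equality) (auto intro: boundary_value_unique)

lemma holo_extension_eq: "has_boundary_value F u \<Longrightarrow> holo_extension u = F"
 unfolding holo_extension_def by (rule the_equality) (auto intro: extension_unique)

text \<open>Functions with a boundary value, and their boundary values, are parametrized by the sequences of
 polynomial growth on the positive orthant.\<close>

lemma has_boundary_valueE:
 assumes "has_boundary_value F u"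
 obtains c where "poly_bounded c" "\<And>n. n \<notin> nonneg_freqs \<Longrightarrow> c n = 0" "F = power_sum c" "u = series_dist c"
proof
 show c: "poly_bounded (dist_coeff u)" using assms by (intro poly_bounded_dist_coeff) (simp add: has_boundary_value_def)
 show v: "dist_coeff u n = 0" if "n \<notin> nonneg_freqs" for n using boundary_value_coeff(2)[OF assms that] .
 show F: "F = power_sum (dist_coeff u)"
  using assms boundary_value_coeff(1)[OF assms] power_sum_holomorphic[OF c] power_series_of_power_sum[OF c]
  by (intro holomorphic_eqI[where c = "dist_coeff u" and d = "dist_coeff u"]) (auto simp: has_boundary_value_def)
 show "u = series_dist (dist_coeff u)"
  using boundary_value_unique[OF assms[unfolded F]] boundary_value_of_series[OF c v] F
  by (metis assms boundary_value_unique)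
qed

lemma has_boundary_value_add:
 assumes "has_boundary_value F u" "has_boundary_value G v"
 shows "has_boundary_value (\<lambda>z. F z + G z) (\<lambda>t. u t + v t)"
proof -
 obtain c where c: "poly_bounded c" "\<And>n. n \<notin> nonneg_freqs \<Longrightarrow> c n = 0" "F = power_sum c" "u = series_dist c"
  using has_boundary_valueE[OF assms(1)] by blast
 obtain d where d: "poly_bounded d" "\<And>n. n \<notin> nonneg_freqs \<Longrightarrow> d n = 0" "G = power_sum d" "v = series_dist d"
  using has_boundary_valueE[OF assms(2)] by blast
 let ?e = "\<lambda>n. c n + d n"
 have e: "poly_bounded ?e"
 proof -
  obtain C M where C: "C \<ge> 0" "\<And>n. norm (c n) \<le> C * jbracket n ^ M" using poly_boundedE[OF c(1)] by blast
  obtain D N where D: "D \<ge> 0" "\<And>n. norm (d n) \<le> D * jbracket n ^ N" using poly_boundedE[OF d(1)] by blast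
  have "norm (?e n) \<le> (C + D) * jbracket n ^ (M + N)" for n
  proof -
   have "jbracket n ^ M \<le> jbracket n ^ (M + N)" "jbracket n ^ N \<le> jbracket n ^ (M + N)"
    by (intro power_increasing jbracket_ge_1; simp)+
   then have "C * jbracket n ^ M \<le> C * jbracket n ^ (M + N)" "D * jbracket n ^ N \<le> D * jbracket n ^ (M + N)"
    using C(1) D(1) by (simp_all add: mult_left_mono)
   then show ?thesis using norm_triangle_ineq[of "c n" "d n"] C(2)[of n] D(2)[of n] by (simp add: distrib_right)
  qed
  then show ?thesis unfolding poly_bounded_def by blast
 qed
 have "power_sum ?e = (\<lambda>z. F z + G z)"
 proof
  fix z
  show "power_sum ?e z = F z + G z"
  proof (cases "z \<in> polydisc")
   case True
   have "((\<lambda>n. ?e n * monomial z n) has_sum F z + G z) nonneg_freqs"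
    using has_sum_add[OF power_series_has_sum[OF c(1) True] power_series_has_sum[OF d(1) True]] by (simp add: c(3) d(3) distrib_right)
   then show ?thesis using power_series_has_sum[OF e True] by (rule has_sum_unique[rotated])
  qed (simp add: c(3) d(3) power_sum_def)
 qed
 moreover have "series_dist ?e = (\<lambda>t. u t + v t)"
 proof
  fix \<psi>
  show "series_dist ?e \<psi> = u \<psi> + v \<psi>"
  proof (cases "\<psi> \<in> test_functions")
   case True
   have "((\<lambda>n. torus_integral (\<lambda>x. ?e n * exp_fun n x * \<psi> x)) has_sum u \<psi> + v \<psi>) UNIV"
    using has_sum_add[OF series_dist_has_sum[OF c(1) True] series_dist_has_sum[OF d(1) True]]
    unfolding c(4) d(4) torus_integral_eq_fun_coeff by (simp add: algebra_simps)
   then show ?thesis using series_dist_has_sum[OF e True] by (rule has_sum_unique[rotated])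
  qed (simp add: c(4) d(4) series_dist_def)
 qed
 ultimately show ?thesis using boundary_value_of_series[OF e] c(2) d(2) by simp
qed

lemma has_boundary_value_cmult:
 assumes "has_boundary_value F u"
 shows "has_boundary_value (\<lambda>z. k * F z) (\<lambda>t. k * u t)"
proof -
 obtain c where c: "poly_bounded c" "\<And>n. n \<notin> nonneg_freqs \<Longrightarrow> c n = 0" "F = power_sum c" "u = series_dist c"
  using has_boundary_valueE[OF assms] by blast
 let ?e = "\<lambda>n. k * c n"
 have e: "poly_bounded ?e"
 proof -
  obtain C M where C: "C \<ge> 0" "\<And>n. norm (c n) \<le> C * jbracket n ^ M" using poly_boundedE[OF c(1)] by blast
  have "norm (?e n) \<le> (norm k * C) * jbracket n ^ M" for n
   using mult_left_mono[OF C(2)[of n], of "norm k"] by (simp add: norm_mult mult.assoc)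
  then show ?thesis unfolding poly_bounded_def by blast
 qed
 have "power_sum ?e = (\<lambda>z. k * F z)"
  unfolding c(3) power_sum_def fun_eq_iff mult.assoc by (simp add: infsum_cmult_right')
 moreover have "series_dist ?e = (\<lambda>t. k * u t)"
  unfolding c(4) series_dist_def fun_eq_iff mult.assoc by (simp add: infsum_cmult_right' mult.left_commute)
 ultimately show ?thesis using boundary_value_of_series[OF e] c(2) by simp
qed

section \<open>Mapping properties of triangular operators\<close>

lemma quantization_plus:
 assumes a: "a \<in> triangular_symbols m" and f: "f \<in> plus_distributions"
 shows "quantization a f \<in> plus_distributions"
proof -
 have s: "a \<in> symbols m" using a by (simp add: triangular_symbols_def)
 have f': "f \<in> distributions" "\<And>n. n \<notin> nonneg_freqs \<Longrightarrow> dist_coeff f n = 0" using f by (auto simp: plus_distributions_def)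
 show ?thesis unfolding plus_distributions_def
  using quantization_distribution[OF s f'(1)] quant_coeff_plus[OF a f'(2)] by (simp add: dist_coeff_quantization[OF s f'(1)])
qed

lemma boundary_value_holo_quantization:
 assumes a: "a \<in> triangular_symbols m" and f: "f \<in> plus_distributions" and F: "has_boundary_value F f"
 shows "has_boundary_value (holo_quantization a F) (quantization a f)"
proof -
 have s: "a \<in> symbols m" using a by (simp add: triangular_symbols_def)
 have f': "f \<in> distributions" "\<And>n. n \<notin> nonneg_freqs \<Longrightarrow> dist_coeff f n = 0" using f by (auto simp: plus_distributions_def)
 note c = poly_bounded_dist_coeff[OF f'(1)]
 have "has_boundary_value (power_sum (quant_coeff a (dist_coeff f))) (quantization a f)"
  unfolding quantization_eq_series_dist(2)[OF s c]
  by (rule boundary_value_of_series[OF poly_bounded_quant_coeff[OF s c]]) (rule quant_coeff_plus[OF a f'(2)])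
 from this holo_extension_eq[OF this] show ?thesis by (simp add: holo_quantization_def boundary_value_eq[OF F])
qed

text \<open>Linearity and the preservation of the support are common to all spaces; only the norm estimate differs.\<close>

lemma bounded_operator_plus:
 fixes N1 N2 :: "'d::finite dist \<Rightarrow> ennreal"
 assumes a: "a \<in> triangular_symbols m"
  and N: "\<And>f. f \<in> distributions \<Longrightarrow> N2 (quantization a f) \<le> ennreal C * N1 f"
 shows "bounded_operator ({f \<in> distributions. N1 f < \<infinity>} \<inter> plus_distributions) N1
  ({f \<in> distributions. N2 f < \<infinity>} \<inter> plus_distributions) N2 (quantization a)"
proof -
 have s: "a \<in> symbols m" using a by (simp add: triangular_symbols_def)
 have fin: "N2 (quantization a f) < \<infinity>" if "f \<in> distributions" "N1 f < \<infinity>" for f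
 proof -
  have "ennreal C * N1 f < \<infinity>" using that(2) by (simp add: ennreal_mult_less_top)
  with N[OF that(1)] show ?thesis by (rule le_less_trans)
 qed
 show ?thesis unfolding bounded_operator_def
  using fin quantization_plus[OF a] quantization_distribution[OF s] quantization_add[OF s] quantization_cmult[OF s] N by blast
qed

text \<open>All assertions are transported along the linear bijection between functions and boundary values.\<close>

lemma bounded_operator_holo:
 fixes X Y :: "'d::finite dist set"
 assumes a: "a \<in> triangular_symbols m" and X: "X \<subseteq> plus_distributions"
  and b: "bounded_operator X N1 Y N2 (quantization a)"
 shows "bounded_operator {F. \<exists>u\<in>X. has_boundary_value F u} (\<lambda>F. N1 (boundary_value F))
  {F. \<exists>u\<in>Y. has_boundary_value F u} (\<lambda>F. N2 (boundary_value F)) (holo_quantization a)"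
proof -
 have s: "a \<in> symbols m" using a by (simp add: triangular_symbols_def)
 have hbv: "has_boundary_value (holo_quantization a F) (quantization a u)" if "u \<in> X" "has_boundary_value F u" for F u
  using boundary_value_holo_quantization[OF a _ that(2)] that(1) X by blast
 have dist: "u \<in> distributions" if "has_boundary_value F u" for F and u :: "'d dist"
  using that by (simp add: has_boundary_value_def)
 have ext: "holo_quantization a F = G" if "has_boundary_value F u" "has_boundary_value G (quantization a u)" for F G u
  using that by (simp add: holo_quantization_def boundary_value_eq holo_extension_eq)
 obtain C where C: "\<And>f. f \<in> X \<Longrightarrow> N2 (quantization a f) \<le> ennreal C * N1 f" and XY: "\<And>f. f \<in> X \<Longrightarrow> quantization a f \<in> Y"
  using b unfolding bounded_operator_def by blast
 show ?thesis unfolding bounded_operator_def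
 proof (intro conjI ballI allI exI[of _ C])
  fix F assume "F \<in> {F. \<exists>u\<in>X. has_boundary_value F u}"
  then obtain u where u: "u \<in> X" "has_boundary_value F u" by blast
  note h = hbv[OF u]
  show "holo_quantization a F \<in> {F. \<exists>u\<in>Y. has_boundary_value F u}" using h XY[OF u(1)] by blast
  show "N2 (boundary_value (holo_quantization a F)) \<le> ennreal C * N1 (boundary_value F)"
   using C[OF u(1)] by (simp add: boundary_value_eq[OF h] boundary_value_eq[OF u(2)])
  show "holo_quantization a (\<lambda>z. k * F z) = (\<lambda>z. k * holo_quantization a F z)" for k
  proof (rule ext[OF has_boundary_value_cmult[OF u(2)]])
   show "has_boundary_value (\<lambda>z. k * holo_quantization a F z) (quantization a (\<lambda>t. k * u t))"
    unfolding quantization_cmult[OF s dist[OF u(2)]] by (rule has_boundary_value_cmult[OF h])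
  qed
  fix G assume "G \<in> {F. \<exists>u\<in>X. has_boundary_value F u}"
  then obtain v where v: "v \<in> X" "has_boundary_value G v" by blast
  show "holo_quantization a (\<lambda>z. F z + G z) = (\<lambda>z. holo_quantization a F z + holo_quantization a G z)"
  proof (rule ext[OF has_boundary_value_add[OF u(2) v(2)]])
   show "has_boundary_value (\<lambda>z. holo_quantization a F z + holo_quantization a G z) (quantization a (\<lambda>t. u t + v t))"
    unfolding quantization_add[OF s dist[OF u(2)] dist[OF v(2)]] by (rule has_boundary_value_add[OF h hbv[OF v]])
  qed
 qed
qed

context littlewood_paley
begin

lemma bounded_operator_Besov_plus:
 assumes a: "a \<in> triangular_symbols m" and p: "0 < p" and q: "0 < q"
 shows "bounded_operator (Besov_plus \<phi>0 \<phi> (s + m) p q) (Besov_norm \<phi>0 \<phi> (s + m) p q)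
  (Besov_plus \<phi>0 \<phi> s p q) (Besov_norm \<phi>0 \<phi> s p q) (quantization a)"
proof -
 have sy: "a \<in> symbols m" using a by (simp add: triangular_symbols_def)
 obtain C where C: "\<And>c. poly_bounded c \<Longrightarrow>
  besov_size p q s (quant_coeff a c) \<le>
  ennreal C * besov_size p q (s + m) c"
  using besov_bound[OF sy p q] by blast
 show ?thesis unfolding Besov_plus_def
 proof (rule bounded_operator_plus[OF a])
  fix f :: "'d dist" assume f: "f \<in> distributions"
  show "Besov_norm \<phi>0 \<phi> s p q (quantization a f) \<le> ennreal C * Besov_norm \<phi>0 \<phi> (s + m) p q f"
   unfolding Besov_norm_def lp_block_eq dist_coeff_quantization[OF sy f] by (rule C[OF poly_bounded_dist_coeff[OF f]])
 qed
qed

lemma bounded_operator_Triebel_plus: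
 assumes a: "a \<in> triangular_symbols m" and p: "0 < p" "p < \<infinity>" and q: "0 < q"
 shows "bounded_operator (Triebel_plus \<phi>0 \<phi> (s + m) p q) (Triebel_norm \<phi>0 \<phi> (s + m) p q)
  (Triebel_plus \<phi>0 \<phi> s p q) (Triebel_norm \<phi>0 \<phi> s p q) (quantization a)"
proof -
 have sy: "a \<in> symbols m" using a by (simp add: triangular_symbols_def)
 obtain r where r: "0 < r" "p = ennreal r" using p(1) by (cases p rule: positive_exponent_cases) (use p(2) in auto)
 obtain C where C: "\<And>c. poly_bounded c \<Longrightarrow>
  triebel_size (ennreal r) q s (\<lambda>j. amp j (quant_coeff a c)) \<le>
  ennreal C * triebel_size (ennreal r) q (s + m) (\<lambda>j. amp j c)"
  using triebel_bound[OF sy r(1) q] by blast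
 show ?thesis unfolding Triebel_plus_def
 proof (rule bounded_operator_plus[OF a])
  fix f :: "'d dist" assume f: "f \<in> distributions"
  show "Triebel_norm \<phi>0 \<phi> s p q (quantization a f) \<le> ennreal C * Triebel_norm \<phi>0 \<phi> (s + m) p q f"
   unfolding Triebel_norm_def lp_block_eq dist_coeff_quantization[OF sy f] r(2) by (rule C[OF poly_bounded_dist_coeff[OF f]])
 qed
qed

end

theorem theorem4p3:
 fixes s m :: real
  and a :: "real ^ 'd::finite \<Rightarrow> int ^ 'd \<Rightarrow> complex"
  and \<phi>0 \<phi> :: "real ^ 'd \<Rightarrow> complex"
 assumes "lp_partition \<phi>0 \<phi>"
  and "a \<in> triangular_symbols m"
 shows "(\<forall>f\<in>distributions. \<forall>\<psi>\<in>test_functions. quant_term a f \<psi> summable_on UNIV) \<and>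
  (\<forall>p q. 0 < p \<and> 0 < q \<longrightarrow>
    bounded_operator
     (Besov_plus \<phi>0 \<phi> (s + m) p q) (Besov_norm \<phi>0 \<phi> (s + m) p q)
     (Besov_plus \<phi>0 \<phi> s p q) (Besov_norm \<phi>0 \<phi> s p q) (quantization a)) \<and>
  (\<forall>p q. 0 < p \<and> p < \<infinity> \<and> 0 < q \<longrightarrow>
    bounded_operator
     (Triebel_plus \<phi>0 \<phi> (s + m) p q) (Triebel_norm \<phi>0 \<phi> (s + m) p q)
     (Triebel_plus \<phi>0 \<phi> s p q) (Triebel_norm \<phi>0 \<phi> s p q) (quantization a)) \<and>
  (\<forall>F f. f \<in> plus_distributions \<and> has_boundary_value F f \<longrightarrow>
    has_boundary_value (holo_quantization a F) (quantization a f)) \<and>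
  (\<forall>p q. 0 < p \<and> 0 < q \<longrightarrow>
    bounded_operator
     (Besov_holo \<phi>0 \<phi> (s + m) p q) (Besov_holo_norm \<phi>0 \<phi> (s + m) p q)
     (Besov_holo \<phi>0 \<phi> s p q) (Besov_holo_norm \<phi>0 \<phi> s p q) (holo_quantization a)) \<and>
  (\<forall>p q. 0 < p \<and> p < \<infinity> \<and> 0 < q \<longrightarrow>
    bounded_operator
     (Triebel_holo \<phi>0 \<phi> (s + m) p q) (Triebel_holo_norm \<phi>0 \<phi> (s + m) p q)
     (Triebel_holo \<phi>0 \<phi> s p q) (Triebel_holo_norm \<phi>0 \<phi> s p q) (holo_quantization a))"
proof (intro conjI ballI allI impI)
 have sy: "a \<in> symbols m" using assms(2) by (simp add: triangular_symbols_def)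
 show "quant_term a f \<psi> summable_on UNIV" if "f \<in> distributions" "\<psi> \<in> test_functions" for f \<psi>
  by (rule quant_term_summable[OF sy poly_bounded_dist_coeff[OF that(1)] that(2)])
 show "has_boundary_value (holo_quantization a F) (quantization a f)" if "f \<in> plus_distributions \<and> has_boundary_value F f" for F f
  using boundary_value_holo_quantization[OF assms(2)] that by blast
 fix p q :: ennreal
 show B: "bounded_operator (Besov_plus \<phi>0 \<phi> (s + m) p q) (Besov_norm \<phi>0 \<phi> (s + m) p q)
   (Besov_plus \<phi>0 \<phi> s p q) (Besov_norm \<phi>0 \<phi> s p q) (quantization a)" if "0 < p \<and> 0 < q"
  using littlewood_paley.bounded_operator_Besov_plus[OF littlewood_paley.intro[OF assms(1)] assms(2)] that by blast
 show "bounded_operator (Besov_holo \<phi>0 \<phi> (s + m) p q) (Besov_holo_norm \<phi>0 \<phi> (s + m) p q)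
   (Besov_holo \<phi>0 \<phi> s p q) (Besov_holo_norm \<phi>0 \<phi> s p q) (holo_quantization a)" if "0 < p \<and> 0 < q"
  unfolding Besov_holo_def Besov_holo_norm_def[abs_def]
  by (rule bounded_operator_holo[OF assms(2) _ B[OF that]]) (auto simp: Besov_plus_def)
 show T: "bounded_operator (Triebel_plus \<phi>0 \<phi> (s + m) p q) (Triebel_norm \<phi>0 \<phi> (s + m) p q)
   (Triebel_plus \<phi>0 \<phi> s p q) (Triebel_norm \<phi>0 \<phi> s p q) (quantization a)" if "0 < p \<and> p < \<infinity> \<and> 0 < q"
  using littlewood_paley.bounded_operator_Triebel_plus[OF littlewood_paley.intro[OF assms(1)] assms(2)] that by blast
 show "bounded_operator (Triebel_holo \<phi>0 \<phi> (s + m) p q) (Triebel_holo_norm \<phi>0 \<phi> (s + m) p q)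
   (Triebel_holo \<phi>0 \<phi> s p q) (Triebel_holo_norm \<phi>0 \<phi> s p q) (holo_quantization a)" if "0 < p \<and> p < \<infinity> \<and> 0 < q"
  unfolding Triebel_holo_def Triebel_holo_norm_def[abs_def]
  by (rule bounded_operator_holo[OF assms(2) _ T[OF that]]) (auto simp: Triebel_plus_def)
qed

end
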